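(* Let $G$ be a finite group and let $\mathcal{O}$ be a $G$-transfer system. The category of rational $\mathcal{O}$-Mackey functors for $G$ splits into orthogonal full subcategories: $$\mathcal{O}\text{-}\mathrm{Mackey}^G_{\mathbb{Q}}\;\cong\;\underline{A}^{\mathcal{O}}_{\mathbb{Q}}\text{-}\mathrm{Mod}\;\simeq\;\prod_{(H)\in \mathrm{Sub}^{\mathcal{O}}(G)/G} e_{[H]^{\mathcal{O}}}\underline{A}^{\mathcal{O}}_{\mathbb{Q}}\text{-}\mathrm{Mod}.$$
   Context: A $G$-transfer system $\mathcal{O}$ is a partial order on the set $\mathrm{Sub}(G)$ of subgroups of $G$, written $K\to H$, which refines inclusion and satisfies: $K\to H$ implies $gKg^{-1}\to gHg^{-1}$ for all $g\in G$; and $K\to H$, $L\subseteq H$ imply $K\cap L\to L$. $\mathrm{Sub}^{\mathcal{O}}(G)$ is the (conjugation-closed) set of subgroups $H$ with $H\to G$ in $\mathcal{O}$, and $\mathrm{Sub}^{\mathcal{O}}(G)/G$ is its set of conjugacy classes $(H)$. $\mathrm{Fin}^G_{\mathcal{O}}$ is the wide subcategory of the category of finite $G$-sets consisting of the equivariant maps $f\colon S\to T$ with $\mathrm{Stab}(s)\to\mathrm{Stab}(f(s))$ in $\mathcal{O}$ for all $s\in S$. The Lindner category $\mathcal{A}^{\mathcal{O}}$ has objects the finite $G$-sets; morphisms from $S$ to $T$ are isomorphism classes of spans $S\leftarrow U\xrightarrow{h} T$ of finite $G$-sets with $h\in\mathrm{Fin}^G_{\mathcal{O}}$ (left leg arbitrary),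 composed by pullback; disjoint union is the biproduct. A (rational) $\mathcal{O}$-Mackey functor is a product preserving functor $\mathcal{A}^{\mathcal{O}}\to \mathrm{Ab}$ (with values in $\mathbb{Q}$-vector spaces); morphisms are natural transformations. $\mathcal{O}\text{-}\mathrm{Mackey}^G_{\mathbb{Q}}$ is the category of rational ones. The $\mathcal{O}$-Burnside Mackey functor $\underline{A}^{\mathcal{O}}$ has $\underline{A}^{\mathcal{O}}(G/H)$ the free abelian group on isomorphism classes of $H$-orbits $H/K$ with $K\to H$ in $\mathcal{O}$, i.e. the Grothendieck ring of finite $H$-sets with all orbits of this form; restrictions and conjugations are those of the usual Burnside Mackey functor and the transfer for $K\to H$ is induction $K/L\mapsto H/L$. $\underline{A}^{\mathcal{O}}_{\mathbb{Q}}=\underline{A}^{\mathcal{O}}\otimes\mathbb{Q}$. It is the unit of the Day convolution symmetric monoidal structure on rational $\mathcal{O}$-Mackey functors, so each rational $\mathcal{O}$-Mackey functor is canonically a module over it. For an idempotent $e\in\underline{A}^{\mathcal{O}}_{\mathbb{Q}}(G/G)$, $e\underline{A}^{\mathcal{O}}_{\mathbb{Q}}$ is the direct summand with $(e\underline{A}^{\mathcal{O}}_{\mathbb{Q}})(G/K)=\mathrm{res}^G_K(e)\,\underline{A}^{\mathcal{O}}_{\mathbb{Q}}(G/K)$, a commutative monoid under Day convolution, and $e\underline{A}^{\mathcal{O}}_{\mathbb{Q}}\text{-}\mathrm{Mod}$ is its category of modules, identified with the full subcategory of rational $\mathcal{O}$-Mackey functors on which $e$ acts as the identity. $e_{[H]^{\mathcal{O}}}\in\underline{A}^{\mathcal{O}}_{\mathbb{Q}}(G/G)$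 is the idempotent which corresponds to the characteristic function of the conjugacy class of $H$ under the ring isomorphism $\underline{A}^{\mathcal{O}}_{\mathbb{Q}}(G/G)\cong\{\text{conjugation-invariant functions }\mathrm{Sub}^{\mathcal{O}}(G)\to\mathbb{Q}\}$ induced by $T\mapsto (K\mapsto|T^K|)$. *)

theory Defs
  imports Complex_Main "HOL-Algebra.Group_Action" "HOL-Algebra.Module" "HOL-Library.Nat_Bijection"
begin

section \<open>Categories, functors, equivalences\<close>

text \<open>Hom sets need not be disjoint, so identities, composites and the action of a functor on
  morphisms carry the objects involved; \<open>cmp C X Y Z g f\<close> is the composite of
  \<open>f : X \<rightarrow> Y\<close> and \<open>g : Y \<rightarrow> Z\<close>.\<close>

record ('o, 'm) cat =
  obj :: "'o set"
  arr :: "'o \<Rightarrow> 'o \<Rightarrow> 'm set"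
  ide :: "'o \<Rightarrow> 'm"
  cmp :: "'o \<Rightarrow> 'o \<Rightarrow> 'o \<Rightarrow> 'm \<Rightarrow> 'm \<Rightarrow> 'm"

definition category :: "('o, 'm) cat \<Rightarrow> bool" where
  "category C \<longleftrightarrow>
     (\<forall>X\<in>obj C. ide C X \<in> arr C X X) \<and>
     (\<forall>X\<in>obj C. \<forall>Y\<in>obj C. \<forall>Z\<in>obj C. \<forall>f\<in>arr C X Y. \<forall>g\<in>arr C Y Z.
        cmp C X Y Z g f \<in> arr C X Z) \<and>
     (\<forall>X\<in>obj C. \<forall>Y\<in>obj C. \<forall>f\<in>arr C X Y.
        cmp C X X Y f (ide C X) = f \<and> cmp C X Y Y (ide C Y) f = f) \<and>
     (\<forall>W\<in>obj C. \<forall>X\<in>obj C. \<forall>Y\<in>obj C. \<forall>Z\<in>obj C.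
        \<forall>f\<in>arr C W X. \<forall>g\<in>arr C X Y. \<forall>h\<in>arr C Y Z.
        cmp C W X Z (cmp C X Y Z h g) f = cmp C W Y Z h (cmp C W X Y g f))"

record ('o, 'm, 'p, 'n) func =
  fob :: "'o \<Rightarrow> 'p"
  fmor :: "'o \<Rightarrow> 'o \<Rightarrow> 'm \<Rightarrow> 'n"

definition is_functor :: "('o, 'm) cat \<Rightarrow> ('p, 'n) cat \<Rightarrow> ('o, 'm, 'p, 'n) func \<Rightarrow> bool" where
  "is_functor C D F \<longleftrightarrow>
     (\<forall>X\<in>obj C. fob F X \<in> obj D \<and> fmor F X X (ide C X) = ide D (fob F X)) \<and>
     (\<forall>X\<in>obj C. \<forall>Y\<in>obj C. \<forall>f\<in>arr C X Y. fmor F X Y f \<in> arr D (fob F X) (fob F Y)) \<and>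
     (\<forall>X\<in>obj C. \<forall>Y\<in>obj C. \<forall>Z\<in>obj C. \<forall>f\<in>arr C X Y. \<forall>g\<in>arr C Y Z.
        fmor F X Z (cmp C X Y Z g f) =
        cmp D (fob F X) (fob F Y) (fob F Z) (fmor F Y Z g) (fmor F X Y f))"

definition id_func :: "('o, 'm, 'o, 'm) func" where
  "id_func = \<lparr>fob = (\<lambda>X. X), fmor = (\<lambda>X Y f. f)\<rparr>"

definition comp_func ::
  "('p, 'n, 'q, 'k) func \<Rightarrow> ('o, 'm, 'p, 'n) func \<Rightarrow> ('o, 'm, 'q, 'k) func" where
  "comp_func F' F = \<lparr>fob = (\<lambda>X. fob F' (fob F X)),
                     fmor = (\<lambda>X Y f. fmor F' (fob F X) (fob F Y) (fmor F X Y f))\<rparr>"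

definition nat_trans :: "('o, 'm) cat \<Rightarrow> ('p, 'n) cat \<Rightarrow>
    ('o, 'm, 'p, 'n) func \<Rightarrow> ('o, 'm, 'p, 'n) func \<Rightarrow> ('o \<Rightarrow> 'n) set" where
  "nat_trans C D F F' =
     {t \<in> (\<Pi>\<^sub>E X\<in>obj C. arr D (fob F X) (fob F' X)).
        \<forall>X\<in>obj C. \<forall>Y\<in>obj C. \<forall>f\<in>arr C X Y.
          cmp D (fob F X) (fob F' X) (fob F' Y) (fmor F' X Y f) (t X) =
          cmp D (fob F X) (fob F Y) (fob F' Y) (t Y) (fmor F X Y f)}"

definition is_iso_arr :: "('o, 'm) cat \<Rightarrow> 'o \<Rightarrow> 'o \<Rightarrow> 'm \<Rightarrow> bool" where
  "is_iso_arr C X Y f \<longleftrightarrow> f \<in> arr C X Y \<and>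
     (\<exists>g\<in>arr C Y X. cmp C X Y X g f = ide C X \<and> cmp C Y X Y f g = ide C Y)"

definition naturally_iso :: "('o, 'm) cat \<Rightarrow> ('p, 'n) cat \<Rightarrow>
    ('o, 'm, 'p, 'n) func \<Rightarrow> ('o, 'm, 'p, 'n) func \<Rightarrow> bool" where
  "naturally_iso C D F F' \<longleftrightarrow>
     (\<exists>t\<in>nat_trans C D F F'. \<forall>X\<in>obj C. is_iso_arr D (fob F X) (fob F' X) (t X))"

definition is_equivalence :: "('o, 'm) cat \<Rightarrow> ('p, 'n) cat \<Rightarrow> ('o, 'm, 'p, 'n) func \<Rightarrow> bool" where
  "is_equivalence C D F \<longleftrightarrow> category C \<and> category D \<and> is_functor C D F \<and>
     (\<exists>F'. is_functor D C F' \<and>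
        naturally_iso C C id_func (comp_func F' F) \<and>
        naturally_iso D D (comp_func F F') id_func)"

definition is_cat_iso :: "('o, 'm) cat \<Rightarrow> ('p, 'n) cat \<Rightarrow> ('o, 'm, 'p, 'n) func \<Rightarrow> bool" where
  "is_cat_iso C D F \<longleftrightarrow> category C \<and> category D \<and> is_functor C D F \<and>
     (\<exists>F'. is_functor D C F' \<and>
        (\<forall>X\<in>obj C. fob F' (fob F X) = X) \<and>
        (\<forall>X\<in>obj C. \<forall>Y\<in>obj C. \<forall>f\<in>arr C X Y.
           fmor F' (fob F X) (fob F Y) (fmor F X Y f) = f) \<and>
        (\<forall>A\<in>obj D. fob F (fob F' A) = A) \<and>
        (\<forall>A\<in>obj D. \<forall>B\<in>obj D. \<forall>h\<in>arr D A B.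
           fmor F (fob F' A) (fob F' B) (fmor F' A B h) = h))"

definition full_subcat :: "('o, 'm) cat \<Rightarrow> ('o \<Rightarrow> bool) \<Rightarrow> ('o, 'm) cat" where
  "full_subcat C P = C\<lparr>obj := {X \<in> obj C. P X}\<rparr>"

definition functor_cat ::
  "('o, 'm) cat \<Rightarrow> ('p, 'n) cat \<Rightarrow> (('o, 'm, 'p, 'n) func, 'o \<Rightarrow> 'n) cat" where
  "functor_cat C D =
     \<lparr>obj = {F. is_functor C D F},
      arr = nat_trans C D,
      ide = (\<lambda>F. \<lambda>X\<in>obj C. ide D (fob F X)),
      cmp = (\<lambda>F F' F'' t s. \<lambda>X\<in>obj C. cmp D (fob F X) (fob F' X) (fob F'' X) (t X) (s X))\<rparr>"

definition prod_cat :: "'i set \<Rightarrow> ('i \<Rightarrow> ('o, 'm) cat) \<Rightarrow> ('i \<Rightarrow> 'o, 'i \<Rightarrow> 'm) cat" where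
  "prod_cat I C =
     \<lparr>obj = (\<Pi>\<^sub>E i\<in>I. obj (C i)),
      arr = (\<lambda>X Y. \<Pi>\<^sub>E i\<in>I. arr (C i) (X i) (Y i)),
      ide = (\<lambda>X. \<lambda>i\<in>I. ide (C i) (X i)),
      cmp = (\<lambda>X Y Z g f. \<lambda>i\<in>I. cmp (C i) (X i) (Y i) (Z i) (g i) (f i))\<rparr>"

section \<open>Modules over a monoid in a monoidal category\<close>

text \<open>Only the part of a symmetric monoidal structure that enters the definition of a left module
  is recorded: \<open>ten\<close> on objects, \<open>tenm X X' Y Y' f g : X \<otimes> Y \<rightarrow> X' \<otimes> Y'\<close>, the unit object,
  the associator \<open>(X \<otimes> Y) \<otimes> Z \<rightarrow> X \<otimes> (Y \<otimes> Z)\<close> and the left unitor.\<close>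

record ('o, 'm) moncat = "('o, 'm) cat" +
  ten :: "'o \<Rightarrow> 'o \<Rightarrow> 'o"
  tenm :: "'o \<Rightarrow> 'o \<Rightarrow> 'o \<Rightarrow> 'o \<Rightarrow> 'm \<Rightarrow> 'm \<Rightarrow> 'm"
  munit :: "'o"
  massoc :: "'o \<Rightarrow> 'o \<Rightarrow> 'o \<Rightarrow> 'm"
  mlunit :: "'o \<Rightarrow> 'm"

record ('o, 'm) monoid_obj =
  mob :: "'o"
  mmul :: "'m"
  mone :: "'m"

definition is_module :: "('o, 'm) moncat \<Rightarrow> ('o, 'm) monoid_obj \<Rightarrow> 'o \<Rightarrow> 'm \<Rightarrow> bool" where
  "is_module D A M \<rho> \<longleftrightarrow>
     (let R = mob A; RM = ten D R M; RR = ten D R R; I = munit D in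
        M \<in> obj D \<and> \<rho> \<in> arr D RM M \<and>
        cmp D (ten D RR M) RM M \<rho> (tenm D RR R M M (mmul A) (ide D M)) =
        cmp D (ten D RR M) RM M \<rho>
          (cmp D (ten D RR M) (ten D R RM) RM (tenm D R R RM M (ide D R) \<rho>) (massoc D R R M)) \<and>
        cmp D (ten D I M) RM M \<rho> (tenm D I R M M (mone A) (ide D M)) = mlunit D M)"

definition module_cat :: "('o, 'm) moncat \<Rightarrow> ('o, 'm) monoid_obj \<Rightarrow> ('o \<times> 'm, 'm) cat" where
  "module_cat D A =
     \<lparr>obj = {(M, \<rho>). is_module D A M \<rho>},
      arr = (\<lambda>(M, \<rho>) (N, \<sigma>). {f \<in> arr D M N.
               cmp D (ten D (mob A) M) M N f \<rho> =
               cmp D (ten D (mob A) M) (ten D (mob A) N) N \<sigma>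
                 (tenm D (mob A) (mob A) M N (ide D (mob A)) f)}),
      ide = (\<lambda>X. ide D (fst X)),
      cmp = (\<lambda>X Y Z. cmp D (fst X) (fst Y) (fst Z))\<rparr>"

definition forget :: "('o \<times> 'm, 'm, 'o, 'm) func" where
  "forget = \<lparr>fob = fst, fmor = (\<lambda>X Y f. f)\<rparr>"

section \<open>Rational vector spaces\<close>

definition rat_ring :: "rat ring" where
  "rat_ring = \<lparr>carrier = UNIV, mult = (*), one = 1, zero = 0, add = (+)\<rparr>"

definition linmaps :: "(rat, 'v) module \<Rightarrow> (rat, 'w) module \<Rightarrow> ('v \<Rightarrow> 'w) set" where
  "linmaps V W = {f \<in> carrier V \<rightarrow>\<^sub>E carrier W.
     (\<forall>x\<in>carrier V. \<forall>y\<in>carrier V. f (x \<oplus>\<^bsub>V\<^esub> y) = f x \<oplus>\<^bsub>W\<^esub> f y) \<and>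
     (\<forall>a. \<forall>x\<in>carrier V. f (a \<odot>\<^bsub>V\<^esub> x) = a \<odot>\<^bsub>W\<^esub> f x)}"

definition Vect :: "((rat, 'v) module, 'v \<Rightarrow> 'v) cat" where
  "Vect = \<lparr>obj = {V. module rat_ring V},
           arr = linmaps,
           ide = (\<lambda>V. \<lambda>x\<in>carrier V. x),
           cmp = (\<lambda>U V W g f. compose (carrier U) g f)\<rparr>"

section \<open>Transfer systems\<close>

definition conj_sub :: "('g, 'b) monoid_scheme \<Rightarrow> 'g \<Rightarrow> 'g set \<Rightarrow> 'g set" where
  "conj_sub G g H = g <#\<^bsub>G\<^esub> H #>\<^bsub>G\<^esub> (inv\<^bsub>G\<^esub> g)"

definition transfer_system :: "('g, 'b) monoid_scheme \<Rightarrow> ('g set \<times> 'g set) set \<Rightarrow> bool" where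
  "transfer_system G r \<longleftrightarrow>
     partial_order_on {H. subgroup H G} r \<and>
     (\<forall>(K, H)\<in>r. K \<subseteq> H) \<and>
     (\<forall>(K, H)\<in>r. \<forall>g\<in>carrier G. (conj_sub G g K, conj_sub G g H) \<in> r) \<and>
     (\<forall>(K, H)\<in>r. \<forall>L. subgroup L G \<and> L \<subseteq> H \<longrightarrow> (K \<inter> L, L) \<in> r)"

definition SubO :: "('g, 'b) monoid_scheme \<Rightarrow> ('g set \<times> 'g set) set \<Rightarrow> 'g set set" where
  "SubO G r = {H. (H, carrier G) \<in> r}"

definition SubO_classes :: "('g, 'b) monoid_scheme \<Rightarrow> ('g set \<times> 'g set) set \<Rightarrow> 'g set set set" where
  "SubO_classes G r = {{conj_sub G g H | g. g \<in> carrier G} | H. H \<in> SubO G r}"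

section \<open>Finite G-sets and the Lindner category\<close>

text \<open>Every finite G-set is isomorphic to one whose points are natural numbers; products and
  disjoint unions stay inside this small model through the standard codings of pairs and sums.
  Off the carrier of \<open>G\<close> and off the points, actions are normalised to \<open>undefined\<close>.\<close>

record 'g gset =
  pts :: "nat set"
  act :: "'g \<Rightarrow> nat \<Rightarrow> nat"

definition gsets :: "('g, 'b) monoid_scheme \<Rightarrow> 'g gset set" where
  "gsets G = {S. finite (pts S) \<and> group_action G (pts S) (act S) \<and> act S \<in> extensional (carrier G)}"

definition gsub :: "('g, 'b) monoid_scheme \<Rightarrow> 'g gset \<Rightarrow> nat set \<Rightarrow> 'g gset" where
  "gsub G S B = \<lparr>pts = B, act = (\<lambda>g\<in>carrier G. \<lambda>x\<in>B. act S g x)\<rparr>"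

definition gpt :: "('g, 'b) monoid_scheme \<Rightarrow> 'g gset" where
  "gpt G = \<lparr>pts = {0}, act = (\<lambda>g\<in>carrier G. \<lambda>x\<in>{0}. 0)\<rparr>"

definition pfst :: "nat \<Rightarrow> nat" where "pfst z = fst (prod_decode z)"
definition psnd :: "nat \<Rightarrow> nat" where "psnd z = snd (prod_decode z)"

definition gprod :: "('g, 'b) monoid_scheme \<Rightarrow> 'g gset \<Rightarrow> 'g gset \<Rightarrow> 'g gset" where
  "gprod G S T =
     \<lparr>pts = prod_encode ` (pts S \<times> pts T),
      act = (\<lambda>g\<in>carrier G. \<lambda>z\<in>prod_encode ` (pts S \<times> pts T).
               prod_encode (act S g (pfst z), act T g (psnd z)))\<rparr>"

definition gsum :: "('g, 'b) monoid_scheme \<Rightarrow> 'g gset \<Rightarrow> 'g gset \<Rightarrow> 'g gset" where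
  "gsum G S T =
     \<lparr>pts = sum_encode ` (pts S <+> pts T),
      act = (\<lambda>g\<in>carrier G. \<lambda>z\<in>sum_encode ` (pts S <+> pts T).
               sum_encode (map_sum (act S g) (act T g) (sum_decode z)))\<rparr>"

definition emaps :: "('g, 'b) monoid_scheme \<Rightarrow> 'g gset \<Rightarrow> 'g gset \<Rightarrow> (nat \<Rightarrow> nat) set" where
  "emaps G S T = {f \<in> pts S \<rightarrow>\<^sub>E pts T.
     \<forall>g\<in>carrier G. \<forall>x\<in>pts S. f (act S g x) = act T g (f x)}"

definition emapsO :: "('g, 'b) monoid_scheme \<Rightarrow> ('g set \<times> 'g set) set \<Rightarrow>
    'g gset \<Rightarrow> 'g gset \<Rightarrow> (nat \<Rightarrow> nat) set" where
  "emapsO G r S T = {f \<in> emaps G S T.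
     \<forall>x\<in>pts S. (stabilizer G (act S) x, stabilizer G (act T) (f x)) \<in> r}"

text \<open>A span \<open>(U, l, h)\<close> stands for \<open>S \<leftarrow> U \<rightarrow> T\<close> with left leg \<open>l\<close> and right leg \<open>h\<close>.\<close>

type_synonym 'g span = "'g gset \<times> (nat \<Rightarrow> nat) \<times> (nat \<Rightarrow> nat)"

definition spans :: "('g, 'b) monoid_scheme \<Rightarrow> ('g set \<times> 'g set) set \<Rightarrow>
    'g gset \<Rightarrow> 'g gset \<Rightarrow> 'g span set" where
  "spans G r S T = {(U, l, h). U \<in> gsets G \<and> l \<in> emaps G U S \<and> h \<in> emapsO G r U T}"

definition span_rel :: "('g, 'b) monoid_scheme \<Rightarrow> ('g set \<times> 'g set) set \<Rightarrow>
    'g gset \<Rightarrow> 'g gset \<Rightarrow> ('g span \<times> 'g span) set" where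
  "span_rel G r S T =
     {((U, l, h), (U', l', h')). (U, l, h) \<in> spans G r S T \<and> (U', l', h') \<in> spans G r S T \<and>
        (\<exists>f\<in>emaps G U U'. bij_betw f (pts U) (pts U') \<and>
           (\<forall>u\<in>pts U. l' (f u) = l u \<and> h' (f u) = h u))}"

abbreviation span_class :: "('g, 'b) monoid_scheme \<Rightarrow> ('g set \<times> 'g set) set \<Rightarrow>
    'g gset \<Rightarrow> 'g gset \<Rightarrow> 'g span \<Rightarrow> 'g span set" where
  "span_class G r S T \<sigma> \<equiv> span_rel G r S T `` {\<sigma>}"

definition span_pb :: "('g, 'b) monoid_scheme \<Rightarrow> 'g span \<Rightarrow> 'g span \<Rightarrow> 'g span" where
  "span_pb G = (\<lambda>(U, l, h) (V, l', h').
     let P = {z \<in> pts (gprod G U V). h (pfst z) = l' (psnd z)}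
     in (gsub G (gprod G U V) P, \<lambda>z\<in>P. l (pfst z), \<lambda>z\<in>P. h' (psnd z)))"

definition Lindner :: "('g, 'b) monoid_scheme \<Rightarrow> ('g set \<times> 'g set) set \<Rightarrow>
    ('g gset, 'g span set) cat" where
  "Lindner G r =
     \<lparr>obj = gsets G,
      arr = (\<lambda>S T. spans G r S T // span_rel G r S T),
      ide = (\<lambda>S. span_class G r S S (S, \<lambda>x\<in>pts S. x, \<lambda>x\<in>pts S. x)),
      cmp = (\<lambda>S T W Y X. span_rel G r S W `` {span_pb G \<sigma> \<tau> | \<sigma> \<tau>. \<sigma> \<in> X \<and> \<tau> \<in> Y})\<rparr>"

text \<open>The morphism \<open>S = S \<rightarrow> T\<close> given by \<open>f : S \<rightarrow> T\<close> in Fin_O, and the morphism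
  \<open>T \<leftarrow> S = S\<close> given by an arbitrary equivariant \<open>f : S \<rightarrow> T\<close>.\<close>

definition tr :: "('g, 'b) monoid_scheme \<Rightarrow> ('g set \<times> 'g set) set \<Rightarrow>
    'g gset \<Rightarrow> 'g gset \<Rightarrow> (nat \<Rightarrow> nat) \<Rightarrow> 'g span set" where
  "tr G r S T f = span_class G r S T (S, \<lambda>x\<in>pts S. x, f)"

definition res :: "('g, 'b) monoid_scheme \<Rightarrow> ('g set \<times> 'g set) set \<Rightarrow>
    'g gset \<Rightarrow> 'g gset \<Rightarrow> (nat \<Rightarrow> nat) \<Rightarrow> 'g span set" where
  "res G r S T f = span_class G r T S (S, f, \<lambda>x\<in>pts S. x)"

text \<open>The functor \<open>S, T \<mapsto> S \<times> T\<close> on morphisms of the Lindner category.\<close>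

definition span_prod :: "('g, 'b) monoid_scheme \<Rightarrow> 'g span \<Rightarrow> 'g span \<Rightarrow> 'g span" where
  "span_prod G = (\<lambda>(U, l, h) (V, l', h').
     (gprod G U V, \<lambda>z\<in>pts (gprod G U V). prod_encode (l (pfst z), l' (psnd z)),
                   \<lambda>z\<in>pts (gprod G U V). prod_encode (h (pfst z), h' (psnd z))))"

definition lprod :: "('g, 'b) monoid_scheme \<Rightarrow> ('g set \<times> 'g set) set \<Rightarrow>
    'g gset \<Rightarrow> 'g gset \<Rightarrow> 'g gset \<Rightarrow> 'g gset \<Rightarrow> 'g span set \<Rightarrow> 'g span set \<Rightarrow> 'g span set" where
  "lprod G r S S' T T' X Y =
     span_rel G r (gprod G S T) (gprod G S' T') `` {span_prod G \<sigma> \<tau> | \<sigma> \<tau>. \<sigma> \<in> X \<and> \<tau> \<in> Y}"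

section \<open>Rational O-Mackey functors\<close>

text \<open>The product of \<open>S\<close> and \<open>T\<close> in the Lindner category is their disjoint union, with the
  restrictions along the two inclusions as projections; the empty G-set is terminal.\<close>

definition product_preserving :: "('g, 'b) monoid_scheme \<Rightarrow> ('g set \<times> 'g set) set \<Rightarrow>
    ('g gset, 'g span set, (rat, 'v) module, 'v \<Rightarrow> 'v) func \<Rightarrow> bool" where
  "product_preserving G r M \<longleftrightarrow>
     (\<forall>S\<in>gsets G. \<forall>T\<in>gsets G.
        bij_betw
          (\<lambda>x. (fmor M (gsum G S T) S
                  (res G r S (gsum G S T) (\<lambda>s\<in>pts S. sum_encode (Inl s))) x,
                fmor M (gsum G S T) T
                  (res G r T (gsum G S T) (\<lambda>t\<in>pts T. sum_encode (Inr t))) x))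
          (carrier (fob M (gsum G S T))) (carrier (fob M S) \<times> carrier (fob M T))) \<and>
     (\<forall>S\<in>gsets G. pts S = {} \<longrightarrow> carrier (fob M S) = {\<zero>\<^bsub>fob M S\<^esub>})"

text \<open>The universe of vectors: subsets of \<open>'v\<close>. The Day structure below is taken over \<open>('g, 'u) val\<close>, where
  the left summand holds the values of the Burnside Mackey functor and \<open>'u\<close> is arbitrary.\<close>

type_synonym ('g, 'u) val = "('g span set \<Rightarrow> rat) + 'u"

type_synonym ('g, 'v) mfun = "('g gset, 'g span set, (rat, 'v) module, 'v \<Rightarrow> 'v) func"

type_synonym ('g, 'v) mtrafo = "'g gset \<Rightarrow> 'v \<Rightarrow> 'v"

type_synonym ('g, 'u) mackey_cat = "(('g, ('g, 'u) val) mfun, ('g, ('g, 'u) val) mtrafo) cat"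

type_synonym ('g, 'u) mackey_moncat = "(('g, ('g, 'u) val) mfun, ('g, ('g, 'u) val) mtrafo) moncat"

definition Mackey :: "('g, 'b) monoid_scheme \<Rightarrow> ('g set \<times> 'g set) set \<Rightarrow>
    (('g, 'v) mfun, ('g, 'v) mtrafo) cat" where
  "Mackey G r = full_subcat (functor_cat (Lindner G r) Vect) (product_preserving G r)"

section \<open>The rational O-Burnside Mackey functor\<close>

text \<open>A finite G-set over \<open>S\<close> with structure map in Fin_O is the same as a morphism from the
  one-point G-set to \<open>S\<close> in the Lindner category. For \<open>S = G/H\<close>, taking the fibre over \<open>eH\<close>
  identifies these with the finite H-sets all of whose orbits are \<open>H/K\<close> with \<open>K \<rightarrow> H\<close>. So the
  value at \<open>S\<close> is the rational vector space on the classes of orbits over \<open>S\<close>. A morphism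
  \<open>S \<leftarrow> U \<rightarrow> T\<close> acts by composition, that is, by pulling back along the left leg (restriction
  and conjugation) and composing with the right leg (on H-sets: induction).\<close>

definition orbit_classes :: "('g, 'b) monoid_scheme \<Rightarrow> ('g set \<times> 'g set) set \<Rightarrow>
    'g gset \<Rightarrow> 'g span set set" where
  "orbit_classes G r S = {\<kappa> \<in> arr (Lindner G r) (gpt G) S.
     \<forall>(U, l, h)\<in>\<kappa>. transitive_action G (pts U) (act U) \<and> pts U \<noteq> {}}"

text \<open>The class in the Burnside group of a finite G-set over \<open>S\<close>: the multiplicities of its
  orbits.\<close>

definition orbit_decomp :: "('g, 'b) monoid_scheme \<Rightarrow> ('g set \<times> 'g set) set \<Rightarrow>
    'g gset \<Rightarrow> 'g span set \<Rightarrow> 'g span set \<Rightarrow> rat" where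
  "orbit_decomp G r S Y = (\<lambda>\<kappa>. case (SOME \<sigma>. \<sigma> \<in> Y) of (U, l, h) \<Rightarrow>
     of_nat (card {B \<in> orbits G (pts U) (act U).
       span_class G r (gpt G) S (gsub G U B, restrict l B, restrict h B) = \<kappa>}))"

definition burnside_ob :: "('g, 'b) monoid_scheme \<Rightarrow> ('g set \<times> 'g set) set \<Rightarrow>
    'g gset \<Rightarrow> (rat, ('g, 'u) val) module" where
  "burnside_ob G r S =
     \<lparr>carrier = Inl ` {c. finite {\<kappa>. c \<kappa> \<noteq> 0} \<and> {\<kappa>. c \<kappa> \<noteq> 0} \<subseteq> orbit_classes G r S},
      mult = undefined, one = undefined,
      zero = Inl (\<lambda>\<kappa>. 0),
      add = (\<lambda>x y. Inl (\<lambda>\<kappa>. projl x \<kappa> + projl y \<kappa>)),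
      smult = (\<lambda>q x. Inl (\<lambda>\<kappa>. q * projl x \<kappa>))\<rparr>"

definition Burnside :: "('g, 'b) monoid_scheme \<Rightarrow> ('g set \<times> 'g set) set \<Rightarrow>
    ('g, ('g, 'u) val) mfun" where
  "Burnside G r =
     \<lparr>fob = burnside_ob G r,
      fmor = (\<lambda>S T X. \<lambda>x\<in>carrier (burnside_ob G r S).
        Inl (\<lambda>\<kappa>'. \<Sum>\<kappa> | projl x \<kappa> \<noteq> 0. projl x \<kappa> *
               orbit_decomp G r T (cmp (Lindner G r) (gpt G) S T X \<kappa>) \<kappa>'))\<rparr>"

definition burnside_one :: "('g, 'b) monoid_scheme \<Rightarrow> ('g set \<times> 'g set) set \<Rightarrow> ('g, 'u) val" where
  "burnside_one G r = Inl (orbit_decomp G r (gpt G) (ide (Lindner G r) (gpt G)))"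

text \<open>The linear extension of \<open>T \<mapsto> |T\<^sup>K|\<close>, and the element of the Burnside ring that it sends
  to the characteristic function of a conjugacy class \<open>C\<close>.\<close>

definition mark :: "'g set \<Rightarrow> ('g, 'u) val \<Rightarrow> rat" where
  "mark K x = (\<Sum>\<kappa> | projl x \<kappa> \<noteq> 0. projl x \<kappa> *
     (case (SOME \<sigma>. \<sigma> \<in> \<kappa>) of (U, l, h) \<Rightarrow>
        of_nat (card {u \<in> pts U. \<forall>k\<in>K. act U k u = u})))"

definition idem :: "('g, 'b) monoid_scheme \<Rightarrow> ('g set \<times> 'g set) set \<Rightarrow> 'g set set \<Rightarrow> ('g, 'u) val" where
  "idem G r C = (THE e. e \<in> carrier (burnside_ob G r (gpt G)) \<and>
     (\<forall>K\<in>SubO G r. mark K e = (if K \<in> C then 1 else 0)))"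

section \<open>Day convolution\<close>

text \<open>The Day convolution of \<open>M\<close> and \<open>N\<close> is the left Kan extension of \<open>S, T \<mapsto> M(S) \<otimes> N(T)\<close>
  along the product of G-sets. A map from \<open>M(S) \<otimes> N(T)\<close> to \<open>P(S \<times> T)\<close> natural in \<open>S\<close> and \<open>T\<close> is
  a natural family of bilinear maps, and the defining universal property of the Kan extension
  says that there is a universal such family.\<close>

definition is_pairing :: "('g, 'b) monoid_scheme \<Rightarrow> ('g set \<times> 'g set) set \<Rightarrow>
    ('g, 'v) mfun \<Rightarrow> ('g, 'v) mfun \<Rightarrow> ('g, 'v) mfun \<Rightarrow>
    ('g gset \<Rightarrow> 'g gset \<Rightarrow> 'v \<Rightarrow> 'v \<Rightarrow> 'v) \<Rightarrow> bool" where
  "is_pairing G r M N P \<beta> \<longleftrightarrow>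
     (\<forall>S\<in>gsets G. \<forall>T\<in>gsets G.
        (\<forall>m\<in>carrier (fob M S).
           (\<lambda>n\<in>carrier (fob N T). \<beta> S T m n) \<in> linmaps (fob N T) (fob P (gprod G S T))) \<and>
        (\<forall>n\<in>carrier (fob N T).
           (\<lambda>m\<in>carrier (fob M S). \<beta> S T m n) \<in> linmaps (fob M S) (fob P (gprod G S T)))) \<and>
     (\<forall>S\<in>gsets G. \<forall>S'\<in>gsets G. \<forall>T\<in>gsets G. \<forall>T'\<in>gsets G.
        \<forall>X\<in>arr (Lindner G r) S S'. \<forall>Y\<in>arr (Lindner G r) T T'.
        \<forall>m\<in>carrier (fob M S). \<forall>n\<in>carrier (fob N T).
          fmor P (gprod G S T) (gprod G S' T') (lprod G r S S' T T' X Y) (\<beta> S T m n) =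
          \<beta> S' T' (fmor M S S' X m) (fmor N T T' Y n))"

definition is_day :: "('g, 'b) monoid_scheme \<Rightarrow> ('g set \<times> 'g set) set \<Rightarrow>
    ('g, 'v) mfun \<Rightarrow> ('g, 'v) mfun \<Rightarrow> ('g, 'v) mfun \<Rightarrow>
    ('g gset \<Rightarrow> 'g gset \<Rightarrow> 'v \<Rightarrow> 'v \<Rightarrow> 'v) \<Rightarrow> bool" where
  "is_day G r M N P \<eta> \<longleftrightarrow>
     P \<in> obj (Mackey G r) \<and> is_pairing G r M N P \<eta> \<and>
     (\<forall>Q\<in>obj (Mackey G r). \<forall>\<beta>. is_pairing G r M N Q \<beta> \<longrightarrow>
        (\<exists>!t. t \<in> arr (Mackey G r) P Q \<and>
           (\<forall>S\<in>gsets G. \<forall>T\<in>gsets G. \<forall>m\<in>carrier (fob M S). \<forall>n\<in>carrier (fob N T).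
              t (gprod G S T) (\<eta> S T m n) = \<beta> S T m n)))"

text \<open>A chosen Day convolution and its universal pairing. All structure maps below are the
  unique ones compatible with the universal pairings.\<close>

definition day_pair :: "('g, 'b) monoid_scheme \<Rightarrow> ('g set \<times> 'g set) set \<Rightarrow>
    ('g, 'v) mfun \<Rightarrow> ('g, 'v) mfun \<Rightarrow>
    ('g, 'v) mfun \<times> ('g gset \<Rightarrow> 'g gset \<Rightarrow> 'v \<Rightarrow> 'v \<Rightarrow> 'v)" where
  "day_pair G r M N = (SOME (P, \<eta>). is_day G r M N P \<eta>)"

definition day :: "('g, 'b) monoid_scheme \<Rightarrow> ('g set \<times> 'g set) set \<Rightarrow>
    ('g, 'v) mfun \<Rightarrow> ('g, 'v) mfun \<Rightarrow> ('g, 'v) mfun" where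
  "day G r M N = fst (day_pair G r M N)"

definition day_univ :: "('g, 'b) monoid_scheme \<Rightarrow> ('g set \<times> 'g set) set \<Rightarrow>
    ('g, 'v) mfun \<Rightarrow> ('g, 'v) mfun \<Rightarrow> 'g gset \<Rightarrow> 'g gset \<Rightarrow> 'v \<Rightarrow> 'v \<Rightarrow> 'v" where
  "day_univ G r M N = snd (day_pair G r M N)"

definition day_map :: "('g, 'b) monoid_scheme \<Rightarrow> ('g set \<times> 'g set) set \<Rightarrow>
    ('g, 'v) mfun \<Rightarrow> ('g, 'v) mfun \<Rightarrow> ('g, 'v) mfun \<Rightarrow> ('g, 'v) mfun \<Rightarrow>
    ('g, 'v) mtrafo \<Rightarrow> ('g, 'v) mtrafo \<Rightarrow> ('g, 'v) mtrafo" where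
  "day_map G r M M' N N' f g = (THE t. t \<in> arr (Mackey G r) (day G r M N) (day G r M' N') \<and>
     (\<forall>S\<in>gsets G. \<forall>T\<in>gsets G. \<forall>m\<in>carrier (fob M S). \<forall>n\<in>carrier (fob N T).
        t (gprod G S T) (day_univ G r M N S T m n) = day_univ G r M' N' S T (f S m) (g T n)))"

definition reassoc :: "nat \<Rightarrow> nat" where
  "reassoc z = prod_encode (pfst (pfst z), prod_encode (psnd (pfst z), psnd z))"

definition day_assoc :: "('g, 'b) monoid_scheme \<Rightarrow> ('g set \<times> 'g set) set \<Rightarrow>
    ('g, 'v) mfun \<Rightarrow> ('g, 'v) mfun \<Rightarrow> ('g, 'v) mfun \<Rightarrow> ('g, 'v) mtrafo" where
  "day_assoc G r L M N =
     (THE t. t \<in> arr (Mackey G r) (day G r (day G r L M) N) (day G r L (day G r M N)) \<and>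
       (\<forall>S\<in>gsets G. \<forall>T\<in>gsets G. \<forall>W\<in>gsets G.
        \<forall>l\<in>carrier (fob L S). \<forall>m\<in>carrier (fob M T). \<forall>n\<in>carrier (fob N W).
          (let ST_W = gprod G (gprod G S T) W; S_TW = gprod G S (gprod G T W) in
           fmor (day G r L (day G r M N)) ST_W S_TW (tr G r ST_W S_TW (restrict reassoc (pts ST_W)))
             (t ST_W (day_univ G r (day G r L M) N (gprod G S T) W (day_univ G r L M S T l m) n)) =
           day_univ G r L (day G r M N) S (gprod G T W) l (day_univ G r M N T W m n))))"

definition pt_iso :: "('g, 'b) monoid_scheme \<Rightarrow> ('g set \<times> 'g set) set \<Rightarrow> 'g gset \<Rightarrow> 'g span set" where
  "pt_iso G r T = tr G r (gprod G (gpt G) T) T (restrict psnd (pts (gprod G (gpt G) T)))"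

definition day_lunit :: "('g, 'b) monoid_scheme \<Rightarrow> ('g set \<times> 'g set) set \<Rightarrow>
    ('g, ('g, 'u) val) mfun \<Rightarrow> ('g, ('g, 'u) val) mtrafo" where
  "day_lunit G r M =
     (THE t. t \<in> arr (Mackey G r) (day G r (Burnside G r) M) M \<and>
       (\<forall>T\<in>gsets G. \<forall>m\<in>carrier (fob M T).
          fmor M (gprod G (gpt G) T) T (pt_iso G r T)
            (t (gprod G (gpt G) T)
               (day_univ G r (Burnside G r) M (gpt G) T (burnside_one G r) m)) = m))"

definition Day :: "('g, 'b) monoid_scheme \<Rightarrow> ('g set \<times> 'g set) set \<Rightarrow> ('g, 'u) mackey_moncat" where
  "Day G r =
     \<lparr>obj = obj (Mackey G r), arr = arr (Mackey G r),
      ide = ide (Mackey G r), cmp = cmp (Mackey G r),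
      ten = day G r, tenm = day_map G r,
      munit = Burnside G r, massoc = day_assoc G r, mlunit = day_lunit G r\<rparr>"

section \<open>Idempotent summands\<close>

definition burnside_monoid :: "('g, 'b) monoid_scheme \<Rightarrow> ('g set \<times> 'g set) set \<Rightarrow>
    (('g, ('g, 'u) val) mfun, ('g, ('g, 'u) val) mtrafo) monoid_obj" where
  "burnside_monoid G r =
     \<lparr>mob = Burnside G r,
      mmul = mlunit (Day G r) (Burnside G r),
      mone = ide (Day G r) (Burnside G r)\<rparr>"

text \<open>The canonical action on \<open>M(S)\<close> of \<open>e\<close> in the Burnside ring of \<open>G/G\<close>, i.e. the component
  at \<open>(G/G, S)\<close> of the left unitor. On the Burnside functor it is multiplication by the
  restriction of \<open>e\<close>.\<close>

definition elt_act :: "('g, 'b) monoid_scheme \<Rightarrow> ('g set \<times> 'g set) set \<Rightarrow> ('g, 'u) val \<Rightarrow>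
    ('g, ('g, 'u) val) mfun \<Rightarrow> ('g, ('g, 'u) val) mtrafo" where
  "elt_act G r e M S m =
     fmor M (gprod G (gpt G) S) S (pt_iso G r S)
       (day_lunit G r M (gprod G (gpt G) S)
          (day_univ G r (Burnside G r) M (gpt G) S e m))"

definition acts_as_id :: "('g, 'b) monoid_scheme \<Rightarrow> ('g set \<times> 'g set) set \<Rightarrow> ('g, 'u) val \<Rightarrow>
    ('g, ('g, 'u) val) mfun \<Rightarrow> bool" where
  "acts_as_id G r e M \<longleftrightarrow> (\<forall>S\<in>gsets G. \<forall>m\<in>carrier (fob M S). elt_act G r e M S m = m)"

definition summand :: "('g, 'b) monoid_scheme \<Rightarrow> ('g set \<times> 'g set) set \<Rightarrow> ('g, 'u) val \<Rightarrow>
    ('g, ('g, 'u) val) mfun \<Rightarrow> ('g, ('g, 'u) val) mfun" where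
  "summand G r e M =
     \<lparr>fob = (\<lambda>S. (fob M S)\<lparr>carrier := elt_act G r e M S ` carrier (fob M S)\<rparr>),
      fmor = (\<lambda>S T X. restrict (fmor M S T X) (elt_act G r e M S ` carrier (fob M S)))\<rparr>"

definition summand_incl :: "('g, 'b) monoid_scheme \<Rightarrow> ('g set \<times> 'g set) set \<Rightarrow> ('g, 'u) val \<Rightarrow>
    ('g, ('g, 'u) val) mfun \<Rightarrow> ('g, ('g, 'u) val) mtrafo" where
  "summand_incl G r e M = (\<lambda>S\<in>gsets G. \<lambda>m\<in>carrier (fob (summand G r e M) S). m)"

text \<open>For an action \<open>\<rho>\<close> of the Burnside functor \<open>A\<close> on \<open>M\<close>: the induced map
  \<open>eA \<box> eM \<rightarrow> A \<box> M \<rightarrow> M\<close>, whose values lie in \<open>eM\<close>.\<close>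

definition summand_action :: "('g, 'b) monoid_scheme \<Rightarrow> ('g set \<times> 'g set) set \<Rightarrow> ('g, 'u) val \<Rightarrow>
    ('g, ('g, 'u) val) mfun \<Rightarrow> ('g, ('g, 'u) val) mtrafo \<Rightarrow> ('g, ('g, 'u) val) mtrafo" where
  "summand_action G r e M \<rho> =
     (let A = Burnside G r; eA = summand G r e A; eM = summand G r e M in
      cmp (Day G r) (ten (Day G r) eA eM) (ten (Day G r) A M) M \<rho>
        (tenm (Day G r) eA A eM M (summand_incl G r e A) (summand_incl G r e M)))"

definition summand_monoid :: "('g, 'b) monoid_scheme \<Rightarrow> ('g set \<times> 'g set) set \<Rightarrow> ('g, 'u) val \<Rightarrow>
    (('g, ('g, 'u) val) mfun, ('g, ('g, 'u) val) mtrafo) monoid_obj" where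
  "summand_monoid G r e =
     \<lparr>mob = summand G r e (Burnside G r),
      mmul = summand_action G r e (Burnside G r) (mmul (burnside_monoid G r)),
      mone = (\<lambda>S\<in>gsets G. \<lambda>a\<in>carrier (fob (Burnside G r) S). elt_act G r e (Burnside G r) S a)\<rparr>"

text \<open>The functor \<open>M \<mapsto> (e\<^sub>C M)\<^sub>C\<close> over the conjugacy classes \<open>C\<close>.\<close>

definition splitting :: "('g, 'b) monoid_scheme \<Rightarrow> ('g set \<times> 'g set) set \<Rightarrow>
    (('g, ('g, 'u) val) mfun \<times> ('g, ('g, 'u) val) mtrafo, ('g, ('g, 'u) val) mtrafo,
     'g set set \<Rightarrow> ('g, ('g, 'u) val) mfun \<times> ('g, ('g, 'u) val) mtrafo,
     'g set set \<Rightarrow> ('g, ('g, 'u) val) mtrafo) func" where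
  "splitting G r =
     \<lparr>fob = (\<lambda>(M, \<rho>). \<lambda>C\<in>SubO_classes G r.
               (summand G r (idem G r C) M, summand_action G r (idem G r C) M \<rho>)),
      fmor = (\<lambda>(M, \<rho>) (N, \<sigma>) f. \<lambda>C\<in>SubO_classes G r. \<lambda>S\<in>gsets G.
               \<lambda>m\<in>carrier (fob (summand G r (idem G r C) M) S). f S m)\<rparr>"

end

theory Submission
  imports Defs "HOL-Library.Countable_Set"
begin

text \<open>A rational O-Mackey functor is a linear functor on the Lindner category that is additive when the
  apex of a span is split into invariant subsets. The Burnside functor \<open>A\<close> is the linearised
  functor represented by the one-point G-set, so by the Yoneda lemma the summand \<open>eA\<close> is generated by \<open>e\<close>, and
  a pairing out of \<open>eA\<close> and \<open>M\<close> is determined by its value at \<open>e\<close>. This identifies the Day convolution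
  of \<open>eA\<close> and \<open>M\<close> with the image \<open>eM\<close>; hence \<open>M\<close> carries an \<open>eA\<close>-module structure if and only if \<open>e\<close>
  acts as the identity on \<open>M\<close>, the structure is then unique, and every natural transformation respects it.
  The table of marks is triangular with nonzero diagonal, so the Burnside ring contains the orthogonal
  idempotents \<open>e\<^sub>C\<close>, which sum to \<open>1\<close>, and every \<open>M\<close> is the direct sum of the \<open>e\<^sub>C M\<close>. A natural
  transformation commutes with the idempotents, so there are no nonzero ones between different
  summands.\<close>

text \<open>The structure maps of \<open>Day G r\<close> are definite descriptions about Day
  convolutions taken by choice, so nothing is known about them before existence and uniqueness are
  shown. Existence inside the fixed universe is proved for left factors that are copies of
  \<open>eA\<close>, because there the convolution is the concrete functor \<open>smd e M\<close>.
  The predicate \<open>cyc\<close> captures such copies up to isomorphism; it covers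
  \<open>A\<close>, \<open>eA\<close> and the chosen square \<open>dy R R\<close> of a copy
  \<open>R\<close>, and these are the left factors in the module laws. The definition of
  \<open>summand\<close> itself refers to the left unitor, so \<open>eM\<close> is first built as
  \<open>smd\<close> from an action \<open>cact\<close> that is free of choices, and is identified
  with \<open>summand\<close> afterwards. The concrete identities concern the external product
  \<open>box\<close>; they are linear, hence are checked on orbits, where they become isomorphisms
  of explicit spans. Division of coefficients occurs only in \<open>realizable_cls\<close>, by the
  mark of \<open>G/H\<close> at \<open>H\<close>.\<close>

lemma pfst_encode [simp]: "pfst (prod_encode (a, b)) = a"
  by (simp add: pfst_def)

lemma psnd_encode [simp]: "psnd (prod_encode (a, b)) = b"
  by (simp add: psnd_def)

lemma encode_pfst_psnd [simp]: "prod_encode (pfst z, psnd z) = z"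
  by (simp add: pfst_def psnd_def)

lemma pair_code_eqI: "pfst z = pfst w \<Longrightarrow> psnd z = psnd w \<Longrightarrow> z = w"
  by (metis encode_pfst_psnd)

section \<open>Closure properties of transfer systems\<close>

locale transfer_group = group G for G (structure) +
  fixes r :: "('a set \<times> 'a set) set"
  assumes fin: "finite (carrier G)" and ts: "transfer_system G r"
begin

lemma r_subgroup: assumes "(K, H) \<in> r" shows "subgroup K G" "subgroup H G" "K \<subseteq> H"
  using ts assms unfolding transfer_system_def partial_order_on_def preorder_on_def refl_on_def
  by auto

lemma r_refl: "subgroup H G \<Longrightarrow> (H, H) \<in> r"
  using ts unfolding transfer_system_def partial_order_on_def preorder_on_def refl_on_def by auto

lemma r_trans: "(K, H) \<in> r \<Longrightarrow> (H, J) \<in> r \<Longrightarrow> (K, J) \<in> r"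
  using ts unfolding transfer_system_def partial_order_on_def preorder_on_def trans_def by blast

lemma r_Int: "(K, H) \<in> r \<Longrightarrow> subgroup L G \<Longrightarrow> L \<subseteq> H \<Longrightarrow> (K \<inter> L, L) \<in> r"
  using ts unfolding transfer_system_def by blast

text \<open>Restrict \<open>K \<rightarrow> H\<close> to \<open>H \<inter> H'\<close>, restrict
  \<open>K' \<rightarrow> H'\<close> to \<open>K \<inter> H'\<close>, and compose. A point of a
  product has the intersection of two stabilisers, so this puts products of right legs into
  Fin_O.\<close>

lemma r_Int2: assumes "(K, H) \<in> r" "(K', H') \<in> r" shows "(K \<inter> K', H \<inter> H') \<in> r"
proof -
  note s = r_subgroup[OF assms(1)] r_subgroup[OF assms(2)]
  have HH: "subgroup (H \<inter> H') G" and KH: "subgroup (K \<inter> H') G"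
    using s by (simp_all add: subgroups_Inter_pair)
  have 1: "(K \<inter> (H \<inter> H'), H \<inter> H') \<in> r" using r_Int[OF assms(1) HH] by blast
  have 2: "(K' \<inter> (K \<inter> H'), K \<inter> H') \<in> r" using r_Int[OF assms(2) KH] by blast
  have "K \<inter> (H \<inter> H') = K \<inter> H'" "K' \<inter> (K \<inter> H') = K \<inter> K'" using s by auto
  then show ?thesis using 1 2 r_trans by metis
qed

subsection \<open>Finite G-sets\<close>

text \<open>Replaces the homomorphism into \<open>BijGroup\<close> hidden in
  \<open>group_action\<close> by pointwise axioms; bijectivity of each \<open>act S g\<close> comes
  from the action of \<open>inv g\<close>.\<close>

lemma gsets_iff: "S \<in> gsets G \<longleftrightarrow> finite (pts S) \<and> act S \<in> extensional (carrier G) \<and>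
   (\<forall>g\<in>carrier G. act S g \<in> extensional (pts S) \<and> (\<forall>x\<in>pts S. act S g x \<in> pts S)) \<and>
   (\<forall>x\<in>pts S. act S \<one> x = x) \<and>
   (\<forall>g\<in>carrier G. \<forall>h\<in>carrier G. \<forall>x\<in>pts S. act S (g \<otimes> h) x = act S g (act S h x))"
  (is "?L \<longleftrightarrow> ?R")
proof
  assume ?L
  then interpret group_action G "pts S" "act S" by (simp add: gsets_def)
  have "act S g \<in> extensional (pts S)" if "g \<in> carrier G" for g
    using bij_prop0[OF that] by (simp add: Bij_def)
  moreover have "act S \<one> x = x" if "x \<in> pts S" for x
    using fun_cong[OF id_eq_one, of x] that by simp
  moreover have "act S g x \<in> pts S" if "g \<in> carrier G" "x \<in> pts S" for g x
    using element_image[OF that refl] .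
  ultimately show ?R using \<open>?L\<close> composition_rule by (simp add: gsets_def)
next
  assume R: ?R
  have bij: "act S g \<in> Bij (pts S)" if g: "g \<in> carrier G" for g
  proof -
    have "bij_betw (act S g) (pts S) (pts S)"
    proof (rule bij_betw_byWitness[where f' = "act S (inv g)"])
      show "\<forall>a\<in>pts S. act S (inv g) (act S g a) = a" using R g by (metis inv_closed l_inv)
      show "\<forall>a\<in>pts S. act S g (act S (inv g) a) = a" using R g by (metis inv_closed r_inv)
    qed (use R g in auto)
    then show ?thesis using R g by (simp add: Bij_def)
  qed
  have "act S \<in> hom G (BijGroup (pts S))"
  proof (rule homI)
    fix g h assume gh: "g \<in> carrier G" "h \<in> carrier G"
    show "act S (g \<otimes> h) = act S g \<otimes>\<^bsub>BijGroup (pts S)\<^esub> act S h"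
      using R gh bij by (intro ext) (auto simp: BijGroup_def compose_def extensional_def)
  qed (simp add: BijGroup_def bij)
  then have "group_action G (pts S) (act S)"
    by (simp add: group_action_def group_hom_def group_hom_axioms_def group_BijGroup is_group)
  then show ?L using R by (simp add: gsets_def)
qed

lemma gsetsI: "finite (pts S) \<Longrightarrow> act S \<in> extensional (carrier G) \<Longrightarrow>
   (\<And>g. g \<in> carrier G \<Longrightarrow> act S g \<in> extensional (pts S)) \<Longrightarrow>
   (\<And>g x. g \<in> carrier G \<Longrightarrow> x \<in> pts S \<Longrightarrow> act S g x \<in> pts S) \<Longrightarrow>
   (\<And>x. x \<in> pts S \<Longrightarrow> act S \<one> x = x) \<Longrightarrow>
   (\<And>g h x. g \<in> carrier G \<Longrightarrow> h \<in> carrier G \<Longrightarrow> x \<in> pts S \<Longrightarrow> act S (g \<otimes> h) x = act S g (act S h x)) \<Longrightarrow>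
   S \<in> gsets G"
  unfolding gsets_iff by blast

lemma gset_action: "S \<in> gsets G \<Longrightarrow> group_action G (pts S) (act S)"
  unfolding gsets_def by blast

lemma gset_finite [simp]: "S \<in> gsets G \<Longrightarrow> finite (pts S)"
  unfolding gsets_iff by blast

lemma act_closed [simp]: "S \<in> gsets G \<Longrightarrow> g \<in> carrier G \<Longrightarrow> x \<in> pts S \<Longrightarrow> act S g x \<in> pts S"
  unfolding gsets_iff by blast

lemma act_one [simp]: "S \<in> gsets G \<Longrightarrow> x \<in> pts S \<Longrightarrow> act S \<one> x = x"
  unfolding gsets_iff by blast

lemma act_mult: "S \<in> gsets G \<Longrightarrow> g \<in> carrier G \<Longrightarrow> h \<in> carrier G \<Longrightarrow> x \<in> pts S \<Longrightarrow>
   act S (g \<otimes> h) x = act S g (act S h x)"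
  unfolding gsets_iff by blast

lemma act_inv [simp]: "S \<in> gsets G \<Longrightarrow> g \<in> carrier G \<Longrightarrow> x \<in> pts S \<Longrightarrow>
   act S (inv g) (act S g x) = x"
  by (metis act_mult act_one inv_closed l_inv)

lemma act_inv' [simp]: "S \<in> gsets G \<Longrightarrow> g \<in> carrier G \<Longrightarrow> x \<in> pts S \<Longrightarrow>
   act S g (act S (inv g) x) = x"
  by (metis act_mult act_one inv_closed r_inv)

lemma act_ext: "S \<in> gsets G \<Longrightarrow> act S \<in> extensional (carrier G)"
  "S \<in> gsets G \<Longrightarrow> g \<in> carrier G \<Longrightarrow> act S g \<in> extensional (pts S)"
  unfolding gsets_iff by blast+

text \<open>Literal equality is available because actions are normalised off the group and off the
  points. Nested sub-G-sets can thus be identified outright and not merely up to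
  isomorphism.\<close>

lemma gset_eqI: assumes "S \<in> gsets G" "T \<in> gsets G" "pts S = pts T"
    "\<And>g x. g \<in> carrier G \<Longrightarrow> x \<in> pts T \<Longrightarrow> act S g x = act T g x"
  shows "S = T"
proof -
  have "act S g = act T g" for g
  proof (cases "g \<in> carrier G")
    case True
    then have "act S g \<in> extensional (pts T)" "act T g \<in> extensional (pts T)"
      using act_ext(2)[OF assms(1) True] act_ext(2)[OF assms(2) True] assms(3) by simp_all
    then show ?thesis using assms(4) True by (intro extensionalityI)
  next
    case False
    then show ?thesis using act_ext(1)[OF assms(1)] act_ext(1)[OF assms(2)] unfolding extensional_def by simp
  qed
  then have "act S = act T" by auto
  then show ?thesis using assms by (cases S; cases T) auto
qed

abbreviation stab :: "'a gset \<Rightarrow> nat \<Rightarrow> 'a set" where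
  "stab S x \<equiv> stabilizer G (act S) x"

lemma stab_subgroup: "S \<in> gsets G \<Longrightarrow> x \<in> pts S \<Longrightarrow> subgroup (stab S x) G"
  by (rule group_action.stabilizer_subgroup[where E = "pts S"]) (simp_all add: gset_action)

lemma mem_stab: "g \<in> stab S x \<longleftrightarrow> g \<in> carrier G \<and> act S g x = x"
  by (simp add: stabilizer_def)

definition invar :: "'a gset \<Rightarrow> nat set \<Rightarrow> bool" where
  "invar S B \<longleftrightarrow> B \<subseteq> pts S \<and> (\<forall>g\<in>carrier G. \<forall>x\<in>B. act S g x \<in> B)"

lemma invar_subset: "invar S B \<Longrightarrow> B \<subseteq> pts S"
  by (simp add: invar_def)

lemma invar_act: "invar S B \<Longrightarrow> g \<in> carrier G \<Longrightarrow> x \<in> B \<Longrightarrow> act S g x \<in> B"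
  by (simp add: invar_def)

lemma invar_compl: assumes S: "S \<in> gsets G" and B: "invar S B" shows "invar S (pts S - B)"
proof -
  have "x \<in> B" if "g \<in> carrier G" "x \<in> pts S" "act S g x \<in> B" for g x
    using invar_act[OF B inv_closed[OF that(1)] that(3)] that S by simp
  then show ?thesis using act_closed[OF S] unfolding invar_def by blast
qed

lemma invar_whole: "S \<in> gsets G \<Longrightarrow> invar S (pts S)"
  by (simp add: invar_def)

lemma gsub_simps [simp]: "pts (gsub G S B) = B"
  "g \<in> carrier G \<Longrightarrow> x \<in> B \<Longrightarrow> act (gsub G S B) g x = act S g x"
  by (simp_all add: gsub_def)

lemma gsub_gset: assumes S: "S \<in> gsets G" and B: "invar S B" shows "gsub G S B \<in> gsets G"
proof (rule gsetsI)
  note xS = subsetD[OF invar_subset[OF B]] and xB = invar_act[OF B]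
  show "finite (pts (gsub G S B))"
    using finite_subset[OF invar_subset[OF B] gset_finite[OF S]] by simp
  show "act (gsub G S B) \<in> extensional (carrier G)" by (simp add: gsub_def)
  show "act (gsub G S B) g \<in> extensional (pts (gsub G S B))" if "g \<in> carrier G" for g
    using that by (simp add: gsub_def)
  show "act (gsub G S B) g x \<in> pts (gsub G S B)" if "g \<in> carrier G" "x \<in> pts (gsub G S B)" for g x
    using that xB by simp
  show "act (gsub G S B) \<one> x = x" if "x \<in> pts (gsub G S B)" for x
    using that S xS by simp
  show "act (gsub G S B) (g \<otimes> h) x = act (gsub G S B) g (act (gsub G S B) h x)"
    if "g \<in> carrier G" "h \<in> carrier G" "x \<in> pts (gsub G S B)" for g h x
    using that S xS xB act_mult by simp
qed

lemma gpt_gset [simp]: "gpt G \<in> gsets G"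
  unfolding gsets_iff[of "gpt G"] by (auto simp: gpt_def)

lemma gpt_simps [simp]: "x \<in> pts (gpt G) \<longleftrightarrow> x = 0" "g \<in> carrier G \<Longrightarrow> act (gpt G) g 0 = 0"
  by (auto simp: gpt_def)

lemma pts_gprod [simp]: "z \<in> pts (gprod G S T) \<longleftrightarrow> pfst z \<in> pts S \<and> psnd z \<in> pts T"
  by (auto simp: gprod_def) (metis encode_pfst_psnd image_eqI mem_Sigma_iff)

lemma act_gprod: "g \<in> carrier G \<Longrightarrow> pfst z \<in> pts S \<Longrightarrow> psnd z \<in> pts T \<Longrightarrow>
   act (gprod G S T) g z = prod_encode (act S g (pfst z), act T g (psnd z))"
  using pts_gprod[of z S T] by (simp add: gprod_def)

lemma gprod_gset [simp]: assumes "S \<in> gsets G" "T \<in> gsets G" shows "gprod G S T \<in> gsets G"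
proof -
  have "finite (pts (gprod G S T))" using assms by (simp add: gprod_def)
  moreover have "act (gprod G S T) \<in> extensional (carrier G)" "g \<in> carrier G \<Longrightarrow> act (gprod G S T) g \<in> extensional (pts (gprod G S T))" for g
    by (simp_all add: gprod_def)
  ultimately show ?thesis using assms unfolding gsets_iff[of "gprod G S T"]
    by (auto simp: act_gprod act_mult)
qed

lemma emapsD: assumes "f \<in> emaps G S T"
  shows "x \<in> pts S \<Longrightarrow> f x \<in> pts T" "g \<in> carrier G \<Longrightarrow> x \<in> pts S \<Longrightarrow> f (act S g x) = act T g (f x)"
    "f \<in> extensional (pts S)"
  using assms by (auto simp: emaps_def PiE_def)

lemma emapsI: "f \<in> extensional (pts S) \<Longrightarrow> (\<And>x. x \<in> pts S \<Longrightarrow> f x \<in> pts T) \<Longrightarrow>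
   (\<And>g x. g \<in> carrier G \<Longrightarrow> x \<in> pts S \<Longrightarrow> f (act S g x) = act T g (f x)) \<Longrightarrow> f \<in> emaps G S T"
  by (auto simp: emaps_def PiE_def)

lemma stab_mono: "f \<in> emaps G S T \<Longrightarrow> x \<in> pts S \<Longrightarrow> stab S x \<subseteq> stab T (f x)"
  by (auto simp: mem_stab) (metis emapsD(2))

lemma emapsOD: assumes "f \<in> emapsO G r S T"
  shows "f \<in> emaps G S T" "x \<in> pts S \<Longrightarrow> (stab S x, stab T (f x)) \<in> r"
  using assms by (auto simp: emapsO_def)

lemma emapsOI: "f \<in> emaps G S T \<Longrightarrow> (\<And>x. x \<in> pts S \<Longrightarrow> (stab S x, stab T (f x)) \<in> r) \<Longrightarrow>
   f \<in> emapsO G r S T"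
  by (auto simp: emapsO_def)

text \<open>An injective equivariant map preserves stabilisers exactly, and \<open>r\<close> is
  reflexive. Inclusions and bijections are therefore always legitimate right legs.\<close>

lemma emapsO_inj: assumes "S \<in> gsets G" "T \<in> gsets G" "f \<in> emaps G S T" "inj_on f (pts S)"
  shows "f \<in> emapsO G r S T"
proof (rule emapsOI[OF assms(3)])
  fix x assume x: "x \<in> pts S"
  have "stab S x = stab T (f x)"
    using stab_mono[OF assms(3) x] assms x
    by (auto simp: mem_stab) (metis act_closed emapsD(2) inj_onD)
  then show "(stab S x, stab T (f x)) \<in> r" using r_refl stab_subgroup assms x by metis
qed

subsection \<open>Spans\<close>

lemma spansD: assumes "(U, l, h) \<in> spans G r S T"
  shows "U \<in> gsets G" "l \<in> emaps G U S" "h \<in> emaps G U T" "h \<in> emapsO G r U T"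
  using assms by (auto simp: spans_def emapsO_def)

lemma spansI: "U \<in> gsets G \<Longrightarrow> l \<in> emaps G U S \<Longrightarrow> h \<in> emapsO G r U T \<Longrightarrow> (U, l, h) \<in> spans G r S T"
  by (auto simp: spans_def)

abbreviation cl :: "'a gset \<Rightarrow> 'a gset \<Rightarrow> 'a span \<Rightarrow> 'a span set" where
  "cl S T \<sigma> \<equiv> span_class G r S T \<sigma>"

lemma span_relI:
  assumes "(U, l, h) \<in> spans G r S T" "(U', l', h') \<in> spans G r S T"
    and f: "\<And>u. u \<in> pts U \<Longrightarrow> f u \<in> pts U'" and f': "\<And>u. u \<in> pts U' \<Longrightarrow> f' u \<in> pts U"
    and "\<And>u. u \<in> pts U \<Longrightarrow> f' (f u) = u" "\<And>u. u \<in> pts U' \<Longrightarrow> f (f' u) = u"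
    and eq: "\<And>g u. g \<in> carrier G \<Longrightarrow> u \<in> pts U \<Longrightarrow> f (act U g u) = act U' g (f u)"
    and "\<And>u. u \<in> pts U \<Longrightarrow> l' (f u) = l u" "\<And>u. u \<in> pts U \<Longrightarrow> h' (f u) = h u"
  shows "((U, l, h), (U', l', h')) \<in> span_rel G r S T"
proof -
  have U: "U \<in> gsets G" using spansD(1)[OF assms(1)] .
  have "restrict f (pts U) \<in> emaps G U U'" using f eq U by (intro emapsI) auto
  moreover have "bij_betw (restrict f (pts U)) (pts U) (pts U')"
    by (rule bij_betw_byWitness[where f' = f']) (use assms in auto)
  ultimately show ?thesis using assms unfolding span_rel_def by (auto intro!: bexI[of _ "restrict f (pts U)"])
qed

lemma span_relE:
  assumes "((U, l, h), (U', l', h')) \<in> span_rel G r S T"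
  obtains f where "f \<in> emaps G U U'" "bij_betw f (pts U) (pts U')"
    "\<And>u. u \<in> pts U \<Longrightarrow> l' (f u) = l u" "\<And>u. u \<in> pts U \<Longrightarrow> h' (f u) = h u"
    "(U, l, h) \<in> spans G r S T" "(U', l', h') \<in> spans G r S T"
  using assms unfolding span_rel_def by auto

lemma span_rel_spans: "(\<sigma>, \<tau>) \<in> span_rel G r S T \<Longrightarrow> \<sigma> \<in> spans G r S T \<and> \<tau> \<in> spans G r S T"
  by (auto simp: span_rel_def)

lemma span_relE2:
  assumes "((U, l, h), (U', l', h')) \<in> span_rel G r S T"
  obtains f f' where "f \<in> emaps G U U'" "f' \<in> emaps G U' U"
    "\<And>u. u \<in> pts U \<Longrightarrow> f' (f u) = u" "\<And>u. u \<in> pts U' \<Longrightarrow> f (f' u) = u"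
    "\<And>u. u \<in> pts U \<Longrightarrow> l' (f u) = l u" "\<And>u. u \<in> pts U \<Longrightarrow> h' (f u) = h u"
    "\<And>u. u \<in> pts U' \<Longrightarrow> l (f' u) = l' u" "\<And>u. u \<in> pts U' \<Longrightarrow> h (f' u) = h' u"
    "(U, l, h) \<in> spans G r S T" "(U', l', h') \<in> spans G r S T"
proof -
  obtain f where f: "f \<in> emaps G U U'" "bij_betw f (pts U) (pts U')"
    "\<And>u. u \<in> pts U \<Longrightarrow> l' (f u) = l u" "\<And>u. u \<in> pts U \<Longrightarrow> h' (f u) = h u"
    "(U, l, h) \<in> spans G r S T" "(U', l', h') \<in> spans G r S T"
    using span_relE[OF assms] by metis
  define f' where "f' = restrict (inv_into (pts U) f) (pts U')"
  have 1: "u \<in> pts U \<Longrightarrow> f' (f u) = u" for u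
    using f(2) emapsD(1)[OF f(1)] by (simp add: f'_def bij_betw_inv_into_left)
  have 2: "u \<in> pts U' \<Longrightarrow> f (f' u) = u" "u \<in> pts U' \<Longrightarrow> f' u \<in> pts U" for u
    using f(2) by (simp_all add: f'_def bij_betw_inv_into_right) (metis bij_betw_imp_surj_on inv_into_into)
  have U: "U \<in> gsets G" "U' \<in> gsets G" using f(5,6) spansD by auto
  have "f' \<in> emaps G U' U"
  proof (rule emapsI)
    fix g x assume g: "g \<in> carrier G" "x \<in> pts U'"
    have "f (f' (act U' g x)) = f (act U g (f' x))"
      using g 2 U by (simp add: emapsD(2)[OF f(1)])
    then show "f' (act U' g x) = act U g (f' x)" using 1 2 g U by (metis act_closed)
  qed (use 2 in \<open>auto simp: f'_def\<close>)
  moreover have "u \<in> pts U' \<Longrightarrow> l (f' u) = l' u" "u \<in> pts U' \<Longrightarrow> h (f' u) = h' u" for u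
    using 2 f by metis+
  ultimately show ?thesis using that[of f f'] f 1 2 by blast
qed

lemma equiv_span_rel: "equiv (spans G r S T) (span_rel G r S T)"
proof (rule equivI)
  show "span_rel G r S T \<subseteq> spans G r S T \<times> spans G r S T" by (auto simp: span_rel_def)
  show "refl_on (spans G r S T) (span_rel G r S T)"
    by (auto simp: refl_on_def intro!: span_relI[where f = "\<lambda>x. x" and f' = "\<lambda>x. x"])
  show "sym (span_rel G r S T)"
  proof (rule symI)
    fix \<sigma> \<tau> assume "(\<sigma>, \<tau>) \<in> span_rel G r S T"
    moreover obtain U l h U' l' h' where [simp]: "\<sigma> = (U, l, h)" "\<tau> = (U', l', h')" by (metis prod_cases3)
    ultimately have "((U, l, h), (U', l', h')) \<in> span_rel G r S T" by simp
    then show "(\<tau>, \<sigma>) \<in> span_rel G r S T"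
    proof (rule span_relE2)
      fix f f' assume a: "f \<in> emaps G U U'" "f' \<in> emaps G U' U"
      "\<And>u. u \<in> pts U \<Longrightarrow> f' (f u) = u" "\<And>u. u \<in> pts U' \<Longrightarrow> f (f' u) = u"
      "\<And>u. u \<in> pts U' \<Longrightarrow> l (f' u) = l' u" "\<And>u. u \<in> pts U' \<Longrightarrow> h (f' u) = h' u"
      "(U, l, h) \<in> spans G r S T" "(U', l', h') \<in> spans G r S T"
      then show ?thesis by (auto intro!: span_relI[where f = f' and f' = f] simp: emapsD)
    qed
  qed
  show "trans (span_rel G r S T)"
  proof (rule transI)
    fix \<sigma> \<tau> \<rho> assume "(\<sigma>, \<tau>) \<in> span_rel G r S T" "(\<tau>, \<rho>) \<in> span_rel G r S T"
    moreover obtain U l h U' l' h' V k m where [simp]: "\<sigma> = (U, l, h)" "\<tau> = (U', l', h')" "\<rho> = (V, k, m)"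
      by (metis prod_cases3)
    ultimately have *: "((U, l, h), (U', l', h')) \<in> span_rel G r S T" "((U', l', h'), (V, k, m)) \<in> span_rel G r S T" by simp_all
    obtain f f' where a: "f \<in> emaps G U U'" "f' \<in> emaps G U' U"
      "\<And>u. u \<in> pts U \<Longrightarrow> f' (f u) = u" "\<And>u. u \<in> pts U' \<Longrightarrow> f (f' u) = u"
      "\<And>u. u \<in> pts U \<Longrightarrow> l' (f u) = l u" "\<And>u. u \<in> pts U \<Longrightarrow> h' (f u) = h u" "(U, l, h) \<in> spans G r S T"
      using span_relE2[OF *(1)] by metis
    obtain k1 k1' where b: "k1 \<in> emaps G U' V" "k1' \<in> emaps G V U'"
      "\<And>u. u \<in> pts U' \<Longrightarrow> k1' (k1 u) = u" "\<And>u. u \<in> pts V \<Longrightarrow> k1 (k1' u) = u"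
      "\<And>u. u \<in> pts U' \<Longrightarrow> k (k1 u) = l' u" "\<And>u. u \<in> pts U' \<Longrightarrow> m (k1 u) = h' u" "(V, k, m) \<in> spans G r S T"
      using span_relE2[OF *(2)] by metis
    show "(\<sigma>, \<rho>) \<in> span_rel G r S T" using a b
      by (auto intro!: span_relI[where f = "\<lambda>x. k1 (f x)" and f' = "\<lambda>x. f' (k1' x)"] simp: emapsD)
  qed
qed

lemma cl_eqI:
  assumes "(U, l, h) \<in> spans G r S T" "(U', l', h') \<in> spans G r S T"
    and "\<And>u. u \<in> pts U \<Longrightarrow> f u \<in> pts U'" and "\<And>u. u \<in> pts U' \<Longrightarrow> f' u \<in> pts U"
    and "\<And>u. u \<in> pts U \<Longrightarrow> f' (f u) = u" "\<And>u. u \<in> pts U' \<Longrightarrow> f (f' u) = u"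
    and "\<And>g u. g \<in> carrier G \<Longrightarrow> u \<in> pts U \<Longrightarrow> f (act U g u) = act U' g (f u)"
    and "\<And>u. u \<in> pts U \<Longrightarrow> l' (f u) = l u" "\<And>u. u \<in> pts U \<Longrightarrow> h' (f u) = h u"
  shows "cl S T (U, l, h) = cl S T (U', l', h')"
  by (rule equiv_class_eq[OF equiv_span_rel], rule span_relI[where f = f and f' = f']) (use assms in auto)

lemma obj_Lindner [simp]: "obj (Lindner G r) = gsets G"
  by (simp add: Lindner_def)

lemma arr_Lindner: "arr (Lindner G r) S T = spans G r S T // span_rel G r S T"
  by (simp add: Lindner_def)

lemma cl_arr [simp]: "\<sigma> \<in> spans G r S T \<Longrightarrow> cl S T \<sigma> \<in> arr (Lindner G r) S T"
  by (simp add: arr_Lindner quotientI)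

lemma arrE: assumes "X \<in> arr (Lindner G r) S T"
  obtains U l h where "(U, l, h) \<in> spans G r S T" "X = cl S T (U, l, h)"
  using assms unfolding arr_Lindner by (auto elim!: quotientE)

lemma cl_self: "\<sigma> \<in> spans G r S T \<Longrightarrow> \<sigma> \<in> cl S T \<sigma>"
  by (metis equiv_class_self equiv_span_rel)

abbreviation Ar :: "'a gset \<Rightarrow> 'a gset \<Rightarrow> 'a span set set" where
  "Ar S T \<equiv> arr (Lindner G r) S T"
abbreviation cmpL where "cmpL \<equiv> cmp (Lindner G r)"
abbreviation idL where "idL \<equiv> ide (Lindner G r)"

declare act_gprod [simp]

definition pbset :: "'a gset \<Rightarrow> 'a gset \<Rightarrow> (nat \<Rightarrow> nat) \<Rightarrow> (nat \<Rightarrow> nat) \<Rightarrow> nat set" where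
  "pbset U V h k = {z. pfst z \<in> pts U \<and> psnd z \<in> pts V \<and> h (pfst z) = k (psnd z)}"

lemma mem_pbset [simp]: "z \<in> pbset U V h k \<longleftrightarrow> pfst z \<in> pts U \<and> psnd z \<in> pts V \<and> h (pfst z) = k (psnd z)"
  by (simp add: pbset_def)

lemma span_pb_eq: "span_pb G (U, l, h) (V, k, m) =
   (gsub G (gprod G U V) (pbset U V h k), \<lambda>z\<in>pbset U V h k. l (pfst z), \<lambda>z\<in>pbset U V h k. m (psnd z))"
proof -
  have "{z \<in> pts (gprod G U V). h (pfst z) = k (psnd z)} = pbset U V h k"
    by auto
  then show ?thesis by (simp add: span_pb_def Let_def)
qed

lemma pbset_invar: assumes "U \<in> gsets G" "V \<in> gsets G" "h \<in> emaps G U T" "k \<in> emaps G V T"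
  shows "invar (gprod G U V) (pbset U V h k)"
  using assms by (auto simp: invar_def emapsD(2)[OF assms(3)] emapsD(2)[OF assms(4)])

text \<open>Here the restriction axiom of transfer systems is essential. A point
  \<open>(u, v)\<close> of the pullback has stabiliser \<open>Stab u \<inter> Stab v\<close>, and
  \<open>Stab v\<close> lies in the stabiliser of \<open>h u\<close>, so
  \<open>Stab u \<rightarrow> Stab (h u)\<close> restricts to \<open>Stab v\<close>; transitivity
  then adds the second right leg.\<close>

lemma span_pb_spans:
  assumes "(U, l, h) \<in> spans G r S T" "(V, k, m) \<in> spans G r T W"
  shows "span_pb G (U, l, h) (V, k, m) \<in> spans G r S W"
proof -
  note 1 = spansD[OF assms(1)] and 2 = spansD[OF assms(2)]
  let ?P = "pbset U V h k" let ?Q = "gsub G (gprod G U V) ?P"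
  have Q: "?Q \<in> gsets G" using 1 2 by (intro gsub_gset pbset_invar) auto
  have "(\<lambda>z\<in>?P. l (pfst z)) \<in> emaps G ?Q S"
    using 1(1) 2(1) by (intro emapsI) (auto simp: emapsD[OF 1(2)] emapsD(2)[OF 1(3)] emapsD(2)[OF 2(2)])
  moreover have m: "(\<lambda>z\<in>?P. m (psnd z)) \<in> emaps G ?Q W"
    using 1(1) 2(1) by (intro emapsI) (auto simp: emapsD[OF 2(3)] emapsD(2)[OF 1(3)] emapsD(2)[OF 2(2)])
  moreover have "(\<lambda>z\<in>?P. m (psnd z)) \<in> emapsO G r ?Q W"
  proof (rule emapsOI[OF m])
    fix z assume "z \<in> pts ?Q"
    then have z: "pfst z \<in> pts U" "psnd z \<in> pts V" "h (pfst z) = k (psnd z)" by auto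
    have st: "stab ?Q z = stab U (pfst z) \<inter> stab V (psnd z)"
      using z by (auto simp: mem_stab) (metis pfst_encode psnd_encode encode_pfst_psnd)+
    have "stab V (psnd z) \<subseteq> stab T (h (pfst z))" using stab_mono[OF 2(2) z(2)] z(3) by simp
    then have "(stab U (pfst z) \<inter> stab V (psnd z), stab V (psnd z)) \<in> r"
      using r_Int[OF emapsOD(2)[OF 1(4) z(1)] stab_subgroup[OF 2(1) z(2)]] by simp
    then show "(stab ?Q z, stab W ((\<lambda>z\<in>?P. m (psnd z)) z)) \<in> r"
      using r_trans emapsOD(2)[OF 2(4) z(2)] z st by simp
  qed
  ultimately show ?thesis using Q by (simp add: span_pb_eq spansI)
qed

lemma span_pb_cong:
  assumes "((U, l, h), (U', l', h')) \<in> span_rel G r S T" "((V, k, m), (V', k', m')) \<in> span_rel G r T W"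
  shows "(span_pb G (U, l, h) (V, k, m), span_pb G (U', l', h') (V', k', m')) \<in> span_rel G r S W"
proof -
  obtain f f' where f: "f \<in> emaps G U U'" "f' \<in> emaps G U' U"
    "\<And>u. u \<in> pts U \<Longrightarrow> f' (f u) = u" "\<And>u. u \<in> pts U' \<Longrightarrow> f (f' u) = u"
    "\<And>u. u \<in> pts U \<Longrightarrow> l' (f u) = l u" "\<And>u. u \<in> pts U \<Longrightarrow> h' (f u) = h u"
    "\<And>u. u \<in> pts U' \<Longrightarrow> l (f' u) = l' u" "\<And>u. u \<in> pts U' \<Longrightarrow> h (f' u) = h' u"
    "(U, l, h) \<in> spans G r S T" "(U', l', h') \<in> spans G r S T"
    using span_relE2[OF assms(1)] by blast
  obtain e e' where e: "e \<in> emaps G V V'" "e' \<in> emaps G V' V"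
    "\<And>u. u \<in> pts V \<Longrightarrow> e' (e u) = u" "\<And>u. u \<in> pts V' \<Longrightarrow> e (e' u) = u"
    "\<And>u. u \<in> pts V \<Longrightarrow> k' (e u) = k u" "\<And>u. u \<in> pts V \<Longrightarrow> m' (e u) = m u"
    "\<And>u. u \<in> pts V' \<Longrightarrow> k (e' u) = k' u" "\<And>u. u \<in> pts V' \<Longrightarrow> m (e' u) = m' u"
    "(V, k, m) \<in> spans G r T W" "(V', k', m') \<in> spans G r T W"
    using span_relE2[OF assms(2)] by blast
  note 1 = span_pb_spans[OF f(9) e(9)] and 2 = span_pb_spans[OF f(10) e(10)]
  note s = spansD[OF f(9)] spansD[OF f(10)] spansD[OF e(9)] spansD[OF e(10)]
  show ?thesis using 1 2 unfolding span_pb_eq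
    by (rule span_relI[where f = "\<lambda>z. prod_encode (f (pfst z), e (psnd z))"
          and f' = "\<lambda>z. prod_encode (f' (pfst z), e' (psnd z))"])
      (simp_all add: f(3-8) e(3-8) s(1,5,9,13) emapsD[OF f(1)] emapsD[OF f(2)] emapsD[OF e(1)] emapsD[OF e(2)])
qed

text \<open>Composition and \<open>lprod\<close> are defined by saturating a whole set of
  representatives. Once the representatives are known to be equivalent, the saturation is a single
  class.\<close>

lemma Image_rel_eq: assumes "\<sigma> \<in> Z" "\<And>\<tau>. \<tau> \<in> Z \<Longrightarrow> (\<sigma>, \<tau>) \<in> span_rel G r S T"
  shows "span_rel G r S T `` Z = cl S T \<sigma>"
proof -
  have "cl S T \<tau> = cl S T \<sigma>" if "\<tau> \<in> Z" for \<tau>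
    using equiv_class_eq[OF equiv_span_rel assms(2)[OF that]] by simp
  then have "(\<Union>\<tau>\<in>Z. cl S T \<tau>) = (\<Union>\<tau>\<in>Z. cl S T \<sigma>)" by (intro SUP_cong) simp_all
  also have "\<dots> = cl S T \<sigma>" using assms(1) by blast
  finally show ?thesis by (subst Image_eq_UN)
qed

lemma cmpL_cl:
  assumes "\<sigma> \<in> spans G r S T" "\<tau> \<in> spans G r T W"
  shows "cmpL S T W (cl T W \<tau>) (cl S T \<sigma>) = cl S W (span_pb G \<sigma> \<tau>)"
proof -
  let ?Z = "{span_pb G \<sigma>' \<tau>' | \<sigma>' \<tau>'. \<sigma>' \<in> cl S T \<sigma> \<and> \<tau>' \<in> cl T W \<tau>}"
  have "span_rel G r S W `` ?Z = cl S W (span_pb G \<sigma> \<tau>)"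
  proof (rule Image_rel_eq)
    show "span_pb G \<sigma> \<tau> \<in> ?Z" using cl_self[OF assms(1)] cl_self[OF assms(2)] by blast
    fix \<rho> assume "\<rho> \<in> ?Z"
    then obtain \<sigma>' \<tau>' where *: "\<rho> = span_pb G \<sigma>' \<tau>'" "(\<sigma>, \<sigma>') \<in> span_rel G r S T" "(\<tau>, \<tau>') \<in> span_rel G r T W"
      by auto
    then show "(span_pb G \<sigma> \<tau>, \<rho>) \<in> span_rel G r S W"
      using span_pb_cong by (metis prod_cases3)
  qed
  then show ?thesis by (simp add: Lindner_def)
qed

lemma idmap_emaps: "S \<in> gsets G \<Longrightarrow> (\<lambda>x\<in>pts S. x) \<in> emaps G S S"
  by (rule emapsI) auto

lemma idmap_emapsO: "S \<in> gsets G \<Longrightarrow> (\<lambda>x\<in>pts S. x) \<in> emapsO G r S S"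
  by (rule emapsO_inj) (auto simp: idmap_emaps)

lemma idspan: "S \<in> gsets G \<Longrightarrow> (S, \<lambda>x\<in>pts S. x, \<lambda>x\<in>pts S. x) \<in> spans G r S S"
  by (simp add: spansI idmap_emaps idmap_emapsO)

lemma idL_eq: "idL S = cl S S (S, \<lambda>x\<in>pts S. x, \<lambda>x\<in>pts S. x)"
  by (simp add: Lindner_def)

lemma idL_arr [simp]: "S \<in> gsets G \<Longrightarrow> idL S \<in> Ar S S"
  by (simp add: idL_eq idspan)

lemma cmpL_arr [simp]: assumes "X \<in> Ar S T" "Y \<in> Ar T W" shows "cmpL S T W Y X \<in> Ar S W"
proof -
  obtain U l h where 1: "(U, l, h) \<in> spans G r S T" "X = cl S T (U, l, h)" using arrE[OF assms(1)] .
  obtain V k m where 2: "(V, k, m) \<in> spans G r T W" "Y = cl T W (V, k, m)" using arrE[OF assms(2)] .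
  show ?thesis using span_pb_spans[OF 1(1) 2(1)] 1 2 by (simp add: cmpL_cl)
qed

lemma cmpL_assoc: assumes "X \<in> Ar S T" "Y \<in> Ar T W" "Z \<in> Ar W R"
  shows "cmpL S T R (cmpL T W R Z Y) X = cmpL S W R Z (cmpL S T W Y X)"
proof -
  obtain U l h where 1: "(U, l, h) \<in> spans G r S T" "X = cl S T (U, l, h)" using arrE[OF assms(1)] .
  obtain V k m where 2: "(V, k, m) \<in> spans G r T W" "Y = cl T W (V, k, m)" using arrE[OF assms(2)] .
  obtain N p q where 3: "(N, p, q) \<in> spans G r W R" "Z = cl W R (N, p, q)" using arrE[OF assms(3)] .
  note 12 = span_pb_spans[OF 1(1) 2(1)] and 23 = span_pb_spans[OF 2(1) 3(1)]
  note n1 = span_pb_spans[OF 12[unfolded span_pb_eq] 3(1)]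
  note n2 = span_pb_spans[OF 1(1) 23[unfolded span_pb_eq]]
  note s = spansD[OF 1(1)] spansD[OF 2(1)] spansD[OF 3(1)]
  have "cl S R (span_pb G (span_pb G (U, l, h) (V, k, m)) (N, p, q)) =
        cl S R (span_pb G (U, l, h) (span_pb G (V, k, m) (N, p, q)))"
    using n1 n2 unfolding span_pb_eq
    by (rule cl_eqI[where f = reassoc and f' = "\<lambda>z. prod_encode (prod_encode (pfst z, pfst (psnd z)), psnd (psnd z))"])
      (use s(1,5,9) in \<open>auto simp: reassoc_def emapsD(2)[OF s(3)] emapsD(2)[OF s(6)] emapsD(2)[OF s(7)] emapsD(2)[OF s(10)]\<close>)
  then show ?thesis using 1 2 3 12 23 by (simp add: cmpL_cl)
qed

lemma cmpL_idL [simp]: assumes "X \<in> Ar S T" "S \<in> gsets G" shows "cmpL S S T X (idL S) = X"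
proof -
  obtain U l h where 1: "(U, l, h) \<in> spans G r S T" "X = cl S T (U, l, h)" using arrE[OF assms(1)] .
  note s = spansD[OF 1(1)]
  have "cl S T (span_pb G (S, \<lambda>x\<in>pts S. x, \<lambda>x\<in>pts S. x) (U, l, h)) = cl S T (U, l, h)"
    using span_pb_spans[OF idspan[OF assms(2)] 1(1)] 1(1) unfolding span_pb_eq
    by (rule cl_eqI[where f = psnd and f' = "\<lambda>u. prod_encode (l u, u)"])
      (use s assms in \<open>auto simp: emapsD[OF s(2)] intro: pair_code_eqI\<close>)
  then show ?thesis using 1 assms by (simp add: cmpL_cl idL_eq idspan)
qed

lemma idL_cmpL [simp]: assumes "X \<in> Ar S T" "T \<in> gsets G" shows "cmpL S T T (idL T) X = X"
proof -
  obtain U l h where 1: "(U, l, h) \<in> spans G r S T" "X = cl S T (U, l, h)" using arrE[OF assms(1)] .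
  note s = spansD[OF 1(1)]
  have "cl S T (span_pb G (U, l, h) (T, \<lambda>x\<in>pts T. x, \<lambda>x\<in>pts T. x)) = cl S T (U, l, h)"
    using span_pb_spans[OF 1(1) idspan[OF assms(2)]] 1(1) unfolding span_pb_eq
    by (rule cl_eqI[where f = pfst and f' = "\<lambda>u. prod_encode (u, h u)"])
      (use s assms in \<open>auto simp: emapsD[OF s(3)] intro: pair_code_eqI\<close>)
  then show ?thesis using 1 assms by (simp add: cmpL_cl idL_eq idspan)
qed

subsection \<open>Products of spans\<close>

lemma span_prod_eq: "span_prod G (U, l, h) (V, k, m) =
    (gprod G U V, \<lambda>z\<in>pts (gprod G U V). prod_encode (l (pfst z), k (psnd z)),
                   \<lambda>z\<in>pts (gprod G U V). prod_encode (h (pfst z), m (psnd z)))"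
  by (simp add: span_prod_def)

lemma span_prod_spans:
  assumes "(U, l, h) \<in> spans G r S T" "(V, k, m) \<in> spans G r S' T'"
  shows "span_prod G (U, l, h) (V, k, m) \<in> spans G r (gprod G S S') (gprod G T T')"
proof -
  note 1 = spansD[OF assms(1)] and 2 = spansD[OF assms(2)]
  let ?Q = "gprod G U V"
  have Q: "?Q \<in> gsets G" using 1 2 by simp
  have "(\<lambda>z\<in>pts ?Q. prod_encode (l (pfst z), k (psnd z))) \<in> emaps G ?Q (gprod G S S')"
    using 1(1) 2(1) by (intro emapsI) (auto simp: emapsD[OF 1(2)] emapsD[OF 2(2)])
  moreover have m: "(\<lambda>z\<in>pts ?Q. prod_encode (h (pfst z), m (psnd z))) \<in> emaps G ?Q (gprod G T T')"
    using 1(1) 2(1) by (intro emapsI) (auto simp: emapsD[OF 1(3)] emapsD[OF 2(3)])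
  moreover have "(\<lambda>z\<in>pts ?Q. prod_encode (h (pfst z), m (psnd z))) \<in> emapsO G r ?Q (gprod G T T')"
  proof (rule emapsOI[OF m])
    have st: "stab (gprod G A B) z = stab A (pfst z) \<inter> stab B (psnd z)"
      if "pfst z \<in> pts A" "psnd z \<in> pts B" for z A B
      using that by (auto simp: mem_stab) (metis pfst_encode psnd_encode encode_pfst_psnd)+
    fix z assume "z \<in> pts ?Q"
    then have z: "pfst z \<in> pts U" "psnd z \<in> pts V" by auto
    show "(stab ?Q z, stab (gprod G T T') ((\<lambda>z\<in>pts ?Q. prod_encode (h (pfst z), m (psnd z))) z)) \<in> r"
      using r_Int2[OF emapsOD(2)[OF 1(4) z(1)] emapsOD(2)[OF 2(4) z(2)]] z
      by (simp add: st emapsD[OF 1(3)] emapsD[OF 2(3)])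
  qed
  ultimately show ?thesis using Q by (simp add: span_prod_eq spansI)
qed

lemma span_prod_cong:
  assumes "((U, l, h), (U', l', h')) \<in> span_rel G r S T" "((V, k, m), (V', k', m')) \<in> span_rel G r S' T'"
  shows "(span_prod G (U, l, h) (V, k, m), span_prod G (U', l', h') (V', k', m')) \<in>
    span_rel G r (gprod G S S') (gprod G T T')"
proof -
  obtain f f' where f: "f \<in> emaps G U U'" "f' \<in> emaps G U' U"
    "\<And>u. u \<in> pts U \<Longrightarrow> f' (f u) = u" "\<And>u. u \<in> pts U' \<Longrightarrow> f (f' u) = u"
    "\<And>u. u \<in> pts U \<Longrightarrow> l' (f u) = l u" "\<And>u. u \<in> pts U \<Longrightarrow> h' (f u) = h u"
    "\<And>u. u \<in> pts U' \<Longrightarrow> l (f' u) = l' u" "\<And>u. u \<in> pts U' \<Longrightarrow> h (f' u) = h' u"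
    "(U, l, h) \<in> spans G r S T" "(U', l', h') \<in> spans G r S T"
    using span_relE2[OF assms(1)] by blast
  obtain e e' where e: "e \<in> emaps G V V'" "e' \<in> emaps G V' V"
    "\<And>u. u \<in> pts V \<Longrightarrow> e' (e u) = u" "\<And>u. u \<in> pts V' \<Longrightarrow> e (e' u) = u"
    "\<And>u. u \<in> pts V \<Longrightarrow> k' (e u) = k u" "\<And>u. u \<in> pts V \<Longrightarrow> m' (e u) = m u"
    "\<And>u. u \<in> pts V' \<Longrightarrow> k (e' u) = k' u" "\<And>u. u \<in> pts V' \<Longrightarrow> m (e' u) = m' u"
    "(V, k, m) \<in> spans G r S' T'" "(V', k', m') \<in> spans G r S' T'"
    using span_relE2[OF assms(2)] by blast
  note 1 = span_prod_spans[OF f(9) e(9)] and 2 = span_prod_spans[OF f(10) e(10)]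
  note s = spansD[OF f(9)] spansD[OF f(10)] spansD[OF e(9)] spansD[OF e(10)]
  show ?thesis using 1 2 unfolding span_prod_eq
    by (rule span_relI[where f = "\<lambda>z. prod_encode (f (pfst z), e (psnd z))"
          and f' = "\<lambda>z. prod_encode (f' (pfst z), e' (psnd z))"])
      (simp_all add: f(3-6) e(3-6) s(1,5,9,13) emapsD[OF f(1)] emapsD[OF f(2)] emapsD[OF e(1)] emapsD[OF e(2)])
qed

lemma lprod_cl:
  assumes "\<sigma> \<in> spans G r S T" "\<tau> \<in> spans G r S' T'"
  shows "lprod G r S T S' T' (cl S T \<sigma>) (cl S' T' \<tau>) = cl (gprod G S S') (gprod G T T') (span_prod G \<sigma> \<tau>)"
  unfolding lprod_def
proof (rule Image_rel_eq)
  let ?Z = "{span_prod G \<sigma>' \<tau>' | \<sigma>' \<tau>'. \<sigma>' \<in> cl S T \<sigma> \<and> \<tau>' \<in> cl S' T' \<tau>}"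
  show "span_prod G \<sigma> \<tau> \<in> ?Z" using cl_self[OF assms(1)] cl_self[OF assms(2)] by blast
  fix \<rho> assume "\<rho> \<in> ?Z"
  then obtain \<sigma>' \<tau>' where *: "\<rho> = span_prod G \<sigma>' \<tau>'" "(\<sigma>, \<sigma>') \<in> span_rel G r S T" "(\<tau>, \<tau>') \<in> span_rel G r S' T'"
    by auto
  then show "(span_prod G \<sigma> \<tau>, \<rho>) \<in> span_rel G r (gprod G S S') (gprod G T T')"
    using span_prod_cong by (metis prod_cases3)
qed

lemma lprod_arr [simp]: assumes "X \<in> Ar S T" "Y \<in> Ar S' T'"
  shows "lprod G r S T S' T' X Y \<in> Ar (gprod G S S') (gprod G T T')"
proof -
  obtain U l h where 1: "(U, l, h) \<in> spans G r S T" "X = cl S T (U, l, h)" using arrE[OF assms(1)] .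
  obtain V k m where 2: "(V, k, m) \<in> spans G r S' T'" "Y = cl S' T' (V, k, m)" using arrE[OF assms(2)] .
  show ?thesis using span_prod_spans[OF 1(1) 2(1)] 1 2 by (simp add: lprod_cl)
qed

lemma lprod_idL: assumes "S \<in> gsets G" "T \<in> gsets G"
  shows "lprod G r S S T T (idL S) (idL T) = idL (gprod G S T)"
proof -
  have "span_prod G (S, \<lambda>x\<in>pts S. x, \<lambda>x\<in>pts S. x) (T, \<lambda>x\<in>pts T. x, \<lambda>x\<in>pts T. x)
    = (gprod G S T, \<lambda>x\<in>pts (gprod G S T). x, \<lambda>x\<in>pts (gprod G S T). x)"
    by (auto simp: span_prod_eq fun_eq_iff)
  then show ?thesis using assms by (simp add: idL_eq lprod_cl idspan)
qed

lemma lprod_cmpL: assumes "X \<in> Ar S T" "X' \<in> Ar T W" "Y \<in> Ar S' T'" "Y' \<in> Ar T' W'"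
  shows "lprod G r S W S' W' (cmpL S T W X' X) (cmpL S' T' W' Y' Y) =
    cmpL (gprod G S S') (gprod G T T') (gprod G W W') (lprod G r T W T' W' X' Y') (lprod G r S T S' T' X Y)"
proof -
  obtain U l h where 1: "(U, l, h) \<in> spans G r S T" "X = cl S T (U, l, h)" using arrE[OF assms(1)] .
  obtain V k m where 2: "(V, k, m) \<in> spans G r T W" "X' = cl T W (V, k, m)" using arrE[OF assms(2)] .
  obtain U' l' h' where 3: "(U', l', h') \<in> spans G r S' T'" "Y = cl S' T' (U', l', h')" using arrE[OF assms(3)] .
  obtain V' k' m' where 4: "(V', k', m') \<in> spans G r T' W'" "Y' = cl T' W' (V', k', m')" using arrE[OF assms(4)] .
  note s = spansD[OF 1(1)] spansD[OF 2(1)] spansD[OF 3(1)] spansD[OF 4(1)]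
  note p = span_pb_spans[OF 1(1) 2(1)] span_pb_spans[OF 3(1) 4(1)] span_prod_spans[OF 1(1) 3(1)] span_prod_spans[OF 2(1) 4(1)]
  \<comment> \<open>Exchanging the two middle coordinates is an involution, so \<open>?f\<close> is
    its own inverse.\<close>
  let ?f = "\<lambda>z. prod_encode (prod_encode (pfst (pfst z), pfst (psnd z)), prod_encode (psnd (pfst z), psnd (psnd z)))"
  have "cl (gprod G S S') (gprod G W W') (span_prod G (span_pb G (U, l, h) (V, k, m)) (span_pb G (U', l', h') (V', k', m'))) =
        cl (gprod G S S') (gprod G W W') (span_pb G (span_prod G (U, l, h) (U', l', h')) (span_prod G (V, k, m) (V', k', m')))"
    using span_prod_spans[OF p(1)[unfolded span_pb_eq] p(2)[unfolded span_pb_eq]]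
      span_pb_spans[OF p(3)[unfolded span_prod_eq] p(4)[unfolded span_prod_eq]]
    unfolding span_pb_eq span_prod_eq
    by (rule cl_eqI[where f = ?f and f' = ?f])
      (simp_all add: s(1,5,9,13) emapsD[OF s(3)] emapsD[OF s(6)] emapsD[OF s(11)] emapsD[OF s(14)], clarsimp)
  then show ?thesis using 1 2 3 4 p by (simp add: cmpL_cl lprod_cl)
qed

section \<open>Transfers and restrictions along equivariant maps\<close>

lemma tr_span: "S \<in> gsets G \<Longrightarrow> f \<in> emapsO G r S T \<Longrightarrow> (S, \<lambda>x\<in>pts S. x, f) \<in> spans G r S T"
  by (simp add: spansI idmap_emaps)

lemma res_span: "S \<in> gsets G \<Longrightarrow> f \<in> emaps G S T \<Longrightarrow> (S, f, \<lambda>x\<in>pts S. x) \<in> spans G r T S"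
  by (simp add: spansI idmap_emapsO)

lemma tr_arr [simp]: "S \<in> gsets G \<Longrightarrow> f \<in> emapsO G r S T \<Longrightarrow> tr G r S T f \<in> Ar S T"
  by (simp add: tr_def tr_span)

lemma res_arr [simp]: "S \<in> gsets G \<Longrightarrow> f \<in> emaps G S T \<Longrightarrow> res G r S T f \<in> Ar T S"
  by (simp add: res_def res_span)

lemma cmpL_tr: assumes "(V, l, h) \<in> spans G r S U" "f \<in> emapsO G r U T" "U \<in> gsets G"
  shows "cmpL S U T (tr G r U T f) (cl S U (V, l, h)) = cl S T (V, l, \<lambda>v\<in>pts V. f (h v))"
    "(V, l, \<lambda>v\<in>pts V. f (h v)) \<in> spans G r S T"
proof -
  note s = spansD[OF assms(1)] and t = emapsOD[OF assms(2)]
  have "(\<lambda>v\<in>pts V. f (h v)) \<in> emaps G V T"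
    by (rule emapsI) (simp_all add: s(1) emapsD[OF s(3)] emapsD[OF t(1)])
  then have "(\<lambda>v\<in>pts V. f (h v)) \<in> emapsO G r V T"
    by (rule emapsOI) (use r_trans[OF emapsOD(2)[OF s(4)] t(2)] emapsD(1)[OF s(3)] in simp)
  then show 1: "(V, l, \<lambda>v\<in>pts V. f (h v)) \<in> spans G r S T" using s by (simp add: spansI)
  have "cl S T (span_pb G (V, l, h) (U, \<lambda>x\<in>pts U. x, f)) = cl S T (V, l, \<lambda>v\<in>pts V. f (h v))"
    using span_pb_spans[OF assms(1) tr_span[OF assms(3,2)]] 1 unfolding span_pb_eq
    by (rule cl_eqI[where f = pfst and f' = "\<lambda>v. prod_encode (v, h v)"])
      (auto simp: assms(3) s(1) emapsD[OF s(3)] intro: pair_code_eqI)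
  then show "cmpL S U T (tr G r U T f) (cl S U (V, l, h)) = cl S T (V, l, \<lambda>v\<in>pts V. f (h v))"
    using cmpL_cl[OF assms(1) tr_span[OF assms(3,2)]] by (simp add: tr_def)
qed

lemma cmpL_res: assumes "(V, l, h) \<in> spans G r U T" "f \<in> emaps G U S" "U \<in> gsets G"
  shows "cmpL S U T (cl U T (V, l, h)) (res G r U S f) = cl S T (V, \<lambda>v\<in>pts V. f (l v), h)"
    "(V, \<lambda>v\<in>pts V. f (l v), h) \<in> spans G r S T"
proof -
  note s = spansD[OF assms(1)] and t = assms(2)
  have "(\<lambda>v\<in>pts V. f (l v)) \<in> emaps G V S"
    by (rule emapsI) (simp_all add: s(1) emapsD[OF s(2)] emapsD[OF t(1)])
  then show 1: "(V, \<lambda>v\<in>pts V. f (l v), h) \<in> spans G r S T" using s by (simp add: spansI)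
  have "cl S T (span_pb G (U, f, \<lambda>x\<in>pts U. x) (V, l, h)) = cl S T (V, \<lambda>v\<in>pts V. f (l v), h)"
    using span_pb_spans[OF res_span[OF assms(3,2)] assms(1)] 1 unfolding span_pb_eq
    by (rule cl_eqI[where f = psnd and f' = "\<lambda>v. prod_encode (l v, v)"])
      (auto simp: assms(3) s(1) emapsD[OF s(2)] intro: pair_code_eqI)
  then show "cmpL S U T (cl U T (V, l, h)) (res G r U S f) = cl S T (V, \<lambda>v\<in>pts V. f (l v), h)"
    using cmpL_cl[OF res_span[OF assms(3,2)] assms(1)] by (simp add: res_def)
qed

text \<open>Pulling back along an injection is intersecting with its image.\<close>

lemma cmpL_res_inj: assumes "(V, l, h) \<in> spans G r S U" "j \<in> emaps G B U" "inj_on j (pts B)" "B \<in> gsets G"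
    and C: "C = {v \<in> pts V. h v \<in> j ` pts B}" and k: "k \<in> emaps G (gsub G V C) B" "\<And>v. v \<in> C \<Longrightarrow> j (k v) = h v"
  shows "cmpL S U B (res G r B U j) (cl S U (V, l, h)) = cl S B (gsub G V C, restrict l C, k)"
    "invar V C" "(gsub G V C, restrict l C, k) \<in> spans G r S B"
proof -
  note s = spansD[OF assms(1)]
  show inv: "invar V C"
  proof -
    have "h (act V g v) \<in> j ` pts B" if gv: "g \<in> carrier G" "v \<in> pts V" "h v \<in> j ` pts B" for g v
    proof -
      obtain b where b: "b \<in> pts B" "h v = j b" using gv(3) by auto
      have "h (act V g v) = j (act B g b)" using gv b emapsD(2)[OF s(3)] emapsD(2)[OF assms(2)] by simp
      then show ?thesis using b gv assms(4) by simp
    qed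
    then show ?thesis unfolding C invar_def using s(1) by simp
  qed
  have gC: "gsub G V C \<in> gsets G" by (rule gsub_gset[OF s(1) inv])
  have subC: "v \<in> pts V" if "v \<in> C" for v using that C by simp
  have "restrict l C \<in> emaps G (gsub G V C) S"
    by (rule emapsI) (simp_all add: subC emapsD[OF s(2)] invar_act[OF inv])
  moreover have "k \<in> emapsO G r (gsub G V C) B"
  proof (rule emapsOI[OF k(1)])
    fix v assume "v \<in> pts (gsub G V C)"
    then have v: "v \<in> C" by simp
    have kv: "k v \<in> pts B" using emapsD(1)[OF k(1)] v by simp
    have "stab (gsub G V C) v = stab V v" using v by (auto simp: mem_stab)
    moreover have "stab B (k v) = stab U (h v)"
      using kv k(2)[OF v] emapsD(2)[OF assms(2)] assms(3,4)
      by (auto simp: mem_stab) (metis act_closed inj_onD)+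
    ultimately show "(stab (gsub G V C) v, stab B (k v)) \<in> r" using emapsOD(2)[OF s(4) subC[OF v]] by simp
  qed
  ultimately show 1: "(gsub G V C, restrict l C, k) \<in> spans G r S B" using gC by (simp add: spansI)
  have jk: "j b = h v \<Longrightarrow> v \<in> pts V \<Longrightarrow> b \<in> pts B \<Longrightarrow> v \<in> C \<and> k v = b" for v b
  proof -
    assume a: "j b = h v" "v \<in> pts V" "b \<in> pts B"
    then have v: "v \<in> C" unfolding C by (simp add: image_iff) metis
    moreover have "k v \<in> pts B" using emapsD(1)[OF k(1)] v by simp
    ultimately show "v \<in> C \<and> k v = b" using k(2)[OF v] a assms(3) by (metis inj_onD)
  qed
  have kB: "v \<in> C \<Longrightarrow> k v \<in> pts B" for v using emapsD(1)[OF k(1)] by simp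
  have "cl S B (span_pb G (V, l, h) (B, j, \<lambda>x\<in>pts B. x)) = cl S B (gsub G V C, restrict l C, k)"
    using span_pb_spans[OF assms(1) res_span[OF assms(4,2)]] 1 unfolding span_pb_eq
  proof (rule cl_eqI[where f = pfst and f' = "\<lambda>v. prod_encode (v, k v)"])
    fix u assume "u \<in> pts (gsub G (gprod G V B) (pbset V B h j))"
    then have u: "pfst u \<in> pts V" "psnd u \<in> pts B" "j (psnd u) = h (pfst u)" by auto
    note uC = jk[OF u(3,1,2)]
    show "pfst u \<in> pts (gsub G V C)" using uC by simp
    show "prod_encode (pfst u, k (pfst u)) = u" using uC by (auto intro: pair_code_eqI)
    show "restrict l C (pfst u) = (\<lambda>z\<in>pbset V B h j. l (pfst z)) u" using u uC by simp
    show "k (pfst u) = (\<lambda>z\<in>pbset V B h j. (\<lambda>x\<in>pts B. x) (psnd z)) u" using u uC by simp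
    show "pfst (act (gsub G (gprod G V B) (pbset V B h j)) g u) = act (gsub G V C) g (pfst u)"
      if "g \<in> carrier G" for g using that u uC by simp
  qed (use k subC kB in auto)
  then show "cmpL S U B (res G r B U j) (cl S U (V, l, h)) = cl S B (gsub G V C, restrict l C, k)"
    using cmpL_cl[OF assms(1) res_span[OF assms(4,2)]] by (simp add: res_def)
qed

text \<open>The pullback of an injection along itself is its diagonal.\<close>

lemma res_tr_inj: assumes "j \<in> emaps G B U" "inj_on j (pts B)" "B \<in> gsets G" "U \<in> gsets G"
  shows "cmpL B U B (res G r B U j) (tr G r B U j) = idL B"
proof -
  have C: "pts B = {v \<in> pts B. j v \<in> j ` pts B}" by auto
  have [simp]: "gsub G B (pts B) = B"
    by (rule gset_eqI) (simp_all add: gsub_gset[OF assms(3) invar_whole] assms(3))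
  have "cmpL B U B (res G r B U j) (tr G r B U j) = cl B B (gsub G B (pts B), restrict (\<lambda>x\<in>pts B. x) (pts B), \<lambda>x\<in>pts B. x)"
    unfolding tr_def
    by (rule cmpL_res_inj(1)[OF tr_span[OF assms(3) emapsO_inj[OF assms(3,4,1,2)]] assms(1-3) C])
      (simp_all add: idmap_emaps assms)
  then show ?thesis by (simp add: idL_eq)
qed

definition empty_gset :: "'a gset" where
  "empty_gset = gsub G (gpt G) {}"

lemma empty_gset [simp]: "empty_gset \<in> gsets G" "pts empty_gset = {}"
  unfolding empty_gset_def by (auto intro!: gsub_gset simp: invar_def)

definition zeroL :: "'a gset \<Rightarrow> 'a gset \<Rightarrow> 'a span set" where
  "zeroL S T = cl S T (empty_gset, \<lambda>x. undefined, \<lambda>x. undefined)"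

lemma empty_gset_unique: "U \<in> gsets G \<Longrightarrow> pts U = {} \<Longrightarrow> U = empty_gset"
  by (rule gset_eqI) auto

lemma empty_span: "(empty_gset, \<lambda>x. undefined, \<lambda>x. undefined) \<in> spans G r S T"
  by (rule spansI) (auto intro!: emapsI emapsOI)

lemma zeroL_arr [simp]: "zeroL S T \<in> Ar S T"
  by (simp add: zeroL_def empty_span)

lemma empty_spanD: assumes "(U, l, h) \<in> spans G r S T" "pts U = {}" shows "cl S T (U, l, h) = zeroL S T"
proof -
  note s = spansD[OF assms(1)]
  have "l = (\<lambda>x. undefined)" "h = (\<lambda>x. undefined)"
    using emapsD(3)[OF s(2)] emapsD(3)[OF s(3)] assms(2) by (auto simp: fun_eq_iff)
  then show ?thesis using empty_gset_unique[OF s(1) assms(2)] by (simp add: zeroL_def)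
qed

lemma res_tr_disjoint: assumes "j \<in> emaps G B U" "inj_on j (pts B)" "B \<in> gsets G" "U \<in> gsets G"
    "k \<in> emaps G C U" "inj_on k (pts C)" "C \<in> gsets G" "j ` pts B \<inter> k ` pts C = {}"
  shows "cmpL C U B (res G r B U j) (tr G r C U k) = zeroL C B"
proof -
  have C: "{} = {v \<in> pts C. k v \<in> j ` pts B}" using assms(8) by auto
  have e: "(\<lambda>x. undefined) \<in> emaps G (gsub G C {}) B" by (auto intro!: emapsI)
  note x = cmpL_res_inj[OF tr_span[OF assms(7) emapsO_inj[OF assms(7,4,5,6)]] assms(1-3) C e]
  show ?thesis unfolding tr_def by (subst x(1), simp, rule empty_spanD[OF x(3)], simp_all)
qed

lemma tr_res_inj: assumes "j \<in> emaps G B U" "inj_on j (pts B)" "B \<in> gsets G" "U \<in> gsets G"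
  shows "cmpL U B U (tr G r B U j) (res G r B U j) = cl U U (B, j, j)"
proof -
  have "cmpL U B U (tr G r B U j) (cl U B (B, j, \<lambda>x\<in>pts B. x)) = cl U U (B, j, \<lambda>v\<in>pts B. j ((\<lambda>x\<in>pts B. x) v))"
    by (rule cmpL_tr(1)[OF res_span[OF assms(3,1)] emapsO_inj[OF assms(3,4,1,2)] assms(3)])
  moreover have "(\<lambda>v\<in>pts B. j ((\<lambda>x\<in>pts B. x) v)) = j"
    using emapsD(3)[OF assms(1)] by (auto simp: fun_eq_iff restrict_def extensional_def)
  ultimately show ?thesis by (simp add: res_def)
qed

lemma tr_res_bij: assumes "j \<in> emaps G B U" "bij_betw j (pts B) (pts U)" "B \<in> gsets G" "U \<in> gsets G"
  shows "cmpL U B U (tr G r B U j) (res G r B U j) = idL U"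
proof -
  have inj: "inj_on j (pts B)" using assms(2) by (simp add: bij_betw_def)
  have "((B, j, j), (U, \<lambda>x\<in>pts U. x, \<lambda>x\<in>pts U. x)) \<in> span_rel G r U U"
    unfolding span_rel_def using assms idspan[OF assms(4)] emapsO_inj[OF assms(3,4,1) inj]
    by (auto simp: spansI intro!: bexI[of _ j] dest: emapsD(1))
  then show ?thesis using tr_res_inj[OF assms(1) inj assms(3,4)] equiv_class_eq[OF equiv_span_rel]
    by (simp add: idL_eq)
qed

subsection \<open>Restricting spans to invariant subsets\<close>

text \<open>Addition of spans is expressed by cutting an apex into an invariant subset and its
  complement, instead of forming coded disjoint unions. All additivity statements below have this
  form.\<close>

fun rst :: "'a span \<Rightarrow> nat set \<Rightarrow> 'a span" where
  "rst (U, l, h) B = (gsub G U B, restrict l B, restrict h B)"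

lemma restrict_emaps: assumes "l \<in> emaps G U S" "invar U B" shows "restrict l B \<in> emaps G (gsub G U B) S"
  using invar_subset[OF assms(2)] by (intro emapsI) (simp_all add: subset_iff emapsD[OF assms(1)] invar_act[OF assms(2)])

lemma restrict_emapsO: assumes "l \<in> emapsO G r U S" "invar U B" shows "restrict l B \<in> emapsO G r (gsub G U B) S"
proof (rule emapsOI[OF restrict_emaps[OF emapsOD(1)[OF assms(1)] assms(2)]])
  fix v assume "v \<in> pts (gsub G U B)"
  then have v: "v \<in> B" "v \<in> pts U" using invar_subset[OF assms(2)] by auto
  have "stab (gsub G U B) v = stab U v" using v by (auto simp: mem_stab)
  then show "(stab (gsub G U B) v, stab S (restrict l B v)) \<in> r" using emapsOD(2)[OF assms(1)] v by simp
qed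

lemma rst_spans: assumes "(U, l, h) \<in> spans G r S T" "invar U B" shows "rst (U, l, h) B \<in> spans G r S T"
  using spansD[OF assms(1)] gsub_gset restrict_emaps restrict_emapsO assms(2) by (simp add: spansI)

text \<open>Composition distributes over the splitting of an apex. The equation holds between the
  spans themselves, not just their classes, because both sides are sub-G-sets of the same coded
  product.\<close>

lemma span_pb_rst1:
  assumes "(U, l, h) \<in> spans G r S T" "(V, k, m) \<in> spans G r T W" "invar U B"
  defines "B' \<equiv> {z \<in> pbset U V h k. pfst z \<in> B}"
  shows "span_pb G (rst (U, l, h) B) (V, k, m) = rst (span_pb G (U, l, h) (V, k, m)) B'"
    "invar (fst (span_pb G (U, l, h) (V, k, m))) B'"
    "fst (span_pb G (U, l, h) (V, k, m)) = gsub G (gprod G U V) (pbset U V h k)"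
proof -
  note s = spansD[OF assms(1)] spansD[OF assms(2)]
  note p = pbset_invar[OF s(1,5,3,6)]
  note sp = spansD[OF span_pb_spans[OF assms(1,2), unfolded span_pb_eq]]
  have gg: "h (act U g (pfst z)) = k (act V g (psnd z))" if "z \<in> pbset U V h k" "g \<in> carrier G" for g z
    using that by (simp add: emapsD[OF s(3)] emapsD[OF s(6)])
  have sub: "x \<in> B \<Longrightarrow> x \<in> pts U" for x using invar_subset[OF assms(3)] by auto
  have eq: "pbset (gsub G U B) V (restrict h B) k = B'"
    using sub by (auto simp: B'_def)
  show i: "invar (fst (span_pb G (U, l, h) (V, k, m))) B'"
    unfolding B'_def span_pb_eq fst_conv invar_def using s(1,5) gg by (auto simp: invar_act[OF assms(3)])
  have "rst (U, l, h) B \<in> spans G r S T" by (rule rst_spans[OF assms(1,3)])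
  note s2 = spansD[OF span_pb_spans[OF this[unfolded rst.simps] assms(2), unfolded span_pb_eq]]
  have "gsub G (gprod G (gsub G U B) V) B' = gsub G (gsub G (gprod G U V) (pbset U V h k)) B'"
  proof (rule gset_eqI)
    show "gsub G (gprod G (gsub G U B) V) B' \<in> gsets G" using s2(1) eq by simp
    show "gsub G (gsub G (gprod G U V) (pbset U V h k)) B' \<in> gsets G"
      by (rule gsub_gset[OF sp(1)]) (use i in \<open>simp add: span_pb_eq\<close>)
  qed (auto simp: B'_def)
  moreover have "restrict (\<lambda>z\<in>pbset U V h k. f z) B' = restrict f B'" for f :: "nat \<Rightarrow> nat"
    by (auto simp: B'_def fun_eq_iff restrict_def)
  moreover have "(\<lambda>z\<in>B'. restrict l B (pfst z)) = (\<lambda>z\<in>B'. l (pfst z))"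
    by (auto simp: B'_def fun_eq_iff restrict_def)
  ultimately show "span_pb G (rst (U, l, h) B) (V, k, m) = rst (span_pb G (U, l, h) (V, k, m)) B'"
    by (simp add: span_pb_eq eq)
qed (simp add: span_pb_eq)

lemma span_pb_rst2:
  assumes "(U, l, h) \<in> spans G r S T" "(V, k, m) \<in> spans G r T W" "invar V B"
  defines "B' \<equiv> {z \<in> pbset U V h k. psnd z \<in> B}"
  shows "span_pb G (U, l, h) (rst (V, k, m) B) = rst (span_pb G (U, l, h) (V, k, m)) B'"
    "invar (fst (span_pb G (U, l, h) (V, k, m))) B'"
    "fst (span_pb G (U, l, h) (V, k, m)) = gsub G (gprod G U V) (pbset U V h k)"
proof -
  note s = spansD[OF assms(1)] spansD[OF assms(2)]
  note p = pbset_invar[OF s(1,5,3,6)]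
  note sp = spansD[OF span_pb_spans[OF assms(1,2), unfolded span_pb_eq]]
  have gg: "h (act U g (pfst z)) = k (act V g (psnd z))" if "z \<in> pbset U V h k" "g \<in> carrier G" for g z
    using that by (simp add: emapsD[OF s(3)] emapsD[OF s(6)])
  have sub: "x \<in> B \<Longrightarrow> x \<in> pts V" for x using invar_subset[OF assms(3)] by auto
  have eq: "pbset U (gsub G V B) h (restrict k B) = B'"
    using sub by (auto simp: B'_def)
  show i: "invar (fst (span_pb G (U, l, h) (V, k, m))) B'"
    unfolding B'_def span_pb_eq fst_conv invar_def using s(1,5) gg by (auto simp: invar_act[OF assms(3)])
  have "rst (V, k, m) B \<in> spans G r T W" by (rule rst_spans[OF assms(2,3)])
  note s2 = spansD[OF span_pb_spans[OF assms(1) this[unfolded rst.simps], unfolded span_pb_eq]]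
  have "gsub G (gprod G U (gsub G V B)) B' = gsub G (gsub G (gprod G U V) (pbset U V h k)) B'"
  proof (rule gset_eqI)
    show "gsub G (gprod G U (gsub G V B)) B' \<in> gsets G" using s2(1) eq by simp
    show "gsub G (gsub G (gprod G U V) (pbset U V h k)) B' \<in> gsets G"
      by (rule gsub_gset[OF sp(1)]) (use i in \<open>simp add: span_pb_eq\<close>)
  qed (auto simp: B'_def)
  moreover have "restrict (\<lambda>z\<in>pbset U V h k. f z) B' = restrict f B'" for f :: "nat \<Rightarrow> nat"
    by (auto simp: B'_def fun_eq_iff restrict_def)
  moreover have "(\<lambda>z\<in>B'. restrict m B (psnd z)) = (\<lambda>z\<in>B'. m (psnd z))"
    by (auto simp: B'_def fun_eq_iff restrict_def)
  ultimately show "span_pb G (U, l, h) (rst (V, k, m) B) = rst (span_pb G (U, l, h) (V, k, m)) B'"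
    by (simp add: span_pb_eq eq)
qed (simp add: span_pb_eq)

lemma span_prod_rst1:
  assumes "(U, l, h) \<in> spans G r S T" "(V, k, m) \<in> spans G r S' T'" "invar U B"
  defines "B' \<equiv> {z \<in> pts (gprod G U V). pfst z \<in> B}"
  shows "span_prod G (rst (U, l, h) B) (V, k, m) = rst (span_prod G (U, l, h) (V, k, m)) B'"
    "invar (gprod G U V) B'"
proof -
  note s = spansD[OF assms(1)] spansD[OF assms(2)]
  have sub: "x \<in> B \<Longrightarrow> x \<in> pts U" for x using invar_subset[OF assms(3)] by auto
  have eq: "pts (gprod G (gsub G U B) V) = B'"
    using sub by (auto simp: B'_def)
  show i: "invar (gprod G U V) B'"
    unfolding B'_def invar_def using s(1,5) by (auto simp: invar_act[OF assms(3)])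
  have "gprod G (gsub G U B) V = gsub G (gprod G U V) B'"
  proof (rule gset_eqI)
    show "gprod G (gsub G U B) V \<in> gsets G" by (rule gprod_gset[OF gsub_gset[OF s(1) assms(3)] s(5)])
    show "gsub G (gprod G U V) B' \<in> gsets G" by (rule gsub_gset[OF gprod_gset[OF s(1,5)] i])
  qed (use eq in \<open>auto simp: B'_def\<close>)
  moreover have "restrict (\<lambda>z\<in>pts (gprod G U V). f z) B' = restrict f B'" for f :: "nat \<Rightarrow> nat"
    by (auto simp: B'_def fun_eq_iff restrict_def)
  moreover have "(\<lambda>z\<in>B'. prod_encode (restrict f B (pfst z), e (psnd z))) = (\<lambda>z\<in>B'. prod_encode (f (pfst z), e (psnd z)))" for f e
    by (auto simp: B'_def fun_eq_iff restrict_def)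
  ultimately show "span_prod G (rst (U, l, h) B) (V, k, m) = rst (span_prod G (U, l, h) (V, k, m)) B'"
    by (simp add: span_prod_eq)
qed

end

subsection \<open>Rational vector spaces\<close>

lemma rat_ring_simps [simp]: "carrier rat_ring = UNIV" "x \<oplus>\<^bsub>rat_ring\<^esub> y = x + y"
  "x \<otimes>\<^bsub>rat_ring\<^esub> y = x * y" "\<zero>\<^bsub>rat_ring\<^esub> = 0" "\<one>\<^bsub>rat_ring\<^esub> = 1"
  by (simp_all add: rat_ring_def)

lemma cring_rat_ring: "cring rat_ring"
proof (rule cringI)
  show "abelian_group rat_ring"
  proof (rule abelian_groupI)
    fix x assume "x \<in> carrier rat_ring"
    show "\<exists>y\<in>carrier rat_ring. y \<oplus>\<^bsub>rat_ring\<^esub> x = \<zero>\<^bsub>rat_ring\<^esub>"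
      by (intro bexI[of _ "- x"]) auto
  qed auto
  show "comm_monoid rat_ring" by (rule comm_monoidI) auto
qed (auto simp: algebra_simps)

abbreviation vs :: "(rat, 'v) module \<Rightarrow> bool" where "vs V \<equiv> module rat_ring V"

lemma vs_simps [simp]: assumes "vs V"
  shows "\<zero>\<^bsub>V\<^esub> \<in> carrier V"
    "x \<in> carrier V \<Longrightarrow> y \<in> carrier V \<Longrightarrow> x \<oplus>\<^bsub>V\<^esub> y \<in> carrier V"
    "x \<in> carrier V \<Longrightarrow> q \<odot>\<^bsub>V\<^esub> x \<in> carrier V"
    "x \<in> carrier V \<Longrightarrow> \<zero>\<^bsub>V\<^esub> \<oplus>\<^bsub>V\<^esub> x = x"
    "x \<in> carrier V \<Longrightarrow> x \<oplus>\<^bsub>V\<^esub> \<zero>\<^bsub>V\<^esub> = x"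
    "x \<in> carrier V \<Longrightarrow> 1 \<odot>\<^bsub>V\<^esub> x = x"
    "x \<in> carrier V \<Longrightarrow> 0 \<odot>\<^bsub>V\<^esub> x = \<zero>\<^bsub>V\<^esub>"
    "q \<odot>\<^bsub>V\<^esub> \<zero>\<^bsub>V\<^esub> = \<zero>\<^bsub>V\<^esub>"
proof -
  interpret module rat_ring V by fact
  show "\<zero>\<^bsub>V\<^esub> \<in> carrier V"
    "x \<in> carrier V \<Longrightarrow> y \<in> carrier V \<Longrightarrow> x \<oplus>\<^bsub>V\<^esub> y \<in> carrier V"
    "x \<in> carrier V \<Longrightarrow> q \<odot>\<^bsub>V\<^esub> x \<in> carrier V"
    "x \<in> carrier V \<Longrightarrow> \<zero>\<^bsub>V\<^esub> \<oplus>\<^bsub>V\<^esub> x = x"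
    "x \<in> carrier V \<Longrightarrow> x \<oplus>\<^bsub>V\<^esub> \<zero>\<^bsub>V\<^esub> = x"
    using smult_closed[of q x] by auto
  show "x \<in> carrier V \<Longrightarrow> 1 \<odot>\<^bsub>V\<^esub> x = x" using smult_one by simp
  show "x \<in> carrier V \<Longrightarrow> 0 \<odot>\<^bsub>V\<^esub> x = \<zero>\<^bsub>V\<^esub>" using smult_l_null by simp
  show "q \<odot>\<^bsub>V\<^esub> \<zero>\<^bsub>V\<^esub> = \<zero>\<^bsub>V\<^esub>" using smult_r_null[of q] by simp
qed

lemma vs_comm: "vs V \<Longrightarrow> x \<in> carrier V \<Longrightarrow> y \<in> carrier V \<Longrightarrow> x \<oplus>\<^bsub>V\<^esub> y = y \<oplus>\<^bsub>V\<^esub> x"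
  by (simp add: module_def abelian_group_def abelian_monoid.a_comm)

lemma vs_assoc: "vs V \<Longrightarrow> x \<in> carrier V \<Longrightarrow> y \<in> carrier V \<Longrightarrow> z \<in> carrier V \<Longrightarrow>
    (x \<oplus>\<^bsub>V\<^esub> y) \<oplus>\<^bsub>V\<^esub> z = x \<oplus>\<^bsub>V\<^esub> (y \<oplus>\<^bsub>V\<^esub> z)"
  by (simp add: module_def abelian_group_def abelian_monoid.a_assoc)

lemma vs_swap: "vs V \<Longrightarrow> x \<in> carrier V \<Longrightarrow> y \<in> carrier V \<Longrightarrow> x' \<in> carrier V \<Longrightarrow> y' \<in> carrier V \<Longrightarrow>
    (x \<oplus>\<^bsub>V\<^esub> y) \<oplus>\<^bsub>V\<^esub> (x' \<oplus>\<^bsub>V\<^esub> y') = (x \<oplus>\<^bsub>V\<^esub> x') \<oplus>\<^bsub>V\<^esub> (y \<oplus>\<^bsub>V\<^esub> y')"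
  by (simp add: module_def abelian_group_def abelian_monoid.a_ac)

lemma vs_smult: assumes "vs V" "x \<in> carrier V"
  shows "(a + b) \<odot>\<^bsub>V\<^esub> x = a \<odot>\<^bsub>V\<^esub> x \<oplus>\<^bsub>V\<^esub> b \<odot>\<^bsub>V\<^esub> x"
    "y \<in> carrier V \<Longrightarrow> a \<odot>\<^bsub>V\<^esub> (x \<oplus>\<^bsub>V\<^esub> y) = a \<odot>\<^bsub>V\<^esub> x \<oplus>\<^bsub>V\<^esub> a \<odot>\<^bsub>V\<^esub> y"
    "a \<odot>\<^bsub>V\<^esub> (b \<odot>\<^bsub>V\<^esub> x) = (a * b) \<odot>\<^bsub>V\<^esub> x"
  using module.smult_l_distr[OF assms(1), of a b x] module.smult_r_distr[OF assms(1), of a x y]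
    module.smult_assoc1[OF assms(1), of a b x] assms(2) by simp_all

lemma vs_self_add: assumes "vs V" "x \<in> carrier V" "y \<in> carrier V" "x = x \<oplus>\<^bsub>V\<^esub> y" shows "y = \<zero>\<^bsub>V\<^esub>"
proof -
  have "(-1) \<odot>\<^bsub>V\<^esub> x \<oplus>\<^bsub>V\<^esub> x = \<zero>\<^bsub>V\<^esub>"
    using vs_smult(1)[OF assms(1,2), of "-1" 1] assms by simp
  then show ?thesis using assms vs_assoc[OF assms(1), of "(-1) \<odot>\<^bsub>V\<^esub> x" x y] by simp
qed

text \<open>Additive inverses are not among the premises: \<open>(-1)\<close> times \<open>x\<close>
  supplies them, by distributivity together with \<open>zs\<close>.\<close>

lemma vsI:
  assumes z: "\<zero>\<^bsub>V\<^esub> \<in> carrier V"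
    and a: "\<And>x y. x \<in> carrier V \<Longrightarrow> y \<in> carrier V \<Longrightarrow> x \<oplus>\<^bsub>V\<^esub> y \<in> carrier V"
    and s: "\<And>q x. x \<in> carrier V \<Longrightarrow> q \<odot>\<^bsub>V\<^esub> x \<in> carrier V"
    and "\<And>x y z. x \<in> carrier V \<Longrightarrow> y \<in> carrier V \<Longrightarrow> z \<in> carrier V \<Longrightarrow> (x \<oplus>\<^bsub>V\<^esub> y) \<oplus>\<^bsub>V\<^esub> z = x \<oplus>\<^bsub>V\<^esub> (y \<oplus>\<^bsub>V\<^esub> z)"
    and "\<And>x y. x \<in> carrier V \<Longrightarrow> y \<in> carrier V \<Longrightarrow> x \<oplus>\<^bsub>V\<^esub> y = y \<oplus>\<^bsub>V\<^esub> x"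
    and zl: "\<And>x. x \<in> carrier V \<Longrightarrow> \<zero>\<^bsub>V\<^esub> \<oplus>\<^bsub>V\<^esub> x = x"
    and zs: "\<And>x. x \<in> carrier V \<Longrightarrow> 0 \<odot>\<^bsub>V\<^esub> x = \<zero>\<^bsub>V\<^esub>"
    and 1: "\<And>a b x. x \<in> carrier V \<Longrightarrow> (a + b) \<odot>\<^bsub>V\<^esub> x = a \<odot>\<^bsub>V\<^esub> x \<oplus>\<^bsub>V\<^esub> b \<odot>\<^bsub>V\<^esub> x"
    and 2: "\<And>a x y. x \<in> carrier V \<Longrightarrow> y \<in> carrier V \<Longrightarrow> a \<odot>\<^bsub>V\<^esub> (x \<oplus>\<^bsub>V\<^esub> y) = a \<odot>\<^bsub>V\<^esub> x \<oplus>\<^bsub>V\<^esub> a \<odot>\<^bsub>V\<^esub> y"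
    and 3: "\<And>a b x. x \<in> carrier V \<Longrightarrow> (a * b) \<odot>\<^bsub>V\<^esub> x = a \<odot>\<^bsub>V\<^esub> (b \<odot>\<^bsub>V\<^esub> x)"
    and 4: "\<And>x. x \<in> carrier V \<Longrightarrow> 1 \<odot>\<^bsub>V\<^esub> x = x"
  shows "vs V"
proof (rule moduleI[OF cring_rat_ring])
  show "abelian_group V"
  proof (rule abelian_groupI)
    fix x assume x: "x \<in> carrier V"
    have "(-1) \<odot>\<^bsub>V\<^esub> x \<oplus>\<^bsub>V\<^esub> x = \<zero>\<^bsub>V\<^esub>" using 1[OF x, of "-1" 1] x by (simp add: 4 zs)
    then show "\<exists>y\<in>carrier V. y \<oplus>\<^bsub>V\<^esub> x = \<zero>\<^bsub>V\<^esub>" using s[OF x] by blast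
  qed (use assms in simp_all)
qed (use assms in simp_all)

lemma linmapsD: assumes "f \<in> linmaps V W"
  shows "x \<in> carrier V \<Longrightarrow> f x \<in> carrier W"
    "x \<in> carrier V \<Longrightarrow> y \<in> carrier V \<Longrightarrow> f (x \<oplus>\<^bsub>V\<^esub> y) = f x \<oplus>\<^bsub>W\<^esub> f y"
    "x \<in> carrier V \<Longrightarrow> f (q \<odot>\<^bsub>V\<^esub> x) = q \<odot>\<^bsub>W\<^esub> f x"
    "f \<in> extensional (carrier V)"
  using assms by (auto simp: linmaps_def PiE_def)

lemma linmapsI: "f \<in> extensional (carrier V) \<Longrightarrow> (\<And>x. x \<in> carrier V \<Longrightarrow> f x \<in> carrier W) \<Longrightarrow>
   (\<And>x y. x \<in> carrier V \<Longrightarrow> y \<in> carrier V \<Longrightarrow> f (x \<oplus>\<^bsub>V\<^esub> y) = f x \<oplus>\<^bsub>W\<^esub> f y) \<Longrightarrow>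
   (\<And>q x. x \<in> carrier V \<Longrightarrow> f (q \<odot>\<^bsub>V\<^esub> x) = q \<odot>\<^bsub>W\<^esub> f x) \<Longrightarrow> f \<in> linmaps V W"
  by (auto simp: linmaps_def PiE_def)

lemma linmaps_zero: assumes "f \<in> linmaps V W" "vs V" "vs W" shows "f \<zero>\<^bsub>V\<^esub> = \<zero>\<^bsub>W\<^esub>"
proof -
  have "f \<zero>\<^bsub>V\<^esub> = f (0 \<odot>\<^bsub>V\<^esub> \<zero>\<^bsub>V\<^esub>)" using assms by simp
  also have "\<dots> = 0 \<odot>\<^bsub>W\<^esub> f \<zero>\<^bsub>V\<^esub>" by (rule linmapsD(3)[OF assms(1)]) (use assms in simp)
  also have "\<dots> = \<zero>\<^bsub>W\<^esub>" using assms linmapsD(1)[OF assms(1)] by simp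
  finally show ?thesis .
qed

lemma linmaps_eqI: "f \<in> linmaps V W \<Longrightarrow> g \<in> linmaps V W \<Longrightarrow> (\<And>x. x \<in> carrier V \<Longrightarrow> f x = g x) \<Longrightarrow> f = g"
  using extensionalityI[of f "carrier V" g] linmapsD(4)[of f V W] linmapsD(4)[of g V W] by blast

lemma linmaps_id: "(\<lambda>x\<in>carrier V. x) \<in> linmaps V V" if "vs V"
  using that by (intro linmapsI) auto

lemma linmaps_compose: assumes "f \<in> linmaps U V" "g \<in> linmaps V W" "vs U"
  shows "compose (carrier U) g f \<in> linmaps U W"
  using assms(3) by (intro linmapsI) (simp_all add: compose_eq linmapsD[OF assms(1)] linmapsD[OF assms(2)])

lemma Vect_simps [simp]: "obj Vect = {V. vs V}" "arr Vect = linmaps" "ide Vect V = (\<lambda>x\<in>carrier V. x)"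
  "cmp Vect U V W g f = compose (carrier U) g f"
  by (simp_all add: Vect_def)

subsection \<open>Mackey functors as additive functors\<close>

lemma gsum_pts: "pts (gsum G S T) = sum_encode ` (Inl ` pts S \<union> Inr ` pts T)"
  by (simp add: gsum_def Plus_def)

context transfer_group
begin

lemma gsum_act [simp]: "g \<in> carrier G \<Longrightarrow> x \<in> pts S \<Longrightarrow> act (gsum G S T) g (sum_encode (Inl x)) = sum_encode (Inl (act S g x))"
  "g \<in> carrier G \<Longrightarrow> y \<in> pts T \<Longrightarrow> act (gsum G S T) g (sum_encode (Inr y)) = sum_encode (Inr (act T g y))"
  by (auto simp: gsum_def)

lemma gsum_mem: "sum_encode (Inl x) \<in> pts (gsum G S T) \<longleftrightarrow> x \<in> pts S"
  "sum_encode (Inr y) \<in> pts (gsum G S T) \<longleftrightarrow> y \<in> pts T"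
  by (auto simp: gsum_pts sum_encode_eq)

lemma gsum_cases: assumes "z \<in> pts (gsum G S T)"
  obtains x where "x \<in> pts S" "z = sum_encode (Inl x)" | y where "y \<in> pts T" "z = sum_encode (Inr y)"
  using assms by (auto simp: gsum_pts)

lemma gsum_gset [simp]: assumes S: "S \<in> gsets G" and T: "T \<in> gsets G" shows "gsum G S T \<in> gsets G"
proof (rule gsetsI)
  show "finite (pts (gsum G S T))" using assms by (simp add: gsum_pts)
  show "act (gsum G S T) \<in> extensional (carrier G)" by (simp add: gsum_def)
  show "act (gsum G S T) g \<in> extensional (pts (gsum G S T))" if "g \<in> carrier G" for g
    using that by (simp add: gsum_def)
  show "act (gsum G S T) g x \<in> pts (gsum G S T)" if "g \<in> carrier G" "x \<in> pts (gsum G S T)" for g x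
    using that(2) by (rule gsum_cases) (use that S T in \<open>simp_all add: gsum_mem\<close>)
  show "act (gsum G S T) \<one> x = x" if "x \<in> pts (gsum G S T)" for x
    using that by (rule gsum_cases) (use S T in simp_all)
  show "act (gsum G S T) (g \<otimes> h) x = act (gsum G S T) g (act (gsum G S T) h x)"
    if "g \<in> carrier G" "h \<in> carrier G" "x \<in> pts (gsum G S T)" for g h x
    using that(3) by (rule gsum_cases) (use that S T in \<open>simp_all add: act_mult\<close>)
qed

abbreviation il where "il S \<equiv> (\<lambda>s\<in>pts S. sum_encode (Inl s))"
abbreviation ir where "ir S \<equiv> (\<lambda>s\<in>pts S. sum_encode (Inr s))"

lemma il_emaps: "S \<in> gsets G \<Longrightarrow> il S \<in> emaps G S (gsum G S T)" "inj_on (il S) (pts S)"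
  by (auto intro!: emapsI inj_onI simp: gsum_mem sum_encode_eq)

lemma ir_emaps: "T \<in> gsets G \<Longrightarrow> ir T \<in> emaps G T (gsum G S T)" "inj_on (ir T) (pts T)"
  by (auto intro!: emapsI inj_onI simp: gsum_mem sum_encode_eq)

definition lin_functor :: "('a, 'v) mfun \<Rightarrow> bool" where
  "lin_functor M \<longleftrightarrow> is_functor (Lindner G r) Vect M"

lemma lin_functorD: assumes "lin_functor M"
  shows "S \<in> gsets G \<Longrightarrow> vs (fob M S)"
    "S \<in> gsets G \<Longrightarrow> T \<in> gsets G \<Longrightarrow> X \<in> Ar S T \<Longrightarrow> fmor M S T X \<in> linmaps (fob M S) (fob M T)"
    "S \<in> gsets G \<Longrightarrow> m \<in> carrier (fob M S) \<Longrightarrow> fmor M S S (idL S) m = m"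
    "S \<in> gsets G \<Longrightarrow> T \<in> gsets G \<Longrightarrow> W \<in> gsets G \<Longrightarrow> X \<in> Ar S T \<Longrightarrow> Y \<in> Ar T W \<Longrightarrow> m \<in> carrier (fob M S) \<Longrightarrow>
     fmor M S W (cmpL S T W Y X) m = fmor M T W Y (fmor M S T X m)"
    "S \<in> gsets G \<Longrightarrow> T \<in> gsets G \<Longrightarrow> X \<in> Ar S T \<Longrightarrow> m \<in> carrier (fob M S) \<Longrightarrow> fmor M S T X m \<in> carrier (fob M T)"
proof -
  note d = assms[unfolded lin_functor_def is_functor_def]
  have d1: "fob M S \<in> obj Vect" "fmor M S S (idL S) = ide Vect (fob M S)" if "S \<in> gsets G" for S
    using d that unfolding obj_Lindner by blast+
  have d2: "fmor M S T X \<in> arr Vect (fob M S) (fob M T)" if "S \<in> gsets G" "T \<in> gsets G" "X \<in> Ar S T" for S T X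
    using d that unfolding obj_Lindner by blast
  have d3: "fmor M S W (cmpL S T W Y X) = cmp Vect (fob M S) (fob M T) (fob M W) (fmor M T W Y) (fmor M S T X)"
    if "S \<in> gsets G" "T \<in> gsets G" "W \<in> gsets G" "X \<in> Ar S T" "Y \<in> Ar T W" for S T W X Y
    using d that unfolding obj_Lindner by blast
  show "S \<in> gsets G \<Longrightarrow> vs (fob M S)" using d1(1) by simp
  show l: "fmor M S T X \<in> linmaps (fob M S) (fob M T)" if "S \<in> gsets G" "T \<in> gsets G" "X \<in> Ar S T" for S T X
    using d2[OF that] by simp
  show "S \<in> gsets G \<Longrightarrow> m \<in> carrier (fob M S) \<Longrightarrow> fmor M S S (idL S) m = m" using d1(2) by simp
  show "S \<in> gsets G \<Longrightarrow> T \<in> gsets G \<Longrightarrow> W \<in> gsets G \<Longrightarrow> X \<in> Ar S T \<Longrightarrow> Y \<in> Ar T W \<Longrightarrow> m \<in> carrier (fob M S) \<Longrightarrow>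
     fmor M S W (cmpL S T W Y X) m = fmor M T W Y (fmor M S T X m)"
    using d3[of S T W X Y] by (simp add: compose_eq)
  show "S \<in> gsets G \<Longrightarrow> T \<in> gsets G \<Longrightarrow> X \<in> Ar S T \<Longrightarrow> m \<in> carrier (fob M S) \<Longrightarrow> fmor M S T X m \<in> carrier (fob M T)"
    using linmapsD(1)[OF l] by blast
qed

lemma lin_functorI:
  assumes "\<And>S. S \<in> gsets G \<Longrightarrow> vs (fob M S)"
    and l: "\<And>S T X. S \<in> gsets G \<Longrightarrow> T \<in> gsets G \<Longrightarrow> X \<in> Ar S T \<Longrightarrow> fmor M S T X \<in> linmaps (fob M S) (fob M T)"
    and i: "\<And>S m. S \<in> gsets G \<Longrightarrow> m \<in> carrier (fob M S) \<Longrightarrow> fmor M S S (idL S) m = m"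
    and c: "\<And>S T W X Y m. S \<in> gsets G \<Longrightarrow> T \<in> gsets G \<Longrightarrow> W \<in> gsets G \<Longrightarrow> X \<in> Ar S T \<Longrightarrow> Y \<in> Ar T W \<Longrightarrow>
     m \<in> carrier (fob M S) \<Longrightarrow> fmor M S W (cmpL S T W Y X) m = fmor M T W Y (fmor M S T X m)"
  shows "lin_functor M"
  unfolding lin_functor_def is_functor_def
proof (intro conjI ballI)
  fix S assume "S \<in> obj (Lindner G r)" then have S: "S \<in> gsets G" by simp
  show "fob M S \<in> obj Vect" using assms(1)[OF S] by simp
  have "fmor M S S (idL S) = (\<lambda>x\<in>carrier (fob M S). x)"
    by (rule linmaps_eqI[OF l[OF S S] linmaps_id]) (use S i assms(1) in simp_all)
  then show "fmor M S S (idL S) = ide Vect (fob M S)" by simp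
next
  fix S T X assume "S \<in> obj (Lindner G r)" "T \<in> obj (Lindner G r)" "X \<in> Ar S T"
  then show "fmor M S T X \<in> arr Vect (fob M S) (fob M T)" using l by simp
next
  fix S T W X Y assume a: "S \<in> obj (Lindner G r)" "T \<in> obj (Lindner G r)" "W \<in> obj (Lindner G r)" "X \<in> Ar S T" "Y \<in> Ar T W"
  have "fmor M S W (cmpL S T W Y X) = compose (carrier (fob M S)) (fmor M T W Y) (fmor M S T X)"
    by (rule linmaps_eqI[OF l linmaps_compose[OF l l]]) (use a c assms(1) in \<open>simp_all add: compose_eq\<close>)
  then show "fmor M S W (cmpL S T W Y X) = cmp Vect (fob M S) (fob M T) (fob M W) (fmor M T W Y) (fmor M S T X)" by simp
qed

text \<open>The working form of product preservation. It speaks about splitting the apex inside a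
  given G-set, which is what the induction over spans and the functor \<open>shift\<close> can
  handle directly; \<open>Mackey_obj_iff\<close> gives the equivalence.\<close>

definition additive :: "('a, 'v) mfun \<Rightarrow> bool" where
  "additive M \<longleftrightarrow> (\<forall>S\<in>gsets G. \<forall>T\<in>gsets G. \<forall>U l h B. (U, l, h) \<in> spans G r S T \<longrightarrow> invar U B \<longrightarrow>
     (\<forall>m\<in>carrier (fob M S). fmor M S T (cl S T (U, l, h)) m =
        fmor M S T (cl S T (rst (U, l, h) B)) m \<oplus>\<^bsub>fob M T\<^esub> fmor M S T (cl S T (rst (U, l, h) (pts U - B))) m))"

lemma additiveD: "additive M \<Longrightarrow> S \<in> gsets G \<Longrightarrow> T \<in> gsets G \<Longrightarrow> (U, l, h) \<in> spans G r S T \<Longrightarrow> invar U B \<Longrightarrow>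
  m \<in> carrier (fob M S) \<Longrightarrow> fmor M S T (cl S T (U, l, h)) m =
        fmor M S T (cl S T (rst (U, l, h) B)) m \<oplus>\<^bsub>fob M T\<^esub> fmor M S T (cl S T (rst (U, l, h) (pts U - B))) m"
  unfolding additive_def by blast

lemma additive_zeroL: assumes "lin_functor M" "additive M" "S \<in> gsets G" "T \<in> gsets G" "m \<in> carrier (fob M S)"
  shows "fmor M S T (zeroL S T) m = \<zero>\<^bsub>fob M T\<^esub>"
proof -
  let ?e = "(empty_gset, \<lambda>x. undefined, \<lambda>x. undefined)"
  have i: "invar empty_gset {}" by (simp add: invar_def)
  have e: "cl S T (rst ?e {}) = zeroL S T"
    using rst_spans[OF empty_span[of S T] i] by (simp add: empty_spanD)
  have "fmor M S T (zeroL S T) m = fmor M S T (zeroL S T) m \<oplus>\<^bsub>fob M T\<^esub> fmor M S T (zeroL S T) m"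
    using additiveD[OF assms(2-4) empty_span i assms(5)] e by (simp add: zeroL_def)
  then show ?thesis using vs_self_add lin_functorD[OF assms(1)] assms zeroL_arr by metis
qed

lemma Mackey_obj: "M \<in> obj (Mackey G r) \<longleftrightarrow> lin_functor M \<and> product_preserving G r M"
  by (simp add: Mackey_def full_subcat_def functor_cat_def lin_functor_def)

text \<open>The span with empty apex factors through the empty G-set, on which the functor takes the
  zero space as value.\<close>

lemma preserving_zeroL: assumes "lin_functor M" "product_preserving G r M" "S \<in> gsets G" "T \<in> gsets G" "m \<in> carrier (fob M S)"
  shows "fmor M S T (zeroL S T) m = \<zero>\<^bsub>fob M T\<^esub>"
proof -
  let ?e = "(empty_gset, \<lambda>x. undefined, \<lambda>x. undefined)"
  note z = empty_span[of S "empty_gset"] empty_span[of "empty_gset" T]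
  have "cmpL S empty_gset T (zeroL empty_gset T) (zeroL S empty_gset) = cl S T (span_pb G ?e ?e)"
    using cmpL_cl[OF z] by (simp add: zeroL_def)
  also have "\<dots> = zeroL S T" using span_pb_spans[OF z] by (simp add: span_pb_eq empty_spanD pbset_def)
  finally have "fmor M S T (zeroL S T) m = fmor M empty_gset T (zeroL empty_gset T) (fmor M S empty_gset (zeroL S empty_gset) m)"
    using lin_functorD(4)[OF assms(1), of S empty_gset T "zeroL S empty_gset" "zeroL empty_gset T" m] assms by simp
  moreover have "fmor M S empty_gset (zeroL S empty_gset) m = \<zero>\<^bsub>fob M empty_gset\<^esub>"
    using lin_functorD(5)[OF assms(1,3) empty_gset(1) zeroL_arr assms(5)] assms(2) unfolding product_preserving_def by auto
  ultimately show ?thesis using linmaps_zero[OF lin_functorD(2)[OF assms(1)]] lin_functorD(1)[OF assms(1)] assms by simp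
qed

abbreviation inc where "inc B \<equiv> (\<lambda>x\<in>B. x)"

lemma inc_emaps: assumes "U \<in> gsets G" "invar U B"
  shows "inc B \<in> emaps G (gsub G U B) U" "inj_on (inc B) (pts (gsub G U B))" "gsub G U B \<in> gsets G"
  using invar_subset[OF assms(2)] invar_act[OF assms(2)] gsub_gset[OF assms]
  by (auto intro!: emapsI simp: subset_iff inj_on_def)

text \<open>Transports the product axiom, stated for \<open>gsum\<close>, to an internal
  decomposition of \<open>U\<close>. The folding map \<open>f\<close> from the coded sum of
  \<open>B\<close> and \<open>C\<close> to \<open>U\<close> is bijective, so restriction along it is
  injective, with the transfer as left inverse.\<close>

lemma res_jointly_inj:
  assumes M: "lin_functor M" "product_preserving G r M" and U: "U \<in> gsets G" and B: "invar U B"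
    and C: "C = pts U - B" and xy: "x \<in> carrier (fob M U)" "y \<in> carrier (fob M U)"
    and eqB: "fmor M U (gsub G U B) (res G r (gsub G U B) U (inc B)) x = fmor M U (gsub G U B) (res G r (gsub G U B) U (inc B)) y"
    and eqC: "fmor M U (gsub G U C) (res G r (gsub G U C) U (inc C)) x = fmor M U (gsub G U C) (res G r (gsub G U C) U (inc C)) y"
  shows "x = y"
proof -
  have Ci: "invar U C" unfolding C by (rule invar_compl[OF U B])
  let ?B = "gsub G U B" let ?C = "gsub G U C"
  note iB = inc_emaps[OF U B] and iC = inc_emaps[OF U Ci]
  define W where "W = gsum G ?B ?C"
  have W: "W \<in> gsets G" using iB iC by (simp add: W_def)
  define f where "f = (\<lambda>z\<in>pts W. case sum_decode z of Inl b \<Rightarrow> b | Inr c \<Rightarrow> c)"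
  have fB: "f (sum_encode (Inl b)) = b" if "b \<in> B" for b using that by (simp add: f_def W_def gsum_mem)
  have fC: "f (sum_encode (Inr b)) = b" if "b \<in> C" for b using that by (simp add: f_def W_def gsum_mem)
  have sub: "b \<in> pts U" if "b \<in> B \<or> b \<in> C" for b using that invar_subset[OF B] C by auto
  have fe: "f \<in> emaps G W U"
  proof (rule emapsI)
    show "f \<in> extensional (pts W)" by (simp add: f_def)
    fix z assume z: "z \<in> pts W"
    show "f z \<in> pts U" using z[unfolded W_def] by (rule gsum_cases) (simp_all add: fB fC sub)
    show "f (act W g z) = act U g (f z)" if g: "g \<in> carrier G" for g using z[unfolded W_def]
      by (rule gsum_cases) (use g in \<open>simp_all add: W_def[symmetric] fB fC invar_act[OF B] invar_act[OF Ci], simp_all add: W_def fB fC invar_act[OF B] invar_act[OF Ci]\<close>)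
  qed
  have fbij: "bij_betw f (pts W) (pts U)"
  proof (rule bij_betw_byWitness[where f' = "\<lambda>u. if u \<in> B then sum_encode (Inl u) else sum_encode (Inr u)"])
    show "\<forall>z\<in>pts W. (if f z \<in> B then sum_encode (Inl (f z)) else sum_encode (Inr (f z))) = z"
    proof
      fix z assume "z \<in> pts W" then show "(if f z \<in> B then sum_encode (Inl (f z)) else sum_encode (Inr (f z))) = z"
        unfolding W_def by (rule gsum_cases) (auto simp: fB fC C)
    qed
    show "\<forall>u\<in>pts U. f (if u \<in> B then sum_encode (Inl u) else sum_encode (Inr u)) = u"
      by (auto simp: fB fC C)
    show "f ` pts W \<subseteq> pts U" using emapsD(1)[OF fe] by auto
    show "(\<lambda>u. if u \<in> B then sum_encode (Inl u) else sum_encode (Inr u)) ` pts U \<subseteq> pts W"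
      by (auto simp: W_def gsum_mem C)
  qed
  have finj: "inj_on f (pts W)" using fbij by (simp add: bij_betw_def)
  define x' where "x' = fmor M U W (res G r W U f) x"
  define y' where "y' = fmor M U W (res G r W U f) y"
  have bck: "fmor M W U (tr G r W U f) (fmor M U W (res G r W U f) z) = z" if "z \<in> carrier (fob M U)" for z
    using lin_functorD(4)[OF M(1) U W U res_arr[OF W fe] tr_arr[OF W emapsO_inj[OF W U fe finj]] that]
      tr_res_bij[OF fe fbij W U] lin_functorD(3)[OF M(1) U that] by simp
  have c1: "cmpL U W ?B (res G r ?B W (il ?B)) (res G r W U f) = res G r ?B U (inc B)"
  proof -
    have "(\<lambda>v\<in>pts ?B. f (il ?B v)) = inc B" by (auto simp: fun_eq_iff fB restrict_def)
    then show ?thesis using cmpL_res(1)[OF res_span[OF iB(3) il_emaps(1)[OF iB(3), of ?C]], of f U] fe W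
      by (simp add: res_def[of _ _ ?B] W_def)
  qed
  have c2: "cmpL U W ?C (res G r ?C W (ir ?C)) (res G r W U f) = res G r ?C U (inc C)"
  proof -
    have "(\<lambda>v\<in>pts ?C. f (ir ?C v)) = inc C" by (auto simp: fun_eq_iff fC restrict_def)
    then show ?thesis using cmpL_res(1)[OF res_span[OF iC(3) ir_emaps(1)[OF iC(3), of ?B]], of f U] fe W
      by (simp add: res_def[of _ _ ?C] W_def)
  qed
  have p1: "fmor M W ?B (res G r ?B W (il ?B)) (fmor M U W (res G r W U f) z) = fmor M U ?B (res G r ?B U (inc B)) z"
    if "z \<in> carrier (fob M U)" for z
    using lin_functorD(4)[OF M(1) U W iB(3) res_arr[OF W fe] res_arr[OF iB(3) il_emaps(1)[OF iB(3), of ?C, folded W_def]] that] c1 by simp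
  have p2: "fmor M W ?C (res G r ?C W (ir ?C)) (fmor M U W (res G r W U f) z) = fmor M U ?C (res G r ?C U (inc C)) z"
    if "z \<in> carrier (fob M U)" for z
    using lin_functorD(4)[OF M(1) U W iC(3) res_arr[OF W fe] res_arr[OF iC(3) ir_emaps(1)[OF iC(3), of ?B, folded W_def]] that] c2 by simp
  have mem: "x' \<in> carrier (fob M W)" "y' \<in> carrier (fob M W)"
    unfolding x'_def y'_def using lin_functorD(5)[OF M(1) U W res_arr[OF W fe]] xy by auto
  have inj: "inj_on (\<lambda>x. (fmor M W ?B (res G r ?B W (il ?B)) x, fmor M W ?C (res G r ?C W (ir ?C)) x)) (carrier (fob M W))"
    using M(2) iB(3) iC(3) unfolding product_preserving_def W_def bij_betw_def by blast
  have e1: "fmor M W ?B (res G r ?B W (il ?B)) x' = fmor M W ?B (res G r ?B W (il ?B)) y'"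
    unfolding x'_def y'_def p1[OF xy(1)] p1[OF xy(2)] by (rule eqB)
  have e2: "fmor M W ?C (res G r ?C W (ir ?C)) x' = fmor M W ?C (res G r ?C W (ir ?C)) y'"
    unfolding x'_def y'_def p2[OF xy(1)] p2[OF xy(2)] by (rule eqC)
  have xy': "x' = y'"
    using inj e1 e2 mem unfolding inj_on_def by blast
  have "x = fmor M W U (tr G r W U f) x'" unfolding x'_def bck[OF xy(1)] ..
  also have "\<dots> = y" unfolding xy' unfolding y'_def by (rule bck[OF xy(2)])
  finally show "x = y" .
qed

lemma tr_res_span: assumes "(U, l, h) \<in> spans G r S T"
  shows "cmpL S U T (tr G r U T h) (res G r U S l) = cl S T (U, l, h)"
proof -
  note s = spansD[OF assms]
  have "(\<lambda>v\<in>pts U. h ((\<lambda>x\<in>pts U. x) v)) = h"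
    using emapsD(3)[OF s(3)] by (auto simp: fun_eq_iff restrict_def extensional_def)
  then show ?thesis using cmpL_tr(1)[OF res_span[OF s(1,2)] s(4,1)] by (simp add: res_def)
qed

text \<open>The endomorphism \<open>(B, inc, inc)\<close> of \<open>U\<close> is the projection onto
  the biproduct summand \<open>B\<close>. Inserting it between the two legs cuts a span down to
  \<open>B\<close>, which reduces additivity of arbitrary spans to splitting the identity of
  \<open>U\<close>.\<close>

lemma tr_inc_span: assumes "(U, l, h) \<in> spans G r S T" "invar U B"
  shows "cmpL S U T (tr G r U T h) (cmpL S U U (cl U U (gsub G U B, inc B, inc B)) (res G r U S l)) = cl S T (rst (U, l, h) B)"
    "(gsub G U B, inc B, inc B) \<in> spans G r U U"
proof -
  note s = spansD[OF assms(1)] and i = inc_emaps[OF spansD(1)[OF assms(1)] assms(2)]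
  show 1: "(gsub G U B, inc B, inc B) \<in> spans G r U U"
    using i s(1) by (simp add: spansI emapsO_inj)
  have e: "(\<lambda>v\<in>pts (gsub G U B). l (inc B v)) = restrict l B" "(\<lambda>v\<in>pts (gsub G U B). h (inc B v)) = restrict h B"
    by (auto simp: fun_eq_iff restrict_def)
  note 2 = cmpL_res[OF 1 s(2,1)]
  then show "cmpL S U T (tr G r U T h) (cmpL S U U (cl U U (gsub G U B, inc B, inc B)) (res G r U S l)) = cl S T (rst (U, l, h) B)"
    using cmpL_tr(1)[OF 2(2) s(4,1)] e by simp
qed

text \<open>It suffices to write an element \<open>x\<close> of the value at \<open>U\<close> as the
  sum of its two projections. This is tested after restriction to \<open>B\<close> and to its
  complement, where one projection becomes the identity (\<open>key\<close>) and the other becomes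
  zero (\<open>key0\<close>).\<close>

lemma preserving_imp_additive: assumes M: "lin_functor M" "product_preserving G r M"
  shows "additive M"
  unfolding additive_def
proof (intro ballI allI impI)
  fix S T U l h B m
  assume S: "S \<in> gsets G" and T: "T \<in> gsets G" and sp: "(U, l, h) \<in> spans G r S T"
    and B: "invar U B" and m: "m \<in> carrier (fob M S)"
  note s = spansD[OF sp]
  define C where "C = pts U - B"
  have C: "invar U C" unfolding C_def by (rule invar_compl[OF s(1) B])
  let ?B = "gsub G U B" let ?C = "gsub G U C"
  note iB = inc_emaps[OF s(1) B] and iC = inc_emaps[OF s(1) C]
  note tB = tr_inc_span[OF sp B] and tC = tr_inc_span[OF sp C]
  let ?pB = "cl U U (?B, inc B, inc B)" let ?pC = "cl U U (?C, inc C, inc C)"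
  define x where "x = fmor M S U (res G r U S l) m"
  have x: "x \<in> carrier (fob M U)" unfolding x_def by (rule lin_functorD(5)[OF M(1) S s(1) res_arr[OF s(1,2)] m])
  have V: "vs (fob M U)" "vs (fob M T)" using lin_functorD(1)[OF M(1)] s(1) T by auto
  have pc: "fmor M U U ?pB x \<in> carrier (fob M U)" "fmor M U U ?pC x \<in> carrier (fob M U)"
    using lin_functorD(5)[OF M(1) s(1) s(1) cl_arr x] tB(2) tC(2) by auto
  have disj: "inc B ` pts ?B \<inter> inc C ` pts ?C = {}" "inc C ` pts ?C \<inter> inc B ` pts ?B = {}"
    by (auto simp: C_def)
  have key: "fmor M U K (res G r K U j) (fmor M U U (cl U U (K, j, j)) x) = fmor M U K (res G r K U j) x"
    if "j \<in> emaps G K U" "inj_on j (pts K)" "K \<in> gsets G" for K j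
  proof -
    have a: "tr G r K U j \<in> Ar K U" "res G r K U j \<in> Ar U K"
      using that s(1) emapsO_inj by auto
    have "fmor M U U (cl U U (K, j, j)) x = fmor M K U (tr G r K U j) (fmor M U K (res G r K U j) x)"
      using lin_functorD(4)[OF M(1) s(1) that(3) s(1) a(2,1) x] tr_res_inj[OF that s(1)] by simp
    moreover have y: "fmor M U K (res G r K U j) x \<in> carrier (fob M K)"
      by (rule lin_functorD(5)[OF M(1) s(1) that(3) a(2) x])
    ultimately show ?thesis
      using lin_functorD(4)[OF M(1) that(3) s(1) that(3) a(1,2) y] res_tr_inj[OF that s(1)] lin_functorD(3)[OF M(1) that(3) y] by simp
  qed
  have key0: "fmor M U K (res G r K U j) (fmor M U U (cl U U (N, k, k)) x) = \<zero>\<^bsub>fob M K\<^esub>"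
    if j: "j \<in> emaps G K U" "inj_on j (pts K)" "K \<in> gsets G" and
      k: "k \<in> emaps G N U" "inj_on k (pts N)" "N \<in> gsets G" and d: "j ` pts K \<inter> k ` pts N = {}" for K j N k
  proof -
    have a: "tr G r N U k \<in> Ar N U" "res G r N U k \<in> Ar U N" "res G r K U j \<in> Ar U K"
      using that s(1) emapsO_inj by auto
    have "fmor M U U (cl U U (N, k, k)) x = fmor M N U (tr G r N U k) (fmor M U N (res G r N U k) x)"
      using lin_functorD(4)[OF M(1) s(1) k(3) s(1) a(2,1) x] tr_res_inj[OF k s(1)] by simp
    moreover have y: "fmor M U N (res G r N U k) x \<in> carrier (fob M N)"
      by (rule lin_functorD(5)[OF M(1) s(1) k(3) a(2) x])
    ultimately show ?thesis
      using lin_functorD(4)[OF M(1) k(3) s(1) j(3) a(1,3) y] res_tr_disjoint[OF j s(1) k d]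
        preserving_zeroL[OF M k(3) j(3) y] by simp
  qed
  have lB: "res G r ?B U (inc B) \<in> Ar U ?B" and lC: "res G r ?C U (inc C) \<in> Ar U ?C"
    using iB iC by simp_all
  have split: "x = fmor M U U ?pB x \<oplus>\<^bsub>fob M U\<^esub> fmor M U U ?pC x"
  proof (rule res_jointly_inj[OF M s(1) B C_def x])
    show "fmor M U U ?pB x \<oplus>\<^bsub>fob M U\<^esub> fmor M U U ?pC x \<in> carrier (fob M U)" using pc V by simp
    show "fmor M U ?B (res G r ?B U (inc B)) x = fmor M U ?B (res G r ?B U (inc B)) (fmor M U U ?pB x \<oplus>\<^bsub>fob M U\<^esub> fmor M U U ?pC x)"
      using linmapsD(2)[OF lin_functorD(2)[OF M(1) s(1) iB(3) lB] pc] key[OF iB] key0[OF iB iC disj(1)]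
        lin_functorD(1)[OF M(1) iB(3)] lin_functorD(5)[OF M(1) s(1) iB(3) lB x] by simp
    show "fmor M U ?C (res G r ?C U (inc C)) x = fmor M U ?C (res G r ?C U (inc C)) (fmor M U U ?pB x \<oplus>\<^bsub>fob M U\<^esub> fmor M U U ?pC x)"
      using linmapsD(2)[OF lin_functorD(2)[OF M(1) s(1) iC(3) lC] pc] key[OF iC] key0[OF iC iB disj(2)]
        lin_functorD(1)[OF M(1) iC(3)] lin_functorD(5)[OF M(1) s(1) iC(3) lC x] by simp
  qed
  have a: "tr G r U T h \<in> Ar U T" "res G r U S l \<in> Ar S U" using s by simp_all
  have q: "fmor M U T (tr G r U T h) (fmor M U U (cl U U (gsub G U D, inc D, inc D)) x) = fmor M S T (cl S T (rst (U, l, h) D)) m"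
    if D: "invar U D" for D
  proof -
    note t = tr_inc_span[OF sp D]
    have p: "cl U U (gsub G U D, inc D, inc D) \<in> Ar U U" using t(2) by simp
    show ?thesis unfolding x_def
      using lin_functorD(4)[OF M(1) S s(1) s(1) a(2) p m] lin_functorD(4)[OF M(1) S s(1) T cmpL_arr[OF a(2) p] a(1) m] t(1) by simp
  qed
  have "fmor M S T (cl S T (U, l, h)) m = fmor M U T (tr G r U T h) x"
    using lin_functorD(4)[OF M(1) S s(1) T a(2,1) m] tr_res_span[OF sp] by (simp add: x_def)
  also have "\<dots> = fmor M U T (tr G r U T h) (fmor M U U ?pB x \<oplus>\<^bsub>fob M U\<^esub> fmor M U U ?pC x)"
    using split by simp
  also have "\<dots> = fmor M S T (cl S T (rst (U, l, h) B)) m \<oplus>\<^bsub>fob M T\<^esub> fmor M S T (cl S T (rst (U, l, h) C)) m"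
    using linmapsD(2)[OF lin_functorD(2)[OF M(1) s(1) T a(1)] pc] q[OF B] q[OF C] by simp
  finally show "fmor M S T (cl S T (U, l, h)) m = fmor M S T (cl S T (rst (U, l, h) B)) m \<oplus>\<^bsub>fob M T\<^esub>
      fmor M S T (cl S T (rst (U, l, h) (pts U - B))) m" unfolding C_def .
qed

lemma image_span: assumes "j \<in> emaps G S W" "inj_on j (pts S)" "S \<in> gsets G" "W \<in> gsets G"
  shows "cl W W (rst (W, \<lambda>x\<in>pts W. x, \<lambda>x\<in>pts W. x) (j ` pts S)) = cl W W (S, j, j)" "invar W (j ` pts S)"
proof -
  show i: "invar W (j ` pts S)"
    unfolding invar_def using emapsD[OF assms(1)] assms(3) by (auto simp: emapsD(2)[OF assms(1), symmetric])
  have sp: "(S, j, j) \<in> spans G r W W" using assms by (simp add: spansI emapsO_inj)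
  have "cl W W (S, j, j) = cl W W (rst (W, \<lambda>x\<in>pts W. x, \<lambda>x\<in>pts W. x) (j ` pts S))"
    using sp rst_spans[OF idspan[OF assms(4)] i] unfolding rst.simps
    by (rule cl_eqI[where f = j and f' = "inv_into (pts S) j"])
      (auto simp: assms(2) emapsD[OF assms(1)] inv_into_into f_inv_into_f)
  then show "cl W W (rst (W, \<lambda>x\<in>pts W. x, \<lambda>x\<in>pts W. x) (j ` pts S)) = cl W W (S, j, j)" by simp
qed

text \<open>The usual biproduct argument. Additivity for the identity span of the disjoint union
  writes each element as a sum of transferred restrictions (\<open>dec\<close>), while restriction
  after transfer is the identity or zero (\<open>rt\<close>). The inverse of the comparison map is
  therefore the sum of the two transfers.\<close>

lemma additive_imp_preserving: assumes M: "lin_functor M" "additive M"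
  shows "product_preserving G r M"
  unfolding product_preserving_def
proof (intro conjI ballI impI)
  fix S T assume S: "S \<in> gsets G" and T: "T \<in> gsets G"
  define W where "W = gsum G S T"
  have W: "W \<in> gsets G" using S T by (simp add: W_def)
  note iS = il_emaps(1)[OF S, of T, folded W_def] il_emaps(2)[of S]
  note iT = ir_emaps(1)[OF T, of S, folded W_def] ir_emaps(2)[of T]
  have a: "res G r S W (il S) \<in> Ar W S" "tr G r S W (il S) \<in> Ar S W" "res G r T W (ir T) \<in> Ar W T" "tr G r T W (ir T) \<in> Ar T W"
    using iS iT S T W emapsO_inj by simp_all
  have disj: "il S ` pts S \<inter> ir T ` pts T = {}" "ir T ` pts T \<inter> il S ` pts S = {}"
    by (auto simp: sum_encode_eq)
  have compl: "pts W - il S ` pts S = ir T ` pts T"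
    by (auto simp: W_def gsum_pts sum_encode_eq)
  note cl' = lin_functorD(5)[OF M(1) W S a(1)] lin_functorD(5)[OF M(1) S W a(2)] lin_functorD(5)[OF M(1) W T a(3)] lin_functorD(5)[OF M(1) T W a(4)]
  have V: "vs (fob M S)" "vs (fob M T)" "vs (fob M W)" using lin_functorD(1)[OF M(1)] S T W by auto
  have dec: "m = fmor M S W (tr G r S W (il S)) (fmor M W S (res G r S W (il S)) m) \<oplus>\<^bsub>fob M W\<^esub>
      fmor M T W (tr G r T W (ir T)) (fmor M W T (res G r T W (ir T)) m)" if m: "m \<in> carrier (fob M W)" for m
  proof -
    have "m = fmor M W W (cl W W (W, \<lambda>x\<in>pts W. x, \<lambda>x\<in>pts W. x)) m"
      using lin_functorD(3)[OF M(1) W m] by (simp add: idL_eq)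
    also have "\<dots> = fmor M W W (cl W W (S, il S, il S)) m \<oplus>\<^bsub>fob M W\<^esub> fmor M W W (cl W W (T, ir T, ir T)) m"
      using additiveD[OF M(2) W W idspan[OF W] image_span(2)[OF iS S W] m] image_span(1)[OF iS S W]
        image_span(1)[OF iT T W] unfolding compl by simp
    finally show ?thesis
      using lin_functorD(4)[OF M(1) W S W a(1,2) m] lin_functorD(4)[OF M(1) W T W a(3,4) m] tr_res_inj[OF iS S W] tr_res_inj[OF iT T W] by simp
  qed
  have rt: "fmor M W S (res G r S W (il S)) (fmor M S W (tr G r S W (il S)) y \<oplus>\<^bsub>fob M W\<^esub> fmor M T W (tr G r T W (ir T)) z) = y"
    "fmor M W T (res G r T W (ir T)) (fmor M S W (tr G r S W (il S)) y \<oplus>\<^bsub>fob M W\<^esub> fmor M T W (tr G r T W (ir T)) z) = z"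
    if y: "y \<in> carrier (fob M S)" and z: "z \<in> carrier (fob M T)" for y z
  proof -
    have 1: "fmor M W S (res G r S W (il S)) (fmor M S W (tr G r S W (il S)) y) = y"
      using lin_functorD(4)[OF M(1) S W S a(2,1) y] res_tr_inj[OF iS S W] lin_functorD(3)[OF M(1) S y] by simp
    have 2: "fmor M W T (res G r T W (ir T)) (fmor M T W (tr G r T W (ir T)) z) = z"
      using lin_functorD(4)[OF M(1) T W T a(4,3) z] res_tr_inj[OF iT T W] lin_functorD(3)[OF M(1) T z] by simp
    have 3: "fmor M W T (res G r T W (ir T)) (fmor M S W (tr G r S W (il S)) y) = \<zero>\<^bsub>fob M T\<^esub>"
      using lin_functorD(4)[OF M(1) S W T a(2,3) y] res_tr_disjoint[OF iT T W iS S disj(2)] additive_zeroL[OF M S T y] by simp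
    have 4: "fmor M W S (res G r S W (il S)) (fmor M T W (tr G r T W (ir T)) z) = \<zero>\<^bsub>fob M S\<^esub>"
      using lin_functorD(4)[OF M(1) T W S a(4,1) z] res_tr_disjoint[OF iS S W iT T disj(1)] additive_zeroL[OF M T S z] by simp
    show "fmor M W S (res G r S W (il S)) (fmor M S W (tr G r S W (il S)) y \<oplus>\<^bsub>fob M W\<^esub> fmor M T W (tr G r T W (ir T)) z) = y"
      using linmapsD(2)[OF lin_functorD(2)[OF M(1) W S a(1)] cl'(2)[OF y] cl'(4)[OF z]] 1 4 V y by simp
    show "fmor M W T (res G r T W (ir T)) (fmor M S W (tr G r S W (il S)) y \<oplus>\<^bsub>fob M W\<^esub> fmor M T W (tr G r T W (ir T)) z) = z"
      using linmapsD(2)[OF lin_functorD(2)[OF M(1) W T a(3)] cl'(2)[OF y] cl'(4)[OF z]] 2 3 V z by simp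
  qed
  show "bij_betw
          (\<lambda>x. (fmor M (gsum G S T) S (res G r S (gsum G S T) (il S)) x,
                fmor M (gsum G S T) T (res G r T (gsum G S T) (ir T)) x))
          (carrier (fob M (gsum G S T))) (carrier (fob M S) \<times> carrier (fob M T))"
    unfolding W_def[symmetric]
    by (rule bij_betw_byWitness[where f' = "\<lambda>p. fmor M S W (tr G r S W (il S)) (fst p) \<oplus>\<^bsub>fob M W\<^esub> fmor M T W (tr G r T W (ir T)) (snd p)"])
      (use rt V cl' in \<open>auto simp del: restrict_apply simp: dec[symmetric]\<close>)
next
  fix S assume S: "S \<in> gsets G" "pts S = {}"
  have "m = \<zero>\<^bsub>fob M S\<^esub>" if m: "m \<in> carrier (fob M S)" for m
    using lin_functorD(3)[OF M(1) S(1) m] additive_zeroL[OF M S(1) S(1) m] empty_spanD[OF idspan[OF S(1)] S(2)]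
    by (simp add: idL_eq)
  then show "carrier (fob M S) = {\<zero>\<^bsub>fob M S\<^esub>}" using lin_functorD(1)[OF M(1) S(1)] by auto
qed

definition mack :: "('a, 'v) mfun \<Rightarrow> bool" where
  "mack M \<longleftrightarrow> lin_functor M \<and> additive M"

lemma Mackey_obj_iff: "M \<in> obj (Mackey G r) \<longleftrightarrow> mack M"
  using preserving_imp_additive additive_imp_preserving unfolding Mackey_obj mack_def by blast

lemma mackD: assumes "mack M" shows "lin_functor M" "additive M"
  using assms by (simp_all add: mack_def)

abbreviation Hom :: "('a, 'v) mfun \<Rightarrow> ('a, 'v) mfun \<Rightarrow> ('a, 'v) mtrafo set" where
  "Hom M N \<equiv> nat_trans (Lindner G r) Vect M N"

lemma HomD: assumes "t \<in> Hom M N"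
  shows "S \<in> gsets G \<Longrightarrow> t S \<in> linmaps (fob M S) (fob N S)"
    "S \<in> gsets G \<Longrightarrow> m \<in> carrier (fob M S) \<Longrightarrow> t S m \<in> carrier (fob N S)"
    "S \<in> gsets G \<Longrightarrow> m \<in> carrier (fob M S) \<Longrightarrow> m' \<in> carrier (fob M S) \<Longrightarrow> t S (m \<oplus>\<^bsub>fob M S\<^esub> m') = t S m \<oplus>\<^bsub>fob N S\<^esub> t S m'"
    "S \<in> gsets G \<Longrightarrow> m \<in> carrier (fob M S) \<Longrightarrow> t S (q \<odot>\<^bsub>fob M S\<^esub> m) = q \<odot>\<^bsub>fob N S\<^esub> t S m"
    "S \<in> gsets G \<Longrightarrow> T \<in> gsets G \<Longrightarrow> X \<in> Ar S T \<Longrightarrow> m \<in> carrier (fob M S) \<Longrightarrow> t T (fmor M S T X m) = fmor N S T X (t S m)"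
    "t \<in> extensional (gsets G)"
proof -
  have p: "t \<in> (\<Pi>\<^sub>E X\<in>gsets G. linmaps (fob M X) (fob N X))"
    and n: "compose (carrier (fob M S)) (fmor N S T X) (t S) = compose (carrier (fob M S)) (t T) (fmor M S T X)"
    if "S \<in> gsets G" "T \<in> gsets G" "X \<in> Ar S T" for S T X
    using assms that by (auto simp: nat_trans_def)
  have p: "t \<in> (\<Pi>\<^sub>E X\<in>gsets G. linmaps (fob M X) (fob N X))"
    using assms by (auto simp: nat_trans_def)
  show l: "t S \<in> linmaps (fob M S) (fob N S)" if "S \<in> gsets G" for S using p that by auto
  show "S \<in> gsets G \<Longrightarrow> m \<in> carrier (fob M S) \<Longrightarrow> t S m \<in> carrier (fob N S)"
    "S \<in> gsets G \<Longrightarrow> m \<in> carrier (fob M S) \<Longrightarrow> m' \<in> carrier (fob M S) \<Longrightarrow> t S (m \<oplus>\<^bsub>fob M S\<^esub> m') = t S m \<oplus>\<^bsub>fob N S\<^esub> t S m'"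
    "S \<in> gsets G \<Longrightarrow> m \<in> carrier (fob M S) \<Longrightarrow> t S (q \<odot>\<^bsub>fob M S\<^esub> m) = q \<odot>\<^bsub>fob N S\<^esub> t S m"
    using linmapsD[OF l] by auto
  show "S \<in> gsets G \<Longrightarrow> T \<in> gsets G \<Longrightarrow> X \<in> Ar S T \<Longrightarrow> m \<in> carrier (fob M S) \<Longrightarrow> t T (fmor M S T X m) = fmor N S T X (t S m)"
    using fun_cong[OF n, of S T X m] by (simp add: compose_eq)
  show "t \<in> extensional (gsets G)" using p by (auto simp: PiE_def)
qed

lemma HomI: assumes "mack M"
  and "\<And>S m. S \<in> gsets G \<Longrightarrow> m \<in> carrier (fob M S) \<Longrightarrow> t S m \<in> carrier (fob N S)"
    "\<And>S m m'. S \<in> gsets G \<Longrightarrow> m \<in> carrier (fob M S) \<Longrightarrow> m' \<in> carrier (fob M S) \<Longrightarrow> t S (m \<oplus>\<^bsub>fob M S\<^esub> m') = t S m \<oplus>\<^bsub>fob N S\<^esub> t S m'"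
    "\<And>S m q. S \<in> gsets G \<Longrightarrow> m \<in> carrier (fob M S) \<Longrightarrow> t S (q \<odot>\<^bsub>fob M S\<^esub> m) = q \<odot>\<^bsub>fob N S\<^esub> t S m"
    "\<And>S T X m. S \<in> gsets G \<Longrightarrow> T \<in> gsets G \<Longrightarrow> X \<in> Ar S T \<Longrightarrow> m \<in> carrier (fob M S) \<Longrightarrow> t T (fmor M S T X m) = fmor N S T X (t S m)"
  shows "(\<lambda>S\<in>gsets G. \<lambda>m\<in>carrier (fob M S). t S m) \<in> Hom M N"
proof -
  note M = lin_functorD[OF mackD(1)[OF assms(1)]]
  have "(\<lambda>m\<in>carrier (fob M S). t S m) \<in> linmaps (fob M S) (fob N S)" if S: "S \<in> gsets G" for S
    using assms(2-4)[OF S] M(1)[OF S] by (intro linmapsI) auto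
  moreover have "compose (carrier (fob M S)) (fmor N S T X) (\<lambda>m\<in>carrier (fob M S). t S m) =
    compose (carrier (fob M S)) (\<lambda>m\<in>carrier (fob M T). t T m) (fmor M S T X)"
    if "S \<in> gsets G" "T \<in> gsets G" "X \<in> Ar S T" for S T X
    using assms(5)[OF that] M(5)[OF that] by (auto simp: compose_def fun_eq_iff)
  ultimately show ?thesis by (simp add: nat_trans_def)
qed

lemma Hom_eqI: assumes "t \<in> Hom M N" "t' \<in> Hom M N"
    "\<And>S m. S \<in> gsets G \<Longrightarrow> m \<in> carrier (fob M S) \<Longrightarrow> t S m = t' S m"
  shows "t = t'"
proof (rule extensionalityI[OF HomD(6)[OF assms(1)] HomD(6)[OF assms(2)]])
  fix S assume S: "S \<in> gsets G"
  show "t S = t' S" by (rule linmaps_eqI[OF HomD(1)[OF assms(1) S] HomD(1)[OF assms(2) S] assms(3)[OF S]])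
qed

lemma Mackey_simps [simp]: "arr (Mackey G r) M N = Hom M N"
  "ide (Mackey G r) M = (\<lambda>S\<in>gsets G. \<lambda>m\<in>carrier (fob M S). m)"
  "cmp (Mackey G r) M N P t s = (\<lambda>S\<in>gsets G. compose (carrier (fob M S)) (t S) (s S))"
  by (simp_all add: Mackey_def full_subcat_def functor_cat_def)

lemma Hom_id: "mack M \<Longrightarrow> (\<lambda>S\<in>gsets G. \<lambda>m\<in>carrier (fob M S). m) \<in> Hom M M"
  by (rule HomI) auto

lemma Hom_compose: assumes "mack M" "s \<in> Hom M N" "t \<in> Hom N P"
  shows "(\<lambda>S\<in>gsets G. compose (carrier (fob M S)) (t S) (s S)) \<in> Hom M P"
  unfolding compose_def
  by (rule HomI[OF assms(1)]) (simp_all add: HomD[OF assms(2)] HomD[OF assms(3)])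

end

text \<open>Linearity without the extensionality built into \<open>linmaps\<close>, so that plain
  lambda terms can be composed and compared without \<open>compose\<close> and
  \<open>restrict\<close>.\<close>

definition lin :: "(rat, 'v) module \<Rightarrow> (rat, 'w) module \<Rightarrow> ('v \<Rightarrow> 'w) \<Rightarrow> bool" where
  "lin V W f \<longleftrightarrow> (\<forall>x\<in>carrier V. f x \<in> carrier W) \<and>
     (\<forall>x\<in>carrier V. \<forall>y\<in>carrier V. f (x \<oplus>\<^bsub>V\<^esub> y) = f x \<oplus>\<^bsub>W\<^esub> f y) \<and>
     (\<forall>q. \<forall>x\<in>carrier V. f (q \<odot>\<^bsub>V\<^esub> x) = q \<odot>\<^bsub>W\<^esub> f x)"

lemma linD: assumes "lin V W f"
  shows "x \<in> carrier V \<Longrightarrow> f x \<in> carrier W"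
    "x \<in> carrier V \<Longrightarrow> y \<in> carrier V \<Longrightarrow> f (x \<oplus>\<^bsub>V\<^esub> y) = f x \<oplus>\<^bsub>W\<^esub> f y"
    "x \<in> carrier V \<Longrightarrow> f (q \<odot>\<^bsub>V\<^esub> x) = q \<odot>\<^bsub>W\<^esub> f x"
  using assms by (auto simp: lin_def)

lemma linmaps_lin: "f \<in> linmaps V W \<Longrightarrow> lin V W f"
  by (simp add: lin_def linmapsD)

lemma lin_comp: "lin U V f \<Longrightarrow> lin V W g \<Longrightarrow> lin U W (\<lambda>x. g (f x))"
  by (simp add: lin_def)

lemma lin_add: assumes "lin U V f" "lin U V g" "vs V" shows "lin U V (\<lambda>x. f x \<oplus>\<^bsub>V\<^esub> g x)"
  using assms by (simp add: lin_def vs_swap vs_smult)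

definition lc :: "(rat, 'v) module \<Rightarrow> ('k \<Rightarrow> rat) \<Rightarrow> ('k \<Rightarrow> 'v) \<Rightarrow> 'v" where
  "lc V a f = finsum V (\<lambda>k. a k \<odot>\<^bsub>V\<^esub> f k) {k. a k \<noteq> 0}"

lemma lc_superset:
  assumes "vs V" "finite J" "{k. a k \<noteq> 0} \<subseteq> J" "\<And>k. k \<in> J \<Longrightarrow> f k \<in> carrier V"
  shows "lc V a f = finsum V (\<lambda>k. a k \<odot>\<^bsub>V\<^esub> f k) J"
proof -
  interpret module rat_ring V by fact
  show ?thesis unfolding lc_def
    by (rule add.finprod_mono_neutral_cong_left) (use assms in auto)
qed

lemma lc_closed: assumes "vs V" "\<And>k. a k \<noteq> 0 \<Longrightarrow> f k \<in> carrier V" shows "lc V a f \<in> carrier V"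
proof -
  interpret module rat_ring V by fact
  show ?thesis unfolding lc_def by (rule finsum_closed) (use assms in auto)
qed

lemma lc_add:
  assumes V: "vs V" and fin: "finite {k. a k \<noteq> 0}" "finite {k. b k \<noteq> 0}"
    and f: "\<And>k. a k \<noteq> 0 \<or> b k \<noteq> 0 \<Longrightarrow> f k \<in> carrier V"
  shows "lc V (\<lambda>k. a k + b k) f = lc V a f \<oplus>\<^bsub>V\<^esub> lc V b f"
proof -
  interpret module rat_ring V by fact
  let ?J = "{k. a k \<noteq> 0} \<union> {k. b k \<noteq> 0}"
  have J: "finite ?J" using fin by simp
  have "lc V (\<lambda>k. a k + b k) f = finsum V (\<lambda>k. (a k + b k) \<odot>\<^bsub>V\<^esub> f k) ?J"
    by (rule lc_superset[OF V J]) (use f in auto)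
  also have "\<dots> = finsum V (\<lambda>k. a k \<odot>\<^bsub>V\<^esub> f k \<oplus>\<^bsub>V\<^esub> b k \<odot>\<^bsub>V\<^esub> f k) ?J"
    by (rule finsum_cong') (use f V in \<open>auto simp: vs_smult(1)\<close>)
  also have "\<dots> = finsum V (\<lambda>k. a k \<odot>\<^bsub>V\<^esub> f k) ?J \<oplus>\<^bsub>V\<^esub> finsum V (\<lambda>k. b k \<odot>\<^bsub>V\<^esub> f k) ?J"
    by (rule finsum_addf) (use f V in auto)
  also have "finsum V (\<lambda>k. a k \<odot>\<^bsub>V\<^esub> f k) ?J = lc V a f"
    by (rule lc_superset[symmetric, OF V J]) (use f in auto)
  also have "finsum V (\<lambda>k. b k \<odot>\<^bsub>V\<^esub> f k) ?J = lc V b f"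
    by (rule lc_superset[symmetric, OF V J]) (use f in auto)
  finally show ?thesis .
qed

lemma lc_smult:
  assumes V: "vs V" and fin: "finite {k. a k \<noteq> 0}" and f: "\<And>k. a k \<noteq> 0 \<Longrightarrow> f k \<in> carrier V"
  shows "lc V (\<lambda>k. q * a k) f = q \<odot>\<^bsub>V\<^esub> lc V a f"
proof -
  interpret module rat_ring V by fact
  have "lc V (\<lambda>k. q * a k) f = finsum V (\<lambda>k. (q * a k) \<odot>\<^bsub>V\<^esub> f k) {k. a k \<noteq> 0}"
    by (rule lc_superset[OF V fin]) (use f in auto)
  also have "\<dots> = finsum V (\<lambda>k. q \<odot>\<^bsub>V\<^esub> (a k \<odot>\<^bsub>V\<^esub> f k)) {k. a k \<noteq> 0}"
    by (rule finsum_cong') (use f V in \<open>auto simp: vs_smult(3)\<close>)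
  also have "\<dots> = q \<odot>\<^bsub>V\<^esub> lc V a f" unfolding lc_def
    by (rule finsum_smult_ldistr[symmetric]) (use fin f V in auto)
  finally show ?thesis .
qed

lemma lc_delta: assumes V: "vs V" and f: "f k \<in> carrier V"
  shows "lc V (\<lambda>k'. if k' = k then 1 else 0) f = f k"
proof -
  interpret module rat_ring V by fact
  have "lc V (\<lambda>k'. if k' = k then 1 else 0) f = finsum V (\<lambda>k'. (if k' = k then 1 else 0) \<odot>\<^bsub>V\<^esub> f k') {k}"
    by (rule lc_superset[OF V]) (use f in auto)
  then show ?thesis using f V by (simp add: finsum_insert)
qed

context transfer_group
begin

subsection \<open>Orbits and the induction principle for spans\<close>

definition trans_gset :: "'a gset \<Rightarrow> bool" where
  "trans_gset U \<longleftrightarrow> pts U \<noteq> {} \<and> (\<forall>x\<in>pts U. \<forall>y\<in>pts U. \<exists>g\<in>carrier G. act U g x = y)"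

abbreviation orb :: "'a gset \<Rightarrow> nat \<Rightarrow> nat set" where "orb U x \<equiv> orbit G (act U) x"
abbreviation orbs :: "'a gset \<Rightarrow> nat set set" where "orbs U \<equiv> orbits G (pts U) (act U)"

lemma orb_self: "U \<in> gsets G \<Longrightarrow> x \<in> pts U \<Longrightarrow> x \<in> orb U x"
  unfolding orbit_def by (auto intro: exI[of _ \<one>])

lemma orb_invar: "U \<in> gsets G \<Longrightarrow> x \<in> pts U \<Longrightarrow> invar U (orb U x)"
  unfolding orbit_def invar_def by (auto simp: act_mult[symmetric])

lemma orbs_mem: "B \<in> orbs U \<longleftrightarrow> (\<exists>x\<in>pts U. B = orb U x)"
  unfolding orbits_def by auto

lemma orbs_invar: "U \<in> gsets G \<Longrightarrow> B \<in> orbs U \<Longrightarrow> invar U B"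
  using orb_invar unfolding orbs_mem by auto

lemma orb_trans: assumes U: "U \<in> gsets G" and x: "x \<in> pts U" shows "trans_gset (gsub G U (orb U x))"
  unfolding trans_gset_def
proof (intro conjI ballI)
  show "pts (gsub G U (orb U x)) \<noteq> {}" using orb_self[OF U x] by auto
  fix y z assume "y \<in> pts (gsub G U (orb U x))" "z \<in> pts (gsub G U (orb U x))"
  then obtain g h where g: "g \<in> carrier G" "y = act U g x" "h \<in> carrier G" "z = act U h x" "y \<in> orb U x"
    by (auto simp: orbit_def)
  then have "act U (h \<otimes> inv g) y = z" using U x by (simp add: act_mult)
  then show "\<exists>g\<in>carrier G. act (gsub G U (orb U x)) g y = z" using g by (intro bexI[of _ "h \<otimes> inv g"]) auto
qed

lemma orb_subset_invar: "invar U B \<Longrightarrow> x \<in> B \<Longrightarrow> orb U x \<subseteq> B"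
  unfolding orbit_def by (auto simp: invar_act)

lemma trans_invar: assumes "trans_gset U" "invar U B" "B \<noteq> {}" shows "B = pts U"
proof -
  obtain x where x: "x \<in> B" "x \<in> pts U" using assms(2,3) invar_subset by blast
  have "y \<in> B" if "y \<in> pts U" for y
    using assms(1) x that invar_act[OF assms(2) _ x(1)] unfolding trans_gset_def by metis
  then show ?thesis using invar_subset[OF assms(2)] by auto
qed

lemma trans_cong: assumes "f \<in> emaps G U V" "f ` pts U = pts V" "trans_gset U" shows "trans_gset V"
proof -
  have "\<exists>g\<in>carrier G. act V g x = y" if xy: "x \<in> pts V" "y \<in> pts V" for x y
  proof -
    obtain u v where uv: "u \<in> pts U" "v \<in> pts U" "x = f u" "y = f v" using xy assms(2) by blast
    then obtain g where "g \<in> carrier G" "act U g u = v" using assms(3) unfolding trans_gset_def by blast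
    then show ?thesis using uv emapsD(2)[OF assms(1)] by (metis)
  qed
  then show ?thesis using assms unfolding trans_gset_def by auto
qed

text \<open>Strong induction on the number of points of the apex: if it is neither empty nor
  transitive, one orbit and its complement are both strictly smaller.\<close>

lemma spans_induct [consumes 1, case_names empty trans split]:
  assumes "(U, l, h) \<in> spans G r S T"
    and e: "\<And>U l h. (U, l, h) \<in> spans G r S T \<Longrightarrow> pts U = {} \<Longrightarrow> P (U, l, h)"
    and t: "\<And>U l h. (U, l, h) \<in> spans G r S T \<Longrightarrow> trans_gset U \<Longrightarrow> P (U, l, h)"
    and s: "\<And>U l h B. (U, l, h) \<in> spans G r S T \<Longrightarrow> invar U B \<Longrightarrow> P (rst (U, l, h) B) \<Longrightarrow>
      P (rst (U, l, h) (pts U - B)) \<Longrightarrow> P (U, l, h)"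
  shows "P (U, l, h)"
  using assms(1)
proof (induction "card (pts U)" arbitrary: U l h rule: less_induct)
  case less
  note U = spansD(1)[OF less.prems]
  show ?case
  proof (cases "pts U = {} \<or> trans_gset U")
    case True then show ?thesis using e t less.prems by blast
  next
    case False
    then obtain x where x: "x \<in> pts U" by blast
    define B where "B = orb U x"
    have B: "invar U B" unfolding B_def by (rule orb_invar[OF U x])
    have C: "invar U (pts U - B)" by (rule invar_compl[OF U B])
    have "B \<noteq> pts U"
    proof
      assume "B = pts U"
      then have "gsub G U B = U" by (intro gset_eqI gsub_gset U B) auto
      then show False using orb_trans[OF U x] False unfolding B_def by simp
    qed
    then have "B \<subset> pts U" using invar_subset[OF B] by auto
    then have "card B < card (pts U)" by (intro psubset_card_mono) (use U in auto)
    moreover have "card (pts U - B) < card (pts U)"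
      using orb_self[OF U x] x U unfolding B_def by (intro psubset_card_mono) auto
    ultimately show ?thesis
      using less.hyps[of "gsub G U B" "restrict l B" "restrict h B"] less.hyps[of "gsub G U (pts U - B)" "restrict l (pts U - B)" "restrict h (pts U - B)"]
        rst_spans[OF less.prems B] rst_spans[OF less.prems C]
      by (intro s[OF less.prems B]) auto
  qed
qed

subsection \<open>Orbit decomposition\<close>

abbreviation pt where "pt \<equiv> gpt G"
abbreviation Om where "Om S \<equiv> orbit_classes G r S"

lemma transitive_action_iff: "U \<in> gsets G \<Longrightarrow> transitive_action G (pts U) (act U) \<and> pts U \<noteq> {} \<longleftrightarrow> trans_gset U"
  unfolding transitive_action_def transitive_action_axioms_def trans_gset_def using gset_action by blast

lemma Om_cl: assumes "(U, l, h) \<in> spans G r pt S" shows "cl pt S (U, l, h) \<in> Om S \<longleftrightarrow> trans_gset U"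
proof
  assume "cl pt S (U, l, h) \<in> Om S"
  then show "trans_gset U" using cl_self[OF assms] transitive_action_iff spansD(1)[OF assms]
    unfolding orbit_classes_def by blast
next
  assume t: "trans_gset U"
  have "trans_gset V" if "(V, k, m) \<in> cl pt S (U, l, h)" for V k m
  proof -
    have "((U, l, h), (V, k, m)) \<in> span_rel G r pt S" using that by simp
    then obtain f where "f \<in> emaps G U V" "bij_betw f (pts U) (pts V)" by (rule span_relE)
    then show ?thesis using trans_cong t by (auto simp: bij_betw_def)
  qed
  moreover have "V \<in> gsets G" if "(V, k, m) \<in> cl pt S (U, l, h)" for V k m
    using that span_rel_spans spansD(1) by blast
  ultimately have "transitive_action G (pts V) (act V) \<and> pts V \<noteq> {}" if "(V, k, m) \<in> cl pt S (U, l, h)" for V k m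
    using that transitive_action_iff by blast
  then show "cl pt S (U, l, h) \<in> Om S"
    using cl_arr[OF assms] unfolding orbit_classes_def by blast
qed

lemma OmE: assumes "\<kappa> \<in> Om S" obtains U l h where "(U, l, h) \<in> spans G r pt S" "\<kappa> = cl pt S (U, l, h)" "trans_gset U"
proof -
  have "\<kappa> \<in> Ar pt S" using assms by (simp add: orbit_classes_def)
  then obtain U l h where *: "(U, l, h) \<in> spans G r pt S" "\<kappa> = cl pt S (U, l, h)" by (rule arrE)
  then show ?thesis using that assms Om_cl by blast
qed

lemma Om_arr [simp]: "\<kappa> \<in> Om S \<Longrightarrow> \<kappa> \<in> Ar pt S"
  by (simp add: orbit_classes_def)

text \<open>The multiplicities counted on a given representative. \<open>orbit_decomp\<close> counts
  on one picked by \<open>SOME\<close>; \<open>od_rel\<close> and \<open>orbit_decomp_cl\<close>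
  make the two agree.\<close>

definition od :: "'a gset \<Rightarrow> 'a span \<Rightarrow> 'a span set \<Rightarrow> nat" where
  "od S \<sigma> \<kappa> = card {B \<in> orbs (fst \<sigma>). cl pt S (rst \<sigma> B) = \<kappa>}"

text \<open>An isomorphism of spans carries orbits to orbits and restricts to an isomorphism between
  the corresponding restricted spans.\<close>

lemma od_rel: assumes "((U, l, h), (U', l', h')) \<in> span_rel G r pt S"
  shows "od S (U, l, h) \<kappa> = od S (U', l', h') \<kappa>"
proof -
  obtain f f' where f: "f \<in> emaps G U U'" "f' \<in> emaps G U' U"
    "\<And>u. u \<in> pts U \<Longrightarrow> f' (f u) = u" "\<And>u. u \<in> pts U' \<Longrightarrow> f (f' u) = u"
    "\<And>u. u \<in> pts U \<Longrightarrow> l' (f u) = l u" "\<And>u. u \<in> pts U \<Longrightarrow> h' (f u) = h u"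
    "\<And>u. u \<in> pts U' \<Longrightarrow> l (f' u) = l' u" "\<And>u. u \<in> pts U' \<Longrightarrow> h (f' u) = h' u"
    "(U, l, h) \<in> spans G r pt S" "(U', l', h') \<in> spans G r pt S"
    using span_relE2[OF assms] by blast
  note U = spansD(1)[OF f(9)] and U' = spansD(1)[OF f(10)]
  have im: "k ` orb V x = orb W (k x)" if "k \<in> emaps G V W" "x \<in> pts V" for k V W x
    unfolding orbit_def using emapsD(2)[OF that(1) _ that(2)] by force
  have cleq: "cl pt S (rst (U, l, h) B) = cl pt S (rst (U', l', h') (f ` B))" if B: "invar U B" for B
  proof -
    have sub: "b \<in> pts U" if "b \<in> B" for b using invar_subset[OF B] that by auto
    have B': "invar U' (f ` B)" unfolding invar_def
      using emapsD[OF f(1)] sub invar_act[OF B] by (auto simp: emapsD(2)[OF f(1), symmetric])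
    show ?thesis using rst_spans[OF f(9) B] rst_spans[OF f(10) B'] unfolding rst.simps
      by (rule cl_eqI[where f = f and f' = f'])
        (auto simp: sub f(3-6) emapsD(2)[OF f(1)])
  qed
  have oi: "f ` B \<in> orbs U'" if "B \<in> orbs U" for B
    using that im[OF f(1)] emapsD(1)[OF f(1)] unfolding orbs_mem by metis
  have oi': "f' ` B \<in> orbs U" if "B \<in> orbs U'" for B
    using that im[OF f(2)] emapsD(1)[OF f(2)] unfolding orbs_mem by metis
  have ff: "f' ` f ` B = B" if "B \<subseteq> pts U" for B
    using that f(3) by (force simp: image_image)
  have ff': "f ` f' ` B = B" if "B \<subseteq> pts U'" for B
    using that f(4) by (force simp: image_image)
  have "bij_betw (image f) {B \<in> orbs U. cl pt S (rst (U, l, h) B) = \<kappa>} {B \<in> orbs U'. cl pt S (rst (U', l', h') B) = \<kappa>}"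
  proof (rule bij_betw_byWitness[where f' = "image f'"])
    show "\<forall>B\<in>{B \<in> orbs U. cl pt S (rst (U, l, h) B) = \<kappa>}. f' ` f ` B = B"
      using ff invar_subset[OF orbs_invar[OF U]] by blast
    show "\<forall>B\<in>{B \<in> orbs U'. cl pt S (rst (U', l', h') B) = \<kappa>}. f ` f' ` B = B"
      using ff' invar_subset[OF orbs_invar[OF U']] by blast
    show "image f ` {B \<in> orbs U. cl pt S (rst (U, l, h) B) = \<kappa>} \<subseteq> {B \<in> orbs U'. cl pt S (rst (U', l', h') B) = \<kappa>}"
    proof (rule image_subsetI)
      fix B assume "B \<in> {B \<in> orbs U. cl pt S (rst (U, l, h) B) = \<kappa>}"
      then have B: "B \<in> orbs U" "cl pt S (rst (U, l, h) B) = \<kappa>" by blast+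
      then have "cl pt S (rst (U', l', h') (f ` B)) = \<kappa>" using cleq[OF orbs_invar[OF U B(1)]] by metis
      then show "f ` B \<in> {B \<in> orbs U'. cl pt S (rst (U', l', h') B) = \<kappa>}" using oi[OF B(1)] by blast
    qed
    have "cl pt S (rst (U, l, h) (f' ` B)) = cl pt S (rst (U', l', h') B)" if B: "B \<in> orbs U'" for B
      using cleq[OF orbs_invar[OF U oi'[OF B]]] ff'[OF invar_subset[OF orbs_invar[OF U' B]]] by metis
    then show "image f' ` {B \<in> orbs U'. cl pt S (rst (U', l', h') B) = \<kappa>} \<subseteq> {B \<in> orbs U. cl pt S (rst (U, l, h) B) = \<kappa>}"
      using oi' by blast
  qed
  then show ?thesis unfolding od_def fst_conv by (rule bij_betw_same_card)
qed

lemma orbit_decomp_cl: assumes "(U, l, h) \<in> spans G r pt S"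
  shows "orbit_decomp G r S (cl pt S (U, l, h)) = (\<lambda>\<kappa>. of_nat (od S (U, l, h) \<kappa>))"
proof -
  obtain U' l' h' where e: "(SOME \<sigma>. \<sigma> \<in> cl pt S (U, l, h)) = (U', l', h')" by (metis prod_cases3)
  have "(U', l', h') \<in> cl pt S (U, l, h)" using someI_ex[of "\<lambda>\<sigma>. \<sigma> \<in> cl pt S (U, l, h)"] cl_self[OF assms] e by metis
  then have "((U, l, h), (U', l', h')) \<in> span_rel G r pt S" by simp
  then have "od S (U, l, h) \<kappa> = od S (U', l', h') \<kappa>" for \<kappa> by (rule od_rel)
  then show ?thesis unfolding orbit_decomp_def e by (simp add: od_def)
qed

lemma finite_orbs: "U \<in> gsets G \<Longrightarrow> finite (orbs U)"
  unfolding orbits_def by simp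

lemma od_Om: assumes "(U, l, h) \<in> spans G r pt S" "od S (U, l, h) \<kappa> \<noteq> 0" 
  shows "\<kappa> \<in> (\<lambda>B. cl pt S (rst (U, l, h) B)) ` orbs U" "\<kappa> \<in> Om S"
proof -
  note U = spansD(1)[OF assms(1)]
  have "{B \<in> orbs U. cl pt S (rst (U, l, h) B) = \<kappa>} \<noteq> {}" using assms(2) unfolding od_def fst_conv by (metis card.empty)
  then obtain B where B: "B \<in> orbs U" "cl pt S (rst (U, l, h) B) = \<kappa>" by blast
  then show "\<kappa> \<in> (\<lambda>B. cl pt S (rst (U, l, h) B)) ` orbs U" by blast
  have "trans_gset (gsub G U B)" using B(1) orb_trans[OF U] unfolding orbs_mem by auto
  then show "\<kappa> \<in> Om S" using Om_cl[of "gsub G U B" "restrict l B" "restrict h B" S] rst_spans[OF assms(1) orbs_invar[OF U B(1)]] B(2) by simp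
qed

lemma rst_rst: assumes "(U, l, h) \<in> spans G r S T" "invar U B" "invar U C" "C \<subseteq> B"
  shows "rst (rst (U, l, h) B) C = rst (U, l, h) C"
proof -
  note U = spansD(1)[OF assms(1)]
  have "invar (gsub G U B) C" using assms(3,4) by (auto simp: invar_def subset_iff)
  then have "gsub G (gsub G U B) C = gsub G U C"
    using assms by (intro gset_eqI gsub_gset) (auto simp: U)
  moreover have "B \<inter> C = C" using assms(4) by auto
  ultimately show ?thesis by simp
qed

text \<open>Each orbit lies entirely in \<open>B\<close> or entirely in the complement, and orbits
  of an invariant subset are orbits of the whole G-set.\<close>

lemma od_split: assumes "(U, l, h) \<in> spans G r pt S" "invar U B"
  shows "od S (U, l, h) \<kappa> = od S (rst (U, l, h) B) \<kappa> + od S (rst (U, l, h) (pts U - B)) \<kappa>"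
proof -
  note U = spansD(1)[OF assms(1)]
  have C: "invar U (pts U - B)" by (rule invar_compl[OF U assms(2)])
  have o: "orbs (gsub G U D) = {Q \<in> orbs U. Q \<subseteq> D}" if D: "invar U D" for D
  proof -
    have e: "orb (gsub G U D) x = orb U x" if "x \<in> D" for x
      unfolding orbit_def by (rule Collect_cong) (use that gsub_simps(2) in metis)
    have "x \<in> pts U" if "x \<in> D" for x using that invar_subset[OF D] by auto
    moreover have "x \<in> D" if "x \<in> pts U" "orb U x \<subseteq> D" for x using orb_self[OF U that(1)] that(2) by auto
    ultimately have 1: "orb U x \<in> {Q \<in> orbs U. Q \<subseteq> D} \<longleftrightarrow> x \<in> D" if "x \<in> pts U" for x
      using orb_subset_invar[OF D] that unfolding orbs_mem by blast
    have 2: "pts (gsub G U D) \<subseteq> pts U" using invar_subset[OF D] by simp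
    show ?thesis
    proof (intro equalityI subsetI)
      fix Q assume "Q \<in> orbs (gsub G U D)"
      then obtain x where "x \<in> D" "Q = orb (gsub G U D) x" unfolding orbs_mem by auto
      then show "Q \<in> {Q \<in> orbs U. Q \<subseteq> D}" using 1 2 e by auto
    next
      fix Q assume Q: "Q \<in> {Q \<in> orbs U. Q \<subseteq> D}"
      then obtain x where x: "x \<in> pts U" "Q = orb U x" unfolding orbs_mem by auto
      then have "x \<in> D" using 1 Q by auto
      then show "Q \<in> orbs (gsub G U D)" using x e unfolding orbs_mem by auto
    qed
  qed
  have od: "od S (rst (U, l, h) D) \<kappa> = card {Q \<in> orbs U. Q \<subseteq> D \<and> cl pt S (rst (U, l, h) Q) = \<kappa>}" if D: "invar U D" for D
  proof -
    have "{Q \<in> orbs (gsub G U D). cl pt S (rst (rst (U, l, h) D) Q) = \<kappa>} = {Q \<in> orbs U. Q \<subseteq> D \<and> cl pt S (rst (U, l, h) Q) = \<kappa>}"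
      using rst_rst[OF assms(1) D orbs_invar[OF U]] unfolding o[OF D] by (auto simp del: rst.simps)
    then show ?thesis unfolding od_def by simp
  qed
  have "{Q \<in> orbs U. cl pt S (rst (U, l, h) Q) = \<kappa>} = {Q \<in> orbs U. Q \<subseteq> B \<and> cl pt S (rst (U, l, h) Q) = \<kappa>} \<union>
     {Q \<in> orbs U. Q \<subseteq> pts U - B \<and> cl pt S (rst (U, l, h) Q) = \<kappa>}"
  proof -
    have "Q \<subseteq> B \<or> Q \<subseteq> pts U - B" if "Q \<in> orbs U" for Q
      using that orb_subset_invar[OF assms(2)] orb_subset_invar[OF C] unfolding orbs_mem by blast
    then show ?thesis by blast
  qed
  moreover have "{Q \<in> orbs U. Q \<subseteq> B \<and> cl pt S (rst (U, l, h) Q) = \<kappa>} \<inter>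
     {Q \<in> orbs U. Q \<subseteq> pts U - B \<and> cl pt S (rst (U, l, h) Q) = \<kappa>} = {}"
    using orb_self[OF U] unfolding orbs_mem by blast
  ultimately show ?thesis
    unfolding od[OF assms(2)] od[OF C] using finite_orbs[OF U] by (simp add: od_def card_Un_disjoint)
qed

lemma od_trans: assumes "(U, l, h) \<in> spans G r pt S" "trans_gset U"
  shows "od S (U, l, h) \<kappa> = (if \<kappa> = cl pt S (U, l, h) then 1 else 0)"
proof -
  note s = spansD[OF assms(1)]
  have 1: "Q = pts U" if "Q \<in> orbs U" for Q
    using trans_invar[OF assms(2) orbs_invar[OF s(1) that]] orb_self[OF s(1)] that unfolding orbs_mem by blast
  obtain x where "x \<in> pts U" using assms(2) unfolding trans_gset_def by blast
  then have "orb U x \<in> orbs U" unfolding orbs_mem by blast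
  then have "pts U \<in> orbs U" using 1[of "orb U x"] by simp
  then have "orbs U = {pts U}" using 1 by (intro equalityI subsetI) simp_all
  moreover have "rst (U, l, h) (pts U) = (U, l, h)"
  proof -
    have "gsub G U (pts U) = U" by (intro gset_eqI gsub_gset s invar_whole) auto
    moreover have "restrict l (pts U) = l" "restrict h (pts U) = h"
      using emapsD(3)[OF s(2)] emapsD(3)[OF s(3)] by (auto simp: fun_eq_iff extensional_def restrict_def)
    ultimately show ?thesis by simp
  qed
  ultimately have "{B \<in> orbs U. cl pt S (rst (U, l, h) B) = \<kappa>} = (if \<kappa> = cl pt S (U, l, h) then {pts U} else {})"
    by (auto simp del: rst.simps)
  then show ?thesis by (simp add: od_def)
qed

lemma od_empty: "pts U = {} \<Longrightarrow> od S (U, l, h) \<kappa> = 0"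
  by (simp add: od_def orbits_def)

subsection \<open>The Burnside functor and the Yoneda lemma\<close>

definition delta :: "'a span set \<Rightarrow> ('a, 'u) val" where
  "delta \<kappa> = Inl (\<lambda>\<kappa>'. if \<kappa>' = \<kappa> then 1 else 0)"

text \<open>The class in the Burnside group of an arbitrary finite G-set over \<open>S\<close>, read
  as a span from the point. On a single orbit it is the basis vector \<open>delta\<close>
  (\<open>bel_Om\<close>).\<close>

definition bel :: "'a gset \<Rightarrow> 'a span set \<Rightarrow> ('a, 'u) val" where
  "bel S Y = Inl (orbit_decomp G r S Y)"

abbreviation A :: "('a, ('a, 'u) val) mfun" where "A \<equiv> Burnside G r"
abbreviation bob :: "'a gset \<Rightarrow> (rat, ('a, 'u) val) module" where "bob \<equiv> burnside_ob G r"

lemma fob_A [simp]: "fob A S = bob S"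
  by (simp add: Burnside_def)

lemma bob_simps [simp]:
  "x \<oplus>\<^bsub>bob S\<^esub> y = Inl (\<lambda>\<kappa>. projl x \<kappa> + projl y \<kappa>)"
  "q \<odot>\<^bsub>bob S\<^esub> x = Inl (\<lambda>\<kappa>. q * projl x \<kappa>)"
  "\<zero>\<^bsub>bob S\<^esub> = Inl (\<lambda>\<kappa>. 0)"
  by (simp_all add: burnside_ob_def)

lemma bob_carrier: "Inl c \<in> carrier (bob S) \<longleftrightarrow> finite {\<kappa>. c \<kappa> \<noteq> 0} \<and> {\<kappa>. c \<kappa> \<noteq> 0} \<subseteq> Om S"
  by (auto simp: burnside_ob_def)

lemma bobE: assumes "x \<in> carrier (bob S)"
  obtains c where "x = Inl c" "finite {\<kappa>. c \<kappa> \<noteq> 0}" "{\<kappa>. c \<kappa> \<noteq> 0} \<subseteq> Om S"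
  using assms by (auto simp: burnside_ob_def)

lemma finite_supp_add: "finite {k. a k \<noteq> (0::rat)} \<Longrightarrow> finite {k. b k \<noteq> 0} \<Longrightarrow> finite {k. a k + b k \<noteq> 0}"
  by (rule finite_subset[of _ "{k. a k \<noteq> 0} \<union> {k. b k \<noteq> 0}"]) auto

lemma vs_bob [simp]: "vs (bob S :: (rat, ('a, 'u) val) module)"
proof (rule vsI)
  fix x y :: "('a, 'u) val" assume x: "x \<in> carrier (bob S)" and y: "y \<in> carrier (bob S)"
  obtain c where c: "x = Inl c" "finite {\<kappa>. c \<kappa> \<noteq> 0}" "{\<kappa>. c \<kappa> \<noteq> 0} \<subseteq> Om S" using x by (rule bobE)
  obtain d where d: "y = Inl d" "finite {\<kappa>. d \<kappa> \<noteq> 0}" "{\<kappa>. d \<kappa> \<noteq> 0} \<subseteq> Om S" using y by (rule bobE)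
  have "{\<kappa>. c \<kappa> + d \<kappa> \<noteq> 0} \<subseteq> {\<kappa>. c \<kappa> \<noteq> 0} \<union> {\<kappa>. d \<kappa> \<noteq> 0}" by auto
  then show "x \<oplus>\<^bsub>bob S\<^esub> y \<in> carrier (bob S)"
    using c d finite_supp_add[OF c(2) d(2)] by (auto simp: bob_carrier)
next
  fix x :: "('a, 'u) val" and q assume x: "x \<in> carrier (bob S)"
  obtain c where c: "x = Inl c" "finite {\<kappa>. c \<kappa> \<noteq> 0}" "{\<kappa>. c \<kappa> \<noteq> 0} \<subseteq> Om S" using x by (rule bobE)
  show "q \<odot>\<^bsub>bob S\<^esub> x \<in> carrier (bob S)" using c by (cases "q = 0") (auto simp: bob_carrier)
qed (auto simp: bob_carrier algebra_simps elim: bobE)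

lemma delta_bob [simp]: "\<kappa> \<in> Om S \<Longrightarrow> delta \<kappa> \<in> carrier (bob S)"
  by (auto simp: delta_def bob_carrier)

lemma bob_induct [consumes 1, case_names zero add]:
  assumes "x \<in> carrier (bob S)" and z: "P \<zero>\<^bsub>bob S\<^esub>"
    and step: "\<And>x q \<kappa>. x \<in> carrier (bob S) \<Longrightarrow> \<kappa> \<in> Om S \<Longrightarrow> P x \<Longrightarrow> P (x \<oplus>\<^bsub>bob S\<^esub> (q \<odot>\<^bsub>bob S\<^esub> delta \<kappa>))"
  shows "P x"
proof -
  obtain c where c: "x = Inl c" "finite {\<kappa>. c \<kappa> \<noteq> 0}" "{\<kappa>. c \<kappa> \<noteq> 0} \<subseteq> Om S" using assms(1) by (rule bobE)
  have "P (Inl c)" if "finite J" "J = {\<kappa>. c \<kappa> \<noteq> 0}" "J \<subseteq> Om S" for J c using that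
  proof (induction J arbitrary: c rule: finite_induct)
    case empty
    then have "c = (\<lambda>\<kappa>. 0)" by auto
    then show ?case using z by simp
  next
    case (insert k J)
    define c' where "c' = c(k := 0)"
    have J: "J = {\<kappa>. c' \<kappa> \<noteq> 0}" using insert.prems(1) insert.hyps(2) unfolding c'_def by auto
    have "P (Inl c')" using insert.IH[OF J] insert.prems by auto
    moreover have "Inl c' \<in> carrier (bob S)" using J insert by (auto simp: bob_carrier)
    ultimately have "P (Inl c' \<oplus>\<^bsub>bob S\<^esub> (c k \<odot>\<^bsub>bob S\<^esub> delta k))" using insert.prems by (intro step) auto
    moreover have "Inl c' \<oplus>\<^bsub>bob S\<^esub> (c k \<odot>\<^bsub>bob S\<^esub> delta k) = Inl c" by (auto simp: delta_def c'_def fun_eq_iff)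
    ultimately show ?case by metis
  qed
  then show ?thesis using c by simp
qed

lemma lin_zero: assumes "lin V W f" "vs V" "vs W" shows "f \<zero>\<^bsub>V\<^esub> = \<zero>\<^bsub>W\<^esub>"
proof -
  have "f (0 \<odot>\<^bsub>V\<^esub> \<zero>\<^bsub>V\<^esub>) = 0 \<odot>\<^bsub>W\<^esub> f \<zero>\<^bsub>V\<^esub>" by (rule linD(3)[OF assms(1)]) (simp add: assms)
  then show ?thesis using assms linD(1)[OF assms(1)] by simp
qed

text \<open>The main reduction: an identity that is linear in an element of \<open>A(S)\<close>
  needs checking on single orbits only, where it turns into a statement about spans.\<close>

lemma bob_lin_eqI:
  assumes "lin (bob S) V f" "lin (bob S) V g" "vs V" "\<And>\<kappa>. \<kappa> \<in> Om S \<Longrightarrow> f (delta \<kappa>) = g (delta \<kappa>)" "a \<in> carrier (bob S)"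
  shows "f a = g a"
  using assms(5)
proof (induction rule: bob_induct)
  case zero
  show ?case unfolding lin_zero[OF assms(1) vs_bob assms(3)] lin_zero[OF assms(2) vs_bob assms(3)] ..
next
  case (add x q \<kappa>)
  then have *: "delta \<kappa> \<in> carrier (bob S)" "q \<odot>\<^bsub>bob S\<^esub> delta \<kappa> \<in> carrier (bob S)"
    using delta_bob vs_simps(3)[OF vs_bob] by blast+
  show ?case
    unfolding linD(2)[OF assms(1) add(1) *(2)] linD(2)[OF assms(2) add(1) *(2)]
      linD(3)[OF assms(1) *(1)] linD(3)[OF assms(2) *(1)] add(3) assms(4)[OF add(2)] ..
qed

lemma bel_cl: "(U, l, h) \<in> spans G r pt S \<Longrightarrow> bel S (cl pt S (U, l, h)) = Inl (\<lambda>\<kappa>. of_nat (od S (U, l, h) \<kappa>))"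
  by (simp add: bel_def orbit_decomp_cl)

lemma bel_bob [simp]: assumes "Y \<in> Ar pt S" shows "bel S Y \<in> carrier (bob S)"
proof -
  obtain U l h where Y: "(U, l, h) \<in> spans G r pt S" "Y = cl pt S (U, l, h)" using arrE[OF assms] .
  note U = spansD(1)[OF Y(1)]
  have "{\<kappa>. od S (U, l, h) \<kappa> \<noteq> 0} \<subseteq> (\<lambda>B. cl pt S (rst (U, l, h) B)) ` orbs U" using od_Om(1)[OF Y(1)] by blast
  then have "finite {\<kappa>. od S (U, l, h) \<kappa> \<noteq> 0}" using finite_orbs[OF U] by (rule finite_subset[OF _ finite_imageI])
  moreover have "{\<kappa>. od S (U, l, h) \<kappa> \<noteq> 0} \<subseteq> Om S" using od_Om(2)[OF Y(1)] by blast
  ultimately show ?thesis unfolding Y(2) bel_cl[OF Y(1)] bob_carrier by simp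
qed

lemma bel_Om: assumes "\<kappa> \<in> Om S" shows "bel S \<kappa> = delta \<kappa>"
proof -
  obtain U l h where k: "(U, l, h) \<in> spans G r pt S" "\<kappa> = cl pt S (U, l, h)" "trans_gset U" using assms by (rule OmE)
  show ?thesis unfolding k(2) bel_cl[OF k(1)] delta_def by (auto simp: od_trans[OF k(1,3)] fun_eq_iff)
qed

lemma bel_split: assumes "(U, l, h) \<in> spans G r pt S" "invar U B"
  shows "bel S (cl pt S (U, l, h)) = bel S (cl pt S (rst (U, l, h) B)) \<oplus>\<^bsub>bob S\<^esub> bel S (cl pt S (rst (U, l, h) (pts U - B)))"
proof -
  have C: "invar U (pts U - B)" by (rule invar_compl[OF spansD(1)[OF assms(1)] assms(2)])
  show ?thesis using rst_spans[OF assms] rst_spans[OF assms(1) C] bel_cl[OF assms(1)] od_split[OF assms]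
    by (simp add: bel_cl)
qed

lemma bel_empty: "(U, l, h) \<in> spans G r pt S \<Longrightarrow> pts U = {} \<Longrightarrow> bel S (cl pt S (U, l, h)) = \<zero>\<^bsub>bob S\<^esub>"
  by (simp add: bel_cl od_empty)

text \<open>A function of spans that is additive under splitting is determined by its values on
  orbits, by \<open>spans_induct\<close>. This carries formulas known on \<open>delta\<close> over
  to composites of orbits with spans, whose apex need not be transitive.\<close>

lemma lin_bel:
  assumes f: "lin (bob S) V f" and V: "vs V" and g: "\<And>Y. Y \<in> Ar pt S \<Longrightarrow> g Y \<in> carrier V"
    and d: "\<And>\<kappa>. \<kappa> \<in> Om S \<Longrightarrow> f (delta \<kappa>) = g \<kappa>"
    and s: "\<And>U l h B. (U, l, h) \<in> spans G r pt S \<Longrightarrow> invar U B \<Longrightarrow>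
      g (cl pt S (U, l, h)) = g (cl pt S (rst (U, l, h) B)) \<oplus>\<^bsub>V\<^esub> g (cl pt S (rst (U, l, h) (pts U - B)))"
    and Y: "Y \<in> Ar pt S"
  shows "f (bel S Y) = g Y"
proof -
  have *: "f (bel S (cl pt S \<sigma>)) = g (cl pt S \<sigma>)" if "\<sigma> = (U, l, h)" "(U, l, h) \<in> spans G r pt S" for \<sigma> U l h
    unfolding that(1) using that(2)
  proof (induction rule: spans_induct)
    case (empty U l h)
    have i: "invar U {}" by (simp add: invar_def)
    have e: "cl pt S (rst (U, l, h) {}) = cl pt S (U, l, h)" "cl pt S (rst (U, l, h) (pts U - {})) = cl pt S (U, l, h)"
      using rst_spans[OF empty(1) i] empty by (simp_all add: empty_spanD)
    note gc = g[OF cl_arr[OF empty(1)]]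
    \<comment> \<open>The empty span splits into two copies of itself, so its value \<open>y\<close>
      satisfies \<open>y = y + y\<close>.\<close>
    have "g (cl pt S (U, l, h)) = \<zero>\<^bsub>V\<^esub>"
      by (rule vs_self_add[OF V gc gc s[OF empty(1) i, unfolded e]])
    moreover have "f \<zero>\<^bsub>bob S\<^esub> = \<zero>\<^bsub>V\<^esub>" by (rule lin_zero[OF f vs_bob V])
    ultimately show ?case unfolding bel_empty[OF empty] by simp
  next
    case (trans U l h)
    then have "cl pt S (U, l, h) \<in> Om S" using Om_cl by simp
    then show ?case using d bel_Om by metis
  next
    case (split U l h B)
    have C: "invar U (pts U - B)" by (rule invar_compl[OF spansD(1)[OF split(1)] split(2)])
    have b: "bel S (cl pt S (rst (U, l, h) B)) \<in> carrier (bob S)" "bel S (cl pt S (rst (U, l, h) (pts U - B))) \<in> carrier (bob S)"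
      using bel_bob[OF cl_arr[OF rst_spans[OF split(1,2)]]] bel_bob[OF cl_arr[OF rst_spans[OF split(1) C]]] .
    show ?case unfolding bel_split[OF split(1,2)] linD(2)[OF f b] split(3,4) s[OF split(1,2)] ..
  qed
  show ?thesis using Y by (rule arrE) (use * in auto)
qed

lemma fmor_A: assumes "a \<in> carrier (bob S)"
  shows "fmor A S T X a = Inl (\<lambda>\<kappa>'. \<Sum>\<kappa> | projl a \<kappa> \<noteq> 0. projl a \<kappa> * orbit_decomp G r T (cmpL pt S T X \<kappa>) \<kappa>')"
  using assms by (simp add: Burnside_def)

lemma fmor_A_superset: assumes "a \<in> carrier (bob S)" "finite J" "{\<kappa>. projl a \<kappa> \<noteq> 0} \<subseteq> J"
  shows "fmor A S T X a = Inl (\<lambda>\<kappa>'. \<Sum>\<kappa>\<in>J. projl a \<kappa> * orbit_decomp G r T (cmpL pt S T X \<kappa>) \<kappa>')"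
proof -
  have "(\<Sum>\<kappa> | projl a \<kappa> \<noteq> 0. projl a \<kappa> * orbit_decomp G r T (cmpL pt S T X \<kappa>) \<kappa>') =
    (\<Sum>\<kappa>\<in>J. projl a \<kappa> * orbit_decomp G r T (cmpL pt S T X \<kappa>) \<kappa>')" for \<kappa>'
    by (rule sum.mono_neutral_left) (use assms in auto)
  then show ?thesis by (simp add: fmor_A[OF assms(1)])
qed

lemma fmor_A_add: assumes "a \<in> carrier (bob S)" "b \<in> carrier (bob S)"
  shows "fmor A S T X (a \<oplus>\<^bsub>bob S\<^esub> b) = fmor A S T X a \<oplus>\<^bsub>bob T\<^esub> fmor A S T X b"
proof -
  let ?J = "{\<kappa>. projl a \<kappa> \<noteq> 0} \<union> {\<kappa>. projl b \<kappa> \<noteq> 0}"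
  have J: "finite ?J" using assms by (auto elim!: bobE)
  show ?thesis
    unfolding fmor_A_superset[OF assms(1) J Un_upper1] fmor_A_superset[OF assms(2) J Un_upper2]
    by (subst fmor_A_superset[OF vs_simps(2)[OF vs_bob assms] J]) (auto simp: sum.distrib algebra_simps)
qed

lemma fmor_A_smult: assumes "a \<in> carrier (bob S)"
  shows "fmor A S T X (q \<odot>\<^bsub>bob S\<^esub> a) = q \<odot>\<^bsub>bob T\<^esub> fmor A S T X a"
proof -
  have J: "finite {\<kappa>. projl a \<kappa> \<noteq> 0}" using assms by (auto elim!: bobE)
  show ?thesis
    unfolding fmor_A_superset[OF assms(1) J order_refl]
    by (subst fmor_A_superset[OF vs_simps(3)[OF vs_bob assms] J]) (auto simp: sum_distrib_left algebra_simps)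
qed

lemma fmor_A_delta: assumes "\<kappa> \<in> Om S" shows "fmor A S T X (delta \<kappa>) = bel T (cmpL pt S T X \<kappa>)"
  by (subst fmor_A_superset[OF delta_bob[OF assms], of "{\<kappa>}"]) (auto simp: delta_def bel_def split: if_splits)

lemma fmor_A_closed: fixes a :: "('a, 'u) val"
  assumes "a \<in> carrier (bob S)" "X \<in> Ar S T" shows "fmor A S T X a \<in> carrier (bob T)"
  using assms(1)
proof (induction rule: bob_induct)
  case zero
  have "fmor A S T X \<zero>\<^bsub>bob S\<^esub> = (\<zero>\<^bsub>bob T\<^esub> :: ('a, 'u) val)"
    by (subst fmor_A[OF vs_simps(1)[OF vs_bob]]) simp
  then show ?case using vs_simps(1)[OF vs_bob, of T] by metis
next
  case (add x q \<kappa>)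
  have 1: "delta \<kappa> \<in> carrier (bob S)" "q \<odot>\<^bsub>bob S\<^esub> delta \<kappa> \<in> carrier (bob S)"
    using delta_bob[OF add(2)] vs_simps(3)[OF vs_bob] by blast+
  have "bel T (cmpL pt S T X \<kappa>) \<in> carrier (bob T)" using add(2) assms(2) by simp
  then show ?case
    unfolding fmor_A_add[OF add(1) 1(2)] fmor_A_smult[OF 1(1)] fmor_A_delta[OF add(2)]
    using add(3) vs_simps(2,3)[OF vs_bob] by blast
qed

lemma fmor_A_linmaps: assumes "X \<in> Ar S T" shows "fmor A S T X \<in> linmaps (bob S) (bob T)"
proof (rule linmapsI)
  show "fmor A S T X \<in> extensional (carrier (bob S))" by (simp add: Burnside_def)
qed (use assms fmor_A_closed fmor_A_add fmor_A_smult in blast)+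

lemma fmor_A_lin: "X \<in> Ar S T \<Longrightarrow> lin (bob S) (bob T) (fmor A S T X)"
  by (rule linmaps_lin[OF fmor_A_linmaps])

text \<open>Together with \<open>bel_cmp_split2\<close>: composition of spans becomes biadditive
  once only multiplicities of orbits are recorded.\<close>

lemma bel_cmp_split1: assumes "(U, l, h) \<in> spans G r pt S" "invar U B" "X \<in> Ar S T"
  shows "bel T (cmpL pt S T X (cl pt S (U, l, h))) =
    bel T (cmpL pt S T X (cl pt S (rst (U, l, h) B))) \<oplus>\<^bsub>bob T\<^esub> bel T (cmpL pt S T X (cl pt S (rst (U, l, h) (pts U - B))))"
proof -
  obtain V k m where X: "(V, k, m) \<in> spans G r S T" "X = cl S T (V, k, m)" using arrE[OF assms(3)] .
  have C: "invar U (pts U - B)" by (rule invar_compl[OF spansD(1)[OF assms(1)] assms(2)])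
  note sB = span_pb_rst1[OF assms(1) X(1) assms(2)] and sC = span_pb_rst1[OF assms(1) X(1) C]
  have e: "{z \<in> pbset U V h k. pfst z \<in> pts U - B} = pts (fst (span_pb G (U, l, h) (V, k, m))) - {z \<in> pbset U V h k. pfst z \<in> B}"
    unfolding sB(3) by auto
  obtain W p q where pb: "span_pb G (U, l, h) (V, k, m) = (W, p, q)" by (metis prod_cases3)
  note 1 = span_pb_spans[OF assms(1) X(1), unfolded pb]
  note i = sB(2)[unfolded pb fst_conv]
  show ?thesis unfolding X(2) cmpL_cl[OF assms(1) X(1)] cmpL_cl[OF rst_spans[OF assms(1,2)] X(1)] cmpL_cl[OF rst_spans[OF assms(1) C] X(1)]
    unfolding sB(1) sC(1) e unfolding pb fst_conv by (rule bel_split[OF 1 i])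
qed

lemma bel_cmp_split2: assumes "(V, k, m) \<in> spans G r S T" "invar V B" "Y \<in> Ar pt S"
  shows "bel T (cmpL pt S T (cl S T (V, k, m)) Y) =
    bel T (cmpL pt S T (cl S T (rst (V, k, m) B)) Y) \<oplus>\<^bsub>bob T\<^esub> bel T (cmpL pt S T (cl S T (rst (V, k, m) (pts V - B))) Y)"
proof -
  obtain U l h where Y: "(U, l, h) \<in> spans G r pt S" "Y = cl pt S (U, l, h)" using arrE[OF assms(3)] .
  have C: "invar V (pts V - B)" by (rule invar_compl[OF spansD(1)[OF assms(1)] assms(2)])
  note sB = span_pb_rst2[OF Y(1) assms(1,2)] and sC = span_pb_rst2[OF Y(1) assms(1) C]
  have e: "{z \<in> pbset U V h k. psnd z \<in> pts V - B} = pts (fst (span_pb G (U, l, h) (V, k, m))) - {z \<in> pbset U V h k. psnd z \<in> B}"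
    unfolding sB(3) by auto
  obtain W p q where pb: "span_pb G (U, l, h) (V, k, m) = (W, p, q)" by (metis prod_cases3)
  note 1 = span_pb_spans[OF Y(1) assms(1), unfolded pb]
  note i = sB(2)[unfolded pb fst_conv]
  show ?thesis unfolding Y(2) cmpL_cl[OF Y(1) assms(1)] cmpL_cl[OF Y(1) rst_spans[OF assms(1,2)]] cmpL_cl[OF Y(1) rst_spans[OF assms(1) C]]
    unfolding sB(1) sC(1) e unfolding pb fst_conv by (rule bel_split[OF 1 i])
qed

text \<open>\<open>Burnside\<close> is defined by its effect on orbits, but functoriality composes a
  second morphism with a G-set that has many orbits. This formula covers that case.\<close>

lemma fmor_A_bel: assumes "X \<in> Ar S T" "Y \<in> Ar pt S" shows "fmor A S T X (bel S Y) = bel T (cmpL pt S T X Y)"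
  by (rule lin_bel[OF fmor_A_lin[OF assms(1)] vs_bob]) (use assms bel_cmp_split1 fmor_A_delta in auto)

lemma mack_A: "mack (A :: ('a, ('a, 'u) val) mfun)"
  unfolding mack_def
proof
  show "lin_functor (A :: ('a, ('a, 'u) val) mfun)"
  proof (rule lin_functorI, unfold fob_A)
    fix S T W X Y and m :: "('a, 'u) val" assume a: "S \<in> gsets G" "T \<in> gsets G" "W \<in> gsets G" "X \<in> Ar S T" "Y \<in> Ar T W" "m \<in> carrier (bob S)"
    show "fmor A S W (cmpL S T W Y X) m = fmor A T W Y (fmor A S T X m)"
      by (rule bob_lin_eqI[OF fmor_A_lin lin_comp[OF fmor_A_lin fmor_A_lin] vs_bob _ a(6)])
        (use a in \<open>simp_all add: fmor_A_delta fmor_A_bel cmpL_assoc\<close>)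
  next
    fix S and m :: "('a, 'u) val" assume a: "S \<in> gsets G" "m \<in> carrier (bob S)"
    show "fmor A S S (idL S) m = m"
      by (rule bob_lin_eqI[OF fmor_A_lin _ vs_bob _ a(2)])
        (use a in \<open>simp_all add: fmor_A_delta bel_Om lin_def\<close>)
  qed (simp_all add: fmor_A_linmaps)
  show "additive (A :: ('a, ('a, 'u) val) mfun)"
    unfolding additive_def fob_A
  proof (intro ballI allI impI)
    fix S T V k m B and a :: "('a, 'u) val"
    assume a: "S \<in> gsets G" "T \<in> gsets G" "(V, k, m) \<in> spans G r S T" "invar V B" "a \<in> carrier (bob S)"
    have C: "invar V (pts V - B)" by (rule invar_compl[OF spansD(1)[OF a(3)] a(4)])
    show "fmor A S T (cl S T (V, k, m)) a =
        fmor A S T (cl S T (rst (V, k, m) B)) a \<oplus>\<^bsub>bob T\<^esub> fmor A S T (cl S T (rst (V, k, m) (pts V - B))) a"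
      by (rule bob_lin_eqI[OF fmor_A_lin lin_add[OF fmor_A_lin fmor_A_lin vs_bob] vs_bob _ a(5)])
        (simp_all add: cl_arr[OF a(3)] cl_arr[OF rst_spans[OF a(3,4)]] cl_arr[OF rst_spans[OF a(3) C]]
           bel_cmp_split2[OF a(3,4)] fmor_A_delta del: bob_simps rst.simps)
  qed
qed

definition one_A :: "('a, 'u) val" where "one_A = bel pt (idL pt)"

lemma one_A_bob [simp]: "one_A \<in> carrier (bob pt)"
  by (simp add: one_A_def)

lemma burnside_one_eq: "burnside_one G r = one_A"
  by (simp add: burnside_one_def one_A_def bel_def)

text \<open>The map \<open>A \<rightarrow> P\<close> that the Yoneda lemma attaches to an element
  \<open>p\<close> of the value at the point: an orbit over \<open>S\<close> is itself a morphism
  from the point to \<open>S\<close>, and is sent to its effect on \<open>p\<close>.\<close>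

definition yo :: "('a, 'v) mfun \<Rightarrow> 'v \<Rightarrow> 'a gset \<Rightarrow> ('a, 'u) val \<Rightarrow> 'v" where
  "yo P p S a = lc (fob P S) (projl a) (\<lambda>\<kappa>. fmor P pt S \<kappa> p)"

lemma yo_lin: fixes P :: "('a, 'v) mfun" assumes "mack P" "p \<in> carrier (fob P pt)" "S \<in> gsets G"
  shows "lin (bob S) (fob P S) (yo P p S :: ('a, 'u) val \<Rightarrow> 'v)"
proof -
  note P = lin_functorD[OF mackD(1)[OF assms(1)]]
  have f: "fmor P pt S \<kappa> p \<in> carrier (fob P S)" if "\<kappa> \<in> Om S" for \<kappa> using P(5)[OF gpt_gset assms(3) Om_arr[OF that] assms(2)] .
  show ?thesis unfolding lin_def
  proof (intro conjI ballI allI)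
    fix x :: "('a, 'u) val" and q assume x: "x \<in> carrier (bob S)"
    obtain c where c: "x = Inl c" "finite {\<kappa>. c \<kappa> \<noteq> 0}" "{\<kappa>. c \<kappa> \<noteq> 0} \<subseteq> Om S" using x by (rule bobE)
    show "yo P p S x \<in> carrier (fob P S)" unfolding yo_def using c f by (intro lc_closed P(1) assms(3)) auto
    have "lc (fob P S) (\<lambda>k. q * c k) (\<lambda>\<kappa>. fmor P pt S \<kappa> p) = q \<odot>\<^bsub>fob P S\<^esub> lc (fob P S) c (\<lambda>\<kappa>. fmor P pt S \<kappa> p)"
      by (rule lc_smult) (use c f P assms(3) in auto)
    then show "yo P p S (q \<odot>\<^bsub>bob S\<^esub> x) = q \<odot>\<^bsub>fob P S\<^esub> yo P p S x" using c by (simp add: yo_def)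
    fix y :: "('a, 'u) val" assume y: "y \<in> carrier (bob S)"
    obtain d where d: "y = Inl d" "finite {\<kappa>. d \<kappa> \<noteq> 0}" "{\<kappa>. d \<kappa> \<noteq> 0} \<subseteq> Om S" using y by (rule bobE)
    have "lc (fob P S) (\<lambda>k. c k + d k) (\<lambda>\<kappa>. fmor P pt S \<kappa> p) = lc (fob P S) c (\<lambda>\<kappa>. fmor P pt S \<kappa> p) \<oplus>\<^bsub>fob P S\<^esub> lc (fob P S) d (\<lambda>\<kappa>. fmor P pt S \<kappa> p)"
      by (rule lc_add) (use c d f P assms(3) in auto)
    then show "yo P p S (x \<oplus>\<^bsub>bob S\<^esub> y) = yo P p S x \<oplus>\<^bsub>fob P S\<^esub> yo P p S y" using c d by (simp add: yo_def)
  qed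
qed

lemma yo_delta: assumes "mack P" "p \<in> carrier (fob P pt)" "S \<in> gsets G" "\<kappa> \<in> Om S"
  shows "yo P p S (delta \<kappa>) = fmor P pt S \<kappa> p"
  unfolding yo_def delta_def sum.sel
  by (rule lc_delta) (use lin_functorD[OF mackD(1)[OF assms(1)]] assms in auto)

text \<open>Additivity of \<open>P\<close> is what \<open>lin_bel\<close> asks of the function
  taking \<open>Y\<close> to \<open>fmor P pt S Y p\<close>. At this point product preservation
  enters the Yoneda lemma.\<close>

lemma yo_bel: assumes "mack P" "p \<in> carrier (fob P pt)" "S \<in> gsets G" "Y \<in> Ar pt S"
  shows "yo P p S (bel S Y) = fmor P pt S Y p"
  by (rule lin_bel[OF yo_lin[OF assms(1-3)]])
    (use lin_functorD[OF mackD(1)[OF assms(1)]] assms yo_delta[OF assms(1-3)] additiveD[OF mackD(2)[OF assms(1)] gpt_gset assms(3)]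
      in \<open>simp_all del: rst.simps\<close>)

lemma yo_one: assumes "mack P" "p \<in> carrier (fob P pt)" shows "yo P p pt one_A = p"
  using yo_bel[OF assms gpt_gset idL_arr[OF gpt_gset]] lin_functorD(3)[OF mackD(1)[OF assms(1)] gpt_gset assms(2)]
  by (simp add: one_A_def)

lemma yo_natural: assumes "mack P" "p \<in> carrier (fob P pt)" "S \<in> gsets G" "T \<in> gsets G" "X \<in> Ar S T" "a \<in> carrier (bob S)"
  shows "yo P p T (fmor A S T X a) = fmor P S T X (yo P p S a)"
proof -
  note P = lin_functorD[OF mackD(1)[OF assms(1)]]
  show ?thesis
    by (rule bob_lin_eqI[OF lin_comp[OF fmor_A_lin yo_lin] lin_comp[OF yo_lin linmaps_lin[OF P(2)]] P(1) _ assms(6)])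
      (use assms P(4)[OF gpt_gset assms(3,4) _ assms(5,2)] in \<open>simp_all add: fmor_A_delta yo_delta yo_bel\<close>)
qed

lemma yo_Hom: assumes "mack P" "p \<in> carrier (fob P pt)"
  shows "(\<lambda>S\<in>gsets G. \<lambda>m\<in>carrier (bob S). yo P p S m) \<in> Hom A P"
  using HomI[OF mack_A, of "yo P p" P] linD[OF yo_lin[OF assms]] yo_natural[OF assms]
  unfolding fob_A by blast

text \<open>The uniqueness half of Yoneda: \<open>delta \<kappa>\<close> is the image of
  \<open>one_A\<close> under \<open>\<kappa>\<close>, so naturality leaves no freedom.\<close>

lemma Hom_A_yo: fixes a :: "('a, 'u) val" assumes "t \<in> Hom A P" "mack P" "S \<in> gsets G" "a \<in> carrier (bob S)"
  shows "t S a = yo P (t pt one_A) S a"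
proof -
  note P = lin_functorD[OF mackD(1)[OF assms(2)]]
  note t = HomD[OF assms(1), unfolded fob_A]
  have p: "t pt one_A \<in> carrier (fob P pt)" using t(2)[OF gpt_gset one_A_bob] .
  show ?thesis
  proof (rule bob_lin_eqI[OF linmaps_lin[OF t(1)] yo_lin P(1) _ assms(4)])
    fix \<kappa> assume k: "\<kappa> \<in> Om S"
    have "fmor A pt S \<kappa> one_A = (delta \<kappa> :: ('a, 'u) val)"
      unfolding one_A_def using fmor_A_bel[OF Om_arr[OF k] idL_arr[OF gpt_gset]] k by (simp add: bel_Om)
    then have "t S (delta \<kappa>) = fmor P pt S \<kappa> (t pt one_A)"
      using t(5)[OF gpt_gset assms(3) Om_arr[OF k] one_A_bob] by simp
    then show "t S (delta \<kappa>) = yo P (t pt one_A) S (delta \<kappa>)" by (simp add: yo_delta[OF assms(2) p assms(3) k])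
  qed (use assms p in auto)
qed

subsection \<open>The external product with the Burnside functor\<close>

abbreviation pe where "pe T \<equiv> restrict psnd (pts (gprod G pt T))"
abbreviation gp where "gp \<equiv> gprod G"

lemma pe_emaps: assumes "T \<in> gsets G" shows "pe T \<in> emaps G (gp pt T) T" "bij_betw (pe T) (pts (gp pt T)) (pts T)"
    "inj_on (pe T) (pts (gp pt T))"
proof -
  show "pe T \<in> emaps G (gp pt T) T" using assms by (intro emapsI) auto
  show "bij_betw (pe T) (pts (gp pt T)) (pts T)"
    by (rule bij_betw_byWitness[where f' = "\<lambda>t. prod_encode (0, t)"]) (auto intro: pair_code_eqI)
  then show "inj_on (pe T) (pts (gp pt T))" by (simp add: bij_betw_def)
qed

definition ptinv :: "'a gset \<Rightarrow> 'a span set" where "ptinv T = res G r (gp pt T) T (pe T)"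

abbreviation ptiso where "ptiso \<equiv> pt_iso G r"

lemma pe_emapsO: assumes "T \<in> gsets G" shows "pe T \<in> emapsO G r (gp pt T) T"
  by (rule emapsO_inj[OF gprod_gset[OF gpt_gset assms] assms pe_emaps(1,3)[OF assms]])

lemma ptiso_arr [simp]: assumes "T \<in> gsets G" shows "ptiso T \<in> Ar (gp pt T) T"
  unfolding pt_iso_def by (rule tr_arr[OF gprod_gset[OF gpt_gset assms] pe_emapsO[OF assms]])

lemma ptinv_arr [simp]: assumes "T \<in> gsets G" shows "ptinv T \<in> Ar T (gp pt T)"
  unfolding ptinv_def by (rule res_arr[OF gprod_gset[OF gpt_gset assms] pe_emaps(1)[OF assms]])

lemma ptiso_ptinv: assumes "T \<in> gsets G" shows "cmpL T (gp pt T) T (ptiso T) (ptinv T) = idL T"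
  unfolding pt_iso_def ptinv_def by (rule tr_res_bij[OF pe_emaps(1,2)[OF assms] gprod_gset[OF gpt_gset assms] assms])

lemma ptinv_ptiso: assumes "T \<in> gsets G" shows "cmpL (gp pt T) T (gp pt T) (ptinv T) (ptiso T) = idL (gp pt T)"
  unfolding pt_iso_def ptinv_def by (rule res_tr_inj[OF pe_emaps(1,3)[OF assms] gprod_gset[OF gpt_gset assms] assms])

text \<open>Over the point both legs of the first factor are constant, so after transport along
  \<open>pt \<times> T = T\<close> only the apex still sees \<open>U\<close>. The cases
  \<open>U = pt\<close> and \<open>V = pt\<close> give the two lemmas that follow.\<close>

lemma ptiso_conj: assumes "(U, l, h) \<in> spans G r pt pt" "(V, k, m) \<in> spans G r T T'" "T \<in> gsets G" "T' \<in> gsets G"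
  shows "cmpL T (gp pt T) T' (cmpL (gp pt T) (gp pt T') T' (ptiso T') (lprod G r pt pt T T' (cl pt pt (U, l, h)) (cl T T' (V, k, m)))) (ptinv T)
    = cl T T' (gp U V, \<lambda>z\<in>pts (gp U V). k (psnd z), \<lambda>z\<in>pts (gp U V). m (psnd z))"
    "(gp U V, \<lambda>z\<in>pts (gp U V). k (psnd z), \<lambda>z\<in>pts (gp U V). m (psnd z)) \<in> spans G r T T'"
proof -
  note s = spansD[OF assms(1)] spansD[OF assms(2)]
  note p = span_prod_spans[OF assms(1,2), unfolded span_prod_eq]
  have psO: "pe T' \<in> emapsO G r (gp pt T') T'" using emapsO_inj pe_emaps assms by simp
  note t = cmpL_tr[OF p psO] note q = cmpL_res[OF t(2) pe_emaps(1)]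
  have e: "(\<lambda>v\<in>pts (gp U V). pe T ((\<lambda>z\<in>pts (gp U V). prod_encode (l (pfst z), k (psnd z))) v)) = (\<lambda>z\<in>pts (gp U V). k (psnd z))"
    "(\<lambda>v\<in>pts (gp U V). pe T' ((\<lambda>z\<in>pts (gp U V). prod_encode (h (pfst z), m (psnd z))) v)) = (\<lambda>z\<in>pts (gp U V). m (psnd z))"
    using emapsD(1)[OF s(2)] emapsD(1)[OF s(3)] emapsD(1)[OF s(6)] emapsD(1)[OF s(7)] by (auto simp: fun_eq_iff)
  show "(gp U V, \<lambda>z\<in>pts (gp U V). k (psnd z), \<lambda>z\<in>pts (gp U V). m (psnd z)) \<in> spans G r T T'"
    using q(2) assms(3,4) unfolding e by simp
  show "cmpL T (gp pt T) T' (cmpL (gp pt T) (gp pt T') T' (ptiso T') (lprod G r pt pt T T' (cl pt pt (U, l, h)) (cl T T' (V, k, m)))) (ptinv T)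
    = cl T T' (gp U V, \<lambda>z\<in>pts (gp U V). k (psnd z), \<lambda>z\<in>pts (gp U V). m (psnd z))"
    using q(1) assms(3,4) t(1) unfolding e by (simp add: lprod_cl[OF assms(1,2)] span_prod_eq pt_iso_def ptinv_def)
qed

lemma ptiso_conj_id: assumes "Y \<in> Ar T T'" "T \<in> gsets G" "T' \<in> gsets G"
  shows "cmpL T (gp pt T) T' (cmpL (gp pt T) (gp pt T') T' (ptiso T') (lprod G r pt pt T T' (idL pt) Y)) (ptinv T) = Y"
proof -
  obtain V k m where Y: "(V, k, m) \<in> spans G r T T'" "Y = cl T T' (V, k, m)" using arrE[OF assms(1)] .
  note s = spansD[OF Y(1)]
  note c = ptiso_conj[OF idspan[OF gpt_gset] Y(1) assms(2,3)]
  have "cl T T' (gp pt V, \<lambda>z\<in>pts (gp pt V). k (psnd z), \<lambda>z\<in>pts (gp pt V). m (psnd z)) = cl T T' (V, k, m)"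
    using c(2) Y(1) by (rule cl_eqI[where f = psnd and f' = "\<lambda>v. prod_encode (0, v)"])
      (auto simp: s(1) intro: pair_code_eqI)
  then show ?thesis using c(1) by (simp add: Y(2) idL_eq)
qed

lemma ptiso_conj_pt: assumes "\<kappa> \<in> Ar pt pt"
  shows "cmpL pt (gp pt pt) pt (cmpL (gp pt pt) (gp pt pt) pt (ptiso pt) (lprod G r pt pt pt pt \<kappa> (idL pt))) (ptinv pt) = \<kappa>"
proof -
  obtain U l h where Y: "(U, l, h) \<in> spans G r pt pt" "\<kappa> = cl pt pt (U, l, h)" using arrE[OF assms(1)] .
  note s = spansD[OF Y(1)]
  note c = ptiso_conj[OF Y(1) idspan[OF gpt_gset] gpt_gset gpt_gset]
  have z: "l u = 0" "h u = 0" if "u \<in> pts U" for u using emapsD(1)[OF s(2) that] emapsD(1)[OF s(3) that] by simp_all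
  have "cl pt pt (gp U pt, \<lambda>z\<in>pts (gp U pt). (\<lambda>x\<in>pts pt. x) (psnd z), \<lambda>z\<in>pts (gp U pt). (\<lambda>x\<in>pts pt. x) (psnd z)) = cl pt pt (U, l, h)"
    using c(2) Y(1) by (rule cl_eqI[where f = pfst and f' = "\<lambda>v. prod_encode (v, 0)"])
      (auto simp: s(1) z intro: pair_code_eqI)
  then show ?thesis using c(1) by (simp add: Y(2) idL_eq)
qed

text \<open>Obtained from \<open>ptiso_conj_id\<close> by cancelling the isomorphism
  \<open>ptinv T\<close>.\<close>

lemma ptiso_natural: assumes Y: "Y \<in> Ar T T'" and T: "T \<in> gsets G" "T' \<in> gsets G"
  shows "cmpL (gp pt T) (gp pt T') T' (ptiso T') (lprod G r pt pt T T' (idL pt) Y) = cmpL (gp pt T) T T' Y (ptiso T)"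
proof -
  let ?L = "cmpL (gp pt T) (gp pt T') T' (ptiso T') (lprod G r pt pt T T' (idL pt) Y)"
  have L: "?L \<in> Ar (gp pt T) T'" using assms by (intro cmpL_arr[where T = "gp pt T'"]) simp_all
  have "cmpL (gp pt T) T T' (cmpL T (gp pt T) T' ?L (ptinv T)) (ptiso T) = ?L"
    using cmpL_assoc[OF ptiso_arr[OF T(1)] ptinv_arr[OF T(1)] L] ptinv_ptiso[OF T(1)] cmpL_idL[OF L] T by simp
  then show ?thesis using ptiso_conj_id[OF assms] by simp
qed

lemma ptinv_natural: assumes Y: "Y \<in> Ar T T'" and T: "T \<in> gsets G" "T' \<in> gsets G"
  shows "cmpL T (gp pt T) (gp pt T') (lprod G r pt pt T T' (idL pt) Y) (ptinv T) = cmpL T T' (gp pt T') (ptinv T') Y"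
proof -
  let ?L = "lprod G r pt pt T T' (idL pt) Y"
  have L: "?L \<in> Ar (gp pt T) (gp pt T')" "ptiso T' \<in> Ar (gp pt T') T'" "ptinv T' \<in> Ar T' (gp pt T')" "ptinv T \<in> Ar T (gp pt T)"
    using assms by simp_all
  note L' = cmpL_arr[OF L(4,1)]
  have "cmpL T (gp pt T') T' (ptiso T') (cmpL T (gp pt T) (gp pt T') ?L (ptinv T)) = Y"
    using ptiso_conj_id[OF assms] cmpL_assoc[OF L(4,1,2)] by simp
  then have "cmpL T T' (gp pt T') (ptinv T') Y = cmpL T T' (gp pt T') (ptinv T') (cmpL T (gp pt T') T' (ptiso T') (cmpL T (gp pt T) (gp pt T') ?L (ptinv T)))" by simp
  also have "\<dots> = cmpL T (gp pt T) (gp pt T') ?L (ptinv T)"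
    using cmpL_assoc[OF L' L(2,3)] ptinv_ptiso[OF T(2)] idL_cmpL[OF L'] T by simp
  finally show ?thesis by simp
qed

text \<open>The morphism \<open>\<kappa> \<times> id\<close> from \<open>T\<close>, identified with
  \<open>pt \<times> T\<close>, to \<open>S \<times> T\<close>. The external product of an orbit
  \<open>\<kappa>\<close> with an element of \<open>M(T)\<close> is the image of that element under
  it (\<open>box_delta\<close>).\<close>

definition ext :: "'a gset \<Rightarrow> 'a span set \<Rightarrow> 'a gset \<Rightarrow> 'a span set" where
  "ext S \<kappa> T = cmpL T (gp pt T) (gp S T) (lprod G r pt S T T \<kappa> (idL T)) (ptinv T)"

lemma ext_arr [simp]: "\<kappa> \<in> Ar pt S \<Longrightarrow> T \<in> gsets G \<Longrightarrow> ext S \<kappa> T \<in> Ar T (gp S T)"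
  unfolding ext_def by (rule cmpL_arr[where T = "gp pt T"]) simp_all

lemma ext_natural: assumes "X \<in> Ar S S'" "Y \<in> Ar T T'" "\<kappa> \<in> Ar pt S" and T: "T \<in> gsets G" "T' \<in> gsets G" and S: "S \<in> gsets G" "S' \<in> gsets G"
  shows "cmpL T (gp S T) (gp S' T') (lprod G r S S' T T' X Y) (ext S \<kappa> T) = cmpL T T' (gp S' T') (ext S' (cmpL pt S S' X \<kappa>) T') Y"
proof -
  let ?X = "cmpL pt S S' X \<kappa>"
  have X: "?X \<in> Ar pt S'" using cmpL_arr[OF assms(3,1)] .
  have a: "lprod G r pt S T T \<kappa> (idL T) \<in> Ar (gp pt T) (gp S T)" "lprod G r S S' T T' X Y \<in> Ar (gp S T) (gp S' T')"
    "lprod G r pt S' T' T' ?X (idL T') \<in> Ar (gp pt T') (gp S' T')" "lprod G r pt pt T T' (idL pt) Y \<in> Ar (gp pt T) (gp pt T')"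
    using assms X by simp_all
  have "cmpL T (gp S T) (gp S' T') (lprod G r S S' T T' X Y) (ext S \<kappa> T) =
    cmpL T (gp pt T) (gp S' T') (cmpL (gp pt T) (gp S T) (gp S' T') (lprod G r S S' T T' X Y) (lprod G r pt S T T \<kappa> (idL T))) (ptinv T)"
    unfolding ext_def using cmpL_assoc[OF ptinv_arr[OF T(1)] a(1,2)] by simp
  also have "cmpL (gp pt T) (gp S T) (gp S' T') (lprod G r S S' T T' X Y) (lprod G r pt S T T \<kappa> (idL T)) = lprod G r pt S' T T' ?X Y"
    using lprod_cmpL[OF assms(3,1) idL_arr[OF T(1)] assms(2)] assms(2) T by simp
  also have "\<dots> = cmpL (gp pt T) (gp pt T') (gp S' T') (lprod G r pt S' T' T' ?X (idL T')) (lprod G r pt pt T T' (idL pt) Y)"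
    using lprod_cmpL[OF idL_arr[OF gpt_gset] X assms(2) idL_arr[OF T(2)]] assms(2) X T by simp
  also have "cmpL T (gp pt T) (gp S' T') \<dots> (ptinv T) = cmpL T (gp pt T') (gp S' T') (lprod G r pt S' T' T' ?X (idL T')) (cmpL T (gp pt T) (gp pt T') (lprod G r pt pt T T' (idL pt) Y) (ptinv T))"
    using cmpL_assoc[OF ptinv_arr[OF T(1)] a(4,3)] .
  also have "\<dots> = cmpL T T' (gp S' T') (ext S' ?X T') Y"
    unfolding ptinv_natural[OF assms(2) T] ext_def using cmpL_assoc[OF assms(2) ptinv_arr[OF T(2)] a(3)] by simp
  finally show ?thesis .
qed

lemma ext_cl: assumes "(U, l, h) \<in> spans G r pt S" "T \<in> gsets G"
  shows "ext S (cl pt S (U, l, h)) T = cl T (gp S T) (gp U T, \<lambda>z\<in>pts (gp U T). psnd z, \<lambda>z\<in>pts (gp U T). prod_encode (h (pfst z), psnd z))"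
    "(gp U T, \<lambda>z\<in>pts (gp U T). psnd z, \<lambda>z\<in>pts (gp U T). prod_encode (h (pfst z), psnd z)) \<in> spans G r T (gp S T)"
proof -
  note s = spansD[OF assms(1)]
  note p = span_prod_spans[OF assms(1) idspan[OF assms(2)], unfolded span_prod_eq]
  note q = cmpL_res[OF p pe_emaps(1)[OF assms(2)] gprod_gset[OF gpt_gset assms(2)]]
  have e: "(\<lambda>v\<in>pts (gp U T). pe T ((\<lambda>z\<in>pts (gp U T). prod_encode (l (pfst z), (\<lambda>x\<in>pts T. x) (psnd z))) v)) = (\<lambda>z\<in>pts (gp U T). psnd z)"
    "(\<lambda>z\<in>pts (gp U T). prod_encode (h (pfst z), (\<lambda>x\<in>pts T. x) (psnd z))) = (\<lambda>z\<in>pts (gp U T). prod_encode (h (pfst z), psnd z))"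
    using emapsD(1)[OF s(2)] by (auto simp: fun_eq_iff)
  show "(gp U T, \<lambda>z\<in>pts (gp U T). psnd z, \<lambda>z\<in>pts (gp U T). prod_encode (h (pfst z), psnd z)) \<in> spans G r T (gp S T)"
    using q(2) assms(2) unfolding e by simp
  show "ext S (cl pt S (U, l, h)) T = cl T (gp S T) (gp U T, \<lambda>z\<in>pts (gp U T). psnd z, \<lambda>z\<in>pts (gp U T). prod_encode (h (pfst z), psnd z))"
    unfolding ext_def idL_eq lprod_cl[OF assms(1) idspan[OF assms(2)]] span_prod_eq ptinv_def
    unfolding e by (rule q(1)[unfolded e])
qed

abbreviation ra where "ra S T W \<equiv> restrict reassoc (pts (gp (gp S T) W))"
definition alp where "alp S T W = tr G r (gp (gp S T) W) (gp S (gp T W)) (ra S T W)"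

lemma ra_emaps: assumes "S \<in> gsets G" "T \<in> gsets G" "W \<in> gsets G"
  shows "ra S T W \<in> emaps G (gp (gp S T) W) (gp S (gp T W))" "inj_on (ra S T W) (pts (gp (gp S T) W))"
proof -
  show "ra S T W \<in> emaps G (gp (gp S T) W) (gp S (gp T W))"
    using assms by (intro emapsI) (auto simp: reassoc_def)
  have "inj_on reassoc UNIV"
    by (rule inj_on_inverseI[where g = "\<lambda>z. prod_encode (prod_encode (pfst z, pfst (psnd z)), psnd (psnd z))"])
      (simp add: reassoc_def)
  then show "inj_on (ra S T W) (pts (gp (gp S T) W))" by (auto simp: inj_on_def)
qed

lemma alp_arr [simp]: "S \<in> gsets G \<Longrightarrow> T \<in> gsets G \<Longrightarrow> W \<in> gsets G \<Longrightarrow> alp S T W \<in> Ar (gp (gp S T) W) (gp S (gp T W))"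
  unfolding alp_def by (intro tr_arr emapsO_inj ra_emaps) simp_all

text \<open>Restriction along the reassociating bijection is a left inverse of the transfer along
  it. Equations may therefore be checked after applying \<open>alp\<close>.\<close>

lemma alp_inj: assumes "lin_functor M" "S \<in> gsets G" "T \<in> gsets G" "W \<in> gsets G"
    "x \<in> carrier (fob M (gp (gp S T) W))" "y \<in> carrier (fob M (gp (gp S T) W))"
    "fmor M (gp (gp S T) W) (gp S (gp T W)) (alp S T W) x = fmor M (gp (gp S T) W) (gp S (gp T W)) (alp S T W) y"
  shows "x = y"
proof -
  let ?A = "gp (gp S T) W" let ?B = "gp S (gp T W)" let ?r = "res G r ?A ?B (ra S T W)"
  have g: "?A \<in> gsets G" "?B \<in> gsets G" using assms by simp_all
  have ar: "?r \<in> Ar ?B ?A" using ra_emaps(1)[OF assms(2-4)] g by simp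
  have "fmor M ?B ?A ?r (fmor M ?A ?B (alp S T W) z) = z" if "z \<in> carrier (fob M ?A)" for z
    using lin_functorD(4)[OF assms(1) g(1,2,1) alp_arr[OF assms(2-4)] ar that] res_tr_inj[OF ra_emaps[OF assms(2-4)] g] lin_functorD(3)[OF assms(1) g(1) that]
    by (simp add: alp_def)
  then show ?thesis using assms(5-7) by metis
qed

text \<open>Only \<open>t2\<close>, which does not involve \<open>\<mu>\<close>, is computed with
  explicit spans; \<open>\<mu>\<close> is brought in by \<open>ext_natural\<close>.\<close>

lemma ext_assoc: assumes "\<kappa> \<in> Ar pt S" "\<mu> \<in> Ar pt T" "S \<in> gsets G" "T \<in> gsets G" "W \<in> gsets G"
  shows "cmpL W (gp (gp S T) W) (gp S (gp T W)) (alp S T W) (ext (gp S T) (cmpL pt T (gp S T) (ext S \<kappa> T) \<mu>) W) =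
    cmpL W (gp T W) (gp S (gp T W)) (ext S \<kappa> (gp T W)) (ext T \<mu> W)"
proof -
  obtain U l h where k: "(U, l, h) \<in> spans G r pt S" "\<kappa> = cl pt S (U, l, h)" using arrE[OF assms(1)] .
  note s = spansD[OF k(1)]
  note x = ext_cl[OF k(1) assms(4)] ext_cl[OF k(1) gprod_gset[OF assms(4,5)]]
  note p = span_prod_spans[OF x(2) idspan[OF assms(5)]]
  note t = cmpL_tr[OF p[unfolded span_prod_eq] emapsO_inj[OF _ _ ra_emaps[OF assms(3-5)]]]
  have t2: "cmpL (gp T W) (gp (gp S T) W) (gp S (gp T W)) (alp S T W) (lprod G r T (gp S T) W W (ext S \<kappa> T) (idL W)) = ext S \<kappa> (gp T W)"
  proof -
    let ?l1 = "\<lambda>z\<in>pts (gp (gp U T) W). prod_encode ((\<lambda>z\<in>pts (gp U T). psnd z) (pfst z), (\<lambda>x\<in>pts W. x) (psnd z))"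
    let ?h1 = "\<lambda>z\<in>pts (gp (gp U T) W). prod_encode ((\<lambda>z\<in>pts (gp U T). prod_encode (h (pfst z), psnd z)) (pfst z), (\<lambda>x\<in>pts W. x) (psnd z))"
    have "cl (gp T W) (gp S (gp T W)) (gp (gp U T) W, ?l1, \<lambda>v\<in>pts (gp (gp U T) W). ra S T W (?h1 v)) =
       cl (gp T W) (gp S (gp T W)) (gp U (gp T W), \<lambda>z\<in>pts (gp U (gp T W)). psnd z, \<lambda>z\<in>pts (gp U (gp T W)). prod_encode (h (pfst z), psnd z))"
      by (rule cl_eqI[OF t(2) x(4), where f = reassoc and f' = "\<lambda>z. prod_encode (prod_encode (pfst z, pfst (psnd z)), psnd (psnd z))"])
        (use assms(3-5) in \<open>auto simp: reassoc_def s(1) emapsD[OF s(3)]\<close>)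
    then show ?thesis unfolding k(2) x(1,3) idL_eq lprod_cl[OF x(2) idspan[OF assms(5)]] span_prod_eq
      using t(1) assms(3-5) by (simp add: alp_def)
  qed
  have e: "ext S \<kappa> T \<in> Ar T (gp S T)" using assms by simp
  have l: "lprod G r T (gp S T) W W (ext S \<kappa> T) (idL W) \<in> Ar (gp T W) (gp (gp S T) W)" using lprod_arr[OF e idL_arr[OF assms(5)]] .
  have "ext (gp S T) (cmpL pt T (gp S T) (ext S \<kappa> T) \<mu>) W = cmpL W (gp T W) (gp (gp S T) W) (lprod G r T (gp S T) W W (ext S \<kappa> T) (idL W)) (ext T \<mu> W)"
    using ext_natural[OF e idL_arr[OF assms(5)] assms(2) assms(5,5) assms(4) gprod_gset[OF assms(3,4)]]
      cmpL_idL[OF ext_arr[OF cmpL_arr[OF assms(2) e] assms(5)] assms(5)] by simp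
  then show ?thesis using cmpL_assoc[OF ext_arr[OF assms(2,5)] l alp_arr[OF assms(3-5)]] t2 by simp
qed

text \<open>The functor \<open>S \<mapsto> M(S \<times> T)\<close>. Its value at the point is a copy
  of \<open>M(T)\<close>, so Yoneda turns an element of \<open>M(T)\<close> into a map out of
  \<open>A\<close>.\<close>

definition shift :: "('a, 'v) mfun \<Rightarrow> 'a gset \<Rightarrow> ('a, 'v) mfun" where
  "shift M T = \<lparr>fob = (\<lambda>S. fob M (gp S T)), fmor = (\<lambda>S S' X. fmor M (gp S T) (gp S' T) (lprod G r S S' T T X (idL T)))\<rparr>"

lemma shift_simps [simp]: "fob (shift M T) S = fob M (gp S T)"
  "fmor (shift M T) S S' X = fmor M (gp S T) (gp S' T) (lprod G r S S' T T X (idL T))"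
  by (simp_all add: shift_def)

text \<open>For additivity, a splitting of an apex \<open>U\<close> induces a splitting of
  \<open>U \<times> T\<close>, by \<open>span_prod_rst1\<close>.\<close>

lemma mack_shift: assumes "mack M" and T: "T \<in> gsets G" shows "mack (shift M T)"
  unfolding mack_def
proof
  note M = lin_functorD[OF mackD(1)[OF assms(1)]]
  have la: "lprod G r S S' T T X (idL T) \<in> Ar (gp S T) (gp S' T)" if "X \<in> Ar S S'" for S S' X
    using lprod_arr[OF that idL_arr[OF T]] .
  show "lin_functor (shift M T)"
  proof (rule lin_functorI, unfold shift_simps)
    fix S W X Y R m assume a: "S \<in> gsets G" "W \<in> gsets G" "R \<in> gsets G" "X \<in> Ar S W" "Y \<in> Ar W R" "m \<in> carrier (fob M (gp S T))"
    have "lprod G r S R T T (cmpL S W R Y X) (idL T) = cmpL (gp S T) (gp W T) (gp R T) (lprod G r W R T T Y (idL T)) (lprod G r S W T T X (idL T))"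
      using lprod_cmpL[OF a(4,5) idL_arr[OF T] idL_arr[OF T]] T by simp
    then show "fmor M (gp S T) (gp R T) (lprod G r S R T T (cmpL S W R Y X) (idL T)) m =
       fmor M (gp W T) (gp R T) (lprod G r W R T T Y (idL T)) (fmor M (gp S T) (gp W T) (lprod G r S W T T X (idL T)) m)"
      using M(4)[OF _ _ _ la[OF a(4)] la[OF a(5)] a(6)] a T by simp
  qed (use M T la in \<open>simp_all add: lprod_idL\<close>)
  show "additive (shift M T)" unfolding additive_def shift_simps
  proof (intro ballI allI impI)
    fix S S' U l h B m
    assume S: "S \<in> gsets G" "S' \<in> gsets G" and sp: "(U, l, h) \<in> spans G r S S'" and B: "invar U B" and m: "m \<in> carrier (fob M (gp S T))"
    note U = spansD(1)[OF sp]
    have C: "invar U (pts U - B)" by (rule invar_compl[OF U B])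
    note b = span_prod_rst1[OF sp idspan[OF T] B] and c = span_prod_rst1[OF sp idspan[OF T] C]
    have e: "{z \<in> pts (gp U T). pfst z \<in> pts U - B} = pts (gp U T) - {z \<in> pts (gp U T). pfst z \<in> B}" by auto
    note p = span_prod_spans[OF sp idspan[OF T]]
    have g: "gp S T \<in> gsets G" "gp S' T \<in> gsets G" using S T by auto
    show "fmor M (gp S T) (gp S' T) (lprod G r S S' T T (cl S S' (U, l, h)) (idL T)) m =
       fmor M (gp S T) (gp S' T) (lprod G r S S' T T (cl S S' (rst (U, l, h) B)) (idL T)) m \<oplus>\<^bsub>fob M (gp S' T)\<^esub>
       fmor M (gp S T) (gp S' T) (lprod G r S S' T T (cl S S' (rst (U, l, h) (pts U - B))) (idL T)) m"
      unfolding idL_eq lprod_cl[OF sp idspan[OF T]] lprod_cl[OF rst_spans[OF sp B] idspan[OF T]] lprod_cl[OF rst_spans[OF sp C] idspan[OF T]]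
        b(1) c(1) e
      using additiveD[OF mackD(2)[OF assms(1)] g p[unfolded span_prod_eq] b(2) m] unfolding span_prod_eq .
  qed
qed

text \<open>The external product of \<open>A(S)\<close> and \<open>M(T)\<close> with values in
  \<open>M(S \<times> T)\<close>: the Yoneda map into \<open>shift M T\<close> that belongs to
  \<open>m\<close>. For \<open>e = one_A\<close> it becomes the universal pairing of
  \<open>A\<close> and \<open>M\<close>.\<close>

definition box :: "('a, 'v) mfun \<Rightarrow> 'a gset \<Rightarrow> 'a gset \<Rightarrow> ('a, 'u) val \<Rightarrow> 'v \<Rightarrow> 'v" where
  "box M S T a m = yo (shift M T) (fmor M T (gp pt T) (ptinv T) m) S a"

context
  fixes M :: "('a, 'v) mfun"
  assumes M: "mack M"
begin

lemmas Ml = lin_functorD[OF mackD(1)[OF M]]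

lemma box_lin1: assumes "S \<in> gsets G" "T \<in> gsets G" "m \<in> carrier (fob M T)"
  shows "lin (bob S) (fob M (gp S T)) (\<lambda>a. box M S T a m)"
  unfolding box_def using yo_lin[OF mack_shift[OF M assms(2)], of "fmor M T (gp pt T) (ptinv T) m" S] assms Ml by simp

lemma box_bel: assumes "S \<in> gsets G" "T \<in> gsets G" "m \<in> carrier (fob M T)" "Y \<in> Ar pt S"
  shows "box M S T (bel S Y) m = fmor M T (gp S T) (ext S Y T) m"
  unfolding box_def ext_def
  using yo_bel[OF mack_shift[OF M assms(2)], of "fmor M T (gp pt T) (ptinv T) m" S Y] assms Ml by simp

lemma box_delta: assumes "S \<in> gsets G" "T \<in> gsets G" "m \<in> carrier (fob M T)" "\<kappa> \<in> Om S"
  shows "box M S T (delta \<kappa>) m = fmor M T (gp S T) (ext S \<kappa> T) m"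
  using box_bel[OF assms(1-3) Om_arr[OF assms(4)]] bel_Om[OF assms(4)] by metis

lemma box_closed [simp]: assumes "S \<in> gsets G" "T \<in> gsets G" "m \<in> carrier (fob M T)" "a \<in> carrier (bob S)"
  shows "box M S T a m \<in> carrier (fob M (gp S T))"
  using linD(1)[OF box_lin1[OF assms(1-3)] assms(4)] .

lemma box_lin2: assumes "S \<in> gsets G" "T \<in> gsets G" "a \<in> carrier (bob S)"
  shows "lin (fob M T) (fob M (gp S T)) (\<lambda>m. box M S T a m)"
proof -
  have V: "vs (fob M T)" "vs (fob M (gp S T))" using Ml assms by simp_all
  have L: "lin (fob M T) (fob M (gp S T)) (fmor M T (gp S T) (ext S \<kappa> T))" if "\<kappa> \<in> Om S" for \<kappa>
    using linmaps_lin[OF Ml(2)] that assms by simp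
  have 1: "box M S T a (m \<oplus>\<^bsub>fob M T\<^esub> m') = box M S T a m \<oplus>\<^bsub>fob M (gp S T)\<^esub> box M S T a m'"
    if m: "m \<in> carrier (fob M T)" "m' \<in> carrier (fob M T)" for m m'
    by (rule bob_lin_eqI[OF box_lin1 lin_add[OF box_lin1 box_lin1 V(2)] V(2) _ assms(3)])
      (use assms m V linD(2)[OF L] in \<open>simp_all add: box_delta\<close>)
  have 2: "box M S T a (q \<odot>\<^bsub>fob M T\<^esub> m) = q \<odot>\<^bsub>fob M (gp S T)\<^esub> box M S T a m"
    if m: "m \<in> carrier (fob M T)" for q m
  proof (rule bob_lin_eqI[OF box_lin1 _ V(2) _ assms(3)])
    have "lin (fob M (gp S T)) (fob M (gp S T)) (\<lambda>x. q \<odot>\<^bsub>fob M (gp S T)\<^esub> x)"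
      using V(2) by (simp add: lin_def vs_smult mult.commute)
    then show "lin (bob S) (fob M (gp S T)) (\<lambda>a. q \<odot>\<^bsub>fob M (gp S T)\<^esub> box M S T a m)"
      using lin_comp[OF box_lin1[OF assms(1,2) m]] by blast
  qed (use assms m V linD(3)[OF L] in \<open>simp_all add: box_delta\<close>)
  show ?thesis unfolding lin_def using 1 2 assms by simp
qed

lemma box_natural: assumes g: "S \<in> gsets G" "S' \<in> gsets G" "T \<in> gsets G" "T' \<in> gsets G" and X: "X \<in> Ar S S'" and Y: "Y \<in> Ar T T'"
    and a: "a \<in> carrier (bob S)" and m: "m \<in> carrier (fob M T)"
  shows "fmor M (gp S T) (gp S' T') (lprod G r S S' T T' X Y) (box M S T a m) = box M S' T' (fmor A S S' X a) (fmor M T T' Y m)"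
proof (rule bob_lin_eqI[OF lin_comp[OF box_lin1 linmaps_lin[OF Ml(2)]] lin_comp[OF fmor_A_lin box_lin1] Ml(1) _ a])
  fix \<kappa> assume k: "\<kappa> \<in> Om S"
  have Ym: "fmor M T T' Y m \<in> carrier (fob M T')" using Ml(5) g Y m by simp
  have e: "ext S \<kappa> T \<in> Ar T (gp S T)" "lprod G r S S' T T' X Y \<in> Ar (gp S T) (gp S' T')"
     "cmpL pt S S' X \<kappa> \<in> Ar pt S'" "ext S' (cmpL pt S S' X \<kappa>) T' \<in> Ar T' (gp S' T')"
    using ext_arr[OF Om_arr[OF k] g(3)] lprod_arr[OF X Y] cmpL_arr[OF Om_arr[OF k] X]
      ext_arr[OF cmpL_arr[OF Om_arr[OF k] X] g(4)] by simp_all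
  have "fmor M (gp S T) (gp S' T') (lprod G r S S' T T' X Y) (fmor M T (gp S T) (ext S \<kappa> T) m) =
     fmor M T' (gp S' T') (ext S' (cmpL pt S S' X \<kappa>) T') (fmor M T T' Y m)"
    using Ml(4)[OF g(3) gprod_gset[OF g(1,3)] gprod_gset[OF g(2,4)] e(1,2) m]
      Ml(4)[OF g(3,4) gprod_gset[OF g(2,4)] Y e(4) m] ext_natural[OF X Y Om_arr[OF k] g(3,4,1,2)] by simp
  then show "fmor M (gp S T) (gp S' T') (lprod G r S S' T T' X Y) (box M S T (delta \<kappa>) m) = box M S' T' (fmor A S S' X (delta \<kappa>)) (fmor M T T' Y m)"
    using g m k Ym e(3) by (simp add: box_delta fmor_A_delta box_bel)
qed (use g X Y m Ml(5) in \<open>simp_all\<close>)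

lemma box_Hom: assumes t: "t \<in> Hom M N" and N: "mack N" and g: "S \<in> gsets G" "T \<in> gsets G" and a: "a \<in> carrier (bob S)" and m: "m \<in> carrier (fob M T)"
  shows "t (gp S T) (box M S T a m) = yo (shift N T) (fmor N T (gp pt T) (ptinv T) (t T m)) S a"
proof -
  note Nl = lin_functorD[OF mackD(1)[OF N]] note t' = HomD[OF t]
  have n: "fmor N T (gp pt T) (ptinv T) (t T m) \<in> carrier (fob (shift N T) pt)"
    using Nl(5) g t'(2) m by simp
  show ?thesis
  proof (rule bob_lin_eqI[OF lin_comp[OF box_lin1 linmaps_lin[OF t'(1)]] yo_lin[OF mack_shift[OF N g(2)] n g(1), simplified] _ _ a])
    fix \<kappa> assume k: "\<kappa> \<in> Om S"
    have "t (gp S T) (fmor M T (gp S T) (ext S \<kappa> T) m) = fmor N T (gp S T) (ext S \<kappa> T) (t T m)"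
      using t'(5) k g m by simp
    then show "t (gp S T) (box M S T (delta \<kappa>) m) = yo (shift N T) (fmor N T (gp pt T) (ptinv T) (t T m)) S (delta \<kappa>)"
      using Nl(4)[OF g(2) _ _ ptinv_arr[OF g(2)] lprod_arr[OF Om_arr[OF k] idL_arr[OF g(2)]] t'(2)[OF g(2) m]] g m k
      by (simp add: box_delta yo_delta[OF mack_shift[OF N g(2)] n g(1) k] ext_def)
  qed (use g m Nl(1) in simp_all)
qed

lemma box_one: assumes "T \<in> gsets G" "m \<in> carrier (fob M T)"
  shows "fmor M (gp pt T) T (ptiso T) (box M pt T (one_A :: ('a, 'u) val) m) = m"
proof -
  have "ext pt (idL pt) T = ptinv T" unfolding ext_def using assms by (simp add: lprod_idL)
  then have "box M pt T (one_A :: ('a, 'u) val) m = fmor M T (gp pt T) (ptinv T) m"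
    using box_bel[OF gpt_gset assms idL_arr[OF gpt_gset]] by (simp add: one_A_def)
  then show ?thesis using Ml(4)[OF assms(1) _ assms(1) ptinv_arr[OF assms(1)] ptiso_arr[OF assms(1)] assms(2)]
     ptiso_ptinv[OF assms(1)] Ml(3)[OF assms] assms(1) by simp
qed

end

lemma box_Hom': assumes "mack M" "t \<in> Hom M N" "mack N" "S \<in> gsets G" "T \<in> gsets G" "a \<in> carrier (bob S)" "m \<in> carrier (fob M T)"
  shows "t (gp S T) (box M S T a m) = box N S T a (t T m)"
  using box_Hom[OF assms] by (simp add: box_def)

text \<open>Both sides are linear in \<open>a\<close> and in \<open>b\<close>, so one reduces first
  to an orbit for \<open>a\<close> and then to an orbit for \<open>b\<close>; what remains is
  \<open>ext_assoc\<close>.\<close>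

lemma box_assoc: fixes a b :: "('a, 'u) val"
  assumes M: "mack M" and g: "S \<in> gsets G" "T \<in> gsets G" "W \<in> gsets G"
    and a: "a \<in> carrier (bob S)" and b: "b \<in> carrier (bob T)" and m: "m \<in> carrier (fob M W)"
  shows "fmor M (gp (gp S T) W) (gp S (gp T W)) (alp S T W) (box M (gp S T) W (box A S T a b) m) = box M S (gp T W) a (box M T W b m)"
proof -
  note Ml = lin_functorD[OF mackD(1)[OF M]]
  have A1: "lin (bob T) (bob (gp S T)) (\<lambda>b. box A S T a (b :: ('a, 'u) val))" if "a \<in> carrier (bob S)" for a :: "('a, 'u) val"
    using box_lin2[OF mack_A g(1,2) that] by simp
  have A2: "lin (bob S) (bob (gp S T)) (\<lambda>a :: ('a, 'u) val. box A S T a (b :: ('a, 'u) val))" if "b \<in> carrier (bob T)" for b :: "('a, 'u) val"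
    using box_lin1[OF mack_A g(1,2)] that by simp
  have 1: "fmor M (gp (gp S T) W) (gp S (gp T W)) (alp S T W) (box M (gp S T) W (box A S T (delta \<kappa> :: ('a, 'u) val) b) m) = box M S (gp T W) (delta \<kappa> :: ('a, 'u) val) (box M T W b m)"
    if k: "\<kappa> \<in> Om S" for \<kappa>
  proof (rule bob_lin_eqI[OF lin_comp[OF lin_comp[OF A1 box_lin1[OF M]] linmaps_lin[OF Ml(2)]] lin_comp[OF box_lin1[OF M] box_lin2[OF M]] Ml(1) _ b])
    fix \<mu> assume u: "\<mu> \<in> Om T"
    let ?x = "cmpL pt T (gp S T) (ext S \<kappa> T) \<mu>"
    have e: "ext S \<kappa> T \<in> Ar T (gp S T)" "ext T \<mu> W \<in> Ar W (gp T W)" "ext S \<kappa> (gp T W) \<in> Ar (gp T W) (gp S (gp T W))"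
      using k u g by simp_all
    have x: "?x \<in> Ar pt (gp S T)" by (rule cmpL_arr[OF Om_arr[OF u] e(1)])
    have "box A S T (delta \<kappa> :: ('a, 'u) val) (delta \<mu>) = (bel (gp S T) ?x :: ('a, 'u) val)"
      using box_delta[OF mack_A g(1,2) _ k, of "delta \<mu> :: ('a, 'u) val"] u by (simp add: fmor_A_delta)
    then show "fmor M (gp (gp S T) W) (gp S (gp T W)) (alp S T W) (box M (gp S T) W (box A S T (delta \<kappa> :: ('a, 'u) val) (delta \<mu> :: ('a, 'u) val)) m) = box M S (gp T W) (delta \<kappa> :: ('a, 'u) val) (box M T W (delta \<mu> :: ('a, 'u) val) m)"
      using Ml(4)[OF g(3) _ _ ext_arr[OF x g(3)] alp_arr[OF g] m]
        Ml(4)[OF g(3) _ _ e(2,3) m] ext_assoc[OF Om_arr[OF k] Om_arr[OF u] g] g m k u Ml(5)[OF g(3) _ e(2) m]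
      by (simp add: box_delta[OF M] box_bel[OF M _ g(3) m x])
  qed (use g k m box_closed[OF M] in simp_all)
  show ?thesis
    by (rule bob_lin_eqI[OF lin_comp[OF lin_comp[OF A2 box_lin1[OF M]] linmaps_lin[OF Ml(2)]] box_lin1[OF M] Ml(1) 1 a])
      (use g b m box_closed[OF M] in simp_all)
qed

subsection \<open>The action of the Burnside ring\<close>

text \<open>The concrete form of \<open>elt_act\<close>, built without any chosen Day convolution;
  \<open>elt_act_eq\<close> identifies the two.\<close>

definition cact :: "('a, 'v) mfun \<Rightarrow> 'a gset \<Rightarrow> ('a, 'u) val \<Rightarrow> 'v \<Rightarrow> 'v" where
  "cact M T a m = fmor M (gp pt T) T (ptiso T) (box M pt T a m)"

lemma cact_lin1: assumes "mack M" "T \<in> gsets G" "m \<in> carrier (fob M T)"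
  shows "lin (bob pt) (fob M T) (\<lambda>a. cact M T a m)"
  unfolding cact_def
  by (rule lin_comp[OF box_lin1[OF assms(1) gpt_gset assms(2,3)] linmaps_lin[OF Ml(2)[OF assms(1)]]]) (use assms in simp_all)

lemma cact_lin2: assumes "mack M" "T \<in> gsets G" "a \<in> carrier (bob pt)"
  shows "lin (fob M T) (fob M T) (\<lambda>m. cact M T a m)"
  unfolding cact_def
  by (rule lin_comp[OF box_lin2[OF assms(1) gpt_gset assms(2,3)] linmaps_lin[OF Ml(2)[OF assms(1)]]]) (use assms in simp_all)

lemma cact_closed [simp]: assumes "mack M" "T \<in> gsets G" "m \<in> carrier (fob M T)" "a \<in> carrier (bob pt)"
  shows "cact M T a m \<in> carrier (fob M T)"
  using linD(1)[OF cact_lin1[OF assms(1-3)] assms(4)] .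

lemma cact_natural: assumes M: "mack M" and g: "T \<in> gsets G" "T' \<in> gsets G" and Y: "Y \<in> Ar T T'"
    and m: "m \<in> carrier (fob M T)" and a: "a \<in> carrier (bob pt)"
  shows "fmor M T T' Y (cact M T a m) = cact M T' a (fmor M T T' Y m)"
proof -
  note Ml = Ml[OF M]
  have b: "box M pt T a m \<in> carrier (fob M (gp pt T))" using box_closed[OF M gpt_gset g(1) m a] .
  have "fmor M T T' Y (cact M T a m) = fmor M (gp pt T) T' (cmpL (gp pt T) T T' Y (ptiso T)) (box M pt T a m)"
    unfolding cact_def using Ml(4)[OF _ g(1,2) ptiso_arr[OF g(1)] Y b] g by simp
  also have "\<dots> = fmor M (gp pt T') T' (ptiso T') (fmor M (gp pt T) (gp pt T') (lprod G r pt pt T T' (idL pt) Y) (box M pt T a m))"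
    unfolding ptiso_natural[OF Y g, symmetric]
    using Ml(4)[OF _ _ g(2) lprod_arr[OF idL_arr[OF gpt_gset] Y] ptiso_arr[OF g(2)] b] g by simp
  also have "fmor M (gp pt T) (gp pt T') (lprod G r pt pt T T' (idL pt) Y) (box M pt T a m) = box M pt T' a (fmor M T T' Y m)"
    using box_natural[OF M gpt_gset gpt_gset g idL_arr[OF gpt_gset] Y a m] lin_functorD(3)[OF mackD(1)[OF mack_A] gpt_gset, simplified, OF a] by simp
  finally show ?thesis unfolding cact_def .
qed

lemma cact_Hom: assumes "mack M" "t \<in> Hom M N" "mack N" "T \<in> gsets G" "a \<in> carrier (bob pt)" "m \<in> carrier (fob M T)"
  shows "t T (cact M T a m) = cact N T a (t T m)"
  unfolding cact_def using HomD(5)[OF assms(2) _ assms(4) ptiso_arr[OF assms(4)] box_closed[OF assms(1) gpt_gset assms(4,6,5)]]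
    box_Hom'[OF assms(1-3) gpt_gset assms(4-6)] assms(4) by simp

lemma cact_one: "mack M \<Longrightarrow> T \<in> gsets G \<Longrightarrow> m \<in> carrier (fob M T) \<Longrightarrow> cact M T one_A m = m"
  unfolding cact_def by (rule box_one)

lemma box_cact2: assumes M: "mack M" and g: "S \<in> gsets G" "T \<in> gsets G" and m: "m \<in> carrier (fob M T)"
    and a: "a \<in> carrier (bob S)" and e: "e \<in> carrier (bob pt)"
  shows "box M S T a (cact M T e m) = cact M (gp S T) e (box M S T a m)"
proof (rule bob_lin_eqI[OF box_lin1[OF M g] lin_comp[OF box_lin1[OF M g m] cact_lin2[OF M]] _ _ a])
  show "box M S T (delta \<kappa>) (cact M T e m) = cact M (gp S T) e (box M S T (delta \<kappa>) m)" if "\<kappa> \<in> Om S" for \<kappa>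
    unfolding box_delta[OF M g m that] box_delta[OF M g cact_closed[OF M g(2) m e] that]
    using cact_natural[OF M g(2) gprod_gset[OF g] ext_arr[OF Om_arr[OF that] g(2)] m e] .
qed (use M g m e Ml[OF M] in simp_all)

lemma box_pt: assumes M: "mack M" and g: "T \<in> gsets G" and m: "m \<in> carrier (fob M T)" and e: "e \<in> carrier (bob pt)"
  shows "box M pt T e m = fmor M T (gp pt T) (ptinv T) (cact M T e m)"
  unfolding cact_def
  using Ml(4)[OF M _ g _ ptiso_arr[OF g] ptinv_arr[OF g] box_closed[OF M gpt_gset g m e]] ptinv_ptiso[OF g]
    Ml(3)[OF M _ box_closed[OF M gpt_gset g m e]] g by simp

lemma delta_one: assumes "\<kappa> \<in> Om S" shows "delta \<kappa> = fmor A pt S \<kappa> one_A"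
  unfolding one_A_def fmor_A_bel[OF Om_arr[OF assms] idL_arr[OF gpt_gset]] using assms by (simp add: bel_Om)

text \<open>The unit law on the other side from \<open>cact_one\<close>. On orbits it is the
  identity \<open>ptiso_conj_pt\<close> between spans over the point.\<close>

lemma cact_A_one: fixes a :: "('a, 'u) val"
  assumes a: "a \<in> carrier (bob pt)" shows "cact A pt a one_A = a"
proof (rule bob_lin_eqI[OF cact_lin1[OF mack_A gpt_gset, unfolded fob_A, OF one_A_bob] _ vs_bob _ a])
  fix \<kappa> assume k: "\<kappa> \<in> Om pt"
  have e: "ext pt \<kappa> pt \<in> Ar pt (gp pt pt)" using k by simp
  have l: "lprod G r pt pt pt pt \<kappa> (idL pt) \<in> Ar (gp pt pt) (gp pt pt)" using k by simp
  have "cmpL pt (gp pt pt) pt (ptiso pt) (ext pt \<kappa> pt) = \<kappa>"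
    unfolding ext_def using cmpL_assoc[OF ptinv_arr[OF gpt_gset] l ptiso_arr[OF gpt_gset]] ptiso_conj_pt[OF Om_arr[OF k]] by simp
  then show "cact A pt (delta \<kappa> :: ('a, 'u) val) one_A = (delta \<kappa> :: ('a, 'u) val)"
    using cmpL_assoc[OF idL_arr[OF gpt_gset] e ptiso_arr[OF gpt_gset]] cmpL_idL[OF e gpt_gset] k
    unfolding cact_def box_delta[OF mack_A gpt_gset gpt_gset, unfolded fob_A, OF one_A_bob k]
    by (simp add: one_A_def fmor_A_bel bel_Om)
qed (simp_all add: lin_def)

text \<open>An orbit is \<open>fmor A pt S \<kappa> one_A\<close>, so acting on it by
  \<open>e\<close> gives \<open>fmor A pt S \<kappa> e\<close>. Naturality moves
  \<open>\<kappa>\<close> outside, and \<open>box_pt\<close> turns the remaining \<open>e\<close>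
  into the action on \<open>m\<close>. With \<open>box_cact2\<close>, a scalar can be moved out of
  either factor.\<close>

lemma box_cact1: fixes a e :: "('a, 'u) val"
  assumes M: "mack M" and g: "S \<in> gsets G" "T \<in> gsets G" and m: "m \<in> carrier (fob M T)"
    and a: "a \<in> carrier (bob S)" and e: "e \<in> carrier (bob pt)"
  shows "box M S T (cact A S e a) m = cact M (gp S T) e (box M S T a m)"
proof (rule bob_lin_eqI[OF lin_comp[OF cact_lin2[OF mack_A g(1) e, unfolded fob_A] box_lin1[OF M g m]] lin_comp[OF box_lin1[OF M g m] cact_lin2[OF M]] _ _ a])
  fix \<kappa> assume k: "\<kappa> \<in> Om S"
  have l: "lprod G r pt S T T \<kappa> (idL T) \<in> Ar (gp pt T) (gp S T)" using k g by simp
  have "cact A S e (delta \<kappa> :: ('a, 'u) val) = fmor A pt S \<kappa> e"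
    unfolding delta_one[OF k] cact_natural[OF mack_A gpt_gset g(1) Om_arr[OF k], unfolded fob_A, OF one_A_bob e, symmetric]
    using cact_A_one[OF e] by simp
  moreover have "box M S T (fmor A pt S \<kappa> e) m = fmor M (gp pt T) (gp S T) (lprod G r pt S T T \<kappa> (idL T)) (box M pt T e m)"
    using box_natural[OF M gpt_gset g(1) g(2,2) Om_arr[OF k] idL_arr[OF g(2)] e m] Ml(3)[OF M g(2) m] by simp
  moreover have "\<dots> = fmor M T (gp S T) (ext S \<kappa> T) (cact M T e m)"
    unfolding box_pt[OF M g(2) m e] ext_def
    using Ml(4)[OF M g(2) _ _ ptinv_arr[OF g(2)] l cact_closed[OF M g(2) m e]] g by simp
  ultimately show "box M S T (cact A S e (delta \<kappa> :: ('a, 'u) val)) m = cact M (gp S T) e (box M S T (delta \<kappa> :: ('a, 'u) val) m)"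
    unfolding box_delta[OF M g m k] using cact_natural[OF M g(2) gprod_gset[OF g] ext_arr[OF Om_arr[OF k] g(2)] m e] by simp
qed (use M g m e Ml[OF M] in simp_all)

text \<open>The scalar \<open>b\<close> is moved out of the second factor of \<open>box\<close> and
  back into the first one, which explains the order of \<open>b\<close> and \<open>a\<close> on the
  right.\<close>

lemma cact_cact: fixes a b :: "('a, 'u) val"
  assumes M: "mack M" and g: "T \<in> gsets G" and m: "m \<in> carrier (fob M T)" and a: "a \<in> carrier (bob pt)" and b: "b \<in> carrier (bob pt)"
  shows "cact M T a (cact M T b m) = cact M T (cact A pt b a) m"
proof -
  have "box M pt T a (cact M T b m) = box M pt T (cact A pt b a) m"
    by (simp only: box_cact2[OF M gpt_gset g m a b] box_cact1[OF M gpt_gset g m a b])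
  then show ?thesis by (simp only: cact_def[of M T a] cact_def[of M T "cact A pt b a"])
qed

lemma yo_Hom_natural: assumes "mack P" "p \<in> carrier (fob P pt)" "t \<in> Hom P Q" "mack Q" "S \<in> gsets G" "a \<in> carrier (bob S)"
  shows "t S (yo P p S a) = yo Q (t pt p) S a"
proof -
  have tp: "t pt p \<in> carrier (fob Q pt)" using HomD(2)[OF assms(3) gpt_gset assms(2)] .
  show ?thesis
    by (rule bob_lin_eqI[OF lin_comp[OF yo_lin[OF assms(1,2,5)] linmaps_lin[OF HomD(1)[OF assms(3,5)]]] yo_lin[OF assms(4) tp assms(5)] Ml(1)[OF assms(4,5)] _ assms(6)])
      (use assms tp HomD(5)[OF assms(3) gpt_gset assms(5)] in \<open>simp_all add: yo_delta\<close>)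
qed

subsection \<open>Idempotent summands\<close>

text \<open>The image of \<open>e\<close> on \<open>M\<close>, a stand-in for
  \<open>summand\<close>: the latter is defined through the left unitor, whose existence will be
  derived from this very functor.\<close>

definition smd :: "('a, 'u) val \<Rightarrow> ('a, 'v) mfun \<Rightarrow> ('a, 'v) mfun" where
  "smd e M = \<lparr>fob = (\<lambda>S. (fob M S)\<lparr>carrier := cact M S e ` carrier (fob M S)\<rparr>),
      fmor = (\<lambda>S T X. restrict (fmor M S T X) (cact M S e ` carrier (fob M S)))\<rparr>"

definition idem_el :: "('a, 'u) val \<Rightarrow> bool" where
  "idem_el e \<longleftrightarrow> e \<in> carrier (bob pt) \<and> cact A pt e e = e"

lemma smd_simps [simp]: "x \<oplus>\<^bsub>fob (smd e M) S\<^esub> y = x \<oplus>\<^bsub>fob M S\<^esub> y"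
  "q \<odot>\<^bsub>fob (smd e M) S\<^esub> x = q \<odot>\<^bsub>fob M S\<^esub> x" "\<zero>\<^bsub>fob (smd e M) S\<^esub> = \<zero>\<^bsub>fob M S\<^esub>"
  by (simp_all add: smd_def)

lemma smd_mem: assumes "idem_el e" "mack M" "S \<in> gsets G"
  shows "x \<in> carrier (fob (smd e M) S) \<longleftrightarrow> x \<in> carrier (fob M S) \<and> cact M S e x = x"
proof -
  have e: "e \<in> carrier (bob pt)" "cact A pt e e = e" using assms(1) by (auto simp: idem_el_def)
  have "cact M S e (cact M S e m) = cact M S e m" if "m \<in> carrier (fob M S)" for m
    using cact_cact[OF assms(2,3) that e(1,1)] e(2) by simp
  moreover have "carrier (fob (smd e M) S) = cact M S e ` carrier (fob M S)" by (simp add: smd_def)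
  ultimately show ?thesis using cact_closed[OF assms(2,3) _ e(1)] by (auto simp: image_iff) metis
qed

lemma smd_cact [simp]: assumes "idem_el e" "mack M" "S \<in> gsets G" "m \<in> carrier (fob M S)"
  shows "cact M S e m \<in> carrier (fob (smd e M) S)"
  using assms by (simp add: smd_def)

lemma smd_fmor: "x \<in> carrier (fob (smd e M) S) \<Longrightarrow> fmor (smd e M) S T X x = fmor M S T X x"
  by (simp add: smd_def)

lemma lin_fixed: assumes "lin V V f" "vs V"
  shows "f \<zero>\<^bsub>V\<^esub> = \<zero>\<^bsub>V\<^esub>" using lin_zero[OF assms(1,2,2)] .

lemma mack_smd: assumes e: "idem_el e" and M: "mack M" shows "mack (smd e M)"
  unfolding mack_def
proof
  have eb: "e \<in> carrier (bob pt)" using e by (auto simp: idem_el_def)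
  note mem = smd_mem[OF e M] and Ml = Ml[OF M]
  note cl = cact_lin2[OF M _ eb]
  have fc: "fmor M S T X m \<in> carrier (fob (smd e M) T)"
    if a: "S \<in> gsets G" "T \<in> gsets G" "X \<in> Ar S T" and m: "m \<in> carrier (fob (smd e M) S)" for S T X m
  proof -
    have m': "m \<in> carrier (fob M S)" "cact M S e m = m" using m mem[OF a(1)] by auto
    then have "cact M T e (fmor M S T X m) = fmor M S T X m" using cact_natural[OF M a m'(1) eb] by metis
    then show ?thesis using mem[OF a(2)] Ml(5)[OF a m'(1)] by simp
  qed
  show "lin_functor (smd e M)"
  proof (rule lin_functorI)
    fix S assume S: "S \<in> gsets G"
    note V = Ml(1)[OF S] and L = linD[OF cl[OF S]]
    show "vs (fob (smd e M) S)"
      by (rule vsI) (use V L lin_fixed[OF cl[OF S] V] in \<open>auto simp: mem[OF S] vs_assoc vs_smult intro: vs_comm\<close>)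
  next
    fix S T X assume a: "S \<in> gsets G" "T \<in> gsets G" "X \<in> Ar S T"
    show "fmor (smd e M) S T X \<in> linmaps (fob (smd e M) S) (fob (smd e M) T)"
    proof (rule linmapsI)
      show "fmor (smd e M) S T X \<in> extensional (carrier (fob (smd e M) S))" by (simp add: smd_def)
      fix x q assume x: "x \<in> carrier (fob (smd e M) S)"
      show "fmor (smd e M) S T X x \<in> carrier (fob (smd e M) T)"
        using fc[OF a x] x by (simp add: smd_fmor)
      have "q \<odot>\<^bsub>fob M S\<^esub> x \<in> carrier (fob (smd e M) S)"
        using x a Ml(1) linD(3)[OF cl[OF a(1)]] by (simp add: mem)
      then show "fmor (smd e M) S T X (q \<odot>\<^bsub>fob (smd e M) S\<^esub> x) = q \<odot>\<^bsub>fob (smd e M) T\<^esub> fmor (smd e M) S T X x"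
        using x a linmapsD(3)[OF Ml(2)[OF a]] by (simp add: smd_fmor mem)
      fix y assume y: "y \<in> carrier (fob (smd e M) S)"
      have "x \<oplus>\<^bsub>fob M S\<^esub> y \<in> carrier (fob (smd e M) S)"
        using x y a Ml(1) linD(2)[OF cl[OF a(1)]] by (simp add: mem)
      then show "fmor (smd e M) S T X (x \<oplus>\<^bsub>fob (smd e M) S\<^esub> y) = fmor (smd e M) S T X x \<oplus>\<^bsub>fob (smd e M) T\<^esub> fmor (smd e M) S T X y"
        using x y a linmapsD(2)[OF Ml(2)[OF a]] by (simp add: smd_fmor mem)
    qed
  next
    fix S m assume "S \<in> gsets G" "m \<in> carrier (fob (smd e M) S)"
    then show "fmor (smd e M) S S (idL S) m = m" using Ml(3) by (simp add: smd_fmor mem)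
  next
    fix S T W X Y m assume a: "S \<in> gsets G" "T \<in> gsets G" "W \<in> gsets G" "X \<in> Ar S T" "Y \<in> Ar T W" "m \<in> carrier (fob (smd e M) S)"
    have "fmor M S T X m \<in> carrier (fob (smd e M) T)"
      by (rule fc[OF a(1,2,4,6)])
    then show "fmor (smd e M) S W (cmpL S T W Y X) m = fmor (smd e M) T W Y (fmor (smd e M) S T X m)"
      using a Ml(4) by (simp add: smd_fmor) (simp add: mem)
  qed
  show "additive (smd e M)"
    unfolding additive_def using additiveD[OF mackD(2)[OF M]] mem by (simp add: smd_fmor del: rst.simps)
qed

lemma Hom_restrict: assumes "t \<in> Hom M Q" "idem_el e" "mack M" 
  shows "(\<lambda>S\<in>gsets G. \<lambda>m\<in>carrier (fob (smd e M) S). t S m) \<in> Hom (smd e M) Q"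
  by (rule HomI[OF mack_smd[OF assms(2,3)]]) (use smd_mem[OF assms(2,3)] HomD[OF assms(1)] in \<open>auto simp: smd_fmor\<close>)

subsection \<open>Day convolution with a summand of the Burnside functor\<close>

text \<open>\<open>P\<close> is the image of the idempotent \<open>e\<close> on the Burnside functor, with generator \<open>p\<close>
  corresponding to \<open>e\<close> under the inclusion \<open>i\<close>.\<close>

definition cyc :: "('a, 'u) val \<Rightarrow> ('a, ('a, 'u) val) mfun \<Rightarrow> ('a, 'u) val \<Rightarrow> ('a, ('a, 'u) val) mtrafo \<Rightarrow> bool" where
  "cyc e P p i \<longleftrightarrow> mack P \<and> p \<in> carrier (fob P pt) \<and> i \<in> Hom P A \<and> i pt p = e \<and>
     (\<forall>S\<in>gsets G. \<forall>x\<in>carrier (fob P S). yo P p S (i S x) = x)"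

lemma cycD: assumes "cyc e P p i"
  shows "mack P" "p \<in> carrier (fob P pt)" "i \<in> Hom P A" "i pt p = e"
    "S \<in> gsets G \<Longrightarrow> x \<in> carrier (fob P S) \<Longrightarrow> yo P p S (i S x) = x"
    "S \<in> gsets G \<Longrightarrow> x \<in> carrier (fob P S) \<Longrightarrow> i S x \<in> carrier (bob S)" "e \<in> carrier (bob pt)"
proof -
  show *: "mack P" "p \<in> carrier (fob P pt)" "i \<in> Hom P A" "i pt p = e"
    "S \<in> gsets G \<Longrightarrow> x \<in> carrier (fob P S) \<Longrightarrow> yo P p S (i S x) = x" for S x
    using assms by (auto simp: cyc_def)
  show i: "S \<in> gsets G \<Longrightarrow> x \<in> carrier (fob P S) \<Longrightarrow> i S x \<in> carrier (bob S)" for S x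
    using HomD(2)[OF *(3)] by simp
  show "e \<in> carrier (bob pt)" using i[OF gpt_gset *(2)] *(4) by simp
qed

text \<open>The Yoneda map \<open>?q\<close> sends both \<open>one_A\<close> and \<open>e\<close> to
  \<open>p\<close>, the latter because \<open>e\<close> is the image of \<open>p\<close> under the
  section \<open>i\<close>. Since \<open>e\<close> is \<open>e\<close> acting on
  \<open>one_A\<close>, the generator \<open>p\<close> is fixed by \<open>e\<close>; hence so is all
  of \<open>P\<close>, and applying \<open>i\<close> to \<open>p\<close> shows that \<open>e\<close>
  is idempotent.\<close>

lemma cyc_fixed: fixes e p :: "('a, 'u) val"
  assumes c: "cyc e P p i" shows "S \<in> gsets G \<Longrightarrow> x \<in> carrier (fob P S) \<Longrightarrow> cact P S e x = x"
    "cact P pt e p = p" "idem_el e"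
proof -
  note P = cycD[OF c]
  let ?q = "\<lambda>S\<in>gsets G. \<lambda>m\<in>carrier (bob S). yo P p S (m :: ('a, 'u) val)"
  have q: "?q \<in> Hom A P" by (rule yo_Hom[OF P(1,2)])
  have 1: "?q pt (one_A :: ('a, 'u) val) = p" by (simp add: yo_one[OF P(1,2)])
  have 2: "?q pt e = p" using P(5)[OF gpt_gset P(2)] P(4,7) by simp
  show 3: "cact P pt e p = p"
    using cact_Hom[OF mack_A q P(1) gpt_gset P(7), of one_A] cact_A_one[OF P(7)] 1 2 P(7) by simp
  show "cact P S e x = x" if S: "S \<in> gsets G" and x: "x \<in> carrier (fob P S)"
  proof -
    have "cact P S e (yo P p S a) = yo P p S a" if "a \<in> carrier (bob S)" for a :: "('a, 'u) val"
    proof (rule bob_lin_eqI[OF lin_comp[OF yo_lin[OF P(1,2) S] cact_lin2[OF P(1) S P(7)]] yo_lin[OF P(1,2) S] Ml(1)[OF P(1) S] _ that])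
      fix \<kappa> assume k: "\<kappa> \<in> Om S"
      show "cact P S e (yo P p S (delta \<kappa>)) = yo P p S (delta \<kappa>)"
        unfolding yo_delta[OF P(1,2) S k] using cact_natural[OF P(1) gpt_gset S Om_arr[OF k] P(2,7)] 3 by simp
    qed
    then show ?thesis using P(5)[OF S x] P(6)[OF S x] by metis
  qed
  show "idem_el e"
    unfolding idem_el_def using P(7) cact_Hom[OF P(1,3) mack_A gpt_gset P(7,2)] 3 P(4) by simp
qed

lemma pairingD: assumes "is_pairing G r P M Q \<beta>" "S \<in> gsets G" "T \<in> gsets G"
  shows "x \<in> carrier (fob P S) \<Longrightarrow> m \<in> carrier (fob M T) \<Longrightarrow> \<beta> S T x m \<in> carrier (fob Q (gp S T))"
    "m \<in> carrier (fob M T) \<Longrightarrow> vs (fob P S) \<Longrightarrow> lin (fob P S) (fob Q (gp S T)) (\<lambda>x. \<beta> S T x m)"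
    "x \<in> carrier (fob P S) \<Longrightarrow> vs (fob M T) \<Longrightarrow> lin (fob M T) (fob Q (gp S T)) (\<lambda>m. \<beta> S T x m)"
    "x \<in> carrier (fob P S) \<Longrightarrow> m \<in> carrier (fob M T) \<Longrightarrow> S' \<in> gsets G \<Longrightarrow> T' \<in> gsets G \<Longrightarrow> X \<in> Ar S S' \<Longrightarrow> Y \<in> Ar T T' \<Longrightarrow>
     fmor Q (gp S T) (gp S' T') (lprod G r S S' T T' X Y) (\<beta> S T x m) = \<beta> S' T' (fmor P S S' X x) (fmor M T T' Y m)"
proof -
  have a: "(\<lambda>n\<in>carrier (fob M T). \<beta> S T x n) \<in> linmaps (fob M T) (fob Q (gp S T))" if "x \<in> carrier (fob P S)" for x
    using assms that unfolding is_pairing_def by blast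
  have b: "(\<lambda>n\<in>carrier (fob P S). \<beta> S T n m) \<in> linmaps (fob P S) (fob Q (gp S T))" if "m \<in> carrier (fob M T)" for m
    using assms that unfolding is_pairing_def by blast
  show "x \<in> carrier (fob P S) \<Longrightarrow> m \<in> carrier (fob M T) \<Longrightarrow> \<beta> S T x m \<in> carrier (fob Q (gp S T))"
    using linmapsD(1)[OF a, of x m] by simp
  have rl: "lin V W f" if "restrict f (carrier V) \<in> linmaps V W" "vs V" for V :: "(rat, 'd) module" and W :: "(rat, 'd) module" and f
    using linmaps_lin[OF that(1)] that(2) by (simp add: lin_def)
  show "m \<in> carrier (fob M T) \<Longrightarrow> vs (fob P S) \<Longrightarrow> lin (fob P S) (fob Q (gp S T)) (\<lambda>x. \<beta> S T x m)"
    using rl[OF b] by blast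
  show "x \<in> carrier (fob P S) \<Longrightarrow> vs (fob M T) \<Longrightarrow> lin (fob M T) (fob Q (gp S T)) (\<lambda>m. \<beta> S T x m)"
    using rl[OF a] by blast
  show "x \<in> carrier (fob P S) \<Longrightarrow> m \<in> carrier (fob M T) \<Longrightarrow> S' \<in> gsets G \<Longrightarrow> T' \<in> gsets G \<Longrightarrow> X \<in> Ar S S' \<Longrightarrow> Y \<in> Ar T T' \<Longrightarrow>
     fmor Q (gp S T) (gp S' T') (lprod G r S S' T T' X Y) (\<beta> S T x m) = \<beta> S' T' (fmor P S S' X x) (fmor M T T' Y m)"
    using assms unfolding is_pairing_def by blast
qed

lemma pairingI:
  assumes "mack P" "mack M"
    and 1: "\<And>S T m. S \<in> gsets G \<Longrightarrow> T \<in> gsets G \<Longrightarrow> m \<in> carrier (fob M T) \<Longrightarrow> lin (fob P S) (fob Q (gp S T)) (\<lambda>x. \<beta> S T x m)"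
    and 2: "\<And>S T x. S \<in> gsets G \<Longrightarrow> T \<in> gsets G \<Longrightarrow> x \<in> carrier (fob P S) \<Longrightarrow> lin (fob M T) (fob Q (gp S T)) (\<lambda>m. \<beta> S T x m)"
    and 3: "\<And>S T S' T' X Y x m. S \<in> gsets G \<Longrightarrow> T \<in> gsets G \<Longrightarrow> S' \<in> gsets G \<Longrightarrow> T' \<in> gsets G \<Longrightarrow> X \<in> Ar S S' \<Longrightarrow> Y \<in> Ar T T' \<Longrightarrow>
      x \<in> carrier (fob P S) \<Longrightarrow> m \<in> carrier (fob M T) \<Longrightarrow>
     fmor Q (gp S T) (gp S' T') (lprod G r S S' T T' X Y) (\<beta> S T x m) = \<beta> S' T' (fmor P S S' X x) (fmor M T T' Y m)"
  shows "is_pairing G r P M Q \<beta>"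
proof -
  have lr: "restrict f (carrier V) \<in> linmaps V W" if "lin V W f" "vs V" for V :: "(rat, 'd) module" and W :: "(rat, 'd) module" and f
    using that by (intro linmapsI) (auto simp: lin_def)
  show ?thesis unfolding is_pairing_def
    by (intro conjI ballI lr 1 2 3 Ml(1)[OF assms(1)] Ml(1)[OF assms(2)])
qed

text \<open>A pairing out of \<open>P\<close> and \<open>M\<close> is determined by its value on the generator.\<close>

definition gen_map :: "('a, 'v) mfun \<Rightarrow> ('a, 'v) mfun \<Rightarrow> 'v \<Rightarrow> ('a gset \<Rightarrow> 'a gset \<Rightarrow> 'v \<Rightarrow> 'v \<Rightarrow> 'v) \<Rightarrow> ('a, 'v) mtrafo" where
  "gen_map M Q p \<beta> = (\<lambda>T\<in>gsets G. \<lambda>m\<in>carrier (fob M T). fmor Q (gp pt T) T (ptiso T) (\<beta> pt T p m))"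

context
  fixes e p :: "('a, 'u) val" and P i and M :: "('a, ('a, 'u) val) mfun"
  assumes c: "cyc e P p i" and M: "mack M"
begin

lemmas P = cycD[OF c]

text \<open>Naturality of the pairing in the first variable, applied to an orbit
  \<open>\<kappa>\<close> and the generator, yields \<open>ext S \<kappa> T\<close> of the value of
  \<open>gen_map\<close>. As \<open>i\<close> is a section of the Yoneda map onto \<open>P\<close>,
  this covers all of \<open>P\<close>. The last formula follows because \<open>gen_map\<close> is
  natural and \<open>box\<close> commutes with natural maps.\<close>

lemma gen_map: assumes Q: "mack Q" and b: "is_pairing G r P M Q \<beta>"
  shows "gen_map M Q p \<beta> \<in> Hom M Q"
    "S \<in> gsets G \<Longrightarrow> T \<in> gsets G \<Longrightarrow> x \<in> carrier (fob P S) \<Longrightarrow> m \<in> carrier (fob M T) \<Longrightarrow>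
       \<beta> S T x m = box Q S T (i S x) (gen_map M Q p \<beta> T m)"
    "S \<in> gsets G \<Longrightarrow> T \<in> gsets G \<Longrightarrow> x \<in> carrier (fob P S) \<Longrightarrow> m \<in> carrier (fob M T) \<Longrightarrow>
       \<beta> S T x m = gen_map M Q p \<beta> (gp S T) (box M S T (i S x) m)"
proof -
  note Q' = lin_functorD[OF mackD(1)[OF Q]]
  show w: "gen_map M Q p \<beta> \<in> Hom M Q"
    unfolding gen_map_def
  proof (rule HomI[OF M])
    fix T m assume T: "T \<in> gsets G" and m: "m \<in> carrier (fob M T)"
    note L = lin_comp[OF pairingD(3)[OF b gpt_gset T P(2) Ml(1)[OF M T]] linmaps_lin[OF Q'(2)[OF _ T ptiso_arr[OF T]]]]
    show "fmor Q (gp pt T) T (ptiso T) (\<beta> pt T p m) \<in> carrier (fob Q T)" using linD(1)[OF L] T m by simp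
    fix m' assume "m' \<in> carrier (fob M T)"
    then show "fmor Q (gp pt T) T (ptiso T) (\<beta> pt T p (m \<oplus>\<^bsub>fob M T\<^esub> m')) =
      fmor Q (gp pt T) T (ptiso T) (\<beta> pt T p m) \<oplus>\<^bsub>fob Q T\<^esub> fmor Q (gp pt T) T (ptiso T) (\<beta> pt T p m')"
      using linD(2)[OF L] T m by simp
  next
    fix T m q assume T: "T \<in> gsets G" and m: "m \<in> carrier (fob M T)"
    note L = lin_comp[OF pairingD(3)[OF b gpt_gset T P(2) Ml(1)[OF M T]] linmaps_lin[OF Q'(2)[OF _ T ptiso_arr[OF T]]]]
    show "fmor Q (gp pt T) T (ptiso T) (\<beta> pt T p (q \<odot>\<^bsub>fob M T\<^esub> m)) = q \<odot>\<^bsub>fob Q T\<^esub> fmor Q (gp pt T) T (ptiso T) (\<beta> pt T p m)"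
      using linD(3)[OF L] T m by simp
  next
    fix T T' Y m assume a: "T \<in> gsets G" "T' \<in> gsets G" "Y \<in> Ar T T'" "m \<in> carrier (fob M T)"
    have bm: "\<beta> pt T p m \<in> carrier (fob Q (gp pt T))" using pairingD(1)[OF b gpt_gset a(1) P(2) a(4)] .
    have "fmor Q T T' Y (fmor Q (gp pt T) T (ptiso T) (\<beta> pt T p m)) = fmor Q (gp pt T) T' (cmpL (gp pt T) T T' Y (ptiso T)) (\<beta> pt T p m)"
      using Q'(4)[OF _ a(1,2) ptiso_arr[OF a(1)] a(3) bm] a by simp
    also have "\<dots> = fmor Q (gp pt T') T' (ptiso T') (fmor Q (gp pt T) (gp pt T') (lprod G r pt pt T T' (idL pt) Y) (\<beta> pt T p m))"
      unfolding ptiso_natural[OF a(3,1,2), symmetric]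
      using Q'(4)[OF _ _ a(2) lprod_arr[OF idL_arr[OF gpt_gset] a(3)] ptiso_arr[OF a(2)] bm] a by simp
    also have "fmor Q (gp pt T) (gp pt T') (lprod G r pt pt T T' (idL pt) Y) (\<beta> pt T p m) = \<beta> pt T' p (fmor M T T' Y m)"
      using pairingD(4)[OF b gpt_gset a(1) P(2) a(4) gpt_gset a(2) idL_arr[OF gpt_gset] a(3)] Ml(3)[OF P(1) gpt_gset P(2)] by simp
    finally show "fmor Q (gp pt T') T' (ptiso T') (\<beta> pt T' p (fmor M T T' Y m)) = fmor Q T T' Y (fmor Q (gp pt T) T (ptiso T) (\<beta> pt T p m))" ..
  qed
  show 1: "\<beta> S T x m = box Q S T (i S x) (gen_map M Q p \<beta> T m)" if S: "S \<in> gsets G" and T: "T \<in> gsets G" and x: "x \<in> carrier (fob P S)" and m: "m \<in> carrier (fob M T)" for S T x m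
  proof -
    have wm: "gen_map M Q p \<beta> T m \<in> carrier (fob Q T)" using HomD(2)[OF w T m] .
    have bm: "\<beta> pt T p m \<in> carrier (fob Q (gp pt T))" using pairingD(1)[OF b gpt_gset T P(2) m] .
    have "\<beta> S T (yo P p S a) m = box Q S T a (gen_map M Q p \<beta> T m)" if "a \<in> carrier (bob S)" for a :: "('a, 'u) val"
    proof (rule bob_lin_eqI[OF lin_comp[OF yo_lin[OF P(1,2) S] pairingD(2)[OF b S T m Ml(1)[OF P(1) S]]] box_lin1[OF Q S T wm] _ _ that])
      fix \<kappa> assume k: "\<kappa> \<in> Om S"
      have l: "lprod G r pt S T T \<kappa> (idL T) \<in> Ar (gp pt T) (gp S T)" using k T by simp
      have "fmor Q T (gp S T) (ext S \<kappa> T) (gen_map M Q p \<beta> T m) = fmor Q (gp pt T) (gp S T) (lprod G r pt S T T \<kappa> (idL T)) (fmor Q T (gp pt T) (ptinv T) (fmor Q (gp pt T) T (ptiso T) (\<beta> pt T p m)))"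
        unfolding ext_def using Q'(4)[OF T _ _ ptinv_arr[OF T] l wm] S T m by (simp add: gen_map_def)
      also have "\<dots> = fmor Q (gp pt T) (gp S T) (lprod G r pt S T T \<kappa> (idL T)) (\<beta> pt T p m)"
        using Q'(4)[OF _ T _ ptiso_arr[OF T] ptinv_arr[OF T] bm] ptinv_ptiso[OF T] Q'(3)[OF _ bm] T by simp
      also have "\<dots> = \<beta> S T (fmor P pt S \<kappa> p) m"
        using pairingD(4)[OF b gpt_gset T P(2) m S T Om_arr[OF k] idL_arr[OF T]] Ml(3)[OF M T m] by simp
      finally show "\<beta> S T (yo P p S (delta \<kappa>)) m = box Q S T (delta \<kappa>) (gen_map M Q p \<beta> T m)"
        unfolding yo_delta[OF P(1,2) S k] box_delta[OF Q S T wm k] ..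
    qed (use Q' S T in simp_all)
    then show ?thesis using P(5)[OF S x] P(6)[OF S x] by metis
  qed
  show "\<beta> S T x m = gen_map M Q p \<beta> (gp S T) (box M S T (i S x) m)" if S: "S \<in> gsets G" and T: "T \<in> gsets G" and x: "x \<in> carrier (fob P S)" and m: "m \<in> carrier (fob M T)"
    unfolding 1[OF that] using box_Hom'[OF M w Q S T P(6)[OF S x] m] ..
qed

lemma box_pairing: "is_pairing G r P M M (\<lambda>S T x m. box M S T (i S x) m)"
proof (rule pairingI[OF P(1) M])
  fix S T m assume a: "S \<in> gsets G" "T \<in> gsets G" "m \<in> carrier (fob M T)"
  show "lin (fob P S) (fob M (gp S T)) (\<lambda>x. box M S T (i S x) m)"
    using lin_comp[OF linmaps_lin[OF HomD(1)[OF P(3) a(1)]] box_lin1[OF M a, folded fob_A]] .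
next
  fix S T x assume a: "S \<in> gsets G" "T \<in> gsets G" "x \<in> carrier (fob P S)"
  show "lin (fob M T) (fob M (gp S T)) (\<lambda>m. box M S T (i S x) m)"
    using box_lin2[OF M a(1,2) P(6)[OF a(1,3)]] .
next
  fix S T S' T' X Y x m assume a: "S \<in> gsets G" "T \<in> gsets G" "S' \<in> gsets G" "T' \<in> gsets G" "X \<in> Ar S S'" "Y \<in> Ar T T'"
      "x \<in> carrier (fob P S)" "m \<in> carrier (fob M T)"
  show "fmor M (gp S T) (gp S' T') (lprod G r S S' T T' X Y) (box M S T (i S x) m) = box M S' T' (i S' (fmor P S S' X x)) (fmor M T T' Y m)"
    using box_natural[OF M a(1,3,2,4,5,6) P(6)[OF a(1,7)] a(8)] HomD(5)[OF P(3) a(1,3,5,7)] by simp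
qed

lemma box_fixed: assumes "S \<in> gsets G" "T \<in> gsets G" "x \<in> carrier (fob P S)" "m \<in> carrier (fob M T)"
  shows "box M S T (i S x) m \<in> carrier (fob (smd e M) (gp S T))"
proof -
  have "cact A S e (i S x) = i S x"
    using cact_Hom[OF P(1,3) mack_A assms(1) P(7) assms(3)] cyc_fixed(1)[OF c assms(1,3)] by simp
  then show ?thesis
    using smd_mem[OF cyc_fixed(3)[OF c] M gprod_gset[OF assms(1,2)]] box_cact1[OF M assms(1,2,4) P(6)[OF assms(1,3)] P(7)]
      box_closed[OF M assms(1,2,4) P(6)[OF assms(1,3)]] by simp
qed

text \<open>A pairing factors through \<open>gen_map\<close>, restricted to \<open>eM\<close>. The
  factorisation is unique because an element \<open>m\<close> of \<open>eM\<close> equals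
  \<open>cact M T e m\<close>, which is a transport of the pairing of \<open>p\<close> with
  \<open>m\<close>.\<close>

lemma is_day_smd: "is_day G r P M (smd e M) (\<lambda>S T x m. box M S T (i S x) m)"
  unfolding is_day_def Mackey_obj_iff Mackey_simps
proof (intro conjI ballI allI impI)
  note id = cyc_fixed(3)[OF c]
  note sm = smd_mem[OF id M]
  show D: "mack (smd e M)" by (rule mack_smd[OF id M])
  note pd = pairingD[OF box_pairing]
  show "is_pairing G r P M (smd e M) (\<lambda>S T x m. box M S T (i S x) m)"
  proof (rule pairingI[OF P(1) M])
    fix S T m assume a: "S \<in> gsets G" "T \<in> gsets G" "m \<in> carrier (fob M T)"
    show "lin (fob P S) (fob (smd e M) (gp S T)) (\<lambda>x. box M S T (i S x) m)"
      using pd(2)[OF a Ml(1)[OF P(1) a(1)]] box_fixed[OF a(1,2) _ a(3)] unfolding lin_def by simp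
  next
    fix S T x assume a: "S \<in> gsets G" "T \<in> gsets G" "x \<in> carrier (fob P S)"
    show "lin (fob M T) (fob (smd e M) (gp S T)) (\<lambda>m. box M S T (i S x) m)"
      using pd(3)[OF a Ml(1)[OF M a(2)]] box_fixed[OF a(1,2,3)] unfolding lin_def by simp
  next
    fix S T S' T' X Y x m assume a: "S \<in> gsets G" "T \<in> gsets G" "S' \<in> gsets G" "T' \<in> gsets G" "X \<in> Ar S S'" "Y \<in> Ar T T'"
        "x \<in> carrier (fob P S)" "m \<in> carrier (fob M T)"
    show "fmor (smd e M) (gp S T) (gp S' T') (lprod G r S S' T T' X Y) (box M S T (i S x) m) = box M S' T' (i S' (fmor P S S' X x)) (fmor M T T' Y m)"
      using pd(4)[OF a(1,2,7,8,3-6)] box_fixed[OF a(1,2,7,8)] by (simp add: smd_fmor)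
  qed
  fix Q \<beta> assume "Q \<in> obj (Mackey G r)" and b: "is_pairing G r P M Q \<beta>"
  then have Q: "mack Q" by (simp add: Mackey_obj_iff)
  note w = gen_map[OF Q b]
  show "\<exists>!t. t \<in> Hom (smd e M) Q \<and> (\<forall>S\<in>gsets G. \<forall>T\<in>gsets G. \<forall>m\<in>carrier (fob P S). \<forall>n\<in>carrier (fob M T). t (gp S T) (box M S T (i S m) n) = \<beta> S T m n)"
  proof (rule ex1I[of _ "\<lambda>S\<in>gsets G. \<lambda>m\<in>carrier (fob (smd e M) S). gen_map M Q p \<beta> S m"], safe)
    show "(\<lambda>S\<in>gsets G. \<lambda>m\<in>carrier (fob (smd e M) S). gen_map M Q p \<beta> S m) \<in> Hom (smd e M) Q"
      by (rule Hom_restrict[OF w(1) id M])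
  next
    fix S T x m assume a: "S \<in> gsets G" "T \<in> gsets G" "x \<in> carrier (fob P S)" "m \<in> carrier (fob M T)"
    show "(\<lambda>S\<in>gsets G. \<lambda>m\<in>carrier (fob (smd e M) S). gen_map M Q p \<beta> S m) (gp S T) (box M S T (i S x) m) = \<beta> S T x m"
      using w(3)[OF a] box_fixed[OF a] a by simp
  next
    fix t assume t: "t \<in> Hom (smd e M) Q" and
      tb: "\<forall>S\<in>gsets G. \<forall>T\<in>gsets G. \<forall>m\<in>carrier (fob P S). \<forall>n\<in>carrier (fob M T). t (gp S T) (box M S T (i S m) n) = \<beta> S T m n"
    show "t = (\<lambda>S\<in>gsets G. \<lambda>m\<in>carrier (fob (smd e M) S). gen_map M Q p \<beta> S m)"
    proof (rule Hom_eqI[OF t Hom_restrict[OF w(1) id M]])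
      fix T m assume T: "T \<in> gsets G" and m: "m \<in> carrier (fob (smd e M) T)"
      have m': "m \<in> carrier (fob M T)" "cact M T e m = m" using m sm[OF T] by auto
      have bx: "box M pt T e m \<in> carrier (fob (smd e M) (gp pt T))" using box_fixed[OF gpt_gset T P(2) m'(1)] P(4) by simp
      have "t T m = t T (fmor (smd e M) (gp pt T) T (ptiso T) (box M pt T e m))"
        using m'(2) bx by (simp add: cact_def smd_fmor)
      also have "\<dots> = fmor Q (gp pt T) T (ptiso T) (\<beta> pt T p m)"
        using HomD(5)[OF t _ T ptiso_arr[OF T] bx] tb P(2,4) T m'(1) by auto
      finally show "t T m = (\<lambda>S\<in>gsets G. \<lambda>m\<in>carrier (fob (smd e M) S). gen_map M Q p \<beta> S m) T m"
        using T m m'(1) by (simp add: gen_map_def)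
    qed
  qed
qed

lemma is_day_day: "is_day G r P M (day G r P M) (day_univ G r P M)"
proof -
  have "case (SOME (D, \<eta>). is_day G r P M D \<eta>) of (D, \<eta>) \<Rightarrow> is_day G r P M D \<eta>"
    by (rule someI[of "\<lambda>(D, \<eta>). is_day G r P M D \<eta>" "(smd e M, \<lambda>S T x m. box M S T (i S x) m)"]) (simp add: is_day_smd)
  then show ?thesis unfolding day_def day_univ_def day_pair_def by (simp add: case_prod_beta)
qed

end

lemma pairing_precomp:
  assumes "is_pairing G r P' M' Q \<beta>" "mack P" "mack M" "mack P'" "mack M'" "f \<in> Hom P P'" "g \<in> Hom M M'"
  shows "is_pairing G r P M Q (\<lambda>S T x m. \<beta> S T (f S x) (g T m))"
proof (rule pairingI[OF assms(2,3)])
  note b = pairingD[OF assms(1)] and f = HomD[OF assms(6)] and g = HomD[OF assms(7)]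
  fix S T m assume a: "S \<in> gsets G" "T \<in> gsets G" "m \<in> carrier (fob M T)"
  show "lin (fob P S) (fob Q (gp S T)) (\<lambda>x. \<beta> S T (f S x) (g T m))"
    using lin_comp[OF linmaps_lin[OF f(1)[OF a(1)]] b(2)[OF a(1,2) g(2)[OF a(2,3)] Ml(1)[OF assms(4) a(1)]]] .
next
  note b = pairingD[OF assms(1)] and f = HomD[OF assms(6)] and g = HomD[OF assms(7)]
  fix S T x assume a: "S \<in> gsets G" "T \<in> gsets G" "x \<in> carrier (fob P S)"
  show "lin (fob M T) (fob Q (gp S T)) (\<lambda>m. \<beta> S T (f S x) (g T m))"
    using lin_comp[OF linmaps_lin[OF g(1)[OF a(2)]] b(3)[OF a(1,2) f(2)[OF a(1,3)] Ml(1)[OF assms(5) a(2)]]] .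
next
  note b = pairingD[OF assms(1)] and f = HomD[OF assms(6)] and g = HomD[OF assms(7)]
  fix S T S' T' X Y x m assume a: "S \<in> gsets G" "T \<in> gsets G" "S' \<in> gsets G" "T' \<in> gsets G" "X \<in> Ar S S'" "Y \<in> Ar T T'"
      "x \<in> carrier (fob P S)" "m \<in> carrier (fob M T)"
  show "fmor Q (gp S T) (gp S' T') (lprod G r S S' T T' X Y) (\<beta> S T (f S x) (g T m)) = \<beta> S' T' (f S' (fmor P S S' X x)) (g T' (fmor M T T' Y m))"
    using b(4)[OF a(1,2) f(2)[OF a(1,7)] g(2)[OF a(2,8)] a(3-6)] f(5)[OF a(1,3,5,7)] g(5)[OF a(2,4,6,8)] by simp
qed

abbreviation dy where "dy \<equiv> day G r"
abbreviation un where "un \<equiv> day_univ G r"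

context
  fixes e p :: "('a, 'u) val" and P i and M :: "('a, ('a, 'u) val) mfun"
  assumes c: "cyc e P p i" and M: "mack M"
begin

lemma day_mack: "mack (dy P M)"
  using is_day_day[OF c M] by (simp add: is_day_def Mackey_obj_iff)

lemma day_pairing: "is_pairing G r P M (dy P M) (un P M)"
  using is_day_day[OF c M] by (simp add: is_day_def)

lemma day_lift: assumes "mack Q" "is_pairing G r P M Q \<beta>"
  obtains t where "t \<in> Hom (dy P M) Q"
    "\<And>S T x m. S \<in> gsets G \<Longrightarrow> T \<in> gsets G \<Longrightarrow> x \<in> carrier (fob P S) \<Longrightarrow> m \<in> carrier (fob M T) \<Longrightarrow> t (gp S T) (un P M S T x m) = \<beta> S T x m"
proof -
  have "Q \<in> obj (Mackey G r)" using assms(1) by (simp add: Mackey_obj_iff)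
  then obtain t where "t \<in> arr (Mackey G r) (dy P M) Q"
    "\<forall>S\<in>gsets G. \<forall>T\<in>gsets G. \<forall>m\<in>carrier (fob P S). \<forall>n\<in>carrier (fob M T). t (gp S T) (un P M S T m n) = \<beta> S T m n"
    using is_day_day[OF c M] assms(2) unfolding is_day_def by blast
  then show ?thesis using that unfolding Mackey_simps by blast
qed

lemma day_unique: assumes "mack Q" "f \<in> Hom (dy P M) Q" "g \<in> Hom (dy P M) Q"
    "\<And>S T x m. S \<in> gsets G \<Longrightarrow> T \<in> gsets G \<Longrightarrow> x \<in> carrier (fob P S) \<Longrightarrow> m \<in> carrier (fob M T) \<Longrightarrow>
      f (gp S T) (un P M S T x m) = g (gp S T) (un P M S T x m)"
  shows "f = g"
proof -
  have Q: "Q \<in> obj (Mackey G r)" using assms(1) by (simp add: Mackey_obj_iff)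
  note pd = pairingD[OF day_pairing] note g = HomD[OF assms(3)]
  note dp = cycD[OF c]
  have "is_pairing G r P M Q (\<lambda>S T x m. g (gp S T) (un P M S T x m))"
  proof (rule pairingI[OF dp(1) M])
    fix S T m assume a: "S \<in> gsets G" "T \<in> gsets G" "m \<in> carrier (fob M T)"
    show "lin (fob P S) (fob Q (gp S T)) (\<lambda>x. g (gp S T) (un P M S T x m))"
      using lin_comp[OF pd(2)[OF a Ml(1)[OF dp(1) a(1)]] linmaps_lin[OF g(1)[OF gprod_gset[OF a(1,2)]]]] .
  next
    fix S T x assume a: "S \<in> gsets G" "T \<in> gsets G" "x \<in> carrier (fob P S)"
    show "lin (fob M T) (fob Q (gp S T)) (\<lambda>m. g (gp S T) (un P M S T x m))"
      using lin_comp[OF pd(3)[OF a Ml(1)[OF M a(2)]] linmaps_lin[OF g(1)[OF gprod_gset[OF a(1,2)]]]] .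
  next
    fix S T S' T' X Y x m assume a: "S \<in> gsets G" "T \<in> gsets G" "S' \<in> gsets G" "T' \<in> gsets G" "X \<in> Ar S S'" "Y \<in> Ar T T'"
        "x \<in> carrier (fob P S)" "m \<in> carrier (fob M T)"
    show "fmor Q (gp S T) (gp S' T') (lprod G r S S' T T' X Y) (g (gp S T) (un P M S T x m)) = g (gp S' T') (un P M S' T' (fmor P S S' X x) (fmor M T T' Y m))"
      using pd(4)[OF a(1,2,7,8,3-6)] g(5)[OF gprod_gset[OF a(1,2)] gprod_gset[OF a(3,4)] lprod_arr[OF a(5,6)] pd(1)[OF a(1,2,7,8)]] by simp
  qed
  then have "\<exists>!t. t \<in> arr (Mackey G r) (dy P M) Q \<and>
    (\<forall>S\<in>gsets G. \<forall>T\<in>gsets G. \<forall>m\<in>carrier (fob P S). \<forall>n\<in>carrier (fob M T). t (gp S T) (un P M S T m n) = g (gp S T) (un P M S T m n))"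
    using is_day_day[OF c M] Q unfolding is_day_def by blast
  then show ?thesis using assms(2-4) unfolding Mackey_simps by blast
qed

abbreviation (input) wm where "wm \<equiv> gen_map M (dy P M) p (un P M)"

lemmas wm = gen_map[OF c M day_mack day_pairing]

lemma wm_eq: "T \<in> gsets G \<Longrightarrow> m \<in> carrier (fob M T) \<Longrightarrow> wm T m = fmor (dy P M) (gp pt T) T (ptiso T) (un P M pt T p m)"
  by (simp add: gen_map_def)

text \<open>The universal property gives a map \<open>t\<close> from the chosen convolution to
  \<open>eM\<close>. Going to \<open>eM\<close> and back by \<open>wm\<close> fixes the universal
  pairing, so it is the identity; every element is thus \<open>wm\<close> of a vector fixed by
  \<open>e\<close>.\<close>

lemma wm_surj: assumes T: "T \<in> gsets G" and y: "y \<in> carrier (fob (dy P M) T)"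
  obtains m where "m \<in> carrier (fob M T)" "cact M T e m = m" "y = wm T m"
proof -
  note id = cyc_fixed(3)[OF c]
  let ?s = "\<lambda>S\<in>gsets G. \<lambda>m\<in>carrier (fob (smd e M) S). wm S m"
  have s: "?s \<in> Hom (smd e M) (dy P M)" by (rule Hom_restrict[OF wm(1) id M])
  have "is_pairing G r P M (smd e M) (\<lambda>S T x m. box M S T (i S x) m)"
    using is_day_smd[OF c M] by (simp add: is_day_def)
  then have sp: "is_pairing G r P M (smd e M) (\<lambda>S T x m. box M S T (i S x) m)" .
  obtain t where t: "t \<in> Hom (dy P M) (smd e M)"
    "\<And>S T x m. S \<in> gsets G \<Longrightarrow> T \<in> gsets G \<Longrightarrow> x \<in> carrier (fob P S) \<Longrightarrow> m \<in> carrier (fob M T) \<Longrightarrow> t (gp S T) (un P M S T x m) = box M S T (i S x) m"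
    by (rule day_lift[OF mack_smd[OF id M] sp]) blast
  have "(\<lambda>S\<in>gsets G. compose (carrier (fob (dy P M) S)) (?s S) (t S)) = (\<lambda>S\<in>gsets G. \<lambda>m\<in>carrier (fob (dy P M) S). m)"
  proof (rule day_unique[OF day_mack Hom_compose[OF day_mack t(1) s] Hom_id[OF day_mack]])
    fix S T x m assume a: "S \<in> gsets G" "T \<in> gsets G" "x \<in> carrier (fob P S)" "m \<in> carrier (fob M T)"
    have u: "un P M S T x m \<in> carrier (fob (dy P M) (gp S T))" by (rule pairingD(1)[OF day_pairing a])
    show "(\<lambda>S\<in>gsets G. compose (carrier (fob (dy P M) S)) (?s S) (t S)) (gp S T) (un P M S T x m) =
       (\<lambda>S\<in>gsets G. \<lambda>m\<in>carrier (fob (dy P M) S). m) (gp S T) (un P M S T x m)"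
      using u t(2)[OF a] a box_fixed[OF c M a] wm(3)[OF a] by (simp add: compose_eq)
  qed
  then have 1: "(\<lambda>S\<in>gsets G. compose (carrier (fob (dy P M) S)) (?s S) (t S)) T y = y" using T y by simp
  have "(\<lambda>S\<in>gsets G. compose (carrier (fob (dy P M) S)) (?s S) (t S)) T y = wm T (t T y)"
    using T y HomD(2)[OF t(1) T y] by (simp add: compose_eq)
  then have "y = wm T (t T y)" unfolding 1 .
  then show ?thesis using that smd_mem[OF id M T] HomD(2)[OF t(1) T y] by blast
qed

text \<open>A sharper test than \<open>day_unique\<close>: by \<open>wm_surj\<close> every element
  is a transport of a pairing with the generator \<open>p\<close>.\<close>

lemma day_hom_eq: assumes "f \<in> Hom (dy P M) Q" "g \<in> Hom (dy P M) Q"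
    "\<And>T m. T \<in> gsets G \<Longrightarrow> m \<in> carrier (fob M T) \<Longrightarrow> f (gp pt T) (un P M pt T p m) = g (gp pt T) (un P M pt T p m)"
  shows "f = g"
proof (rule Hom_eqI[OF assms(1,2)])
  fix T y assume T: "T \<in> gsets G" and y: "y \<in> carrier (fob (dy P M) T)"
  obtain m where m: "m \<in> carrier (fob M T)" "y = wm T m" using wm_surj[OF T y] by metis
  have u: "un P M pt T p m \<in> carrier (fob (dy P M) (gp pt T))" by (rule pairingD(1)[OF day_pairing gpt_gset T cycD(2)[OF c] m(1)])
  show "f T y = g T y"
    unfolding m(2) wm_eq[OF T m(1)] using HomD(5)[OF assms(1) _ T ptiso_arr[OF T] u] HomD(5)[OF assms(2) _ T ptiso_arr[OF T] u] assms(3)[OF T m(1)] T by simp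
qed

text \<open>Together with \<open>wm\<close> this map identifies the Day convolution with the image of \<open>e\<close> on \<open>M\<close>.\<close>

lemma day_back: obtains t where "t \<in> Hom (dy P M) M"
    "\<And>S T x m. S \<in> gsets G \<Longrightarrow> T \<in> gsets G \<Longrightarrow> x \<in> carrier (fob P S) \<Longrightarrow> m \<in> carrier (fob M T) \<Longrightarrow> t (gp S T) (un P M S T x m) = box M S T (i S x) m"
    "\<And>T m. T \<in> gsets G \<Longrightarrow> m \<in> carrier (fob M T) \<Longrightarrow> t T (wm T m) = cact M T e m"
proof -
  obtain t where t: "t \<in> Hom (dy P M) M"
    "\<And>S T x m. S \<in> gsets G \<Longrightarrow> T \<in> gsets G \<Longrightarrow> x \<in> carrier (fob P S) \<Longrightarrow> m \<in> carrier (fob M T) \<Longrightarrow> t (gp S T) (un P M S T x m) = box M S T (i S x) m"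
    by (rule day_lift[OF M box_pairing[OF c M]]) blast
  have "t T (wm T m) = cact M T e m" if a: "T \<in> gsets G" "m \<in> carrier (fob M T)" for T m
  proof -
    have u: "un P M pt T p m \<in> carrier (fob (dy P M) (gp pt T))" by (rule pairingD(1)[OF day_pairing gpt_gset a(1) cycD(2)[OF c] a(2)])
    show ?thesis unfolding wm_eq[OF a] cact_def
      using HomD(5)[OF t(1) _ a(1) ptiso_arr[OF a(1)] u] t(2)[OF gpt_gset a(1) cycD(2)[OF c] a(2)] cycD(4)[OF c] a by simp
  qed
  then show ?thesis using that t by blast
qed

end

section \<open>Structure maps between the chosen Day convolutions\<close>

lemma day_map:
  assumes c: "cyc e P p i" and M: "mack M" and c': "cyc e' P' p' i'" and M': "mack M'" and f: "f \<in> Hom P P'" and g: "g \<in> Hom M M'"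
  shows "day_map G r P P' M M' f g \<in> Hom (dy P M) (dy P' M')"
    "S \<in> gsets G \<Longrightarrow> T \<in> gsets G \<Longrightarrow> x \<in> carrier (fob P S) \<Longrightarrow> m \<in> carrier (fob M T) \<Longrightarrow>
      day_map G r P P' M M' f g (gp S T) (un P M S T x m) = un P' M' S T (f S x) (g T m)"
proof -
  let ?Q = "\<lambda>t. t \<in> arr (Mackey G r) (dy P M) (dy P' M') \<and>
     (\<forall>S\<in>gsets G. \<forall>T\<in>gsets G. \<forall>m\<in>carrier (fob P S). \<forall>n\<in>carrier (fob M T).
        t (gp S T) (un P M S T m n) = un P' M' S T (f S m) (g T n))"
  have D': "dy P' M' \<in> obj (Mackey G r)" using day_mack[OF c' M'] by (simp add: Mackey_obj_iff)
  have "\<exists>!t. ?Q t"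
    using is_day_day[OF c M] D' pairing_precomp[OF day_pairing[OF c' M'] cycD(1)[OF c] M cycD(1)[OF c'] M' f g]
    unfolding is_day_def by blast
  then have "?Q (day_map G r P P' M M' f g)" unfolding day_map_def by (rule theI')
  then show "day_map G r P P' M M' f g \<in> Hom (dy P M) (dy P' M')"
    "S \<in> gsets G \<Longrightarrow> T \<in> gsets G \<Longrightarrow> x \<in> carrier (fob P S) \<Longrightarrow> m \<in> carrier (fob M T) \<Longrightarrow>
      day_map G r P P' M M' f g (gp S T) (un P M S T x m) = un P' M' S T (f S x) (g T m)"
    unfolding Mackey_simps by blast+
qed

abbreviation idA where "idA \<equiv> (\<lambda>S\<in>gsets G. \<lambda>m\<in>carrier (fob A S). m)"

lemma yo_A_one: fixes a :: "('a, 'u) val" assumes "S \<in> gsets G" "a \<in> carrier (bob S)" shows "yo A one_A S a = a"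
  using Hom_A_yo[OF Hom_id[OF mack_A] mack_A assms] assms by simp

lemma cyc_A: "cyc one_A A (one_A :: ('a, 'u) val) idA"
  unfolding cyc_def
proof (intro conjI ballI)
  show "idA \<in> Hom A (A :: ('a, ('a, 'u) val) mfun)" by (rule Hom_id[OF mack_A])
qed (simp_all add: yo_A_one mack_A)

text \<open>The definite description prescribes the unitor only on pairings with
  \<open>one_A\<close>. Since \<open>one_A\<close> generates \<open>A\<close>,
  \<open>wm_surj\<close> shows that this determines it, and the lift of \<open>box\<close> qualifies
  by \<open>box_one\<close>.\<close>

lemma day_lunit: fixes M :: "('a, ('a, 'u) val) mfun"
  assumes M: "mack M"
  shows "day_lunit G r M \<in> Hom (dy A M) M"
    "S \<in> gsets G \<Longrightarrow> T \<in> gsets G \<Longrightarrow> a \<in> carrier (bob S) \<Longrightarrow> m \<in> carrier (fob M T) \<Longrightarrow>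
      day_lunit G r M (gp S T) (un A M S T a m) = box M S T a m"
proof -
  note c = cyc_A
  note cA = day_back[OF c M]
  obtain t where t: "t \<in> Hom (dy A M) M"
    "\<And>S T x m. S \<in> gsets G \<Longrightarrow> T \<in> gsets G \<Longrightarrow> x \<in> carrier (fob A S) \<Longrightarrow> m \<in> carrier (fob M T) \<Longrightarrow> t (gp S T) (un A M S T x m) = box M S T (idA S x) m"
    by (rule cA) blast
  let ?Q = "\<lambda>t. t \<in> arr (Mackey G r) (dy A M) M \<and>
       (\<forall>T\<in>gsets G. \<forall>m\<in>carrier (fob M T).
          fmor M (gp pt T) T (ptiso T) (t (gp pt T) (un A M pt T (burnside_one G r) m)) = m)"
  have "?Q t" unfolding Mackey_simps burnside_one_eq by (simp add: t(1,2) box_one[OF M])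
  moreover have "t' = t" if "?Q t'" for t'
  proof (rule Hom_eqI[OF _ t(1)])
    show t': "t' \<in> Hom (dy A M) M" using that by simp
    fix T y assume T: "T \<in> gsets G" and y: "y \<in> carrier (fob (dy A M) T)"
    obtain m where m: "m \<in> carrier (fob M T)" "y = gen_map M (dy A M) one_A (un A M) T m" using wm_surj[OF c M T y] by metis
    have u: "un A M pt T one_A m \<in> carrier (fob (dy A M) (gp pt T))" using pairingD(1)[OF day_pairing[OF c M] gpt_gset T _ m(1)] by simp
    have "h T y = fmor M (gp pt T) T (ptiso T) (h (gp pt T) (un A M pt T one_A m))" if "h \<in> Hom (dy A M) M" for h
      unfolding m(2) wm_eq[OF c M T m(1)] using HomD(5)[OF that _ T ptiso_arr[OF T] u] T by simp
    then show "t' T y = t T y" using t' t(1) \<open>?Q t'\<close> \<open>?Q t\<close> T m(1) unfolding burnside_one_eq by metis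
  qed
  ultimately have e: "day_lunit G r M = t" unfolding day_lunit_def by (rule the_equality)
  show "day_lunit G r M \<in> Hom (dy A M) M" using e t(1) by simp
  show "S \<in> gsets G \<Longrightarrow> T \<in> gsets G \<Longrightarrow> a \<in> carrier (bob S) \<Longrightarrow> m \<in> carrier (fob M T) \<Longrightarrow>
      day_lunit G r M (gp S T) (un A M S T a m) = box M S T a m"
    unfolding e using t(2) by simp
qed

lemma elt_act_eq: fixes M :: "('a, ('a, 'u) val) mfun"
  assumes "mack M" "e \<in> carrier (bob pt)" "S \<in> gsets G" "m \<in> carrier (fob M S)"
  shows "elt_act G r e M S m = cact M S e m"
  unfolding elt_act_def cact_def using day_lunit(2)[OF assms(1) gpt_gset assms(3,2,4)] by simp

subsection \<open>The associator on the copies of a summand\<close>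

context
  fixes e p :: "('a, 'u) val" and R i and M :: "('a, ('a, 'u) val) mfun"
  assumes c: "cyc e R p i" and M: "mack M"
begin

lemmas R = cycD[OF c]

abbreviation (input) RR where "RR \<equiv> dy R R"

text \<open>The convolution of two copies of \<open>eA\<close> is again a copy of \<open>eA\<close>,
  since \<open>e\<close> acts on \<open>R\<close> as the identity. This makes the square of
  \<open>R\<close> admissible as a left factor, which the associator and the associative law
  require.\<close>

lemma cyc_RR: obtains p2 i2 where "cyc e RR p2 i2" "p2 = fmor RR (gp pt pt) pt (ptiso pt) (un R R pt pt p p)"
    "\<And>S T x y. S \<in> gsets G \<Longrightarrow> T \<in> gsets G \<Longrightarrow> x \<in> carrier (fob R S) \<Longrightarrow> y \<in> carrier (fob R T) \<Longrightarrow>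
      i2 (gp S T) (un R R S T x y) = box A S T (i S x) (i T y)"
proof -
  note D = day_mack[OF c R(1)]
  note w = wm[OF c R(1)]
  obtain t where t: "t \<in> Hom RR R"
    "\<And>S T x m. S \<in> gsets G \<Longrightarrow> T \<in> gsets G \<Longrightarrow> x \<in> carrier (fob R S) \<Longrightarrow> m \<in> carrier (fob R T) \<Longrightarrow> t (gp S T) (un R R S T x m) = box R S T (i S x) m"
    "\<And>T m. T \<in> gsets G \<Longrightarrow> m \<in> carrier (fob R T) \<Longrightarrow> t T (gen_map R RR p (un R R) T m) = cact R T e m"
    by (rule day_back[OF c R(1)]) blast
  define p2 where "p2 = gen_map R RR p (un R R) pt p"
  define i2 where "i2 = (\<lambda>S\<in>gsets G. compose (carrier (fob RR S)) (i S) (t S))"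
  have i2: "i2 \<in> Hom RR A" unfolding i2_def by (rule Hom_compose[OF D t(1) R(3)])
  have p2: "p2 \<in> carrier (fob RR pt)" unfolding p2_def by (rule HomD(2)[OF w(1) gpt_gset R(2)])
  have "i2 pt p2 = e" using t(3)[OF gpt_gset R(2)] cyc_fixed(2)[OF c] R(4) p2 by (simp add: i2_def compose_eq p2_def)
  moreover have "yo RR p2 S (i2 S x) = x" if S: "S \<in> gsets G" and x: "x \<in> carrier (fob RR S)" for S x
  proof -
    obtain m where m: "m \<in> carrier (fob R S)" "cact R S e m = m" "x = gen_map R RR p (un R R) S m"
      using wm_surj[OF c R(1) S x] by metis
    have "i2 S x = i S m" using S x t(3)[OF S m(1)] m(2,3) by (simp add: i2_def compose_eq)
    then have "yo RR p2 S (i2 S x) = gen_map R RR p (un R R) S (yo R p S (i S m))"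
      unfolding p2_def using yo_Hom_natural[OF R(1,2) w(1) D S R(6)[OF S m(1)]] by simp
    then show ?thesis using R(5)[OF S m(1)] m(3) by simp
  qed
  ultimately have "cyc e RR p2 i2" unfolding cyc_def using D p2 i2 by blast
  moreover have "p2 = fmor RR (gp pt pt) pt (ptiso pt) (un R R pt pt p p)"
    unfolding p2_def by (rule wm_eq[OF c R(1) gpt_gset R(2)])
  moreover have "i2 (gp S T) (un R R S T x y) = box A S T (i S x) (i T y)"
    if a: "S \<in> gsets G" "T \<in> gsets G" "x \<in> carrier (fob R S)" "y \<in> carrier (fob R T)" for S T x y
    using t(2)[OF a] pairingD(1)[OF day_pairing[OF c R(1)] a] box_Hom'[OF R(1) R(3) mack_A a(1,2) R(6)[OF a(1,3)] a(4)] a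
    by (simp add: i2_def compose_eq)
  ultimately show ?thesis using that by blast
qed

text \<open>The generator of \<open>RR\<close> is a transport of the pairing of \<open>p\<close>
  with itself. By naturality, agreement on pairings with that generator follows from agreement on
  triple pairings.\<close>

lemma triple_eq: assumes "f \<in> Hom (dy RR M) Q" "g \<in> Hom (dy RR M) Q"
    and eq: "\<And>S T W x y m. S \<in> gsets G \<Longrightarrow> T \<in> gsets G \<Longrightarrow> W \<in> gsets G \<Longrightarrow> x \<in> carrier (fob R S) \<Longrightarrow> y \<in> carrier (fob R T) \<Longrightarrow>
      m \<in> carrier (fob M W) \<Longrightarrow> f (gp (gp S T) W) (un RR M (gp S T) W (un R R S T x y) m) = g (gp (gp S T) W) (un RR M (gp S T) W (un R R S T x y) m)"
  shows "f = g"
proof -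
  obtain p2 i2 where c2: "cyc e RR p2 i2" and p2: "p2 = fmor RR (gp pt pt) pt (ptiso pt) (un R R pt pt p p)"
    using cyc_RR by metis
  show ?thesis
  proof (rule day_hom_eq[OF c2 M assms(1,2)])
    fix W m assume W: "W \<in> gsets G" and m: "m \<in> carrier (fob M W)"
    have z: "un R R pt pt p p \<in> carrier (fob RR (gp pt pt))" by (rule pairingD(1)[OF day_pairing[OF c R(1)] gpt_gset gpt_gset R(2,2)])
    have g: "gp pt pt \<in> gsets G" "gp (gp pt pt) W \<in> gsets G" "gp pt W \<in> gsets G" using W by simp_all
    let ?l = "lprod G r (gp pt pt) pt W W (ptiso pt) (idL W)"
    have l: "?l \<in> Ar (gp (gp pt pt) W) (gp pt W)" using W by simp
    have zz: "un RR M (gp pt pt) W (un R R pt pt p p) m \<in> carrier (fob (dy RR M) (gp (gp pt pt) W))"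
      by (rule pairingD(1)[OF day_pairing[OF c2 M] g(1) W z m])
    have u: "un RR M pt W p2 m = fmor (dy RR M) (gp (gp pt pt) W) (gp pt W) ?l (un RR M (gp pt pt) W (un R R pt pt p p) m)"
      using pairingD(4)[OF day_pairing[OF c2 M] g(1) W z m gpt_gset W ptiso_arr[OF gpt_gset] idL_arr[OF W]] p2 Ml(3)[OF M W m] by simp
    show "f (gp pt W) (un RR M pt W p2 m) = g (gp pt W) (un RR M pt W p2 m)"
      unfolding u using HomD(5)[OF assms(1) g(2,3) l zz] HomD(5)[OF assms(2) g(2,3) l zz] eq[OF gpt_gset gpt_gset W R(2,2) m] by simp
  qed
qed

text \<open>The candidate \<open>t\<close> lifts the pairing that multiplies \<open>u\<close> by the
  image of \<open>RR\<close> in \<open>A\<close>; \<open>box_assoc\<close> shows that it meets the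
  specification. Uniqueness follows from \<open>triple_eq\<close>, because \<open>alp\<close> acts
  injectively.\<close>

lemma day_assoc:
  shows "day_assoc G r R R M \<in> Hom (dy RR M) (dy R (dy R M))"
    "S \<in> gsets G \<Longrightarrow> T \<in> gsets G \<Longrightarrow> W \<in> gsets G \<Longrightarrow> x \<in> carrier (fob R S) \<Longrightarrow> y \<in> carrier (fob R T) \<Longrightarrow> m \<in> carrier (fob M W) \<Longrightarrow>
      fmor (dy R (dy R M)) (gp (gp S T) W) (gp S (gp T W)) (alp S T W)
        (day_assoc G r R R M (gp (gp S T) W) (un RR M (gp S T) W (un R R S T x y) m)) = un R (dy R M) S (gp T W) x (un R M T W y m)"
proof -
  obtain p2 i2 where c2: "cyc e RR p2 i2" and p2: "p2 = fmor RR (gp pt pt) pt (ptiso pt) (un R R pt pt p p)"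
    and i2: "\<And>S T x y. S \<in> gsets G \<Longrightarrow> T \<in> gsets G \<Longrightarrow> x \<in> carrier (fob R S) \<Longrightarrow> y \<in> carrier (fob R T) \<Longrightarrow>
      i2 (gp S T) (un R R S T x y) = box A S T (i S x) (i T y)"
    by (rule cyc_RR) blast
  define D2 where "D2 = dy R M"
  have D2: "mack D2" unfolding D2_def by (rule day_mack[OF c M])
  define D' where "D' = dy R D2"
  have D': "mack D'" unfolding D'_def by (rule day_mack[OF c D2])
  define w2 where "w2 = gen_map M D2 p (un R M)"
  define w' where "w' = gen_map D2 D' p (un R D2)"
  note w2 = wm[OF c M, folded D2_def, folded w2_def]
  note w' = wm[OF c D2, folded D'_def, folded w'_def]
  \<comment> \<open>Up to the unit isomorphisms, \<open>u\<close> takes \<open>m\<close> to the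
    pairing of \<open>p\<close> with the pairing of \<open>p\<close> and \<open>m\<close>.\<close>
  define u where "u = (\<lambda>S\<in>gsets G. compose (carrier (fob M S)) (w' S) (w2 S))"
  have u: "u \<in> Hom M D'" unfolding u_def by (rule Hom_compose[OF M w2(1) w'(1)])
  note bp = pairing_precomp[OF box_pairing[OF c2 D'] cycD(1)[OF c2] M cycD(1)[OF c2] D' Hom_id[OF cycD(1)[OF c2]] u]
  obtain t where t: "t \<in> Hom (dy RR M) D'"
    "\<And>S T x m. S \<in> gsets G \<Longrightarrow> T \<in> gsets G \<Longrightarrow> x \<in> carrier (fob RR S) \<Longrightarrow> m \<in> carrier (fob M T) \<Longrightarrow>
       t (gp S T) (un RR M S T x m) = box D' S T (i2 S ((\<lambda>S\<in>gsets G. \<lambda>m\<in>carrier (fob RR S). m) S x)) (u T m)"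
    by (rule day_lift[OF c2 M D' bp]) blast
  let ?Q = "\<lambda>t. t \<in> arr (Mackey G r) (dy RR M) D' \<and>
       (\<forall>S\<in>gsets G. \<forall>T\<in>gsets G. \<forall>W\<in>gsets G. \<forall>l\<in>carrier (fob R S). \<forall>m\<in>carrier (fob R T). \<forall>n\<in>carrier (fob M W).
           fmor D' (gp (gp S T) W) (gp S (gp T W)) (alp S T W)
             (t (gp (gp S T) W) (un RR M (gp S T) W (un R R S T l m) n)) = un R D2 S (gp T W) l (un R M T W m n))"
  have Qt: "?Q t"
    unfolding Mackey_simps
  proof (intro conjI t(1) ballI)
    fix S T W x y m assume a: "S \<in> gsets G" "T \<in> gsets G" "W \<in> gsets G" "x \<in> carrier (fob R S)" "y \<in> carrier (fob R T)" "m \<in> carrier (fob M W)"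
    have g: "gp S T \<in> gsets G" "gp T W \<in> gsets G" using a by simp_all
    have z: "un R R S T x y \<in> carrier (fob RR (gp S T))" by (rule pairingD(1)[OF day_pairing[OF c R(1)] a(1,2,4,5)])
    have um: "u W m = w' W (w2 W m)" "u W m \<in> carrier (fob D' W)" "w2 W m \<in> carrier (fob D2 W)"
      using a HomD(2)[OF u] HomD(2)[OF w2(1)] by (simp_all add: u_def compose_eq)
    have ix: "i S x \<in> carrier (bob S)" and iy: "i T y \<in> carrier (bob T)" using R(6) a by auto
    have n: "un R M T W y m \<in> carrier (fob D2 (gp T W))"
      using pairingD(1)[OF day_pairing[OF c M] a(2,3,5,6)] by (simp add: D2_def)
    have "t (gp (gp S T) W) (un RR M (gp S T) W (un R R S T x y) m) = box D' (gp S T) W (box A S T (i S x) (i T y)) (u W m)"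
      using t(2)[OF g(1) a(3) z a(6)] i2[OF a(1,2,4,5)] z g(1) by simp
    then have "fmor D' (gp (gp S T) W) (gp S (gp T W)) (alp S T W) (t (gp (gp S T) W) (un RR M (gp S T) W (un R R S T x y) m)) =
       box D' S (gp T W) (i S x) (box D' T W (i T y) (u W m))"
      using box_assoc[OF D' a(1-3) ix iy um(2)] by simp
    also have "box D' T W (i T y) (u W m) = w' (gp T W) (un R M T W y m)"
      unfolding um(1) w2(2)[OF a(2,3,5,6)] using box_Hom'[OF D2 w'(1) D' a(2,3) iy um(3)] by simp
    also have "box D' S (gp T W) (i S x) (w' (gp T W) (un R M T W y m)) = un R D2 S (gp T W) x (un R M T W y m)"
      using w'(2)[OF a(1) g(2) a(4) n] by simp
    finally show "fmor D' (gp (gp S T) W) (gp S (gp T W)) (alp S T W) (t (gp (gp S T) W) (un RR M (gp S T) W (un R R S T x y) m)) =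
       un R D2 S (gp T W) x (un R M T W y m)" .
  qed
  have "t' = t" if Qt': "?Q t'" for t'
  proof (rule triple_eq[OF _ t(1)])
    show t': "t' \<in> Hom (dy RR M) D'" using Qt' by simp
    fix S T W x y m assume a: "S \<in> gsets G" "T \<in> gsets G" "W \<in> gsets G" "x \<in> carrier (fob R S)" "y \<in> carrier (fob R T)" "m \<in> carrier (fob M W)"
    have g: "gp S T \<in> gsets G" "gp (gp S T) W \<in> gsets G" using a by simp_all
    have z: "un R R S T x y \<in> carrier (fob RR (gp S T))" by (rule pairingD(1)[OF day_pairing[OF c R(1)] a(1,2,4,5)])
    note zz = pairingD(1)[OF day_pairing[OF c2 M] g(1) a(3) z a(6)]
    show "t' (gp (gp S T) W) (un RR M (gp S T) W (un R R S T x y) m) = t (gp (gp S T) W) (un RR M (gp S T) W (un R R S T x y) m)"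
      by (rule alp_inj[OF mackD(1)[OF D'] a(1-3) HomD(2)[OF t' g(2) zz] HomD(2)[OF t(1) g(2) zz]])
        (use Qt Qt' a in simp)
  qed
  then have "(THE t. ?Q t) = t" by (rule the_equality[of ?Q, OF Qt])
  then have e: "day_assoc G r R R M = t" unfolding day_assoc_def D'_def D2_def alp_def Let_def by simp
  show "day_assoc G r R R M \<in> Hom (dy RR M) (dy R (dy R M))" unfolding e using t(1) by (simp add: D'_def D2_def)
  show "S \<in> gsets G \<Longrightarrow> T \<in> gsets G \<Longrightarrow> W \<in> gsets G \<Longrightarrow> x \<in> carrier (fob R S) \<Longrightarrow> y \<in> carrier (fob R T) \<Longrightarrow> m \<in> carrier (fob M W) \<Longrightarrow>
      fmor (dy R (dy R M)) (gp (gp S T) W) (gp S (gp T W)) (alp S T W)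
        (day_assoc G r R R M (gp (gp S T) W) (un RR M (gp S T) W (un R R S T x y) m)) = un R (dy R M) S (gp T W) x (un R M T W y m)"
    unfolding e using Qt by (simp add: D'_def D2_def)
qed

end

subsection \<open>Modules over summands of the Burnside functor\<close>

abbreviation hc :: "('a, 'v) mfun \<Rightarrow> ('a, 'v) mtrafo \<Rightarrow> ('a, 'v) mtrafo \<Rightarrow> ('a, 'v) mtrafo" where
  "hc M t s \<equiv> (\<lambda>S\<in>gsets G. compose (carrier (fob M S)) (t S) (s S))"

lemma hc_apply: "S \<in> gsets G \<Longrightarrow> m \<in> carrier (fob M S) \<Longrightarrow> hc M t s S m = t S (s S m)"
  by (simp add: compose_eq)

abbreviation hid :: "('a, 'v) mfun \<Rightarrow> ('a, 'v) mtrafo" where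
  "hid M \<equiv> (\<lambda>S\<in>gsets G. \<lambda>m\<in>carrier (fob M S). m)"

lemma Day_simps [simp]: "obj (Day G r) = obj (Mackey G r)" "arr (Day G r) M N = Hom M N"
  "ide (Day G r) M = hid M" "cmp (Day G r) M N Q t s = hc M t s"
  "ten (Day G r) = dy" "tenm (Day G r) = day_map G r" "munit (Day G r) = A" "massoc (Day G r) = day_assoc G r"
  "mlunit (Day G r) = day_lunit G r"
  by (simp_all add: Day_def)

lemma cact_End: assumes "mack M" "a \<in> carrier (bob pt)"
  shows "(\<lambda>S\<in>gsets G. \<lambda>m\<in>carrier (fob M S). cact M S a m) \<in> Hom M M"
  by (rule HomI[OF assms(1)])
    (use linD[OF cact_lin2[OF assms(1) _ assms(2)]] cact_natural[OF assms(1) _ _ _ _ assms(2)] in simp_all)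

text \<open>The properties shared by the Burnside monoid (with \<open>e = one_A\<close>) and the
  summand monoids, so that modules over both are classified by one argument. The product is the
  external product read through \<open>i\<close>, and the unit sends \<open>one_A\<close> to the
  generator.\<close>

definition idem_monoid :: "('a, 'u) val \<Rightarrow> (('a, ('a, 'u) val) mfun, ('a, ('a, 'u) val) mtrafo) monoid_obj \<Rightarrow>
    ('a, 'u) val \<Rightarrow> ('a, ('a, 'u) val) mtrafo \<Rightarrow> bool" where
  "idem_monoid e \<Omega> p i \<longleftrightarrow> cyc e (mob \<Omega>) p i \<and> mmul \<Omega> \<in> Hom (dy (mob \<Omega>) (mob \<Omega>)) (mob \<Omega>) \<and>
     (\<forall>S\<in>gsets G. \<forall>T\<in>gsets G. \<forall>x\<in>carrier (fob (mob \<Omega>) S). \<forall>y\<in>carrier (fob (mob \<Omega>) T).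
        mmul \<Omega> (gp S T) (un (mob \<Omega>) (mob \<Omega>) S T x y) = box (mob \<Omega>) S T (i S x) y) \<and>
     mone \<Omega> \<in> Hom A (mob \<Omega>) \<and> mone \<Omega> pt one_A = p"

definition fixes_e :: "('a, 'u) val \<Rightarrow> ('a, 'v) mfun \<Rightarrow> bool" where
  "fixes_e e M \<longleftrightarrow> (\<forall>S\<in>gsets G. \<forall>m\<in>carrier (fob M S). cact M S e m = m)"

context
  fixes e p :: "('a, 'u) val" and \<Omega> i
  assumes gd: "idem_monoid e \<Omega> p i"
begin

abbreviation (input) R where "R \<equiv> mob \<Omega>"

lemma gc: "cyc e R p i" using gd by (simp add: idem_monoid_def)
lemma gmul: "mmul \<Omega> \<in> Hom (dy R R) R"
  "S \<in> gsets G \<Longrightarrow> T \<in> gsets G \<Longrightarrow> x \<in> carrier (fob R S) \<Longrightarrow> y \<in> carrier (fob R T) \<Longrightarrow>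
    mmul \<Omega> (gp S T) (un R R S T x y) = box R S T (i S x) y"
  using gd by (simp_all add: idem_monoid_def)
lemma gone: "mone \<Omega> \<in> Hom A R" "mone \<Omega> pt one_A = p"
  using gd by (simp_all add: idem_monoid_def)

text \<open>The unit is the Yoneda map of \<open>p\<close>, and \<open>i\<close> is a section of
  that map.\<close>

lemma gone_i: assumes "S \<in> gsets G" "x \<in> carrier (fob R S)" shows "mone \<Omega> S (i S x) = x"
  using Hom_A_yo[OF gone(1) cycD(1)[OF gc] assms(1) cycD(6)[OF gc assms]] gone(2) cycD(5)[OF gc assms] by simp

text \<open>The unit law alone determines the action: it gives the value on pairings with elements
  \<open>mone \<Omega> S a\<close>, and by \<open>gone_i\<close> every element of \<open>R\<close>
  has this form. The generator is the image of \<open>one_A\<close> as well as of \<open>e\<close>,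
  so both act alike, and \<open>one_A\<close> acts as the identity.\<close>

lemma moduleD: assumes "is_module (Day G r) \<Omega> M \<rho>"
  shows "mack M" "\<rho> \<in> Hom (dy R M) M"
    "S \<in> gsets G \<Longrightarrow> T \<in> gsets G \<Longrightarrow> x \<in> carrier (fob R S) \<Longrightarrow> m \<in> carrier (fob M T) \<Longrightarrow>
      \<rho> (gp S T) (un R M S T x m) = box M S T (i S x) m"
    "fixes_e e M"
proof -
  note d = assms[unfolded is_module_def Let_def Day_simps Mackey_obj_iff]
  show M: "mack M" and rho: "\<rho> \<in> Hom (dy R M) M" using d by blast+
  have U: "hc (dy A M) \<rho> (day_map G r A R M M (mone \<Omega>) (hid M)) = day_lunit G r M" using d by blast
  note dm = day_map[OF cyc_A M gc M gone(1) Hom_id[OF M]]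
  have 1: "\<rho> (gp S T) (un R M S T (mone \<Omega> S a) m) = box M S T a m"
    if a: "S \<in> gsets G" "T \<in> gsets G" "a \<in> carrier (bob S)" "m \<in> carrier (fob M T)" for S T a m
  proof -
    have u: "un A M S T a m \<in> carrier (fob (dy A M) (gp S T))" using pairingD(1)[OF day_pairing[OF cyc_A M] a(1,2) _ a(4)] a(3) by simp
    have "\<rho> (gp S T) (un R M S T (mone \<Omega> S a) m) = hc (dy A M) \<rho> (day_map G r A R M M (mone \<Omega>) (hid M)) (gp S T) (un A M S T a m)"
      using u dm(2)[OF a(1,2) _ a(4)] a by (simp add: compose_eq)
    then show ?thesis unfolding U day_lunit(2)[OF M a] .
  qed
  show 2: "\<rho> (gp S T) (un R M S T x m) = box M S T (i S x) m"
    if a: "S \<in> gsets G" "T \<in> gsets G" "x \<in> carrier (fob R S)" "m \<in> carrier (fob M T)" for S T x m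
    using 1[OF a(1,2) cycD(6)[OF gc a(1,3)] a(4)] gone_i[OF a(1,3)] by simp
  show "fixes_e e M" unfolding fixes_e_def
  proof (intro ballI)
    fix T m assume T: "T \<in> gsets G" and m: "m \<in> carrier (fob M T)"
    have "box M pt T e m = box M pt T (one_A :: ('a, 'u) val) m"
      using 1[OF gpt_gset T one_A_bob m] 2[OF gpt_gset T cycD(2)[OF gc] m] gone(2) cycD(4)[OF gc] by simp
    then show "cact M T e m = m" using cact_one[OF M T m] unfolding cact_def by metis
  qed
qed

text \<open>The action is the lift of \<open>box\<close>. Associativity is tested on triple pairings
  and after \<open>alp\<close>, where it becomes \<open>box_assoc\<close>. For the unit law, going
  to \<open>R\<close> and back to \<open>A\<close> multiplies by \<open>e\<close>, and
  \<open>box\<close> does not notice this factor when \<open>e\<close> fixes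
  \<open>M\<close>.\<close>

lemma module_ex: assumes M: "mack M" and fe: "fixes_e e M"
  shows "\<exists>\<rho>. is_module (Day G r) \<Omega> M \<rho>"
proof -
  note R = cycD[OF gc]
  obtain \<rho> where rho: "\<rho> \<in> Hom (dy R M) M"
    "\<And>S T x m. S \<in> gsets G \<Longrightarrow> T \<in> gsets G \<Longrightarrow> x \<in> carrier (fob R S) \<Longrightarrow> m \<in> carrier (fob M T) \<Longrightarrow> \<rho> (gp S T) (un R M S T x m) = box M S T (i S x) m"
    by (rule day_lift[OF gc M M box_pairing[OF gc M]]) blast
  note dRM = day_mack[OF gc M] and dRR = day_mack[OF gc R(1)]
  obtain p2 i2 where c2: "cyc e (dy R R) p2 i2" by (rule cyc_RR[OF gc M]) blast
  note d1 = day_mack[OF c2 M]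
  note da = day_assoc[OF gc M]
  note m1 = day_map[OF c2 M gc M gmul(1) Hom_id[OF M]]
  note m2 = day_map[OF gc dRM gc M Hom_id[OF R(1)] rho(1)]
  note m3 = day_map[OF cyc_A M gc M gone(1) Hom_id[OF M]]
  have f: "hc (dy (dy R R) M) \<rho> (day_map G r (dy R R) R M M (mmul \<Omega>) (hid M)) \<in> Hom (dy (dy R R) M) M"
    by (rule Hom_compose[OF d1 m1(1) rho(1)])
  let ?g1 = "hc (dy (dy R R) M) (day_map G r R R (dy R M) M (hid R) \<rho>) (day_assoc G r R R M)"
  have g1: "?g1 \<in> Hom (dy (dy R R) M) (dy R M)" by (rule Hom_compose[OF d1 da(1) m2(1)])
  have g: "hc (dy (dy R R) M) \<rho> ?g1 \<in> Hom (dy (dy R R) M) M" by (rule Hom_compose[OF d1 g1 rho(1)])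
  have assoc: "hc (dy (dy R R) M) \<rho> (day_map G r (dy R R) R M M (mmul \<Omega>) (hid M)) = hc (dy (dy R R) M) \<rho> ?g1"
  proof (rule triple_eq[OF gc M f g])
    fix S T W x y m assume a: "S \<in> gsets G" "T \<in> gsets G" "W \<in> gsets G" "x \<in> carrier (fob R S)" "y \<in> carrier (fob R T)" "m \<in> carrier (fob M W)"
    have gs: "gp S T \<in> gsets G" "gp T W \<in> gsets G" "gp (gp S T) W \<in> gsets G" "gp S (gp T W) \<in> gsets G" using a by simp_all
    have z: "un R R S T x y \<in> carrier (fob (dy R R) (gp S T))" by (rule pairingD(1)[OF day_pairing[OF gc R(1)] a(1,2,4,5)])
    let ?t = "un (dy R R) M (gp S T) W (un R R S T x y) m"
    have t: "?t \<in> carrier (fob (dy (dy R R) M) (gp (gp S T) W))" by (rule pairingD(1)[OF day_pairing[OF c2 M] gs(1) a(3) z a(6)])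
    have ix: "i S x \<in> carrier (bob S)" and iy: "i T y \<in> carrier (bob T)" using R(6) a by auto
    have bR: "box R S T (i S x) y \<in> carrier (fob R (gp S T))" using box_closed[OF R(1) a(1,2,5) ix] .
    have ib: "i (gp S T) (box R S T (i S x) y) = box A S T (i S x) (i T y)" by (rule box_Hom'[OF R(1,3) mack_A a(1,2) ix a(5)])
    have n: "un R M T W y m \<in> carrier (fob (dy R M) (gp T W))" by (rule pairingD(1)[OF day_pairing[OF gc M] a(2,3,5,6)])
    have L: "hc (dy (dy R R) M) \<rho> (day_map G r (dy R R) R M M (mmul \<Omega>) (hid M)) (gp (gp S T) W) ?t = box M (gp S T) W (box A S T (i S x) (i T y)) m"
      unfolding hc_apply[OF gs(3) t] m1(2)[OF gs(1) a(3) z a(6)] gmul(2)[OF a(1,2,4,5)]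
      using rho(2)[OF gs(1) a(3) bR a(6)] ib a(3,6) by simp
    have at: "day_assoc G r R R M (gp (gp S T) W) ?t \<in> carrier (fob (dy R (dy R M)) (gp (gp S T) W))" by (rule HomD(2)[OF da(1) gs(3) t])
    have mt: "day_map G r R R (dy R M) M (hid R) \<rho> (gp (gp S T) W) (day_assoc G r R R M (gp (gp S T) W) ?t) \<in> carrier (fob (dy R M) (gp (gp S T) W))"
      by (rule HomD(2)[OF m2(1) gs(3) at])
    have Rv: "hc (dy (dy R R) M) \<rho> ?g1 (gp (gp S T) W) ?t = \<rho> (gp (gp S T) W) (day_map G r R R (dy R M) M (hid R) \<rho> (gp (gp S T) W) (day_assoc G r R R M (gp (gp S T) W) ?t))"
      unfolding hc_apply[OF gs(3) t] ..
    have al: "alp S T W \<in> Ar (gp (gp S T) W) (gp S (gp T W))" by (rule alp_arr[OF a(1-3)])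
    \<comment> \<open>Naturality of both outer maps carries \<open>alp\<close> to the innermost
      term, the only place where the associator is specified.\<close>
    have "fmor M (gp (gp S T) W) (gp S (gp T W)) (alp S T W) (hc (dy (dy R R) M) \<rho> ?g1 (gp (gp S T) W) ?t) =
      \<rho> (gp S (gp T W)) (day_map G r R R (dy R M) M (hid R) \<rho> (gp S (gp T W)) (un R (dy R M) S (gp T W) x (un R M T W y m)))"
      unfolding Rv HomD(5)[OF rho(1) gs(3,4) al mt, symmetric] HomD(5)[OF m2(1) gs(3,4) al at, symmetric] da(2)[OF a] ..
    also have "\<dots> = box M S (gp T W) (i S x) (box M T W (i T y) m)"
      using m2(2)[OF a(1) gs(2) a(4) n] rho(2)[OF a(2,3,5,6)] rho(2)[OF a(1) gs(2) a(4) HomD(2)[OF rho(1) gs(2) n]] a(1,4) by simp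
    also have "\<dots> = fmor M (gp (gp S T) W) (gp S (gp T W)) (alp S T W) (hc (dy (dy R R) M) \<rho> (day_map G r (dy R R) R M M (mmul \<Omega>) (hid M)) (gp (gp S T) W) ?t)"
      unfolding L by (rule box_assoc[OF M a(1-3) ix iy a(6), symmetric])
    finally have eq: "fmor M (gp (gp S T) W) (gp S (gp T W)) (alp S T W) (hc (dy (dy R R) M) \<rho> ?g1 (gp (gp S T) W) ?t) =
       fmor M (gp (gp S T) W) (gp S (gp T W)) (alp S T W) (hc (dy (dy R R) M) \<rho> (day_map G r (dy R R) R M M (mmul \<Omega>) (hid M)) (gp (gp S T) W) ?t)" .
    show "hc (dy (dy R R) M) \<rho> (day_map G r (dy R R) R M M (mmul \<Omega>) (hid M)) (gp (gp S T) W) ?t = hc (dy (dy R R) M) \<rho> ?g1 (gp (gp S T) W) ?t"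
      by (rule alp_inj[OF mackD(1)[OF M] a(1-3) HomD(2)[OF f gs(3) t] HomD(2)[OF g gs(3) t] eq[symmetric]])
  qed
  have unit: "hc (dy A M) \<rho> (day_map G r A R M M (mone \<Omega>) (hid M)) = day_lunit G r M"
  proof (rule day_unique[OF cyc_A M M Hom_compose[OF day_mack[OF cyc_A M] m3(1) rho(1)] day_lunit(1)[OF M]], unfold fob_A)
    fix S T m and a :: "('a, 'u) val" assume a: "S \<in> gsets G" "T \<in> gsets G" "a \<in> carrier (bob S)" "m \<in> carrier (fob M T)"
    have u: "un A M S T a m \<in> carrier (fob (dy A M) (gp S T))" using pairingD(1)[OF day_pairing[OF cyc_A M] a(1,2) _ a(4)] a(3) by simp
    have oa: "mone \<Omega> S a \<in> carrier (fob R S)" using HomD(2)[OF gone(1) a(1)] a(3) by simp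
    \<comment> \<open>Both sides are endomorphisms of \<open>A\<close>, so by Yoneda it is enough to
      compare them at \<open>one_A\<close>.\<close>
    have ioa: "i S (mone \<Omega> S a) = cact A S e a"
    proof -
      have ii: "hc A i (mone \<Omega>) \<in> Hom A A" by (rule Hom_compose[OF mack_A gone(1) R(3)])
      have 1: "hc A i (mone \<Omega>) pt one_A = cact A pt e one_A"
        using gone(2) R(4) cact_A_one[OF R(7)] by (simp add: compose_eq)
      have cc: "(\<lambda>S\<in>gsets G. \<lambda>m\<in>carrier (fob A S). cact A S e m) \<in> Hom A A"
        by (rule cact_End[OF mack_A R(7)])
      have "hc A i (mone \<Omega>) S a = (\<lambda>S\<in>gsets G. \<lambda>m\<in>carrier (fob A S). cact A S e m) S a"
        unfolding Hom_A_yo[OF ii mack_A a(1,3)] Hom_A_yo[OF cc mack_A a(1,3)] 1 by simp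
      then show ?thesis using a by (simp add: compose_eq)
    qed
    have "box M S T (cact A S e a) m = box M S T a m"
      using box_cact1[OF M a(1,2,4,3) R(7)] fe box_closed[OF M a(1,2,4,3)] a(1,2) unfolding fixes_e_def by simp
    then show "hc (dy A M) \<rho> (day_map G r A R M M (mone \<Omega>) (hid M)) (gp S T) (un A M S T a m) = day_lunit G r M (gp S T) (un A M S T a m)"
      unfolding hc_apply[OF gprod_gset[OF a(1,2)] u] day_lunit(2)[OF M a]
      using m3(2)[OF a(1,2) _ a(4)] rho(2)[OF a(1,2) oa a(4)] a ioa by simp
  qed
  have "is_module (Day G r) \<Omega> M \<rho>"
    unfolding is_module_def Let_def Day_simps Mackey_obj_iff using M rho(1) assoc unit by blast
  then show ?thesis by blast
qed

lemma module_unique: assumes "is_module (Day G r) \<Omega> M \<rho>" "is_module (Day G r) \<Omega> M \<rho>'" shows "\<rho> = \<rho>'"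
  by (rule day_unique[OF gc moduleD(1)[OF assms(1)] moduleD(1)[OF assms(1)] moduleD(2)[OF assms(1)] moduleD(2)[OF assms(2)]])
    (use moduleD(3)[OF assms(1)] moduleD(3)[OF assms(2)] in simp)

lemma module_arr: assumes m: "is_module (Day G r) \<Omega> M \<rho>" and n: "is_module (Day G r) \<Omega> N \<sigma>"
  shows "arr (module_cat (Day G r) \<Omega>) (M, \<rho>) (N, \<sigma>) = Hom M N"
proof -
  note M = moduleD[OF m] and N = moduleD[OF n]
  have "hc (dy R M) f \<rho> = hc (dy R M) \<sigma> (day_map G r R R M N (hid R) f)" if f: "f \<in> Hom M N" for f
  proof -
    note d = day_map[OF gc M(1) gc N(1) Hom_id[OF cycD(1)[OF gc]] f]
    show ?thesis
    proof (rule day_unique[OF gc M(1) N(1) Hom_compose[OF day_mack[OF gc M(1)] M(2) f] Hom_compose[OF day_mack[OF gc M(1)] d(1) N(2)]])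
      fix S T x m assume a: "S \<in> gsets G" "T \<in> gsets G" "x \<in> carrier (fob R S)" "m \<in> carrier (fob M T)"
      note u = pairingD(1)[OF day_pairing[OF gc M(1)] a]
      show "hc (dy R M) f \<rho> (gp S T) (un R M S T x m) = hc (dy R M) \<sigma> (day_map G r R R M N (hid R) f) (gp S T) (un R M S T x m)"
        unfolding hc_apply[OF gprod_gset[OF a(1,2)] u]
        using d(2)[OF a] M(3)[OF a] N(3)[OF a(1-3) HomD(2)[OF f a(2,4)]] box_Hom'[OF M(1) f N(1) a(1,2) cycD(6)[OF gc a(1,3)] a(4)] a by simp
    qed
  qed
  then show ?thesis by (auto simp: module_cat_def)
qed

end

text \<open>The morphisms of the module categories and of the full subcategories are the natural
  transformations between underlying Mackey functors, so the category laws can be verified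
  once.\<close>

lemma category_over:
  fixes F :: "'o \<Rightarrow> ('a, 'v) mfun"
  assumes o: "\<And>X. X \<in> obj C \<Longrightarrow> mack (F X)"
    and "\<And>X Y. X \<in> obj C \<Longrightarrow> Y \<in> obj C \<Longrightarrow> arr C X Y = Hom (F X) (F Y)"
    and "\<And>X. X \<in> obj C \<Longrightarrow> ide C X = hid (F X)"
    and "\<And>X Y Z f g. X \<in> obj C \<Longrightarrow> Y \<in> obj C \<Longrightarrow> Z \<in> obj C \<Longrightarrow> cmp C X Y Z g f = hc (F X) g f"
  shows "category C"
proof -
  have 1: "f \<in> Hom M N \<Longrightarrow> g \<in> Hom N Q \<Longrightarrow> mack M \<Longrightarrow> hc M g f \<in> Hom M Q" for f g and M N Q :: "('a, 'v) mfun"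
    using Hom_compose by blast
  have 2: "hc M f (hid M) = f \<and> hc M (hid N) f = f" if "f \<in> Hom M N" "mack M" "mack N" for f and M N :: "('a, 'v) mfun"
  proof
    show "hc M f (hid M) = f"
      by (rule Hom_eqI[OF Hom_compose[OF that(2) Hom_id[OF that(2)] that(1)] that(1)]) (simp add: compose_eq)
    show "hc M (hid N) f = f"
      by (rule Hom_eqI[OF Hom_compose[OF that(2) that(1) Hom_id[OF that(3)]] that(1)]) (simp add: compose_eq HomD[OF that(1)])
  qed
  have 3: "hc M (hc N h g) f = hc M h (hc M g f)"
    if "f \<in> Hom M N" "g \<in> Hom N Q" "h \<in> Hom Q W" "mack M" "mack N" for f g h and M N Q W :: "('a, 'v) mfun"
    by (rule Hom_eqI[OF Hom_compose[OF that(4,1) Hom_compose[OF that(5,2,3)]] Hom_compose[OF that(4) Hom_compose[OF that(4,1,2)] that(3)]])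
      (simp add: compose_eq HomD[OF that(1)])
  show ?thesis unfolding category_def
  proof (intro conjI ballI)
    fix X assume "X \<in> obj C" then show "ide C X \<in> arr C X X" using assms Hom_id[OF o] by simp
  next
    fix X Y Z f g assume "X \<in> obj C" "Y \<in> obj C" "Z \<in> obj C" "f \<in> arr C X Y" "g \<in> arr C Y Z"
    then show "cmp C X Y Z g f \<in> arr C X Z" using assms 1[of f "F X" "F Y" g "F Z"] by simp
  next
    fix X Y f assume a: "X \<in> obj C" "Y \<in> obj C" "f \<in> arr C X Y"
    then show "cmp C X X Y f (ide C X) = f" "cmp C X Y Y (ide C Y) f = f"
      using assms 2[of f "F X" "F Y"] by auto
  next
    fix W X Y Z f g h assume "W \<in> obj C" "X \<in> obj C" "Y \<in> obj C" "Z \<in> obj C" "f \<in> arr C W X" "g \<in> arr C X Y" "h \<in> arr C Y Z"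
    then show "cmp C W X Z (cmp C X Y Z h g) f = cmp C W Y Z h (cmp C W X Y g f)"
      using assms 3[of f "F W" "F X" g "F Y" h "F Z"] by simp
  qed
qed

lemma fixes_e_acts: fixes M :: "('a, ('a, 'u) val) mfun"
  assumes "mack M" "e \<in> carrier (bob pt)" shows "acts_as_id G r e M \<longleftrightarrow> fixes_e e M"
  using elt_act_eq[OF assms] unfolding acts_as_id_def fixes_e_def by simp

lemma module_cat_simps: "X \<in> obj (module_cat D \<Omega>) \<longleftrightarrow> is_module D \<Omega> (fst X) (snd X)"
  "ide (module_cat D \<Omega>) X = ide D (fst X)"
  "cmp (module_cat D \<Omega>) X Y Z = cmp D (fst X) (fst Y) (fst Z)"
  by (auto simp: module_cat_def)

lemma module_arr': assumes "idem_monoid e \<Omega> p i" "X \<in> obj (module_cat (Day G r) \<Omega>)" "Y \<in> obj (module_cat (Day G r) \<Omega>)"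
  shows "arr (module_cat (Day G r) \<Omega>) X Y = Hom (fst X) (fst Y)"
  using module_arr[OF assms(1), of "fst X" "snd X" "fst Y" "snd Y"] assms(2,3) by (simp add: module_cat_simps)

lemma category_modules: assumes "idem_monoid e \<Omega> p i" shows "category (module_cat (Day G r) \<Omega>)"
  by (rule category_over[where F = fst])
    (use moduleD(1)[OF assms] module_arr'[OF assms] in \<open>auto simp: module_cat_simps\<close>)

lemma full_subcat_simps: "X \<in> obj (full_subcat C P) \<longleftrightarrow> X \<in> obj C \<and> P X" "arr (full_subcat C P) = arr C"
  "ide (full_subcat C P) = ide C" "cmp (full_subcat C P) = cmp C"
  by (simp_all add: full_subcat_def)

lemma category_sub: "category (full_subcat (Mackey G r) P)"
  by (rule category_over[where F = "\<lambda>x. x"]) (auto simp: full_subcat_simps Mackey_obj_iff)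

text \<open>It is an isomorphism and not just an equivalence because module structures are unique:
  the inverse functor chooses a structure by \<open>SOME\<close>, and must return the given
  one.\<close>

lemma modules_cat_iso: fixes e :: "('a, 'u) val" assumes gd: "idem_monoid e \<Omega> p i" 
  shows "is_cat_iso (module_cat (Day G r) \<Omega>) (full_subcat (Mackey G r) (acts_as_id G r e)) forget"
  unfolding is_cat_iso_def
proof (intro conjI category_modules[OF gd] category_sub)
  let ?C = "module_cat (Day G r) \<Omega>" and ?D = "full_subcat (Mackey G r) (acts_as_id G r e)"
  note md = moduleD[OF gd] and ar = module_arr'[OF gd]
  have eb: "e \<in> carrier (bob pt)" using cycD(7)[OF gc[OF gd]] .
  have o: "X \<in> obj ?C \<Longrightarrow> mack (fst X) \<and> acts_as_id G r e (fst X)" for X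
    using md fixes_e_acts[OF _ eb] by (simp add: module_cat_simps)
  show "is_functor ?C ?D forget"
    unfolding is_functor_def using o ar by (auto simp: forget_def full_subcat_simps Mackey_obj_iff module_cat_simps(2,3))
  define F' where "F' = \<lparr>fob = (\<lambda>M. (M, SOME \<rho>. is_module (Day G r) \<Omega> M \<rho>)), fmor = (\<lambda>(M :: ('a, ('a, 'u) val) mfun) (N :: ('a, ('a, 'u) val) mfun) (f :: ('a, ('a, 'u) val) mtrafo). f)\<rparr>"
  have m: "is_module (Day G r) \<Omega> M (SOME \<rho>. is_module (Day G r) \<Omega> M \<rho>)" if "M \<in> obj ?D" for M
  proof -
    have M: "mack M" "acts_as_id G r e M" using that by (simp_all add: full_subcat_simps Mackey_obj_iff)
    then have "fixes_e e M" using fixes_e_acts[OF M(1) eb] by simp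
    then show ?thesis by (rule someI_ex[OF module_ex[OF gd M(1)]])
  qed
  have mo: "fob F' M \<in> obj ?C" "fst (fob F' M) = M" if "M \<in> obj ?D" for M
    using m[OF that] by (simp_all add: F'_def module_cat_simps)
  have F': "is_functor ?D ?C F'"
    unfolding is_functor_def
  proof (intro conjI ballI)
    fix M assume M: "M \<in> obj ?D" show "fob F' M \<in> obj ?C" using mo[OF M] by simp
    show "fmor F' M M (ide ?D M) = ide ?C (fob F' M)" using mo[OF M] by (simp add: module_cat_simps(2) full_subcat_simps F'_def)
  next
    fix M N f assume a: "M \<in> obj ?D" "N \<in> obj ?D" "f \<in> arr ?D M N"
    show "fmor F' M N f \<in> arr ?C (fob F' M) (fob F' N)"
      unfolding ar[OF mo(1)[OF a(1)] mo(1)[OF a(2)]] mo(2)[OF a(1)] mo(2)[OF a(2)] using a(3) by (simp add: full_subcat_simps F'_def)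
  next
    fix M N Q f g assume "M \<in> obj ?D" "N \<in> obj ?D" "Q \<in> obj ?D"
    then show "fmor F' M Q (cmp ?D M N Q g f) = cmp ?C (fob F' M) (fob F' N) (fob F' Q) (fmor F' N Q g) (fmor F' M N f)"
      by (simp add: module_cat_simps(3) full_subcat_simps F'_def)
  qed
  have bk: "fob F' (fob forget X) = X" if X: "X \<in> obj ?C" for X
  proof -
    have "fst X \<in> obj ?D" using o[OF X] by (simp add: full_subcat_simps Mackey_obj_iff)
    then have "(SOME \<rho>. is_module (Day G r) \<Omega> (fst X) \<rho>) = snd X"
      using module_unique[OF gd m] X by (simp add: module_cat_simps)
    then show ?thesis by (simp add: F'_def forget_def)
  qed
  show "\<exists>F'. is_functor ?D ?C F' \<and> (\<forall>X\<in>obj ?C. fob F' (fob forget X) = X) \<and>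
        (\<forall>X\<in>obj ?C. \<forall>Y\<in>obj ?C. \<forall>f\<in>arr ?C X Y. fmor F' (fob forget X) (fob forget Y) (fmor forget X Y f) = f) \<and>
        (\<forall>A\<in>obj ?D. fob forget (fob F' A) = A) \<and>
        (\<forall>A\<in>obj ?D. \<forall>B\<in>obj ?D. \<forall>h\<in>arr ?D A B. fmor forget (fob F' A) (fob F' B) (fmor F' A B h) = h)"
    by (rule exI[of _ F']) (use F' bk in \<open>simp add: F'_def forget_def\<close>)
qed

lemma idem_monoid_burnside: "idem_monoid one_A (burnside_monoid G r) (one_A :: ('a, 'u) val) idA"
  unfolding idem_monoid_def burnside_monoid_def monoid_obj.simps Day_simps
proof (intro conjI ballI)
  show "hid A \<in> Hom A (A :: ('a, ('a, 'u) val) mfun)" by (rule Hom_id[OF mack_A])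
qed (simp_all add: cyc_A[simplified] day_lunit[OF mack_A])

section \<open>Summands of Mackey functors and their induced module structures\<close>

abbreviation sm where "sm \<equiv> summand G r"

lemma sm_ops [simp]: "x \<oplus>\<^bsub>fob (sm e M) S\<^esub> y = x \<oplus>\<^bsub>fob M S\<^esub> y"
  "q \<odot>\<^bsub>fob (sm e M) S\<^esub> x = q \<odot>\<^bsub>fob M S\<^esub> x" "\<zero>\<^bsub>fob (sm e M) S\<^esub> = \<zero>\<^bsub>fob M S\<^esub>"
  by (simp_all add: summand_def)

text \<open>\<open>summand\<close> and \<open>smd\<close> are compared only at finite G-sets, so
  they are not identified as records; being a Mackey functor has to be transferred along agreement
  there.\<close>

lemma mack_cong: assumes M: "mack M" and f: "\<And>S. S \<in> gsets G \<Longrightarrow> fob N S = fob M S"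
    and m: "\<And>S T X. S \<in> gsets G \<Longrightarrow> T \<in> gsets G \<Longrightarrow> X \<in> Ar S T \<Longrightarrow> fmor N S T X = fmor M S T X"
  shows "mack N"
  unfolding mack_def
proof
  note Ml = Ml[OF M]
  show "lin_functor N"
    by (rule lin_functorI) (use f m Ml(1-3) Ml(4) cmpL_arr in \<open>simp_all\<close>)
  show "additive N" unfolding additive_def
  proof (intro ballI allI impI)
    fix S T U l h B x
    assume a: "S \<in> gsets G" "T \<in> gsets G" "(U, l, h) \<in> spans G r S T" "invar U B" "x \<in> carrier (fob N S)"
    have C: "invar U (pts U - B)" by (rule invar_compl[OF spansD(1)[OF a(3)] a(4)])
    show "fmor N S T (cl S T (U, l, h)) x = fmor N S T (cl S T (rst (U, l, h) B)) x \<oplus>\<^bsub>fob N T\<^esub> fmor N S T (cl S T (rst (U, l, h) (pts U - B))) x"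
      unfolding m[OF a(1,2) cl_arr[OF a(3)]] m[OF a(1,2) cl_arr[OF rst_spans[OF a(3,4)]]] m[OF a(1,2) cl_arr[OF rst_spans[OF a(3) C]]] f[OF a(2)]
      by (rule additiveD[OF mackD(2)[OF M] a(1-4)]) (use a(5) f[OF a(1)] in simp)
  qed
qed

context
  fixes e :: "('a, 'u) val" and M :: "('a, ('a, 'u) val) mfun"
  assumes e: "idem_el e" and M: "mack M"
begin

lemma eb: "e \<in> carrier (bob pt)" using e by (simp add: idem_el_def)

lemma sm_smd: assumes "S \<in> gsets G" shows "fob (sm e M) S = fob (smd e M) S" "fmor (sm e M) S T X = fmor (smd e M) S T X"
proof -
  have "elt_act G r e M S ` carrier (fob M S) = cact M S e ` carrier (fob M S)"
    by (rule image_cong[OF refl]) (rule elt_act_eq[OF M eb assms])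
  then show "fob (sm e M) S = fob (smd e M) S" "fmor (sm e M) S T X = fmor (smd e M) S T X"
    by (simp_all add: summand_def smd_def)
qed

lemma sm_mack: "mack (sm e M)"
  by (rule mack_cong[OF mack_smd[OF e M]]) (simp_all add: sm_smd)

lemma sm_mem: "S \<in> gsets G \<Longrightarrow> x \<in> carrier (fob (sm e M) S) \<longleftrightarrow> x \<in> carrier (fob M S) \<and> cact M S e x = x"
  unfolding sm_smd(1) by (rule smd_mem[OF e M])

lemma sm_fmor: "S \<in> gsets G \<Longrightarrow> x \<in> carrier (fob (sm e M) S) \<Longrightarrow> fmor (sm e M) S T X x = fmor M S T X x"
  unfolding sm_smd by (rule smd_fmor)

lemma sm_incl: "summand_incl G r e M \<in> Hom (sm e M) M"
  "S \<in> gsets G \<Longrightarrow> x \<in> carrier (fob (sm e M) S) \<Longrightarrow> summand_incl G r e M S x = x"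
  unfolding summand_incl_def
  by (rule HomI[OF sm_mack]) (simp_all add: sm_mem sm_fmor)

lemma sm_box: assumes "S \<in> gsets G" "T \<in> gsets G" "a \<in> carrier (bob S)" "m \<in> carrier (fob (sm e M) T)"
  shows "box (sm e M) S T a m = box M S T a m"
  using box_Hom'[OF sm_mack sm_incl(1) M assms] sm_incl(2)[OF assms(2,4)]
    sm_incl(2)[OF gprod_gset[OF assms(1,2)] box_closed[OF sm_mack assms(1,2,4,3)]] by simp

lemma sm_cact: assumes "T \<in> gsets G" "a \<in> carrier (bob pt)" "m \<in> carrier (fob (sm e M) T)"
  shows "cact (sm e M) T a m = cact M T a m"
  using cact_Hom[OF sm_mack sm_incl(1) M assms] sm_incl(2)[OF assms(1,3)] sm_incl(2)[OF assms(1) cact_closed[OF sm_mack assms(1,3,2)]] by simp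

lemma sm_fixes: "fixes_e e (sm e M)"
  unfolding fixes_e_def using sm_cact[OF _ eb] sm_mem by simp

lemma cact_in_sm: "S \<in> gsets G \<Longrightarrow> m \<in> carrier (fob M S) \<Longrightarrow> cact M S e m \<in> carrier (fob (sm e M) S)"
  unfolding sm_smd(1) by (rule smd_cact[OF e M])

lemma sm_proj: "(\<lambda>S\<in>gsets G. \<lambda>m\<in>carrier (fob M S). cact M S e m) \<in> Hom M (sm e M)"
  using HomI[OF M, of "\<lambda>S m. cact M S e m" "sm e M"] cact_in_sm linD[OF cact_lin2[OF M _ eb]] cact_natural[OF M _ _ _ _ eb] sm_fmor
  by simp

lemma sm_restrict: assumes "f \<in> Hom M N" "mack N" "idem_el e"
  shows "(\<lambda>S\<in>gsets G. \<lambda>m\<in>carrier (fob (sm e M) S). f S m) \<in> Hom (sm e M) N"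
  by (rule HomI[OF sm_mack]) (simp_all add: sm_mem sm_fmor HomD[OF assms(1)])

end

lemma idem_cact_one: "idem_el e \<Longrightarrow> cact A pt e one_A = e"
  by (rule cact_A_one) (simp add: idem_el_def)

text \<open>The projection of \<open>A\<close> onto \<open>eA\<close> sends \<open>one_A\<close> to
  \<open>e\<close>, so it is the Yoneda map of \<open>e\<close>; on elements of \<open>eA\<close> it
  is the identity.\<close>

lemma cyc_sm: fixes e :: "('a, 'u) val" assumes e: "idem_el e" shows "cyc e (sm e A) e (summand_incl G r e A)"
  unfolding cyc_def
proof (intro conjI ballI)
  have eb: "e \<in> carrier (bob pt)" using e by (simp add: idem_el_def)
  note m = sm_mem[OF e mack_A]
  show "mack (sm e A)" by (rule sm_mack[OF e mack_A])
  show ep: "e \<in> carrier (fob (sm e A) pt)" using m[OF gpt_gset] e by (simp add: idem_el_def)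
  show "summand_incl G r e A \<in> Hom (sm e A) A" by (rule sm_incl(1)[OF e mack_A])
  show "summand_incl G r e A pt e = e" by (rule sm_incl(2)[OF e mack_A gpt_gset ep])
  fix S x assume S: "S \<in> gsets G" and x: "x \<in> carrier (fob (sm e A) S)"
  have x': "x \<in> carrier (bob S)" "cact A S e x = x" using x m[OF S] by auto
  let ?q = "\<lambda>S\<in>gsets G. \<lambda>m\<in>carrier (fob A S). cact A S e m"
  have "?q S x = yo (sm e A) (?q pt one_A) S x" by (rule Hom_A_yo[OF sm_proj[OF e mack_A] sm_mack[OF e mack_A] S x'(1)])
  then have "x = yo (sm e A) e S x" using S x' idem_cact_one[OF e] by simp
  then show "yo (sm e A) e S (summand_incl G r e A S x) = x" using sm_incl(2)[OF e mack_A S x] by simp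
qed

text \<open>By definition the composite is a map to \<open>M\<close>, and the issue is to land in
  \<open>eM\<close>. The universal property provides a map \<open>t\<close> to \<open>eM\<close>
  which, followed by the inclusion, agrees with the composite on pairings. The inclusion changes no
  values, so the two are literally the same function.\<close>

lemma summand_action:
  fixes e :: "('a, 'u) val" and M :: "('a, ('a, 'u) val) mfun"
  assumes e: "idem_el e" and M: "mack M" and rho: "\<rho> \<in> Hom (dy A M) M"
    "\<And>S T a m. S \<in> gsets G \<Longrightarrow> T \<in> gsets G \<Longrightarrow> a \<in> carrier (bob S) \<Longrightarrow> m \<in> carrier (fob M T) \<Longrightarrow> \<rho> (gp S T) (un A M S T a m) = box M S T a m"
  shows "summand_action G r e M \<rho> \<in> Hom (dy (sm e A) (sm e M)) (sm e M)"
    "S \<in> gsets G \<Longrightarrow> T \<in> gsets G \<Longrightarrow> x \<in> carrier (fob (sm e A) S) \<Longrightarrow> m \<in> carrier (fob (sm e M) T) \<Longrightarrow>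
       summand_action G r e M \<rho> (gp S T) (un (sm e A) (sm e M) S T x m) = box (sm e M) S T (summand_incl G r e A S x) m"
proof -
  let ?R = "sm e A" and ?N = "sm e M" and ?i = "summand_incl G r e A" and ?j = "summand_incl G r e M"
  note c = cyc_sm[OF e] and N = sm_mack[OF e M]
  note D = day_mack[OF c N] and pd = pairingD[OF day_pairing[OF c N]]
  note dm = day_map[OF c N cyc_A M sm_incl(1)[OF e mack_A] sm_incl(1)[OF e M]]
  have s: "summand_action G r e M \<rho> = hc (dy ?R ?N) \<rho> (day_map G r ?R A ?N M ?i ?j)"
    unfolding summand_action_def Let_def Day_simps ..
  have sH: "hc (dy ?R ?N) \<rho> (day_map G r ?R A ?N M ?i ?j) \<in> Hom (dy ?R ?N) M"
    by (rule Hom_compose[OF D dm(1) rho(1)])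
  have sv: "hc (dy ?R ?N) \<rho> (day_map G r ?R A ?N M ?i ?j) (gp S T) (un ?R ?N S T x m) = box M S T (?i S x) m"
    if a: "S \<in> gsets G" "T \<in> gsets G" "x \<in> carrier (fob ?R S)" "m \<in> carrier (fob ?N T)" for S T x m
    unfolding hc_apply[OF gprod_gset[OF a(1,2)] pd(1)[OF a]] dm(2)[OF a] sm_incl(2)[OF e M a(2,4)]
    by (rule rho(2)[OF a(1,2) cycD(6)[OF c a(1,3)]]) (use a(4) sm_mem[OF e M a(2)] in simp)
  obtain t where t: "t \<in> Hom (dy ?R ?N) ?N"
    "\<And>S T x m. S \<in> gsets G \<Longrightarrow> T \<in> gsets G \<Longrightarrow> x \<in> carrier (fob ?R S) \<Longrightarrow> m \<in> carrier (fob ?N T) \<Longrightarrow> t (gp S T) (un ?R ?N S T x m) = box ?N S T (?i S x) m"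
    by (rule day_back[OF c N]) blast
  have tj: "hc (dy ?R ?N) ?j t = hc (dy ?R ?N) \<rho> (day_map G r ?R A ?N M ?i ?j)"
  proof (rule day_unique[OF c N M Hom_compose[OF D t(1) sm_incl(1)[OF e M]] sH])
    fix S T x m assume a: "S \<in> gsets G" "T \<in> gsets G" "x \<in> carrier (fob ?R S)" "m \<in> carrier (fob ?N T)"
    have b: "box ?N S T (?i S x) m \<in> carrier (fob ?N (gp S T))" by (rule box_closed[OF N a(1,2,4) cycD(6)[OF c a(1,3)]])
    show "hc (dy ?R ?N) ?j t (gp S T) (un ?R ?N S T x m) = hc (dy ?R ?N) \<rho> (day_map G r ?R A ?N M ?i ?j) (gp S T) (un ?R ?N S T x m)"
      unfolding sv[OF a] unfolding hc_apply[OF gprod_gset[OF a(1,2)] pd(1)[OF a]] t(2)[OF a] sm_incl(2)[OF e M gprod_gset[OF a(1,2)] b]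
      by (rule sm_box[OF e M a(1,2) cycD(6)[OF c a(1,3)] a(4)])
  qed
  have "hc (dy ?R ?N) ?j t = t"
  proof (rule extensionalityI[of _ "gsets G"])
    fix S assume S: "S \<in> gsets G"
    show "hc (dy ?R ?N) ?j t S = t S"
    proof (rule extensionalityI[of _ "carrier (fob (dy ?R ?N) S)"])
      show "t S \<in> extensional (carrier (fob (dy ?R ?N) S))" by (rule linmapsD(4)[OF HomD(1)[OF t(1) S]])
      fix y assume y: "y \<in> carrier (fob (dy ?R ?N) S)"
      show "hc (dy ?R ?N) ?j t S y = t S y"
        unfolding hc_apply[OF S y] by (rule sm_incl(2)[OF e M S HomD(2)[OF t(1) S y]])
    qed (use S in simp)
  qed (simp_all add: HomD(6)[OF t(1)])
  then have st: "summand_action G r e M \<rho> = t" unfolding s tj[symmetric] .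
  show "summand_action G r e M \<rho> \<in> Hom (dy ?R ?N) ?N" unfolding st by (rule t(1))
  show "S \<in> gsets G \<Longrightarrow> T \<in> gsets G \<Longrightarrow> x \<in> carrier (fob (sm e A) S) \<Longrightarrow> m \<in> carrier (fob (sm e M) T) \<Longrightarrow>
       summand_action G r e M \<rho> (gp S T) (un (sm e A) (sm e M) S T x m) = box (sm e M) S T (summand_incl G r e A S x) m"
    unfolding st by (rule t(2))
qed

lemma idem_monoid_summand: fixes e :: "('a, 'u) val" assumes e: "idem_el e"
  shows "idem_monoid e (summand_monoid G r e) e (summand_incl G r e A)"
proof -
  have eb: "e \<in> carrier (bob pt)" using e by (simp add: idem_el_def)
  note lu = day_lunit[OF mack_A]
  have lu2: "day_lunit G r A (gp S T) (un A A S T a m) = box A S T a m"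
    if "S \<in> gsets G" "T \<in> gsets G" "a \<in> carrier (bob S)" "m \<in> carrier (fob A T)" for S T and a m :: "('a, 'u) val"
    by (rule lu(2)[OF that])
  note sa = summand_action[OF e mack_A lu(1) lu2]
  have mul: "mmul (summand_monoid G r e) = summand_action G r e A (day_lunit G r A)" "mob (summand_monoid G r e) = sm e A"
    by (simp_all add: summand_monoid_def burnside_monoid_def)
  have one: "mone (summand_monoid G r e) = (\<lambda>S\<in>gsets G. \<lambda>m\<in>carrier (fob A S). cact A S e m)"
    unfolding summand_monoid_def monoid_obj.simps
    by (intro restrict_ext) (rule elt_act_eq[OF mack_A eb])
  show ?thesis
    unfolding idem_monoid_def mul one
  proof (intro conjI ballI)
    show "cyc e (sm e A) e (summand_incl G r e A)" by (rule cyc_sm[OF e])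
    show "summand_action G r e A (day_lunit G r A) \<in> Hom (dy (sm e A) (sm e A)) (sm e A)" by (rule sa(1))
    show "(\<lambda>S\<in>gsets G. \<lambda>m\<in>carrier (fob A S). cact A S e m) \<in> Hom A (sm e A)" by (rule sm_proj[OF e mack_A])
    show "(\<lambda>S\<in>gsets G. \<lambda>m\<in>carrier (fob A S). cact A S e m) pt one_A = e" using idem_cact_one[OF e] by simp
  qed (rule sa(2))
qed

text \<open>The module laws are not verified for the induced action itself. A structure
  \<open>\<sigma>\<close> exists by \<open>module_ex\<close>, and the two actions have the same
  values on pairings, hence coincide.\<close>

lemma summand_module: fixes e :: "('a, 'u) val" and M :: "('a, ('a, 'u) val) mfun"
  assumes e: "idem_el e" and m: "is_module (Day G r) (burnside_monoid G r) M \<rho>"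
  shows "is_module (Day G r) (summand_monoid G r e) (sm e M) (summand_action G r e M \<rho>)"
proof -
  note md = moduleD[OF idem_monoid_burnside m]
  have M: "mack M" by (rule md(1))
  have mob: "mob (burnside_monoid G r) = A" "mob (summand_monoid G r e) = sm e A"
    by (simp_all add: burnside_monoid_def summand_monoid_def)
  have rho: "\<rho> \<in> Hom (dy A M) M" using md(2) by (simp add: mob)
  have r2: "\<rho> (gp S T) (un A M S T a m) = box M S T a m"
    if "S \<in> gsets G" "T \<in> gsets G" "a \<in> carrier (bob S)" "m \<in> carrier (fob M T)" for S T a m
    using md(3)[OF that(1,2) _ that(4), unfolded mob, of a] that(1,3) by simp
  note sa = summand_action[OF e M rho r2]
  note N = sm_mack[OF e M]
  obtain \<sigma> where s: "is_module (Day G r) (summand_monoid G r e) (sm e M) \<sigma>"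
    using module_ex[OF idem_monoid_summand[OF e] N sm_fixes[OF e M]] by blast
  note sd = moduleD[OF idem_monoid_summand[OF e] s, unfolded mob]
  have "summand_action G r e M \<rho> = \<sigma>"
    by (rule day_unique[OF cyc_sm[OF e] N N sa(1) sd(2)]) (simp_all only: sa(2) sd(3))
  then show ?thesis using s by simp
qed

end

lemma lin_finsum:
  assumes "lin V W f" "vs V" "vs W" "finite J" "\<And>j. j \<in> J \<Longrightarrow> x j \<in> carrier V"
  shows "finsum V x J \<in> carrier V" "f (finsum V x J) = finsum W (\<lambda>j. f (x j)) J"
proof -
  interpret V: module rat_ring V by fact
  interpret W: module rat_ring W by fact
  have c: "finsum V x J \<in> carrier V" if "J' \<subseteq> J" "J = J'" for J' using assms(5) by (intro V.finsum_closed) auto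
  then show "finsum V x J \<in> carrier V" by blast
  have fx: "f (x j) \<in> carrier W" if "j \<in> J" for j using linD(1)[OF assms(1) assms(5)[OF that]] .
  show "f (finsum V x J) = finsum W (\<lambda>j. f (x j)) J"
    using assms(4,5) fx
  proof (induction J rule: finite_induct)
    case empty then show ?case
      using linD(3)[OF assms(1), of "\<zero>\<^bsub>V\<^esub>" 0] linD(1)[OF assms(1), of "\<zero>\<^bsub>V\<^esub>"] assms(2,3) by simp
  next
    case (insert j J)
    have s: "finsum V x J \<in> carrier V" using insert.prems by (intro V.finsum_closed) auto
    have e1: "finsum V x (insert j J) = x j \<oplus>\<^bsub>V\<^esub> finsum V x J"
      using insert by (intro V.finsum_insert) auto
    have e2: "finsum W (\<lambda>j. f (x j)) (insert j J) = f (x j) \<oplus>\<^bsub>W\<^esub> finsum W (\<lambda>j. f (x j)) J"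
      using insert by (intro W.finsum_insert) auto
    show ?case unfolding e1 e2 using linD(2)[OF assms(1) _ s, of "x j"] insert by simp
  qed
qed

text \<open>The target of the marks, so that the reduction to orbits by \<open>bob_lin_eqI\<close>
  and \<open>lin_bel\<close> applies to them.\<close>

definition Qv :: "(rat, rat) module" where
  "Qv = \<lparr>carrier = UNIV, mult = undefined, one = undefined, zero = 0, add = (+), smult = (*)\<rparr>"

lemma Qv_simps [simp]: "carrier Qv = UNIV" "x \<oplus>\<^bsub>Qv\<^esub> y = x + y" "q \<odot>\<^bsub>Qv\<^esub> x = q * x" "\<zero>\<^bsub>Qv\<^esub> = 0"
  by (simp_all add: Qv_def)

lemma vs_Qv [simp]: "vs Qv"
  by (rule vsI) (auto simp: algebra_simps)

lemma finsum_Qv: assumes "finite J" shows "finsum Qv f J = sum f J"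
proof -
  interpret module rat_ring Qv by simp
  show ?thesis using assms by (induction J rule: finite_induct) (simp_all add: finsum_insert)
qed

context transfer_group
begin

subsection \<open>Marks\<close>

definition fx :: "'a set \<Rightarrow> 'a gset \<Rightarrow> nat set" where
  "fx K U = {u \<in> pts U. \<forall>k\<in>K. act U k u = u}"

definition mk :: "'a set \<Rightarrow> 'a span set \<Rightarrow> rat" where
  "mk K \<kappa> = (case (SOME \<sigma>. \<sigma> \<in> \<kappa>) of (U, l, h) \<Rightarrow> of_nat (card (fx K U)))"

lemma fx_iso: assumes "f \<in> emaps G U V" "bij_betw f (pts U) (pts V)" "K \<subseteq> carrier G" "U \<in> gsets G"
  shows "card (fx K U) = card (fx K V)"
proof -
  have "f ` fx K U = fx K V"
  proof
    show "f ` fx K U \<subseteq> fx K V" using assms(1,3) emapsD[OF assms(1)] unfolding fx_def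
      by (auto simp: subset_iff emapsD(2)[OF assms(1), symmetric])
    show "fx K V \<subseteq> f ` fx K U"
    proof
      fix v assume v: "v \<in> fx K V"
      then obtain u where u: "u \<in> pts U" "v = f u" using assms(2) unfolding fx_def bij_betw_def by auto
      have "act U k u = u" if k: "k \<in> K" for k
      proof -
        have kc: "k \<in> carrier G" using k assms(3) by auto
        have "f (act U k u) = f u" using emapsD(2)[OF assms(1) kc u(1)] v k u(2) unfolding fx_def by simp
        then show ?thesis using assms(2) u(1) kc assms(4) unfolding bij_betw_def by (meson act_closed inj_onD)
      qed
      then show "v \<in> f ` fx K U" using u unfolding fx_def by auto
    qed
  qed
  moreover have "inj_on f (fx K U)" using assms(2) unfolding bij_betw_def fx_def by (auto intro: inj_on_subset)
  ultimately show ?thesis by (metis card_image)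
qed

lemma mk_cl: assumes "(U, l, h) \<in> spans G r S T" "K \<subseteq> carrier G" shows "mk K (cl S T (U, l, h)) = of_nat (card (fx K U))"
proof -
  obtain U' l' h' where e: "(SOME \<sigma>. \<sigma> \<in> cl S T (U, l, h)) = (U', l', h')" by (metis prod_cases3)
  have "(U', l', h') \<in> cl S T (U, l, h)" using someI_ex[of "\<lambda>\<sigma>. \<sigma> \<in> cl S T (U, l, h)"] cl_self[OF assms(1)] e by metis
  then have "((U, l, h), (U', l', h')) \<in> span_rel G r S T" by simp
  then obtain f where "f \<in> emaps G U U'" "bij_betw f (pts U) (pts U')" by (rule span_relE)
  then have "card (fx K U) = card (fx K U')" using fx_iso assms spansD(1) by blast
  then show ?thesis unfolding mk_def e by simp
qed

lemma mark_eq: "mark K x = (\<Sum>\<kappa> | projl x \<kappa> \<noteq> 0. projl x \<kappa> * mk K \<kappa>)"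
  unfolding mark_def mk_def fx_def ..

lemma mark_superset: "finite J \<Longrightarrow> {\<kappa>. projl x \<kappa> \<noteq> 0} \<subseteq> J \<Longrightarrow> mark K x = (\<Sum>\<kappa>\<in>J. projl x \<kappa> * mk K \<kappa>)"
  unfolding mark_eq by (rule sum.mono_neutral_left) auto

lemma mark_lin: "lin (bob pt :: (rat, ('a, 'u) val) module) Qv (mark K)"
  unfolding lin_def Qv_simps
proof (intro conjI ballI allI)
  fix x y :: "('a, 'u) val" and q assume x: "x \<in> carrier (bob pt)" and y: "y \<in> carrier (bob pt)"
  let ?J = "{\<kappa>. projl x \<kappa> \<noteq> 0} \<union> {\<kappa>. projl y \<kappa> \<noteq> 0}"
  have J: "finite ?J" using x y by (auto elim!: bobE)
  show "mark K (x \<oplus>\<^bsub>bob pt\<^esub> y) = mark K x + mark K y"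
    unfolding mark_superset[OF J Un_upper1] mark_superset[OF J Un_upper2]
    by (subst mark_superset[OF J]) (auto simp: sum.distrib algebra_simps)
next
  fix x :: "('a, 'u) val" and q assume x: "x \<in> carrier (bob pt)"
  have J: "finite {\<kappa>. projl x \<kappa> \<noteq> 0}" using x by (auto elim!: bobE)
  show "mark K (q \<odot>\<^bsub>bob pt\<^esub> x) = q * mark K x"
    unfolding mark_superset[OF J order_refl]
    by (subst mark_superset[OF J]) (auto simp: sum_distrib_left algebra_simps)
qed simp

lemma mark_delta: "mark K (delta \<kappa>) = mk K \<kappa>"
  by (subst mark_superset[of "{\<kappa>}"]) (auto simp: delta_def split: if_splits)

lemma mark_bel: assumes K: "K \<subseteq> carrier G" and Y: "Y \<in> Ar pt pt" shows "mark K (bel pt Y) = mk K Y"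
proof (rule lin_bel[OF mark_lin vs_Qv _ mark_delta _ Y])
  fix U l h B assume sp: "(U, l, h) \<in> spans G r pt pt" and B: "invar U B"
  note U = spansD(1)[OF sp]
  have C: "invar U (pts U - B)" by (rule invar_compl[OF U B])
  note b = rst_spans[OF sp B, unfolded rst.simps] and c = rst_spans[OF sp C, unfolded rst.simps]
  have f: "fx K (gsub G U D) = fx K U \<inter> D" if D: "invar U D" for D
  proof -
    have e: "act (gsub G U D) k x = act U k x" if "k \<in> K" "x \<in> D" for k x using that K by auto
    show ?thesis using invar_subset[OF D] e unfolding fx_def by auto
  qed
  have "fx K U = (fx K U \<inter> B) \<union> (fx K U \<inter> (pts U - B))" unfolding fx_def by auto
  moreover have "finite (fx K U)" unfolding fx_def using U by simp
  ultimately have "card (fx K U) = card (fx K U \<inter> B) + card (fx K U \<inter> (pts U - B))"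
    by (metis (no_types, lifting) Diff_disjoint Int_assoc Int_empty_right Int_left_commute card_Un_disjoint finite_Int)
  then show "mk K (cl pt pt (U, l, h)) = mk K (cl pt pt (rst (U, l, h) B)) \<oplus>\<^bsub>Qv\<^esub> mk K (cl pt pt (rst (U, l, h) (pts U - B)))"
    unfolding rst.simps mk_cl[OF sp K] mk_cl[OF b K] mk_cl[OF c K] f[OF B] f[OF C] by simp
qed simp

lemma mark_one: assumes "K \<subseteq> carrier G" shows "mark K one_A = 1"
proof -
  have "fx K pt = {0}" using assms unfolding fx_def by auto
  then show ?thesis unfolding one_A_def mark_bel[OF assms idL_arr[OF gpt_gset]] unfolding idL_eq mk_cl[OF idspan[OF gpt_gset] assms] by simp
qed

text \<open>On two orbits the product in the Burnside ring is represented by the pullback over the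
  point, that is, by the product of the G-sets, whose \<open>K\<close>-fixed points are pairs of
  \<open>K\<close>-fixed points.\<close>

lemma mark_mult: fixes a b :: "('a, 'u) val"
  assumes K: "K \<subseteq> carrier G" and a: "a \<in> carrier (bob pt)" and b: "b \<in> carrier (bob pt)"
  shows "mark K (cact A pt a b) = mark K a * mark K b"
proof -
  have L: "lin V Qv (\<lambda>x. q * f x)" "lin V Qv (\<lambda>x. f x * q)" if "lin V Qv f" for V :: "(rat, ('a, 'u) val) module" and f and q
    using that by (simp_all add: lin_def algebra_simps)
  have 1: "mark K (cact A pt (delta \<kappa> :: ('a, 'u) val) b) = mark K (delta \<kappa> :: ('a, 'u) val) * mark K b" if k: "\<kappa> \<in> Om pt" for \<kappa>
  proof (rule bob_lin_eqI[OF lin_comp[OF cact_lin2[OF mack_A gpt_gset delta_bob[OF k], unfolded fob_A] mark_lin] L(1)[OF mark_lin] vs_Qv _ b])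
    fix \<mu> assume u: "\<mu> \<in> Om pt"
    have x: "cmpL pt pt pt \<mu> \<kappa> \<in> Ar pt pt" using cmpL_arr[OF Om_arr[OF k] Om_arr[OF u]] .
    have "cact A pt (delta \<kappa> :: ('a, 'u) val) (delta \<mu> :: ('a, 'u) val) = fmor A pt pt \<mu> (cact A pt (delta \<kappa>  :: ('a, 'u) val) (one_A :: ('a, 'u) val))"
      unfolding delta_one[OF u] by (simp only: cact_natural[OF mack_A gpt_gset gpt_gset Om_arr[OF u], unfolded fob_A, OF one_A_bob delta_bob[OF k]])
    also have "\<dots> = bel pt (cmpL pt pt pt \<mu> \<kappa>)" unfolding cact_A_one[OF delta_bob[OF k]] by (rule fmor_A_delta[OF k])
    finally have e: "cact A pt (delta \<kappa> :: ('a, 'u) val) (delta \<mu>) = (bel pt (cmpL pt pt pt \<mu> \<kappa>) :: ('a, 'u) val)" .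
    obtain U l h where s1: "(U, l, h) \<in> spans G r pt pt" "\<kappa> = cl pt pt (U, l, h)" using arrE[OF Om_arr[OF k]] .
    obtain V l' h' where s2: "(V, l', h') \<in> spans G r pt pt" "\<mu> = cl pt pt (V, l', h')" using arrE[OF Om_arr[OF u]] .
    note U = spansD[OF s1(1)] and V = spansD[OF s2(1)]
    have z: "h x = l' y" if "x \<in> pts U" "y \<in> pts V" for x y using emapsD(1)[OF U(3) that(1)] emapsD(1)[OF V(2) that(2)] by simp
    have "fx K (gsub G (gp U V) (pbset U V h l')) = prod_encode ` (fx K U \<times> fx K V)" (is "?l = ?r")
    proof
      show "?l \<subseteq> ?r"
      proof
        fix w assume w: "w \<in> ?l"
        then have p: "pfst w \<in> pts U" "psnd w \<in> pts V" unfolding fx_def by auto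
        have q: "prod_encode (act U g (pfst w), act V g (psnd w)) = w" if "g \<in> K" for g
          using w that K p z[OF p] unfolding fx_def by (auto simp: subset_iff)
        have "act U g (pfst w) = pfst w" "act V g (psnd w) = psnd w" if "g \<in> K" for g
          using arg_cong[OF q[OF that], of pfst] arg_cong[OF q[OF that], of psnd] by simp_all
        then have "(pfst w, psnd w) \<in> fx K U \<times> fx K V" using p unfolding fx_def by simp
        then show "w \<in> ?r" by (metis encode_pfst_psnd imageI)
      qed
      show "?r \<subseteq> ?l" using K z unfolding fx_def by (auto simp: subset_iff)
    qed
    then have c: "card (fx K (gsub G (gp U V) (pbset U V h l'))) = card (fx K U) * card (fx K V)"
      by (simp add: card_image card_cartesian_product inj_prod_encode)
    show "mark K (cact A pt (delta \<kappa> :: ('a, 'u) val) (delta \<mu> :: ('a, 'u) val)) = mark K (delta \<kappa> :: ('a, 'u) val) * mark K (delta \<mu> :: ('a, 'u) val)"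
      unfolding e mark_bel[OF K x] mark_delta
      unfolding s1(2) s2(2) cmpL_cl[OF s1(1) s2(1)] span_pb_eq mk_cl[OF span_pb_spans[OF s1(1) s2(1), unfolded span_pb_eq] K] mk_cl[OF s1(1) K] mk_cl[OF s2(1) K] c by simp
  qed
  show ?thesis
    by (rule bob_lin_eqI[OF lin_comp[OF cact_lin1[OF mack_A gpt_gset, unfolded fob_A, OF b] mark_lin] L(2)[OF mark_lin] vs_Qv 1 a])
qed

lemma SubO_D: assumes "K \<in> SubO G r" shows "subgroup K G" "K \<subseteq> carrier G" "(K, carrier G) \<in> r"
  using assms r_subgroup unfolding SubO_def by auto

lemma stab_pt [simp]: "stab pt 0 = carrier G"
  by (auto simp: mem_stab)

lemma Om_stab: assumes "(U, l, h) \<in> spans G r pt pt" "u \<in> pts U" shows "stab U u \<in> SubO G r"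
  using emapsOD(2)[OF spansD(4)[OF assms(1)] assms(2)] emapsD(1)[OF spansD(3)[OF assms(1)] assms(2)] by (simp add: SubO_def)

text \<open>A point \<open>v\<close> fixed by the stabiliser of \<open>u\<close> defines an
  equivariant map with \<open>u \<mapsto> v\<close>. It is onto because \<open>V\<close> is
  transitive, and the bound on cardinalities makes it bijective. The legs match because the target
  has a single point.\<close>

lemma trans_iso:
  assumes s: "(U, l, h) \<in> spans G r pt pt" "(V, k, m) \<in> spans G r pt pt" and t: "trans_gset U" "trans_gset V"
    and u: "u \<in> pts U" and v: "v \<in> fx (stab U u) V" and c: "card (pts U) \<le> card (pts V)"
  shows "cl pt pt (U, l, h) = cl pt pt (V, k, m)"
proof -
  note U = spansD[OF s(1)] and V = spansD[OF s(2)]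
  have v': "v \<in> pts V" using v by (simp add: fx_def)
  \<comment> \<open>\<open>g x\<close> is some group element carrying \<open>u\<close> to
    \<open>x\<close>; \<open>fg\<close> below shows that the choice does not affect
    \<open>f\<close>.\<close>
  define g where "g x = (SOME g. g \<in> carrier G \<and> act U g u = x)" for x
  have g: "g x \<in> carrier G" "act U (g x) u = x" if "x \<in> pts U" for x
    using someI_ex[of "\<lambda>g. g \<in> carrier G \<and> act U g u = x"] t(1) u that unfolding g_def trans_gset_def by blast+
  define f where "f = (\<lambda>x\<in>pts U. act V (g x) v)"
  have fg: "f (act U a u) = act V a v" if a: "a \<in> carrier G" for a
  proof -
    let ?b = "g (act U a u)"
    have b: "?b \<in> carrier G" "act U ?b u = act U a u" using g[of "act U a u"] a u U(1) by auto
    have "act U (inv a \<otimes> ?b) u = u" using a b u U(1) by (simp add: act_mult)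
    then have "inv a \<otimes> ?b \<in> stab U u" using a b by (simp add: mem_stab)
    then have "act V (inv a \<otimes> ?b) v = v" using v unfolding fx_def by blast
    then have "act V a (act V (inv a) (act V ?b v)) = act V a v" using a b v' V(1) by (simp add: act_mult)
    then show ?thesis using a b u U(1) v' V(1) by (simp add: f_def)
  qed
  have fe: "f \<in> emaps G U V"
  proof (rule emapsI)
    show "f \<in> extensional (pts U)" by (simp add: f_def)
    show "f x \<in> pts V" if "x \<in> pts U" for x using g[OF that] v' V(1) that by (simp add: f_def)
    show "f (act U a x) = act V a (f x)" if "a \<in> carrier G" "x \<in> pts U" for a x
      using fg[of "a \<otimes> g x"] fg[of "g x"] g[OF that(2)] that u v' U(1) V(1) by (simp add: act_mult)
  qed
  have surj: "f ` pts U = pts V"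
  proof
    show "f ` pts U \<subseteq> pts V" using emapsD(1)[OF fe] by auto
    show "pts V \<subseteq> f ` pts U"
    proof
      fix w assume "w \<in> pts V"
      then obtain a where "a \<in> carrier G" "act V a v = w" using t(2) v' unfolding trans_gset_def by blast
      then show "w \<in> f ` pts U" using fg[of a] u U(1) by (metis act_closed imageI)
    qed
  qed
  have "inj_on f (pts U)"
  proof (rule eq_card_imp_inj_on)
    show "finite (pts U)" using U(1) by simp
    show "card (f ` pts U) = card (pts U)" using c surj card_image_le[of "pts U" f] U(1) by simp
  qed
  then have bij: "bij_betw f (pts U) (pts V)" using surj by (simp add: bij_betw_def)
  have "k (f x) = l x \<and> m (f x) = h x" if "x \<in> pts U" for x
    using emapsD(1)[OF U(2) that] emapsD(1)[OF U(3) that] emapsD(1)[OF V(2) emapsD(1)[OF fe that]] emapsD(1)[OF V(3) emapsD(1)[OF fe that]] by simp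
  then have "((U, l, h), (V, k, m)) \<in> span_rel G r pt pt"
    unfolding span_rel_def using s fe bij by blast
  then show ?thesis by (rule equiv_class_eq[OF equiv_span_rel])
qed

text \<open>Look at a class of orbits of smallest cardinality, that is, of largest
  stabiliser.\<close>

lemma mark_zero: fixes a :: "('a, 'u) val"
  assumes a: "a \<in> carrier (bob pt)" and z: "\<And>K. K \<in> SubO G r \<Longrightarrow> mark K a = 0"
  shows "a = \<zero>\<^bsub>bob pt\<^esub>"
proof (rule ccontr)
  assume ne: "a \<noteq> \<zero>\<^bsub>bob pt\<^esub>"
  obtain c where c: "a = Inl c" "finite {\<kappa>. c \<kappa> \<noteq> 0}" "{\<kappa>. c \<kappa> \<noteq> 0} \<subseteq> Om pt" using a by (rule bobE)
  have oc: "{\<one>} \<subseteq> carrier G" by simp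
  let ?F = "{\<kappa>. c \<kappa> \<noteq> 0}"
  have "?F \<noteq> {}" using ne c(1) by auto
  \<comment> \<open>The mark at the trivial subgroup counts all points, so \<open>\<kappa>\<close>
    is an orbit with fewest points in the support. By \<open>trans_iso\<close>, no other orbit in
    the support can have a point fixed by its stabiliser.\<close>
  then obtain \<kappa> where k: "\<kappa> \<in> ?F" "\<And>\<mu>. \<mu> \<in> ?F \<Longrightarrow> mk {\<one>} \<kappa> \<le> mk {\<one>} \<mu>"
    using c(2) by (metis (no_types, lifting) arg_min_if_finite(1) arg_min_least)
  then have kO: "\<kappa> \<in> Om pt" using c(3) by auto
  obtain U l h where s: "(U, l, h) \<in> spans G r pt pt" "\<kappa> = cl pt pt (U, l, h)" "trans_gset U" using kO by (rule OmE)
  obtain u where u: "u \<in> pts U" using s(3) unfolding trans_gset_def by blast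
  let ?H = "stab U u"
  have H: "?H \<in> SubO G r" by (rule Om_stab[OF s(1) u])
  note Hc = SubO_D(2)[OF H]
  have f1: "fx {\<one>} W = pts W" if "W \<in> gsets G" for W using that unfolding fx_def by auto
  have "mk ?H \<mu> = 0" if m: "\<mu> \<in> ?F" "\<mu> \<noteq> \<kappa>" for \<mu>
  proof -
    have "\<mu> \<in> Om pt" using m c(3) by auto
    then obtain V l' h' where t: "(V, l', h') \<in> spans G r pt pt" "\<mu> = cl pt pt (V, l', h')" "trans_gset V" by (rule OmE)
    have "card (pts U) \<le> card (pts V)"
      using k(2)[OF m(1)] unfolding s(2) t(2) mk_cl[OF s(1) oc] mk_cl[OF t(1) oc] f1[OF spansD(1)[OF s(1)]] f1[OF spansD(1)[OF t(1)]] by simp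
    then have "fx ?H V = {}" using trans_iso[OF s(1) t(1) s(3) t(3) u] m(2) s(2) t(2) by blast
    then show ?thesis unfolding t(2) mk_cl[OF t(1) Hc] by simp
  qed
  then have "mark ?H a = c \<kappa> * mk ?H \<kappa>"
    using c(1,2) k(1) unfolding mark_eq by (subst sum.remove[of _ \<kappa>]) auto
  moreover have "mk ?H \<kappa> \<noteq> 0"
  proof -
    have "u \<in> fx ?H U" using u unfolding fx_def by (auto simp: mem_stab)
    moreover have "finite (fx ?H U)" unfolding fx_def using spansD(1)[OF s(1)] by simp
    ultimately show ?thesis unfolding s(2) mk_cl[OF s(1) Hc] by auto
  qed
  ultimately show False using z[OF H] k(1) by simp
qed

lemma mark_inj: fixes a b :: "('a, 'u) val"
  assumes a: "a \<in> carrier (bob pt)" and b: "b \<in> carrier (bob pt)" and e: "\<And>K. K \<in> SubO G r \<Longrightarrow> mark K a = mark K b"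
  shows "a = b"
proof -
  have b': "(-1) \<odot>\<^bsub>bob pt\<^esub> b \<in> carrier (bob pt)" using b vs_simps(3)[OF vs_bob] by blast
  have "a \<oplus>\<^bsub>bob pt\<^esub> ((-1) \<odot>\<^bsub>bob pt\<^esub> b) = \<zero>\<^bsub>bob pt\<^esub>"
  proof (rule mark_zero)
    show "a \<oplus>\<^bsub>bob pt\<^esub> ((-1) \<odot>\<^bsub>bob pt\<^esub> b) \<in> carrier (bob pt)" using a b' vs_simps(2)[OF vs_bob] by blast
    show "mark K (a \<oplus>\<^bsub>bob pt\<^esub> ((-1) \<odot>\<^bsub>bob pt\<^esub> b)) = 0" if "K \<in> SubO G r" for K
      unfolding linD(2)[OF mark_lin a b'] linD(3)[OF mark_lin b] using e[OF that] by simp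
  qed
  then have "projl a \<kappa> = projl b \<kappa>" for \<kappa> by (simp add: fun_eq_iff)
  then show ?thesis using a b by (auto elim!: bobE simp: fun_eq_iff)
qed

subsection \<open>The primitive idempotents\<close>

definition cls :: "'a set \<Rightarrow> 'a set set" where
  "cls H = {conj_sub G g H | g. g \<in> carrier G}"

lemma conj_sub_eq: assumes "g \<in> carrier G" "H \<subseteq> carrier G" shows "conj_sub G g H = (\<lambda>h. g \<otimes> h \<otimes> inv g) ` H"
  unfolding conj_sub_def l_coset_def r_coset_def by auto

lemma conj_sub_carrier: assumes "g \<in> carrier G" shows "conj_sub G g (carrier G) = carrier G"
proof
  show "conj_sub G g (carrier G) \<subseteq> carrier G" using assms by (auto simp: conj_sub_eq)
  show "carrier G \<subseteq> conj_sub G g (carrier G)"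
  proof
    fix x assume x: "x \<in> carrier G"
    have "x = g \<otimes> (inv g \<otimes> x \<otimes> g) \<otimes> inv g" using assms x by (simp add: m_assoc) (simp add: m_assoc[symmetric])
    then show "x \<in> conj_sub G g (carrier G)" using assms x by (auto simp: conj_sub_eq)
  qed
qed

lemma conj_SubO: assumes "H \<in> SubO G r" "g \<in> carrier G" shows "conj_sub G g H \<in> SubO G r"
proof -
  have "(conj_sub G g H, conj_sub G g (carrier G)) \<in> r"
    using ts assms unfolding transfer_system_def SubO_def by blast
  then show ?thesis using conj_sub_carrier[OF assms(2)] by (simp add: SubO_def)
qed

lemma conj_card: assumes "H \<subseteq> carrier G" "g \<in> carrier G" shows "card (conj_sub G g H) = card H"
proof -
  have "inj_on (\<lambda>h. g \<otimes> h \<otimes> inv g) H"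
    using assms by (intro inj_onI) (simp add: subset_iff)
  then show ?thesis using conj_sub_eq[OF assms(2,1)] by (simp add: card_image)
qed

lemma stab_act: assumes U: "U \<in> gsets G" and g: "g \<in> carrier G" and u: "u \<in> pts U"
  shows "stab U (act U g u) = conj_sub G g (stab U u)"
proof -
  have c: "conj_sub G g (stab U u) = (\<lambda>h. g \<otimes> h \<otimes> inv g) ` stab U u"
    by (rule conj_sub_eq[OF g]) (auto simp: mem_stab)
  show ?thesis unfolding c
  proof
    show "(\<lambda>h. g \<otimes> h \<otimes> inv g) ` stab U u \<subseteq> stab U (act U g u)"
      using g u U by (auto simp: mem_stab act_mult)
    show "stab U (act U g u) \<subseteq> (\<lambda>h. g \<otimes> h \<otimes> inv g) ` stab U u"
    proof
      fix x assume "x \<in> stab U (act U g u)"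
      then have x: "x \<in> carrier G" "act U x (act U g u) = act U g u" by (auto simp: mem_stab)
      have "inv g \<otimes> x \<otimes> g \<in> stab U u" using x g u U by (simp add: mem_stab act_mult)
      moreover have "x = g \<otimes> (inv g \<otimes> x \<otimes> g) \<otimes> inv g" using g x(1) by (simp add: m_assoc) (simp add: m_assoc[symmetric])
      ultimately show "x \<in> (\<lambda>h. g \<otimes> h \<otimes> inv g) ` stab U u" by blast
    qed
  qed
qed

text \<open>The coset space \<open>G/H\<close>. Its points have to be natural numbers, so the
  finitely many cosets are numbered by \<open>to_nat_on\<close>.\<close>

lemma coset_gset: assumes H: "subgroup H G"
  obtains U u where "U \<in> gsets G" "trans_gset U" "u \<in> pts U" "stab U u = H"
proof -
  have Hc: "H \<subseteq> carrier G" using H by (rule subgroup.subset)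
  let ?E = "(\<lambda>a. a <# H) ` carrier G"
  have fE: "finite ?E" using fin by simp
  define n where "n = to_nat_on ?E"
  have ninj: "inj_on n ?E" unfolding n_def by (rule inj_on_to_nat_on) (rule countable_finite[OF fE])
  have m: "g <# (a <# H) = (g \<otimes> a) <# H" if "g \<in> carrier G" "a \<in> carrier G" for g a
    using lcos_m_assoc[OF Hc that] .
  define U where "U = \<lparr>pts = n ` ?E, act = (\<lambda>g\<in>carrier G. \<lambda>x\<in>n ` ?E. n (g <# inv_into ?E n x))\<rparr>"
  have ac: "act U g (n (a <# H)) = n ((g \<otimes> a) <# H)" if "g \<in> carrier G" "a \<in> carrier G" for g a
    using that ninj m[OF that] by (simp add: U_def)
  have ptsU: "x \<in> pts U \<longleftrightarrow> (\<exists>a\<in>carrier G. x = n (a <# H))" for x by (auto simp: U_def)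
  have U: "U \<in> gsets G"
  proof (rule gsetsI)
    show "finite (pts U)" using fE by (simp add: U_def)
    show "act U \<in> extensional (carrier G)" by (simp add: U_def)
    show "act U g \<in> extensional (pts U)" if "g \<in> carrier G" for g using that by (simp add: U_def)
    show "act U g x \<in> pts U" if "g \<in> carrier G" "x \<in> pts U" for g x
      using that ac unfolding ptsU by (metis m_closed)
    show "act U \<one> x = x" if "x \<in> pts U" for x using that ac unfolding ptsU by (metis l_one one_closed)
    show "act U (g \<otimes> h) x = act U g (act U h x)" if "g \<in> carrier G" "h \<in> carrier G" "x \<in> pts U" for g h x
      using that ac unfolding ptsU by (metis m_assoc m_closed)
  qed
  define u where "u = n (\<one> <# H)"
  have u: "u \<in> pts U" unfolding ptsU u_def by blast
  have au: "act U a u = n (a <# H)" if "a \<in> carrier G" for a using ac[OF that one_closed] that by (simp add: u_def)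
  have "trans_gset U" unfolding trans_gset_def
  proof (intro conjI ballI)
    show "pts U \<noteq> {}" using u by auto
    fix x y assume "x \<in> pts U" "y \<in> pts U"
    then obtain a b where ab: "a \<in> carrier G" "b \<in> carrier G" "x = n (a <# H)" "y = n (b <# H)" unfolding ptsU by blast
    then have "act U (b \<otimes> inv a) x = y" using ac[of "b \<otimes> inv a" a] by (simp add: m_assoc)
    then show "\<exists>g\<in>carrier G. act U g x = y" using ab by blast
  qed
  moreover have "stab U u = H"
  proof -
    have "act U a u = u \<longleftrightarrow> a \<in> H" if a: "a \<in> carrier G" for a
    proof -
      have "act U a u = u \<longleftrightarrow> a <# H = \<one> <# H" unfolding au[OF a] unfolding u_def by (rule inj_on_eq_iff[OF ninj]) (use a in auto)
      also have "\<dots> \<longleftrightarrow> a <# H = H" using lcos_mult_one[OF Hc] by simp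
      also have "\<dots> \<longleftrightarrow> a \<in> H"
      proof
        assume "a <# H = H"
        moreover have "a \<in> a <# H" using subgroup.one_closed[OF H] a unfolding l_coset_def by force
        ultimately show "a \<in> H" by simp
      qed (rule coset_join3[OF a H])
      finally show ?thesis .
    qed
    then show ?thesis using Hc by (auto simp: mem_stab)
  qed
  ultimately show ?thesis using that U u by blast
qed

text \<open>All stabilisers on \<open>G/H\<close> are conjugate to \<open>H\<close>, and
  \<open>SubO\<close> is closed under conjugation; hence the map to the point lies in Fin_O.\<close>

lemma orbit_span: assumes H: "H \<in> SubO G r"
  obtains U l h u where "(U, l, h) \<in> spans G r pt pt" "trans_gset U" "u \<in> pts U" "stab U u = H"
proof -
  obtain U u where U: "U \<in> gsets G" "trans_gset U" "u \<in> pts U" "stab U u = H"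
    using coset_gset[OF SubO_D(1)[OF H]] by blast
  let ?c = "\<lambda>x\<in>pts U. 0 :: nat"
  have c: "?c \<in> emaps G U pt" by (rule emapsI) (use U(1) in auto)
  have "?c \<in> emapsO G r U pt"
  proof (rule emapsOI[OF c])
    fix x assume x: "x \<in> pts U"
    then obtain g where "g \<in> carrier G" "x = act U g u" using U(2,3) unfolding trans_gset_def by metis
    then show "(stab U x, stab pt (?c x)) \<in> r"
      using stab_act[OF U(1) _ U(3)] conj_SubO[OF H] U(4) x by (simp add: SubO_def)
  qed
  then show ?thesis using that[OF spansI[OF U(1) c] U(2-4)] by blast
qed

text \<open>The argument of type \<open>itself\<close> records the universe parameter, which would
  otherwise be visible only in the bound element.\<close>

definition realizable :: "'u itself \<Rightarrow> ('a set \<Rightarrow> rat) \<Rightarrow> bool" where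
  "realizable _ f \<longleftrightarrow> (\<exists>a :: ('a, 'u) val. a \<in> carrier (bob pt) \<and> (\<forall>K\<in>SubO G r. mark K a = f K))"

lemma realizable_lin: assumes "realizable TYPE('u) f" "realizable TYPE('u) g" shows "realizable TYPE('u) (\<lambda>K. p * f K + q * g K)"
proof -
  obtain a b :: "('a, 'u) val" where a: "a \<in> carrier (bob pt)" "\<And>K. K \<in> SubO G r \<Longrightarrow> mark K a = f K"
    and b: "b \<in> carrier (bob pt)" "\<And>K. K \<in> SubO G r \<Longrightarrow> mark K b = g K"
    using assms unfolding realizable_def by blast
  have pa: "p \<odot>\<^bsub>bob pt\<^esub> a \<in> carrier (bob pt)" "q \<odot>\<^bsub>bob pt\<^esub> b \<in> carrier (bob pt)"
    using a(1) b(1) vs_simps(3)[OF vs_bob] by blast+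
  have "mark K (p \<odot>\<^bsub>bob pt\<^esub> a \<oplus>\<^bsub>bob pt\<^esub> q \<odot>\<^bsub>bob pt\<^esub> b) = p * f K + q * g K" if "K \<in> SubO G r" for K
    unfolding linD(2)[OF mark_lin pa] linD(3)[OF mark_lin a(1)] linD(3)[OF mark_lin b(1)] using a(2) b(2) that by simp
  then show ?thesis unfolding realizable_def using vs_simps(2)[OF vs_bob pa] by blast
qed

lemma realizable_cong: "realizable TYPE('u) f \<Longrightarrow> (\<And>K. K \<in> SubO G r \<Longrightarrow> f K = g K) \<Longrightarrow> realizable TYPE('u) g"
  unfolding realizable_def by metis

lemma realizable_sum: assumes "finite J" "\<And>j. j \<in> J \<Longrightarrow> realizable TYPE('u) (f j)" shows "realizable TYPE('u) (\<lambda>K. \<Sum>j\<in>J. w j * f j K)"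
  using assms
proof (induction J rule: finite_induct)
  case empty
  have "mark K (\<zero>\<^bsub>bob pt\<^esub> :: ('a, 'u) val) = 0" for K by (simp add: mark_eq)
  then show ?case unfolding realizable_def sum.empty using vs_simps(1)[OF vs_bob] by blast
next
  case (insert j J)
  have "realizable TYPE('u) (\<lambda>K. w j * f j K + 1 * (\<Sum>j\<in>J. w j * f j K))" by (rule realizable_lin) (use insert in auto)
  then show ?case using insert(1,2) by simp
qed

lemma finite_SubO: "finite (SubO G r)"
  by (rule finite_subset[of _ "Pow (carrier G)"]) (use SubO_D(2) fin in auto)

lemma cls_self: assumes "H \<in> SubO G r" shows "H \<in> cls H"
proof -
  have "conj_sub G \<one> H = H" using conj_sub_eq[OF one_closed SubO_D(2)[OF assms]] SubO_D(2)[OF assms] by (force simp: image_iff)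
  then show ?thesis unfolding cls_def using one_closed by blast
qed

lemma conj_conj: assumes "g \<in> carrier G" "h \<in> carrier G" "H \<subseteq> carrier G"
  shows "conj_sub G g (conj_sub G h H) = conj_sub G (g \<otimes> h) H"
proof -
  have s: "conj_sub G h H \<subseteq> carrier G" using assms by (auto simp: conj_sub_eq)
  have "g \<otimes> (h \<otimes> x \<otimes> inv h) \<otimes> inv g = g \<otimes> h \<otimes> x \<otimes> inv (g \<otimes> h)" if "x \<in> H" for x
    using assms that by (simp add: inv_mult_group m_assoc subset_iff)
  then show ?thesis unfolding conj_sub_eq[OF assms(1) s] unfolding conj_sub_eq[OF assms(2,3)] conj_sub_eq[OF m_closed[OF assms(1,2)] assms(3)]
    by (simp add: image_image)
qed

lemma cls_eq: assumes "H \<in> SubO G r" "K \<in> cls H" shows "K \<in> SubO G r" "cls K = cls H" "card K = card H"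
proof -
  note Hc = SubO_D(2)[OF assms(1)]
  obtain g where g: "g \<in> carrier G" "K = conj_sub G g H" using assms(2) unfolding cls_def by blast
  show K: "K \<in> SubO G r" unfolding g(2) by (rule conj_SubO[OF assms(1) g(1)])
  show "card K = card H" unfolding g(2) by (rule conj_card[OF Hc g(1)])
  have "conj_sub G a K = conj_sub G (a \<otimes> g) H" if "a \<in> carrier G" for a
    unfolding g(2) by (rule conj_conj[OF that g(1) Hc])
  moreover have "conj_sub G a H = conj_sub G (a \<otimes> inv g) K" if "a \<in> carrier G" for a
    unfolding g(2) using conj_conj[OF _ g(1) Hc, of "a \<otimes> inv g"] that g(1) by (simp add: m_assoc)
  ultimately show "cls K = cls H" unfolding cls_def using g(1)
    by (metis (no_types, opaque_lifting) inv_closed m_closed)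
qed

text \<open>Acting by \<open>g\<close> maps the points fixed by \<open>K\<close> bijectively onto
  those fixed by the conjugate of \<open>K\<close>.\<close>

lemma mk_conj: assumes s: "(U, l, h) \<in> spans G r pt pt" and g: "g \<in> carrier G" and K: "K \<subseteq> carrier G"
  shows "mk (conj_sub G g K) (cl pt pt (U, l, h)) = mk K (cl pt pt (U, l, h))"
proof -
  note U = spansD(1)[OF s]
  have K': "conj_sub G g K \<subseteq> carrier G" using K g by (auto simp: conj_sub_eq)
  have fs: "x \<in> fx L U \<longleftrightarrow> x \<in> pts U \<and> L \<subseteq> stab U x" if "L \<subseteq> carrier G" for L x
    using that unfolding fx_def by (auto simp: mem_stab)
  have c: "L \<subseteq> stab U x \<longleftrightarrow> conj_sub G a L \<subseteq> conj_sub G a (stab U x)" if "a \<in> carrier G" "L \<subseteq> carrier G" for L x a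
  proof
    have st: "stab U x \<subseteq> carrier G" by (auto simp: mem_stab)
    assume i: "conj_sub G a L \<subseteq> conj_sub G a (stab U x)"
    have mono: "L1 \<subseteq> L2 \<Longrightarrow> L2 \<subseteq> carrier G \<Longrightarrow> b \<in> carrier G \<Longrightarrow> conj_sub G b L1 \<subseteq> conj_sub G b L2" for L1 L2 b
      by (simp add: conj_sub_eq image_mono)
    have c2: "conj_sub G a (stab U x) \<subseteq> carrier G" using st that by (auto simp: conj_sub_eq)
    have "conj_sub G (inv a) (conj_sub G a L) \<subseteq> conj_sub G (inv a) (conj_sub G a (stab U x))"
      by (rule mono[OF i c2]) (use that in simp)
    moreover have "conj_sub G \<one> L' = L'" if "L' \<subseteq> carrier G" for L'
      using conj_sub_eq[OF one_closed that] that by (force simp: image_iff)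
    ultimately show "L \<subseteq> stab U x" using conj_conj[OF inv_closed[OF that(1)] that(1)] that st by simp
  next
    assume "L \<subseteq> stab U x"
    moreover have "stab U x \<subseteq> carrier G" by (auto simp: mem_stab)
    ultimately show "conj_sub G a L \<subseteq> conj_sub G a (stab U x)" using that by (simp add: conj_sub_eq image_mono)
  qed
  have "bij_betw (act U g) (fx K U) (fx (conj_sub G g K) U)"
  proof (rule bij_betw_byWitness[where f' = "act U (inv g)"])
    show "act U g ` fx K U \<subseteq> fx (conj_sub G g K) U"
      using c[OF g K] stab_act[OF U g] U g by (auto simp: fs[OF K] fs[OF K'])
    have "act U (inv g) x \<in> fx K U" if "x \<in> fx (conj_sub G g K) U" for x
    proof -
      have x: "x \<in> pts U" "conj_sub G g K \<subseteq> stab U x" using that fs[OF K'] by auto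
      have "stab U x = conj_sub G g (stab U (act U (inv g) x))"
        using stab_act[OF U g, of "act U (inv g) x"] x(1) U g by simp
      then have "K \<subseteq> stab U (act U (inv g) x)" using c[OF g K] x(2) by simp
      then show ?thesis using fs[OF K] x(1) U g by simp
    qed
    then show "act U (inv g) ` fx (conj_sub G g K) U \<subseteq> fx K U" by auto
  qed (use U g in \<open>auto simp: fx_def\<close>)
  then show ?thesis unfolding mk_cl[OF s K] mk_cl[OF s K'] using bij_betw_same_card by metis
qed

text \<open>Triangular inversion of the table of marks, by induction on the order of
  \<open>H\<close>. The orbit \<open>G/H\<close> has nonzero marks only at conjugates of
  \<open>H\<close> and at subgroups of smaller order. Subtracting the characteristic functions of
  the smaller classes with suitable weights and dividing by the mark at \<open>H\<close> leaves the
  characteristic function of the class of \<open>H\<close>.\<close>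

lemma realizable_cls: "H \<in> SubO G r \<Longrightarrow> realizable TYPE('u) (\<lambda>K. if K \<in> cls H then 1 else 0)"
proof (induction "card H" arbitrary: H rule: less_induct)
  case less
  note Hc = SubO_D(2)[OF less.prems]
  obtain U l h u where s: "(U, l, h) \<in> spans G r pt pt" "trans_gset U" "u \<in> pts U" "stab U u = H"
    using orbit_span[OF less.prems] by blast
  note U = spansD(1)[OF s(1)]
  define k where "k = cl pt pt (U, l, h)"
  have k: "k \<in> Om pt" unfolding k_def using Om_cl[OF s(1)] s(2) by simp
  have rb: "realizable TYPE('u) (\<lambda>K. mk K k)"
    unfolding realizable_def using delta_bob[OF k] mark_delta by blast
  have conj: "mk K' k = mk K k" if "K \<in> SubO G r" "K' \<in> cls K" for K K'
    using that mk_conj[OF s(1) _ SubO_D(2)[OF that(1)]] unfolding cls_def k_def by auto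
  have nz: "K \<in> cls H \<or> card K < card H" if K: "K \<in> SubO G r" "mk K k \<noteq> 0" for K
  proof -
    note Kc = SubO_D(2)[OF K(1)]
    have "fx K U \<noteq> {}" using K(2) unfolding k_def mk_cl[OF s(1) Kc] by auto
    then obtain x where x: "x \<in> pts U" "K \<subseteq> stab U x" using Kc unfolding fx_def by (auto simp: mem_stab subset_iff)
    obtain g where g: "g \<in> carrier G" "x = act U g u" using x(1) s(2,3) unfolding trans_gset_def by metis
    have st: "stab U x = conj_sub G g H" using stab_act[OF U g(1) s(3)] g(2) s(4) by simp
    have f: "finite (conj_sub G g H)" using conj_SubO[OF less.prems g(1)] SubO_D(2) fin finite_subset by blast
    show ?thesis
    proof (cases "K = conj_sub G g H")
      case True then show ?thesis using g(1) unfolding cls_def by blast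
    next
      case False
      then have "card K < card (conj_sub G g H)" using x(2) st f by (intro psubset_card_mono) auto
      then show ?thesis using conj_card[OF Hc g(1)] by simp
    qed
  qed
  define J where "J = cls ` {K \<in> SubO G r. card K < card H}"
  have J: "finite J" unfolding J_def using finite_SubO by simp
  \<comment> \<open>The weight is the common mark on the class \<open>c\<close>; the choice of a
    member is harmless, since marks are invariant under conjugation (\<open>conj\<close>).\<close>
  define w where "w c = mk (SOME K. K \<in> c) k" for c
  have rc: "realizable TYPE('u) (\<lambda>K. if K \<in> c then 1 else 0)" if "c \<in> J" for c
    using that less.hyps unfolding J_def by auto
  \<comment> \<open>The number of \<open>H\<close>-fixed points of \<open>G/H\<close>; it is nonzero
    because the point \<open>u\<close> with stabiliser \<open>H\<close> is fixed.\<close>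
  define n where "n = mk H k"
  have "u \<in> fx H U" using s(3,4) unfolding fx_def by (auto simp: mem_stab)
  moreover have "finite (fx H U)" unfolding fx_def using U by simp
  ultimately have n: "n \<noteq> 0" unfolding n_def k_def mk_cl[OF s(1) Hc] by auto
  have "realizable TYPE('u) (\<lambda>K. (1 / n) * mk K k + (- 1 / n) * (\<Sum>c\<in>J. w c * (if K \<in> c then 1 else 0)))"
    by (rule realizable_lin[OF rb realizable_sum[OF J rc]])
  then show ?case
  proof (rule realizable_cong)
    fix K assume K: "K \<in> SubO G r"
    have inJ: "c = cls K \<and> card K < card H" if cJ: "c \<in> J" "K \<in> c" for c
    proof -
      obtain H' where "H' \<in> SubO G r" "card H' < card H" "c = cls H'" using cJ(1) unfolding J_def by auto
      then show ?thesis using cls_eq(2,3)[of H' K] cJ(2) by simp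
    qed
    show "(1 / n) * mk K k + (- 1 / n) * (\<Sum>c\<in>J. w c * (if K \<in> c then 1 else 0)) = (if K \<in> cls H then 1 else 0)"
    proof (cases "card K < card H")
      case True
      have c: "cls K \<in> J" using True K unfolding J_def by auto
      have "(\<Sum>c\<in>J. w c * (if K \<in> c then 1 else 0)) = (\<Sum>c\<in>J. if c = cls K then w c else 0)"
      proof (rule sum.cong[OF refl])
        fix c assume "c \<in> J"
        then have "K \<in> c \<longleftrightarrow> c = cls K" using inJ cls_self[OF K] by blast
        then show "w c * (if K \<in> c then 1 else 0) = (if c = cls K then w c else 0)" by simp
      qed
      also have "\<dots> = w (cls K)" using J c by simp
      also have "\<dots> = mk K k"
        unfolding w_def by (rule conj[OF K]) (rule someI[of "\<lambda>X. X \<in> cls K", OF cls_self[OF K]])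
      finally show ?thesis using True cls_eq(3)[OF less.prems, of K] by auto
    next
      case False
      have "(\<Sum>c\<in>J. w c * (if K \<in> c then 1 else 0)) = 0"
      proof (rule sum.neutral, rule ballI)
        fix c assume "c \<in> J"
        then have "K \<notin> c" using inJ False by blast
        then show "w c * (if K \<in> c then 1 else 0) = 0" by simp
      qed
      moreover have "mk K k = (if K \<in> cls H then n else 0)"
        using nz[OF K] False conj[OF less.prems] unfolding n_def by auto
      ultimately show ?thesis using n by simp
    qed
  qed
qed

lemma SubO_classes_eq: "SubO_classes G r = cls ` SubO G r"
  unfolding SubO_classes_def cls_def by auto

text \<open>Existence comes from \<open>realizable_cls\<close> and uniqueness from
  \<open>mark_inj\<close>, which make the definite description in \<open>idem\<close> meaningful.
  Marks are multiplicative, and values in \<open>{0, 1}\<close> give idempotency.\<close>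

lemma idem_char: fixes e :: "('a, 'u) val" assumes C: "C \<in> SubO_classes G r" and e: "e = idem G r C"
  shows "e \<in> carrier (bob pt)" "K \<in> SubO G r \<Longrightarrow> mark K e = (if K \<in> C then 1 else 0)" "idem_el e"
proof -
  obtain H where H: "H \<in> SubO G r" "C = cls H" using C unfolding SubO_classes_eq by blast
  obtain a :: "('a, 'u) val" where a: "a \<in> carrier (bob pt)" "\<And>K. K \<in> SubO G r \<Longrightarrow> mark K a = (if K \<in> C then 1 else 0)"
    using realizable_cls[OF H(1), where 'u = 'u] unfolding realizable_def H(2) by blast
  have ea: "e = a" unfolding e idem_def
  proof (rule the_equality)
    show "a \<in> carrier (bob pt) \<and> (\<forall>K\<in>SubO G r. mark K a = (if K \<in> C then 1 else 0))" using a by blast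
    fix b :: "('a, 'u) val" assume "b \<in> carrier (bob pt) \<and> (\<forall>K\<in>SubO G r. mark K b = (if K \<in> C then 1 else 0))"
    then show "b = a" using a by (intro mark_inj) auto
  qed
  show 1: "e \<in> carrier (bob pt)" and 2: "K \<in> SubO G r \<Longrightarrow> mark K e = (if K \<in> C then 1 else 0)" for K
    using a unfolding ea by auto
  have "cact A pt e e = e"
  proof (rule mark_inj[OF _ 1])
    show "cact A pt e e \<in> carrier (bob pt)" using cact_closed[OF mack_A gpt_gset _ 1] 1 by simp
    show "mark K (cact A pt e e) = mark K e" if "K \<in> SubO G r" for K
      unfolding mark_mult[OF SubO_D(2)[OF that] 1 1] 2[OF that] by simp
  qed
  then show "idem_el e" unfolding idem_el_def using 1 by simp
qed

lemma idem_orth: assumes C: "C \<in> SubO_classes G r" and D: "D \<in> SubO_classes G r" and "C \<noteq> D"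
  shows "cact A pt (idem G r C :: ('a, 'u) val) (idem G r D :: ('a, 'u) val) = (\<zero>\<^bsub>bob pt\<^esub> :: ('a, 'u) val)"
proof (rule mark_zero)
  have 1: "idem G r C \<in> carrier (bob pt :: (rat, ('a, 'u) val) module)" "idem G r D \<in> carrier (bob pt :: (rat, ('a, 'u) val) module)"
    by (rule idem_char(1)[OF C refl], rule idem_char(1)[OF D refl])
  show "cact A pt (idem G r C :: ('a, 'u) val) (idem G r D :: ('a, 'u) val) \<in> carrier (bob pt :: (rat, ('a, 'u) val) module)"
    using cact_closed[OF mack_A gpt_gset _ 1(1), of "idem G r D"] 1(2) by simp
  fix K assume K: "K \<in> SubO G r"
  have "K \<notin> C \<or> K \<notin> D"
    using C D assms(3) cls_eq(2) unfolding SubO_classes_eq by blast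
  then show "mark K (cact A pt (idem G r C :: ('a, 'u) val) (idem G r D :: ('a, 'u) val) :: ('a, 'u) val) = 0"
    unfolding mark_mult[OF SubO_D(2)[OF K] 1] idem_char(2)[OF C refl K] idem_char(2)[OF D refl K] by auto
qed

lemma finite_classes: "finite (SubO_classes G r)"
  unfolding SubO_classes_eq using finite_SubO by simp

text \<open>Each subgroup in \<open>SubO\<close> lies in exactly one class, so the sum has mark 1
  everywhere, like \<open>one_A\<close>.\<close>

lemma idem_sum: "finsum (bob pt) (idem G r) (SubO_classes G r) = (one_A :: ('a, 'u) val)"
proof (rule mark_inj)
  note lin_functor = lin_finsum[OF mark_lin vs_bob vs_Qv finite_classes idem_char(1)[OF _ refl]]
  show "finsum (bob pt) (idem G r) (SubO_classes G r) \<in> carrier (bob pt :: (rat, ('a, 'u) val) module)" by (rule lin_functor(1))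
  fix K assume K: "K \<in> SubO G r"
  have "mark K (finsum (bob pt) (idem G r) (SubO_classes G r) :: ('a, 'u) val) = (\<Sum>C\<in>SubO_classes G r. mark K (idem G r C :: ('a, 'u) val))"
  proof -
    have "mark K (finsum (bob pt) (idem G r) (SubO_classes G r) :: ('a, 'u) val) = finsum Qv (\<lambda>C. mark K (idem G r C :: ('a, 'u) val)) (SubO_classes G r)"
      by (rule lin_functor(2))
    then show ?thesis unfolding finsum_Qv[OF finite_classes] .
  qed
  also have "\<dots> = (\<Sum>C\<in>SubO_classes G r. if C = cls K then 1 else 0)"
  proof (rule sum.cong[OF refl])
    fix C assume C: "C \<in> SubO_classes G r"
    have "K \<in> C \<longleftrightarrow> C = cls K" using C cls_eq(2) cls_self[OF K] unfolding SubO_classes_eq by blast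
    then show "mark K (idem G r C :: ('a, 'u) val) = (if C = cls K then 1 else 0)" by (simp add: idem_char(2)[OF C refl K])
  qed
  also have "\<dots> = 1" using K finite_classes unfolding SubO_classes_eq by simp
  finally show "mark K (finsum (bob pt) (idem G r) (SubO_classes G r) :: ('a, 'u) val) = mark K (one_A :: ('a, 'u) val)"
    by (simp add: mark_one[OF SubO_D(2)[OF K]])
qed simp

end

section \<open>Finite direct sums inside a fixed universe of values\<close>

lemma infinite_tuple_coding:
  assumes "infinite (UNIV :: 'v set)" "finite I"
  shows "\<exists>f :: ('i \<Rightarrow> 'v) \<Rightarrow> 'v. inj_on f (I \<rightarrow>\<^sub>E UNIV)"
  using assms(2)
proof (induction I rule: finite_induct)
  case empty
  then show ?case by (auto simp: inj_on_def)
next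
  case (insert i I)
  then obtain f :: "('i \<Rightarrow> 'v) \<Rightarrow> 'v" where f: "inj_on f (I \<rightarrow>\<^sub>E UNIV)" by blast
  \<comment> \<open>An infinite set is equipollent to its square, so a pairing bijection absorbs one
    coordinate at a time.\<close>
  obtain p :: "'v \<times> 'v \<Rightarrow> 'v" where p: "bij_betw p (UNIV \<times> UNIV) UNIV" 
    using card_of_Times_same_infinite[OF assms(1)] card_of_ordIso[of "UNIV \<times> UNIV :: ('v \<times> 'v) set" "UNIV :: 'v set"] by blast
  have "inj_on (\<lambda>g. p (g i, f (restrict g I))) (insert i I \<rightarrow>\<^sub>E UNIV)"
  proof (rule inj_onI)
    fix g h assume g: "g \<in> insert i I \<rightarrow>\<^sub>E UNIV" and h: "h \<in> insert i I \<rightarrow>\<^sub>E UNIV" and e: "p (g i, f (restrict g I)) = p (h i, f (restrict h I))"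
    have "g i = h i \<and> f (restrict g I) = f (restrict h I)" using p e unfolding bij_betw_def inj_on_def by blast
    moreover then have "restrict g I = restrict h I" using f by (auto dest: inj_onD)
    ultimately have "g x = h x" if "x \<in> insert i I" for x using that by (metis insertE restrict_apply')
    then show "g = h" using g h by (intro PiE_ext[OF g h])
  qed
  then show ?case by blast
qed

text \<open>The constant functions in the left summand already give infinitely many values, whatever
  the parameter \<open>'u\<close> is.\<close>

lemma infinite_val: "infinite (UNIV :: ('g, 'u) val set)"
proof -
  have "inj (\<lambda>n :: nat. Inl (\<lambda>_. of_nat n) :: ('g, 'u) val)"
    by (rule injI) (simp add: fun_eq_iff)
  then show ?thesis using infinite_iff_countable_subset by blast
qed

lemma category_prod: assumes "\<And>i. i \<in> I \<Longrightarrow> category (C i)" shows "category (prod_cat I C)"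
proof -
  note c = assms[unfolded category_def]
  have 1: "ide (C i) X \<in> arr (C i) X X" if "i \<in> I" "X \<in> obj (C i)" for i X using c[OF that(1)] that(2) by blast
  have 2: "cmp (C i) X Y Z g f \<in> arr (C i) X Z" if "i \<in> I" "X \<in> obj (C i)" "Y \<in> obj (C i)" "Z \<in> obj (C i)" "f \<in> arr (C i) X Y" "g \<in> arr (C i) Y Z" for i X Y Z f g
    using c[OF that(1)] that(2-) by blast
  have 3: "cmp (C i) X X Y f (ide (C i) X) = f" "cmp (C i) X Y Y (ide (C i) Y) f = f" if "i \<in> I" "X \<in> obj (C i)" "Y \<in> obj (C i)" "f \<in> arr (C i) X Y" for i X Y f
    using c[OF that(1)] that(2-) by blast+
  have 4: "cmp (C i) W X Z (cmp (C i) X Y Z h g) f = cmp (C i) W Y Z h (cmp (C i) W X Y g f)"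
    if "i \<in> I" "W \<in> obj (C i)" "X \<in> obj (C i)" "Y \<in> obj (C i)" "Z \<in> obj (C i)" "f \<in> arr (C i) W X" "g \<in> arr (C i) X Y" "h \<in> arr (C i) Y Z" for i W X Y Z f g h
    using c[OF that(1)] that(2-) by blast
  show ?thesis unfolding category_def prod_cat_def cat.simps
  proof (intro conjI ballI)
    fix X Y f assume a: "X \<in> (\<Pi>\<^sub>E i\<in>I. obj (C i))" "Y \<in> (\<Pi>\<^sub>E i\<in>I. obj (C i))" "f \<in> (\<Pi>\<^sub>E i\<in>I. arr (C i) (X i) (Y i))"
    show "(\<lambda>i\<in>I. cmp (C i) (X i) (X i) (Y i) (f i) ((\<lambda>i\<in>I. ide (C i) (X i)) i)) = f"
      "(\<lambda>i\<in>I. cmp (C i) (X i) (Y i) (Y i) ((\<lambda>i\<in>I. ide (C i) (Y i)) i) (f i)) = f"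
      using a 3 by (auto intro!: extensionalityI[where A = I] simp: PiE_iff)
  qed (use 1 2 4 in \<open>auto simp: PiE_iff intro!: restrict_ext\<close>)
qed

context transfer_group
begin

abbreviation I where "I \<equiv> SubO_classes G r"

text \<open>All functors in question take values on one infinite type, so a tuple of values indexed by the
  finitely many classes is coded as a single value; this is how the direct sum stays inside the model.\<close>

definition enc :: "('a set set \<Rightarrow> ('a, 'u) val) \<Rightarrow> ('a, 'u) val" where
  "enc = (SOME f. inj_on f (I \<rightarrow>\<^sub>E UNIV))"

definition dec :: "('a, 'u) val \<Rightarrow> 'a set set \<Rightarrow> ('a, 'u) val" where
  "dec = inv_into (I \<rightarrow>\<^sub>E UNIV) enc"

lemma dec_enc [simp]: "dec (enc (restrict f I)) = restrict f I"
proof -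
  have "inj_on (enc :: ('a set set \<Rightarrow> ('a, 'u) val) \<Rightarrow> ('a, 'u) val) (I \<rightarrow>\<^sub>E UNIV)"
    unfolding enc_def by (rule someI_ex[OF infinite_tuple_coding[OF infinite_val finite_classes]])
  then show ?thesis unfolding dec_def by (intro inv_into_f_f) (auto simp: PiE_iff)
qed

definition dsum :: "('a set set \<Rightarrow> ('a, ('a, 'u) val) mfun) \<Rightarrow> ('a, ('a, 'u) val) mfun" where
  "dsum N = \<lparr>fob = (\<lambda>S. \<lparr>carrier = enc ` (\<Pi>\<^sub>E C\<in>I. carrier (fob (N C) S)), mult = undefined, one = undefined,
      zero = enc (\<lambda>C\<in>I. \<zero>\<^bsub>fob (N C) S\<^esub>),
      add = (\<lambda>x y. enc (\<lambda>C\<in>I. dec x C \<oplus>\<^bsub>fob (N C) S\<^esub> dec y C)),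
      smult = (\<lambda>q x. enc (\<lambda>C\<in>I. q \<odot>\<^bsub>fob (N C) S\<^esub> dec x C))\<rparr>),
    fmor = (\<lambda>S T X. \<lambda>x\<in>enc ` (\<Pi>\<^sub>E C\<in>I. carrier (fob (N C) S)). enc (\<lambda>C\<in>I. fmor (N C) S T X (dec x C)))\<rparr>"

lemma dsum_ops: "x \<oplus>\<^bsub>fob (dsum N) S\<^esub> y = enc (\<lambda>C\<in>I. dec x C \<oplus>\<^bsub>fob (N C) S\<^esub> dec y C)"
  "q \<odot>\<^bsub>fob (dsum N) S\<^esub> x = enc (\<lambda>C\<in>I. q \<odot>\<^bsub>fob (N C) S\<^esub> dec x C)"
  "\<zero>\<^bsub>fob (dsum N) S\<^esub> = enc (\<lambda>C\<in>I. \<zero>\<^bsub>fob (N C) S\<^esub>)"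
  by (simp_all add: dsum_def)

lemma enc_mem: "(\<And>C. C \<in> I \<Longrightarrow> f C \<in> carrier (fob (N C) S)) \<Longrightarrow> enc (restrict f I) \<in> carrier (fob (dsum N) S)"
  by (simp add: dsum_def)

lemma dsum_mem: assumes "x \<in> carrier (fob (dsum N) S)"
  shows "C \<in> I \<Longrightarrow> dec x C \<in> carrier (fob (N C) S)" "enc (restrict (dec x) I) = x"
proof -
  obtain f where f: "f \<in> (\<Pi>\<^sub>E C\<in>I. carrier (fob (N C) S))" "x = enc f" using assms by (auto simp: dsum_def)
  have "restrict f I = f" using f(1) by (simp add: PiE_iff extensional_restrict)
  then have "dec x = f" using dec_enc[of f] f(2) by simp
  then show "C \<in> I \<Longrightarrow> dec x C \<in> carrier (fob (N C) S)" "enc (restrict (dec x) I) = x"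
    using f \<open>restrict f I = f\<close> by auto
qed

lemma dsum_eqI: assumes "x \<in> carrier (fob (dsum N) S)" "y \<in> carrier (fob (dsum N) S)" "\<And>C. C \<in> I \<Longrightarrow> dec x C = dec y C"
  shows "x = y"
proof -
  have "restrict (dec x) I = restrict (dec y) I" using assms(3) by (intro restrict_ext)
  then show ?thesis using dsum_mem(2)[OF assms(1)] dsum_mem(2)[OF assms(2)] by metis
qed

lemma dsum_fmor: "x \<in> carrier (fob (dsum N) S) \<Longrightarrow> fmor (dsum N) S T X x = enc (\<lambda>C\<in>I. fmor (N C) S T X (dec x C))"
  by (simp add: dsum_def)

lemma mack_dsum: assumes N: "\<And>C. C \<in> I \<Longrightarrow> mack (N C)" shows "mack (dsum N)"
  unfolding mack_def
proof
  note Nl = Ml[OF N]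
  show "lin_functor (dsum N)"
  proof (rule lin_functorI)
    fix S assume S: "S \<in> gsets G"
    note V = Nl(1)[OF _ S]
    have ac: "x \<oplus>\<^bsub>fob (dsum N) S\<^esub> y \<in> carrier (fob (dsum N) S)"
      if "x \<in> carrier (fob (dsum N) S)" "y \<in> carrier (fob (dsum N) S)" for x y
      unfolding dsum_ops by (rule enc_mem) (rule vs_simps(2)[OF V dsum_mem(1)[OF that(1)] dsum_mem(1)[OF that(2)]])
    have sc: "q \<odot>\<^bsub>fob (dsum N) S\<^esub> x \<in> carrier (fob (dsum N) S)" if "x \<in> carrier (fob (dsum N) S)" for q x
      unfolding dsum_ops by (rule enc_mem) (rule vs_simps(3)[OF V dsum_mem(1)[OF that]])
    have zc: "\<zero>\<^bsub>fob (dsum N) S\<^esub> \<in> carrier (fob (dsum N) S)"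
      unfolding dsum_ops by (rule enc_mem) (use V in auto)
    show "vs (fob (dsum N) S)"
    proof (rule vsI[OF zc ac sc])
      fix x y z a b assume x: "x \<in> carrier (fob (dsum N) S)"
      note dx = dsum_mem(1)[OF x]
      show "\<zero>\<^bsub>fob (dsum N) S\<^esub> \<oplus>\<^bsub>fob (dsum N) S\<^esub> x = x"
        by (rule dsum_eqI[OF ac[OF zc x] x]) (simp add: dsum_ops V dx)
      show "0 \<odot>\<^bsub>fob (dsum N) S\<^esub> x = \<zero>\<^bsub>fob (dsum N) S\<^esub>"
        by (rule dsum_eqI[OF sc[OF x] zc]) (simp add: dsum_ops V dx)
      show "1 \<odot>\<^bsub>fob (dsum N) S\<^esub> x = x"
        by (rule dsum_eqI[OF sc[OF x] x]) (simp add: dsum_ops V dx)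
      show "(a + b) \<odot>\<^bsub>fob (dsum N) S\<^esub> x = a \<odot>\<^bsub>fob (dsum N) S\<^esub> x \<oplus>\<^bsub>fob (dsum N) S\<^esub> b \<odot>\<^bsub>fob (dsum N) S\<^esub> x"
        by (rule dsum_eqI[OF sc[OF x] ac[OF sc[OF x] sc[OF x]]]) (simp add: dsum_ops V dx vs_smult)
      show "(a * b) \<odot>\<^bsub>fob (dsum N) S\<^esub> x = a \<odot>\<^bsub>fob (dsum N) S\<^esub> (b \<odot>\<^bsub>fob (dsum N) S\<^esub> x)"
        by (rule dsum_eqI[OF sc[OF x] sc[OF sc[OF x]]]) (simp add: dsum_ops V dx vs_smult)
      assume y: "y \<in> carrier (fob (dsum N) S)"
      note dy = dsum_mem(1)[OF y]
      show "x \<oplus>\<^bsub>fob (dsum N) S\<^esub> y = y \<oplus>\<^bsub>fob (dsum N) S\<^esub> x"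
        by (rule dsum_eqI[OF ac[OF x y] ac[OF y x]]) (simp add: dsum_ops vs_comm[OF V dx dy])
      show "a \<odot>\<^bsub>fob (dsum N) S\<^esub> (x \<oplus>\<^bsub>fob (dsum N) S\<^esub> y) = a \<odot>\<^bsub>fob (dsum N) S\<^esub> x \<oplus>\<^bsub>fob (dsum N) S\<^esub> a \<odot>\<^bsub>fob (dsum N) S\<^esub> y"
        by (rule dsum_eqI[OF sc[OF ac[OF x y]] ac[OF sc[OF x] sc[OF y]]]) (simp add: dsum_ops V dx dy vs_smult)
      assume z: "z \<in> carrier (fob (dsum N) S)"
      note dz = dsum_mem(1)[OF z]
      show "(x \<oplus>\<^bsub>fob (dsum N) S\<^esub> y) \<oplus>\<^bsub>fob (dsum N) S\<^esub> z = x \<oplus>\<^bsub>fob (dsum N) S\<^esub> (y \<oplus>\<^bsub>fob (dsum N) S\<^esub> z)"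
        by (rule dsum_eqI[OF ac[OF ac[OF x y] z] ac[OF x ac[OF y z]]]) (simp add: dsum_ops vs_assoc[OF V dx dy dz])
    qed
  next
    fix S T X assume a: "S \<in> gsets G" "T \<in> gsets G" "X \<in> Ar S T"
    note L = linmapsD[OF Nl(2)[OF _ a]]
    have fc: "fmor (dsum N) S T X x \<in> carrier (fob (dsum N) T)" if "x \<in> carrier (fob (dsum N) S)" for x
      unfolding dsum_fmor[OF that] by (rule enc_mem) (use L(1) dsum_mem(1)[OF that] in auto)
    show "fmor (dsum N) S T X \<in> linmaps (fob (dsum N) S) (fob (dsum N) T)"
    proof (rule linmapsI[OF _ fc])
      show "fmor (dsum N) S T X \<in> extensional (carrier (fob (dsum N) S))" by (simp add: dsum_def)
      fix x y q assume x: "x \<in> carrier (fob (dsum N) S)"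
      note dx = dsum_mem(1)[OF x]
      have s: "q \<odot>\<^bsub>fob (dsum N) S\<^esub> x \<in> carrier (fob (dsum N) S)"
        unfolding dsum_ops by (rule enc_mem) (use dx Nl(1)[OF _ a(1)] in auto)
      show "fmor (dsum N) S T X (q \<odot>\<^bsub>fob (dsum N) S\<^esub> x) = q \<odot>\<^bsub>fob (dsum N) T\<^esub> fmor (dsum N) S T X x"
        unfolding dsum_fmor[OF s] dsum_fmor[OF x] unfolding dsum_ops by (intro arg_cong[of _ _ enc] restrict_ext) (simp add: L(3) dx)
      assume y: "y \<in> carrier (fob (dsum N) S)"
      note dy = dsum_mem(1)[OF y]
      have s: "x \<oplus>\<^bsub>fob (dsum N) S\<^esub> y \<in> carrier (fob (dsum N) S)"
        unfolding dsum_ops by (rule enc_mem) (use dx dy Nl(1)[OF _ a(1)] in auto)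
      show "fmor (dsum N) S T X (x \<oplus>\<^bsub>fob (dsum N) S\<^esub> y) = fmor (dsum N) S T X x \<oplus>\<^bsub>fob (dsum N) T\<^esub> fmor (dsum N) S T X y"
        unfolding dsum_fmor[OF s] dsum_fmor[OF x] dsum_fmor[OF y] unfolding dsum_ops by (intro arg_cong[of _ _ enc] restrict_ext) (simp add: L(2) dx dy)
    qed
  next
    fix S m assume a: "S \<in> gsets G" "m \<in> carrier (fob (dsum N) S)"
    have "(\<lambda>C\<in>I. fmor (N C) S S (idL S) (dec m C)) = restrict (dec m) I"
      by (intro restrict_ext) (simp add: Nl(3)[OF _ a(1)] dsum_mem(1)[OF a(2)])
    then show "fmor (dsum N) S S (idL S) m = m" unfolding dsum_fmor[OF a(2)] using dsum_mem(2)[OF a(2)] by simp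
  next
    fix S T W X Y m assume a: "S \<in> gsets G" "T \<in> gsets G" "W \<in> gsets G" "X \<in> Ar S T" "Y \<in> Ar T W" "m \<in> carrier (fob (dsum N) S)"
    have f: "fmor (dsum N) S T X m \<in> carrier (fob (dsum N) T)"
      unfolding dsum_fmor[OF a(6)] by (rule enc_mem) (use Nl(5)[OF _ a(1,2,4)] dsum_mem(1)[OF a(6)] in auto)
    show "fmor (dsum N) S W (cmpL S T W Y X) m = fmor (dsum N) T W Y (fmor (dsum N) S T X m)"
      unfolding dsum_fmor[OF f] unfolding dsum_fmor[OF a(6)]
      by (intro arg_cong[of _ _ enc] restrict_ext) (simp add: Nl(4)[OF _ a(1-5)] dsum_mem(1)[OF a(6)])
  qed
  show "additive (dsum N)" unfolding additive_def
  proof (intro ballI allI impI)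
    fix S T U l h B m
    assume a: "S \<in> gsets G" "T \<in> gsets G" "(U, l, h) \<in> spans G r S T" "invar U B" "m \<in> carrier (fob (dsum N) S)"
    show "fmor (dsum N) S T (cl S T (U, l, h)) m = fmor (dsum N) S T (cl S T (rst (U, l, h) B)) m \<oplus>\<^bsub>fob (dsum N) T\<^esub>
      fmor (dsum N) S T (cl S T (rst (U, l, h) (pts U - B))) m"
      unfolding dsum_fmor[OF a(5)] dsum_ops
      by (intro arg_cong[of _ _ enc] restrict_ext) (use additiveD[OF mackD(2)[OF N] a(1-4)] dsum_mem(1)[OF a(5)] in \<open>simp del: rst.simps\<close>)
  qed
qed

definition dproj :: "('a set set \<Rightarrow> ('a, ('a, 'u) val) mfun) \<Rightarrow> 'a set set \<Rightarrow> ('a, ('a, 'u) val) mtrafo" where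
  "dproj N C = (\<lambda>S\<in>gsets G. \<lambda>x\<in>carrier (fob (dsum N) S). dec x C)"

lemma dproj_Hom: assumes "\<And>C. C \<in> I \<Longrightarrow> mack (N C)" "C \<in> I" shows "dproj N C \<in> Hom (dsum N) (N C)"
  unfolding dproj_def
  by (rule HomI[OF mack_dsum[OF assms(1)]]) (use assms(2) dsum_mem(1) in \<open>auto simp: dsum_ops dsum_fmor\<close>)

lemma dtuple_Hom: assumes "mack M" "\<And>C. C \<in> I \<Longrightarrow> t C \<in> Hom M (N C)"
  shows "(\<lambda>S\<in>gsets G. \<lambda>m\<in>carrier (fob M S). enc (\<lambda>C\<in>I. t C S m)) \<in> Hom M (dsum N)"
proof (rule HomI[OF assms(1)])
  note t = HomD[OF assms(2)]
  have c: "enc (\<lambda>C\<in>I. t C S m) \<in> carrier (fob (dsum N) S)" if "S \<in> gsets G" "m \<in> carrier (fob M S)" for S m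
    by (rule enc_mem) (rule t(2)[OF _ that])
  then show "S \<in> gsets G \<Longrightarrow> m \<in> carrier (fob M S) \<Longrightarrow> enc (\<lambda>C\<in>I. t C S m) \<in> carrier (fob (dsum N) S)" for S m .
  fix S m assume a: "S \<in> gsets G" "m \<in> carrier (fob M S)"
  show "enc (\<lambda>C\<in>I. t C S (m \<oplus>\<^bsub>fob M S\<^esub> m')) = enc (\<lambda>C\<in>I. t C S m) \<oplus>\<^bsub>fob (dsum N) S\<^esub> enc (\<lambda>C\<in>I. t C S m')" if m': "m' \<in> carrier (fob M S)" for m'
    unfolding dsum_ops by (intro arg_cong[of _ _ enc] restrict_ext) (simp add: t(3)[OF _ a m'])
  show "enc (\<lambda>C\<in>I. t C S (q \<odot>\<^bsub>fob M S\<^esub> m)) = q \<odot>\<^bsub>fob (dsum N) S\<^esub> enc (\<lambda>C\<in>I. t C S m)" for q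
    unfolding dsum_ops by (intro arg_cong[of _ _ enc] restrict_ext) (simp add: t(4)[OF _ a])
  show "enc (\<lambda>C\<in>I. t C T (fmor M S T X m)) = fmor (dsum N) S T X (enc (\<lambda>C\<in>I. t C S m))" if "T \<in> gsets G" "X \<in> Ar S T" for T X
    unfolding dsum_fmor[OF c[OF a]] by (intro arg_cong[of _ _ enc] restrict_ext) (simp add: t(5)[OF _ a(1) that a(2)])
qed

lemma Hom_bij_inverse: assumes "mack M" "mack N" "t \<in> Hom M N" "\<And>S. S \<in> gsets G \<Longrightarrow> bij_betw (t S) (carrier (fob M S)) (carrier (fob N S))"
  obtains g where "g \<in> Hom N M" "hc M g t = hid M" "hc N t g = hid N"
proof -
  note t = HomD[OF assms(3)]
  let ?g = "\<lambda>S. inv_into (carrier (fob M S)) (t S)"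
  have gc: "?g S n \<in> carrier (fob M S)" and tg: "t S (?g S n) = n" if "S \<in> gsets G" "n \<in> carrier (fob N S)" for S n
    using assms(4)[OF that(1)] that(2) by (auto simp: bij_betw_def inv_into_into f_inv_into_f)
  have gt: "?g S (t S m) = m" if "S \<in> gsets G" "m \<in> carrier (fob M S)" for S m
    using assms(4)[OF that(1)] that(2) by (simp add: bij_betw_inv_into_left)
  have geq: "?g S n = m" if "S \<in> gsets G" "m \<in> carrier (fob M S)" "t S m = n" for S m n using gt[OF that(1,2)] that(3) by simp
  note V = Ml(1)[OF assms(1)] and Mf = Ml(5)[OF assms(1)]
  have g: "(\<lambda>S\<in>gsets G. \<lambda>m\<in>carrier (fob N S). ?g S m) \<in> Hom N M"
  proof (rule HomI[OF assms(2)])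
    fix S n assume a: "S \<in> gsets G" "n \<in> carrier (fob N S)"
    show "?g S n \<in> carrier (fob M S)" by (rule gc[OF a])
    show "?g S (n \<oplus>\<^bsub>fob N S\<^esub> n') = ?g S n \<oplus>\<^bsub>fob M S\<^esub> ?g S n'" if "n' \<in> carrier (fob N S)" for n'
      by (rule geq[OF a(1)]) (use t(3)[OF a(1) gc[OF a] gc[OF a(1) that]] tg[OF a] tg[OF a(1) that] gc[OF a] gc[OF a(1) that] V[OF a(1)] in simp_all)
    show "?g S (q \<odot>\<^bsub>fob N S\<^esub> n) = q \<odot>\<^bsub>fob M S\<^esub> ?g S n" for q
      by (rule geq[OF a(1)]) (use t(4)[OF a(1) gc[OF a]] tg[OF a] gc[OF a] V[OF a(1)] in simp_all)
    show "?g T (fmor N S T X n) = fmor M S T X (?g S n)" if "T \<in> gsets G" "X \<in> Ar S T" for T X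
      by (rule geq[OF that(1)]) (use t(5)[OF a(1) that gc[OF a]] tg[OF a] Mf[OF a(1) that gc[OF a]] in simp_all)
  qed
  show ?thesis
    by (rule that[OF g]) (intro restrict_ext, auto simp: compose_def gt tg t(2) gc intro!: restrict_ext)
qed

subsection \<open>The splitting\<close>

abbreviation (input) ep :: "'a set set \<Rightarrow> ('a, 'u) val" where "ep \<equiv> idem G r"

lemma cact_zero: assumes "mack M" "S \<in> gsets G" "m \<in> carrier (fob M S)"
  shows "cact M S \<zero>\<^bsub>bob pt\<^esub> m = \<zero>\<^bsub>fob M S\<^esub>"
  by (rule lin_zero[OF cact_lin1[OF assms] vs_bob Ml(1)[OF assms(1,2)]])

lemma cact_orth: fixes M :: "('a, ('a, 'u) val) mfun"
  assumes M: "mack M" and S: "S \<in> gsets G" and m: "m \<in> carrier (fob M S)" and CD: "C \<in> I" "D \<in> I" "C \<noteq> D"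
  shows "cact M S (ep C :: ('a, 'u) val) (cact M S (ep D :: ('a, 'u) val) m) = \<zero>\<^bsub>fob M S\<^esub>"
proof -
  have "cact A pt (ep D :: ('a, 'u) val) (ep C :: ('a, 'u) val) = (\<zero>\<^bsub>bob pt\<^esub> :: ('a, 'u) val)"
    by (rule idem_orth) (use CD in auto)
  then show ?thesis
    using cact_cact[OF M S m idem_char(1)[OF CD(1) refl] idem_char(1)[OF CD(2) refl]] cact_zero[OF M S m] by metis
qed

lemma cact_sum: fixes M :: "('a, ('a, 'u) val) mfun"
  assumes M: "mack M" and S: "S \<in> gsets G" and m: "m \<in> carrier (fob M S)"
  shows "finsum (fob M S) (\<lambda>C. cact M S (ep C :: ('a, 'u) val) m) I = m"
proof -
  have "cact M S (finsum (bob pt) (ep :: _ \<Rightarrow> ('a, 'u) val) I) m = finsum (fob M S) (\<lambda>C. cact M S (ep C :: ('a, 'u) val) m) I"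
    by (rule lin_finsum(2)[OF cact_lin1[OF M S m] vs_bob Ml(1)[OF M S] finite_classes idem_char(1)[OF _ refl]])
  then show ?thesis unfolding idem_sum using cact_one[OF M S m] by metis
qed

text \<open>By orthogonality \<open>e_D\<close> kills every term except the one indexed by
  \<open>D\<close>, which it fixes.\<close>

lemma cact_finsum: fixes M :: "('a, ('a, 'u) val) mfun"
  assumes M: "mack M" and S: "S \<in> gsets G" and D: "D \<in> I"
    and x: "\<And>C. C \<in> I \<Longrightarrow> x C \<in> carrier (fob M S)" "\<And>C. C \<in> I \<Longrightarrow> cact M S (ep C :: ('a, 'u) val) (x C) = x C"
  shows "cact M S (ep D :: ('a, 'u) val) (finsum (fob M S) x I) = x D" "finsum (fob M S) x I \<in> carrier (fob M S)"
proof -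
  note V = Ml(1)[OF M S]
  interpret V: module rat_ring "fob M S" by (rule V)
  note lin_functor = lin_finsum[OF cact_lin2[OF M S idem_char(1)[OF D refl]] V V finite_classes x(1)]
  show "finsum (fob M S) x I \<in> carrier (fob M S)" by (rule lin_functor(1))
  have "cact M S (ep D :: ('a, 'u) val) (finsum (fob M S) x I) = finsum (fob M S) (\<lambda>C. cact M S (ep D :: ('a, 'u) val) (x C)) I"
    by (rule lin_functor(2))
  also have "\<dots> = finsum (fob M S) (\<lambda>C. if D = C then x C else \<zero>\<^bsub>fob M S\<^esub>) I"
  proof (rule V.finsum_cong'[OF refl])
    fix C assume C: "C \<in> I"
    show "cact M S (ep D :: ('a, 'u) val) (x C) = (if D = C then x C else \<zero>\<^bsub>fob M S\<^esub>)"
      using x[OF C] cact_orth[OF M S x(1)[OF C] D C] by auto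
  qed (use x(1) in auto)
  also have "\<dots> = x D" by (rule V.finsum_singleton[OF D finite_classes]) (use x(1) in auto)
  finally show "cact M S (ep D :: ('a, 'u) val) (finsum (fob M S) x I) = x D" .
qed

lemma sm_map: fixes M N :: "('a, ('a, 'u) val) mfun"
  assumes e: "idem_el (e :: ('a, 'u) val)" and M: "mack M" and N: "mack N" and f: "f \<in> Hom M N"
  shows "(\<lambda>S\<in>gsets G. \<lambda>m\<in>carrier (fob (sm e M) S). f S m) \<in> Hom (sm e M) (sm e N)"
proof (rule HomI[OF sm_mack[OF e M]])
  note f' = HomD[OF f]
  have eb: "e \<in> carrier (bob pt)" using e by (simp add: idem_el_def)
  fix S m assume S: "S \<in> gsets G" and m: "m \<in> carrier (fob (sm e M) S)"
  have m': "m \<in> carrier (fob M S)" "cact M S e m = m" using m sm_mem[OF e M S] by auto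
  show fm: "f S m \<in> carrier (fob (sm e N) S)"
    using sm_mem[OF e N S] f'(2)[OF S m'(1)] cact_Hom[OF M f N S eb m'(1)] m'(2) by simp
  show "f S (m \<oplus>\<^bsub>fob (sm e M) S\<^esub> x) = f S m \<oplus>\<^bsub>fob (sm e N) S\<^esub> f S x" if "x \<in> carrier (fob (sm e M) S)" for x
    using f'(3)[OF S m'(1)] that sm_mem[OF e M S] by simp
  show "f S (q \<odot>\<^bsub>fob (sm e M) S\<^esub> m) = q \<odot>\<^bsub>fob (sm e N) S\<^esub> f S m" for q
    using f'(4)[OF S m'(1)] by simp
  show "f T (fmor (sm e M) S T X m) = fmor (sm e N) S T X (f S m)" if "T \<in> gsets G" "X \<in> Ar S T" for T X
    using f'(5)[OF S that m'(1)] sm_fmor[OF e M S m] sm_fmor[OF e N S fm] by simp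
qed

text \<open>Injective because each \<open>m\<close> is the sum of its parts \<open>e_C m\<close>;
  surjective because compatible components can be added up in \<open>M\<close> and are recovered by
  \<open>cact_finsum\<close>. \<open>N\<close> is pinned down only on \<open>I\<close>, since it
  will be the family of underlying functors of an object of the product category.\<close>

lemma split_unit: fixes M :: "('a, ('a, 'u) val) mfun"
  assumes M: "mack M" and N: "\<And>C. C \<in> I \<Longrightarrow> N C = sm (ep C :: ('a, 'u) val) M"
  defines "t \<equiv> (\<lambda>S\<in>gsets G. \<lambda>m\<in>carrier (fob M S). enc (\<lambda>C\<in>I. cact M S (ep C :: ('a, 'u) val) m))"
  shows "t \<in> Hom M (dsum N)" "S \<in> gsets G \<Longrightarrow> bij_betw (t S) (carrier (fob M S)) (carrier (fob (dsum N) S))"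
proof -
  have id: "idem_el (ep C :: ('a, 'u) val)" if "C \<in> I" for C by (rule idem_char(3)[OF that refl])
  define p where "p C = (\<lambda>S\<in>gsets G. \<lambda>m\<in>carrier (fob M S). cact M S (ep C :: ('a, 'u) val) m)" for C
  have "p C \<in> Hom M (N C)" if "C \<in> I" for C
    unfolding N[OF that] p_def by (rule sm_proj[OF id[OF that] M])
  then have "(\<lambda>S\<in>gsets G. \<lambda>m\<in>carrier (fob M S). enc (\<lambda>C\<in>I. p C S m)) \<in> Hom M (dsum N)" by (rule dtuple_Hom[OF M])
  moreover have "(\<lambda>S\<in>gsets G. \<lambda>m\<in>carrier (fob M S). enc (\<lambda>C\<in>I. p C S m)) = t"
    unfolding t_def p_def by (intro restrict_ext arg_cong[of _ _ enc]) simp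
  ultimately show t: "t \<in> Hom M (dsum N)" by simp
  show "bij_betw (t S) (carrier (fob M S)) (carrier (fob (dsum N) S))" if S: "S \<in> gsets G"
  proof -
    have d: "dec (t S m) C = cact M S (ep C :: ('a, 'u) val) m" if "m \<in> carrier (fob M S)" "C \<in> I" for m C
      using S that by (simp add: t_def)
    have mem: "dec x C \<in> carrier (fob M S)" "cact M S (ep C :: ('a, 'u) val) (dec x C) = dec x C" if "x \<in> carrier (fob (dsum N) S)" "C \<in> I" for x C
      using dsum_mem(1)[OF that] sm_mem[OF id[OF that(2)] M S] unfolding N[OF that(2)] by auto
    have "inj_on (t S) (carrier (fob M S))"
    proof (rule inj_onI)
      fix m n assume m: "m \<in> carrier (fob M S)" and n: "n \<in> carrier (fob M S)" and e: "t S m = t S n"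
      interpret V: module rat_ring "fob M S" by (rule Ml(1)[OF M S])
      have "m = finsum (fob M S) (\<lambda>C. cact M S (ep C :: ('a, 'u) val) m) I" by (rule cact_sum[OF M S m, symmetric])
      also have "\<dots> = finsum (fob M S) (\<lambda>C. cact M S (ep C :: ('a, 'u) val) n) I"
        by (rule V.finsum_cong'[OF refl]) (use d[OF m] d[OF n] e cact_closed[OF M S n idem_char(1)[OF _ refl]] in auto)
      also have "\<dots> = n" by (rule cact_sum[OF M S n])
      finally show "m = n" .
    qed
    moreover have "t S ` carrier (fob M S) = carrier (fob (dsum N) S)"
    proof
      show "t S ` carrier (fob M S) \<subseteq> carrier (fob (dsum N) S)" using HomD(2)[OF t S] by auto
      show "carrier (fob (dsum N) S) \<subseteq> t S ` carrier (fob M S)"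
      proof
        fix x assume x: "x \<in> carrier (fob (dsum N) S)"
        let ?m = "finsum (fob M S) (dec x) I"
        note cf = cact_finsum[OF M S _ mem[OF x]]
        have m: "?m \<in> carrier (fob M S)"
        proof -
          interpret V: module rat_ring "fob M S" by (rule Ml(1)[OF M S])
          show ?thesis by (rule V.finsum_closed) (use mem(1)[OF x] in auto)
        qed
        have "t S ?m = x"
          by (rule dsum_eqI[OF HomD(2)[OF t S m] x]) (simp add: d[OF m] cf)
        from this[symmetric] m show "x \<in> t S ` carrier (fob M S)" by (rule image_eqI)
      qed
    qed
    ultimately show ?thesis by (simp add: bij_betw_def)
  qed
qed

text \<open>On the component at \<open>D\<close> the idempotent \<open>e_D\<close> is the identity,
  so by orthogonality \<open>e_C\<close> acts there as zero unless \<open>D = C\<close>. The image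
  of \<open>e_C\<close> therefore consists of the tuples concentrated at \<open>C\<close>.\<close>

lemma split_counit: fixes N :: "'a set set \<Rightarrow> ('a, ('a, 'u) val) mfun"
  assumes N: "\<And>C. C \<in> I \<Longrightarrow> mack (N C)" and fx: "\<And>C. C \<in> I \<Longrightarrow> fixes_e (ep C :: ('a, 'u) val) (N C)" and C: "C \<in> I"
  defines "t \<equiv> (\<lambda>S\<in>gsets G. \<lambda>x\<in>carrier (fob (sm (ep C :: ('a, 'u) val) (dsum N)) S). dec x C)"
  shows "t \<in> Hom (sm (ep C :: ('a, 'u) val) (dsum N)) (N C)"
    "S \<in> gsets G \<Longrightarrow> bij_betw (t S) (carrier (fob (sm (ep C :: ('a, 'u) val) (dsum N)) S)) (carrier (fob (N C) S))"
proof -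
  let ?e = "ep C :: ('a, 'u) val"
  have id: "idem_el ?e" by (rule idem_char(3)[OF C refl])
  have eb: "?e \<in> carrier (bob pt)" by (rule idem_char(1)[OF C refl])
  have D: "mack (dsum N)" by (rule mack_dsum) (rule N)
  have dp: "dproj N C \<in> Hom (dsum N) (N C)" if "C \<in> I" for C by (rule dproj_Hom[OF _ that]) (rule N)
  note mem = sm_mem[OF id D]
  have "(\<lambda>S\<in>gsets G. \<lambda>m\<in>carrier (fob (sm ?e (dsum N)) S). dproj N C S m) \<in> Hom (sm ?e (dsum N)) (N C)"
    by (rule sm_restrict[OF id D dp[OF C] N[OF C] id])
  moreover have "(\<lambda>S\<in>gsets G. \<lambda>m\<in>carrier (fob (sm ?e (dsum N)) S). dproj N C S m) = t"
    unfolding t_def dproj_def by (intro restrict_ext) (simp add: mem)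
  ultimately show t: "t \<in> Hom (sm ?e (dsum N)) (N C)" by simp
  show "bij_betw (t S) (carrier (fob (sm ?e (dsum N)) S)) (carrier (fob (N C) S))" if S: "S \<in> gsets G"
  proof -
    have ca: "dec (cact (dsum N) S ?e x) D = (if D = C then dec x C else \<zero>\<^bsub>fob (N D) S\<^esub>)"
      if x: "x \<in> carrier (fob (dsum N) S)" and DI: "D \<in> I" for x D
    proof -
      have "dec (cact (dsum N) S ?e x) D = cact (N D) S ?e (dec x D)"
        using cact_Hom[OF D dp[OF DI] N[OF DI] S eb x] cact_closed[OF D S x eb] S x by (simp add: dproj_def)
      moreover have "cact (N D) S ?e (dec x D) = \<zero>\<^bsub>fob (N D) S\<^esub>" if "D \<noteq> C"
        using cact_orth[OF N[OF DI] S dsum_mem(1)[OF x DI] C DI] fx[OF DI] dsum_mem(1)[OF x DI] S that unfolding fixes_e_def by simp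
      moreover have "cact (N C) S ?e (dec x C) = dec x C"
        using fx[OF C] dsum_mem(1)[OF x C] S unfolding fixes_e_def by simp
      ultimately show ?thesis by auto
    qed
    show ?thesis
    proof (rule bij_betw_byWitness[where f' = "\<lambda>n. enc (\<lambda>D\<in>I. if D = C then n else \<zero>\<^bsub>fob (N D) S\<^esub>)"])
      have em: "enc (\<lambda>D\<in>I. if D = C then n else \<zero>\<^bsub>fob (N D) S\<^esub>) \<in> carrier (fob (dsum N) S)" if "n \<in> carrier (fob (N C) S)" for n
        by (rule enc_mem) (use that Ml(1)[OF N S] in auto)
      have ems: "enc (\<lambda>D\<in>I. if D = C then n else \<zero>\<^bsub>fob (N D) S\<^esub>) \<in> carrier (fob (sm ?e (dsum N)) S)" if n: "n \<in> carrier (fob (N C) S)" for n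
        unfolding mem[OF S]
        by (intro conjI em[OF n] dsum_eqI[OF cact_closed[OF D S em[OF n] eb] em[OF n]]) (simp add: ca[OF em[OF n]] C)
      show "\<forall>x\<in>carrier (fob (sm ?e (dsum N)) S). enc (\<lambda>D\<in>I. if D = C then t S x else \<zero>\<^bsub>fob (N D) S\<^esub>) = x"
      proof
        fix x assume x: "x \<in> carrier (fob (sm ?e (dsum N)) S)"
        have x': "x \<in> carrier (fob (dsum N) S)" "cact (dsum N) S ?e x = x" using x mem[OF S] by auto
        have tx: "t S x = dec x C" using x S by (simp add: t_def)
        show "enc (\<lambda>D\<in>I. if D = C then t S x else \<zero>\<^bsub>fob (N D) S\<^esub>) = x"
          unfolding tx
          by (rule dsum_eqI[OF em[OF dsum_mem(1)[OF x'(1) C]] x'(1)]) (use ca[OF x'(1)] x'(2) in simp)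
      qed
      show "\<forall>n\<in>carrier (fob (N C) S). t S (enc (\<lambda>D\<in>I. if D = C then n else \<zero>\<^bsub>fob (N D) S\<^esub>)) = n"
        using ems S C by (simp add: t_def)
      show "t S ` carrier (fob (sm ?e (dsum N)) S) \<subseteq> carrier (fob (N C) S)" using HomD(2)[OF t S] by auto
      show "(\<lambda>n. enc (\<lambda>D\<in>I. if D = C then n else \<zero>\<^bsub>fob (N D) S\<^esub>)) ` carrier (fob (N C) S) \<subseteq> carrier (fob (sm ?e (dsum N)) S)"
        using ems by auto
    qed
  qed
qed

end

section \<open>The equivalence with the product of the module categories\<close>

lemma prod_cat_simps: "X \<in> obj (prod_cat I C) \<longleftrightarrow> X \<in> extensional I \<and> (\<forall>i\<in>I. X i \<in> obj (C i))"
  "f \<in> arr (prod_cat I C) X Y \<longleftrightarrow> f \<in> extensional I \<and> (\<forall>i\<in>I. f i \<in> arr (C i) (X i) (Y i))"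
  "ide (prod_cat I C) X = (\<lambda>i\<in>I. ide (C i) (X i))"
  "cmp (prod_cat I C) X Y Z g f = (\<lambda>i\<in>I. cmp (C i) (X i) (Y i) (Z i) (g i) (f i))"
  by (auto simp: prod_cat_def PiE_iff)

lemma naturally_isoI:
  assumes "\<And>X. X \<in> obj C \<Longrightarrow> is_iso_arr D (fob F X) (fob F' X) (t X)"
    "\<And>X Y f. X \<in> obj C \<Longrightarrow> Y \<in> obj C \<Longrightarrow> f \<in> arr C X Y \<Longrightarrow>
      cmp D (fob F X) (fob F' X) (fob F' Y) (fmor F' X Y f) (t X) = cmp D (fob F X) (fob F Y) (fob F' Y) (t Y) (fmor F X Y f)"
  shows "naturally_iso C D F F'"
  unfolding naturally_iso_def nat_trans_def
  by (intro bexI[of _ "restrict t (obj C)"]) (use assms in \<open>auto simp: is_iso_arr_def\<close>)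

lemma prod_iso:
  assumes "f \<in> extensional I" "\<And>i. i \<in> I \<Longrightarrow> is_iso_arr (C i) (X i) (Y i) (f i)"
  shows "is_iso_arr (prod_cat I C) X Y f"
proof -
  obtain g where g: "\<forall>i\<in>I. g i \<in> arr (C i) (Y i) (X i) \<and> cmp (C i) (X i) (Y i) (X i) (g i) (f i) = ide (C i) (X i) \<and>
      cmp (C i) (Y i) (X i) (Y i) (f i) (g i) = ide (C i) (Y i)"
    using bchoice[of I "\<lambda>i g. g \<in> arr (C i) (Y i) (X i) \<and> cmp (C i) (X i) (Y i) (X i) g (f i) = ide (C i) (X i) \<and>
      cmp (C i) (Y i) (X i) (Y i) (f i) g = ide (C i) (Y i)"] assms(2) unfolding is_iso_arr_def by blast
  show ?thesis unfolding is_iso_arr_def prod_cat_simps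
    by (intro conjI bexI[of _ "restrict g I"] restrict_ext) (use assms g in \<open>simp_all add: prod_cat_simps is_iso_arr_def\<close>)
qed

context transfer_group
begin

definition smap :: "('a, 'u) val \<Rightarrow> ('a, ('a, 'u) val) mfun \<Rightarrow> ('a, ('a, 'u) val) mtrafo \<Rightarrow> ('a, ('a, 'u) val) mtrafo" where
  "smap e M f = (\<lambda>S\<in>gsets G. \<lambda>m\<in>carrier (fob (sm e M) S). f S m)"

lemma smap_Hom: "idem_el e \<Longrightarrow> mack M \<Longrightarrow> mack N \<Longrightarrow> f \<in> Hom M N \<Longrightarrow> smap e M f \<in> Hom (sm e M) (sm e N)"
  unfolding smap_def by (rule sm_map)

lemma splitting_simps: "fob (splitting G r) X \<in> extensional I" "fmor (splitting G r) X Y f \<in> extensional I"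
  "C \<in> I \<Longrightarrow> fob (splitting G r) X C = (sm (ep C) (fst X), summand_action G r (ep C) (fst X) (snd X))"
  "C \<in> I \<Longrightarrow> fmor (splitting G r) X Y f C = smap (ep C) (fst X) f"
  by (auto simp: splitting_def split_beta smap_def)

definition dmap :: "('a set set \<Rightarrow> ('a, ('a, 'u) val) mfun) \<Rightarrow> ('a set set \<Rightarrow> ('a, ('a, 'u) val) mtrafo) \<Rightarrow> ('a, ('a, 'u) val) mtrafo" where
  "dmap N f = (\<lambda>S\<in>gsets G. \<lambda>x\<in>carrier (fob (dsum N) S). enc (\<lambda>C\<in>I. f C S (dec x C)))"

lemma dmap_Hom: assumes N: "\<And>C. C \<in> I \<Longrightarrow> mack (N C)" and f: "\<And>C. C \<in> I \<Longrightarrow> f C \<in> Hom (N C) (N' C)"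
  shows "dmap N f \<in> Hom (dsum N) (dsum N')"
proof -
  have D: "mack (dsum N)" by (rule mack_dsum) (rule N)
  have "(\<lambda>S\<in>gsets G. \<lambda>x\<in>carrier (fob (dsum N) S). enc (\<lambda>C\<in>I. hc (dsum N) (f C) (dproj N C) S x)) \<in> Hom (dsum N) (dsum N')"
    by (rule dtuple_Hom[OF D], rule Hom_compose[OF D _ f], rule dproj_Hom) (simp_all add: N)
  moreover have "(\<lambda>S\<in>gsets G. \<lambda>x\<in>carrier (fob (dsum N) S). enc (\<lambda>C\<in>I. hc (dsum N) (f C) (dproj N C) S x)) = dmap N f"
    unfolding dmap_def by (intro restrict_ext arg_cong[of _ _ enc]) (simp add: compose_eq dproj_def)
  ultimately show ?thesis by simp
qed

lemma dmap_dec: "S \<in> gsets G \<Longrightarrow> x \<in> carrier (fob (dsum N) S) \<Longrightarrow> C \<in> I \<Longrightarrow> dec (dmap N f S x) C = f C S (dec x C)"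
  by (simp add: dmap_def)

lemma dmap_id: assumes "\<And>C. C \<in> I \<Longrightarrow> f C = hid (N C)" shows "dmap N f = hid (dsum N)"
  unfolding dmap_def
proof (intro restrict_ext)
  fix S x assume S: "S \<in> gsets G" and x: "x \<in> carrier (fob (dsum N) S)"
  have "(\<lambda>C\<in>I. f C S (dec x C)) = restrict (dec x) I"
    by (intro restrict_ext) (simp add: assms S dsum_mem(1)[OF x])
  then show "enc (\<lambda>C\<in>I. f C S (dec x C)) = x" using dsum_mem(2)[OF x] by simp
qed

lemma dmap_compose: assumes N: "\<And>C. C \<in> I \<Longrightarrow> mack (N C)" and N': "\<And>C. C \<in> I \<Longrightarrow> mack (N' C)"
  and f: "\<And>C. C \<in> I \<Longrightarrow> f C \<in> Hom (N C) (N' C)"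
  and g: "\<And>C. C \<in> I \<Longrightarrow> g C \<in> Hom (N' C) (N'' C)" and h: "\<And>C. C \<in> I \<Longrightarrow> h C = hc (N C) (g C) (f C)"
  shows "dmap N h = hc (dsum N) (dmap N' g) (dmap N f)"
proof -
  have f': "dmap N f \<in> Hom (dsum N) (dsum N')" by (rule dmap_Hom) (simp_all add: N f)
  have "dmap N h S x = dmap N' g S (dmap N f S x)" if "S \<in> gsets G" "x \<in> carrier (fob (dsum N) S)" for S x
  proof -
    have "dmap N' g S (dmap N f S x) = enc (\<lambda>C\<in>I. g C S (dec (dmap N f S x) C))"
      using HomD(2)[OF f' that] that(1) by (simp add: dmap_def[of N'])
    also have "\<dots> = enc (\<lambda>C\<in>I. h C S (dec x C))"
      by (intro arg_cong[of _ _ enc] restrict_ext) (simp add: dmap_dec[OF that] h that(1) compose_eq dsum_mem(1)[OF that(2)])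
    finally show ?thesis using that by (simp add: dmap_def)
  qed
  then show ?thesis unfolding compose_def by (subst dmap_def, intro restrict_ext) (simp add: dmap_def[of N h])
qed

text \<open>Every natural transformation between the underlying functors is a module map, so a
  pointwise bijective one has its inverse in the module category as well.\<close>

lemma module_iso: assumes gd: "idem_monoid e \<Omega> p i" and X: "X \<in> obj (module_cat (Day G r) \<Omega>)" and Y: "Y \<in> obj (module_cat (Day G r) \<Omega>)"
  and t: "t \<in> Hom (fst X) (fst Y)" "\<And>S. S \<in> gsets G \<Longrightarrow> bij_betw (t S) (carrier (fob (fst X) S)) (carrier (fob (fst Y) S))"
  shows "is_iso_arr (module_cat (Day G r) \<Omega>) X Y t"
proof -
  have "mack (fst X)" "mack (fst Y)" using moduleD(1)[OF gd] X Y by (auto simp: module_cat_simps)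
  then obtain g where "g \<in> Hom (fst Y) (fst X)" "hc (fst X) g t = hid (fst X)" "hc (fst Y) t g = hid (fst Y)"
    by (rule Hom_bij_inverse[OF _ _ t])
  then show ?thesis unfolding is_iso_arr_def module_arr'[OF gd X Y] module_arr'[OF gd Y X] module_cat_simps(2,3) Day_simps
    using t(1) by blast
qed

text \<open>The inverse of \<open>splitting\<close>: the coded direct sum with its only possible
  structure of a module over \<open>A\<close>. On the product category the components at indices
  outside \<open>I\<close> do not enter \<open>dsum\<close>.\<close>

definition gluing where
  "gluing = \<lparr>fob = (\<lambda>Y. (dsum (\<lambda>C. fst (Y C)), SOME \<rho>. is_module (Day G r) (burnside_monoid G r) (dsum (\<lambda>C. fst (Y C))) \<rho>)),
     fmor = (\<lambda>Y Z f. dmap (\<lambda>C. fst (Y C)) f)\<rparr>"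

text \<open>All hom sets are identified with \<open>Hom\<close> of underlying functors at the start.
  After that, the module structures need no further attention: invertibility of the unit and counit
  is pointwise bijectivity, from \<open>split_unit\<close> and \<open>split_counit\<close>, and
  naturality is an equation between coordinates.\<close>

lemma splitting_equivalence:
  "is_equivalence (module_cat (Day G r :: ('a, 'u) mackey_moncat) (burnside_monoid G r))
    (prod_cat I (\<lambda>C. module_cat (Day G r) (summand_monoid G r (idem G r C)))) (splitting G r)"
proof -
  let ?A = "module_cat (Day G r :: ('a, 'u) mackey_moncat) (burnside_monoid G r)"
  let ?B = "\<lambda>C. module_cat (Day G r :: ('a, 'u) mackey_moncat) (summand_monoid G r (idem G r C))"
  let ?P = "prod_cat I ?B"
  have id: "idem_el (ep C :: ('a, 'u) val)" if "C \<in> I" for C by (rule idem_char(3)[OF that refl])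
  have eb: "(ep C :: ('a, 'u) val) \<in> carrier (bob pt)" if "C \<in> I" for C by (rule idem_char(1)[OF that refl])
  note gA = idem_monoid_burnside[where 'u = 'u] and gB = idem_monoid_summand[OF id]
  have MA: "mack (fst X)" if "X \<in> obj ?A" for X using moduleD(1)[OF gA] that by (auto simp: module_cat_simps)
  have MB: "mack (fst (Y C))" "fixes_e (ep C :: ('a, 'u) val) (fst (Y C))" "Y C \<in> obj (?B C)" if "Y \<in> obj ?P" "C \<in> I" for Y C
    using moduleD(1,4)[OF gB[OF that(2)], of "fst (Y C)" "snd (Y C)"] that by (auto simp: module_cat_simps prod_cat_simps)
  have arA: "arr ?A X Y = Hom (fst X) (fst Y)" if "X \<in> obj ?A" "Y \<in> obj ?A" for X Y by (rule module_arr'[OF gA that])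
  have arB: "f \<in> arr ?P X Y \<longleftrightarrow> f \<in> extensional I \<and> (\<forall>C\<in>I. f C \<in> Hom (fst (X C)) (fst (Y C)))" if "X \<in> obj ?P" "Y \<in> obj ?P" for X Y f
    unfolding prod_cat_simps using module_arr'[OF gB MB(3) MB(3)] that by auto
  have sob: "fob (splitting G r) X \<in> obj ?P" if "X \<in> obj ?A" for X
    unfolding prod_cat_simps by (intro conjI ballI splitting_simps(1))
      (use summand_module[OF id, of _ "fst X" "snd X"] that in \<open>simp add: module_cat_simps splitting_simps(3)\<close>)
  have sar: "fmor (splitting G r) X Y f \<in> arr ?P (fob (splitting G r) X) (fob (splitting G r) Y)"
    if X: "X \<in> obj ?A" and Y: "Y \<in> obj ?A" and f: "f \<in> Hom (fst X) (fst Y)" for X Y f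
    unfolding arB[OF sob[OF X] sob[OF Y]] using smap_Hom[OF id MA[OF X] MA[OF Y] f] by (auto simp: splitting_simps)
  have F: "is_functor ?A ?P (splitting G r)"
    unfolding is_functor_def
  proof (intro conjI ballI)
    fix X assume X: "X \<in> obj ?A"
    show "fob (splitting G r) X \<in> obj ?P" by (rule sob[OF X])
    show "fmor (splitting G r) X X (ide ?A X) = ide ?P (fob (splitting G r) X)"
      by (rule extensionalityI[OF splitting_simps(2)])
        (auto simp: prod_cat_simps splitting_simps module_cat_simps smap_def sm_mem[OF id MA[OF X]] intro!: restrict_ext)
    fix Y assume Y: "Y \<in> obj ?A"
    show "fmor (splitting G r) X Y f \<in> arr ?P (fob (splitting G r) X) (fob (splitting G r) Y)" if "f \<in> arr ?A X Y" for f
      using sar[OF X Y] that arA[OF X Y] by blast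
    fix Z f g assume Z: "Z \<in> obj ?A" and f: "f \<in> arr ?A X Y" and g: "g \<in> arr ?A Y Z"
    have f': "f \<in> Hom (fst X) (fst Y)" using f arA[OF X Y] by blast
    show "fmor (splitting G r) X Z (cmp ?A X Y Z g f) =
        cmp ?P (fob (splitting G r) X) (fob (splitting G r) Y) (fob (splitting G r) Z) (fmor (splitting G r) Y Z g) (fmor (splitting G r) X Y f)"
    proof (rule extensionalityI[OF splitting_simps(2)])
      fix C assume C: "C \<in> I"
      have m: "smap (ep C) (fst Y) g S (smap (ep C) (fst X) f S x) = g S (f S x)"
        if "S \<in> gsets G" "x \<in> carrier (fob (sm (ep C) (fst X)) S)" for S x
        using HomD(2)[OF smap_Hom[OF id[OF C] MA[OF X] MA[OF Y] f'] that] that by (simp add: smap_def)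
      have "smap (ep C) (fst X) (hc (fst X) g f) = hc (sm (ep C) (fst X)) (smap (ep C) (fst Y) g) (smap (ep C) (fst X) f)"
        unfolding compose_def by (subst smap_def, intro restrict_ext) (simp add: m sm_mem[OF id[OF C] MA[OF X]])
      then show "fmor (splitting G r) X Z (cmp ?A X Y Z g f) C =
        cmp ?P (fob (splitting G r) X) (fob (splitting G r) Y) (fob (splitting G r) Z) (fmor (splitting G r) Y Z g) (fmor (splitting G r) X Y f) C"
        using C by (simp add: prod_cat_simps splitting_simps module_cat_simps)
    qed (simp add: prod_cat_simps)
  qed
  have gob: "fob gluing Y \<in> obj ?A" if Y: "Y \<in> obj ?P" for Y
  proof -
    have D: "mack (dsum (\<lambda>C. fst (Y C)))" by (rule mack_dsum) (rule MB(1)[OF Y])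
    have "fixes_e (one_A :: ('a, 'u) val) (dsum (\<lambda>C. fst (Y C)))" unfolding fixes_e_def using cact_one[OF D] by blast
    then show ?thesis using someI_ex[OF module_ex[OF gA D]] by (simp add: module_cat_simps gluing_def)
  qed
  have gfst: "fst (fob gluing Y) = dsum (\<lambda>C. fst (Y C))" for Y by (simp add: gluing_def)
  have gmor: "fmor gluing Y Z f = dmap (\<lambda>C. fst (Y C)) f" for Y Z f by (simp add: gluing_def)
  have F': "is_functor ?P ?A gluing"
    unfolding is_functor_def
  proof (intro conjI ballI)
    fix X assume X: "X \<in> obj ?P"
    show "fob gluing X \<in> obj ?A" by (rule gob[OF X])
    show "fmor gluing X X (ide ?P X) = ide ?A (fob gluing X)"
      unfolding gmor module_cat_simps Day_simps gfst by (rule dmap_id) (simp add: prod_cat_simps module_cat_simps)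
    fix Y assume Y: "Y \<in> obj ?P"
    show "fmor gluing X Y f \<in> arr ?A (fob gluing X) (fob gluing Y)" if "f \<in> arr ?P X Y" for f
      unfolding arA[OF gob[OF X] gob[OF Y]] gfst gmor
      by (rule dmap_Hom) (use MB(1)[OF X] that arB[OF X Y] in blast)+
    fix Z f g assume Z: "Z \<in> obj ?P" and f: "f \<in> arr ?P X Y" and g: "g \<in> arr ?P Y Z"
    show "fmor gluing X Z (cmp ?P X Y Z g f) = cmp ?A (fob gluing X) (fob gluing Y) (fob gluing Z) (fmor gluing Y Z g) (fmor gluing X Y f)"
      unfolding gmor module_cat_simps Day_simps gfst
    proof (rule dmap_compose)
      show "\<And>C. C \<in> I \<Longrightarrow> f C \<in> Hom (fst (X C)) (fst (Y C))" "\<And>C. C \<in> I \<Longrightarrow> g C \<in> Hom (fst (Y C)) (fst (Z C))"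
        using f g arB[OF X Y] arB[OF Y Z] by blast+
    qed (simp_all add: MB(1)[OF X] MB(1)[OF Y] prod_cat_simps module_cat_simps)
  qed
  have U: "naturally_iso ?A ?A id_func (comp_func gluing (splitting G r))"
  proof -
    \<comment> \<open>The unit records the parts \<open>e_C m\<close> of an element as a coded
      tuple; it is natural because natural transformations commute with \<open>cact\<close>.\<close>
    define \<eta> where "\<eta> X = (\<lambda>S\<in>gsets G. \<lambda>m\<in>carrier (fob (fst X) S). enc (\<lambda>C\<in>I. cact (fst X) S (ep C :: ('a, 'u) val) m))"
      for X :: "('a, ('a, 'u) val) mfun \<times> ('a, ('a, 'u) val) mtrafo"
    have N: "fst (fob (splitting G r) X C) = sm (ep C) (fst X)" if "C \<in> I" for X C using that by (simp add: splitting_simps)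
    have su: "\<eta> X \<in> Hom (fst X) (dsum (\<lambda>C. fst (fob (splitting G r) X C)))"
      "S \<in> gsets G \<Longrightarrow> bij_betw (\<eta> X S) (carrier (fob (fst X) S)) (carrier (fob (dsum (\<lambda>C. fst (fob (splitting G r) X C))) S))"
      if "X \<in> obj ?A" for X S
      unfolding \<eta>_def by (rule split_unit[OF MA[OF that]], rule N, assumption+)+
    show ?thesis
    proof (rule naturally_isoI)
      fix X assume X: "X \<in> obj ?A"
      show "is_iso_arr ?A (fob id_func X) (fob (comp_func gluing (splitting G r)) X) (\<eta> X)"
        unfolding id_func_def comp_func_def func.simps
        by (rule module_iso[OF gA X gob[OF sob[OF X]]]) (simp_all add: gfst su[OF X])
      fix Y f assume Y: "Y \<in> obj ?A" and f: "f \<in> arr ?A X Y"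
      have f': "f \<in> Hom (fst X) (fst Y)" using f arA[OF X Y] by blast
      let ?d = "dmap (\<lambda>C. fst (fob (splitting G r) X C)) (fmor (splitting G r) X Y f)"
      have d: "?d \<in> Hom (dsum (\<lambda>C. fst (fob (splitting G r) X C))) (dsum (\<lambda>C. fst (fob (splitting G r) Y C)))"
        by (rule dmap_Hom[OF MB(1)[OF sob[OF X]]]) (use sar[OF X Y f'] arB[OF sob[OF X] sob[OF Y]] in blast)+
      have "hc (fst X) ?d (\<eta> X) = hc (fst X) (\<eta> Y) f"
      proof (rule Hom_eqI[OF Hom_compose[OF MA[OF X] su(1)[OF X] d] Hom_compose[OF MA[OF X] f' su(1)[OF Y]]])
        fix S m assume S: "S \<in> gsets G" and m: "m \<in> carrier (fob (fst X) S)"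
        note fm = HomD(2)[OF f' S m] and em = HomD(2)[OF su(1)[OF X] S m]
        have "?d S (\<eta> X S m) = \<eta> Y S (f S m)"
        proof (rule dsum_eqI[OF HomD(2)[OF d S em] HomD(2)[OF su(1)[OF Y] S fm]])
          fix C assume C: "C \<in> I"
          have c: "cact (fst X) S (ep C :: ('a, 'u) val) m \<in> carrier (fob (sm (ep C) (fst X)) S)"
            by (rule cact_in_sm[OF id[OF C] MA[OF X] S m])
          show "dec (?d S (\<eta> X S m)) C = dec (\<eta> Y S (f S m)) C"
            unfolding dmap_dec[OF S em C] splitting_simps(4)[OF C]
            using cact_Hom[OF MA[OF X] f' MA[OF Y] S eb[OF C] m] c S m fm C by (simp add: \<eta>_def smap_def)
        qed
        then show "hc (fst X) ?d (\<eta> X) S m = hc (fst X) (\<eta> Y) f S m" using S m by (simp add: compose_eq)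
      qed
      then show "cmp ?A (fob id_func X) (fob (comp_func gluing (splitting G r)) X) (fob (comp_func gluing (splitting G r)) Y)
          (fmor (comp_func gluing (splitting G r)) X Y f) (\<eta> X) =
        cmp ?A (fob id_func X) (fob id_func Y) (fob (comp_func gluing (splitting G r)) Y) (\<eta> Y) (fmor id_func X Y f)"
        by (simp add: id_func_def comp_func_def module_cat_simps gmor)
    qed
  qed
  have E: "naturally_iso ?P ?P (comp_func (splitting G r) gluing) id_func"
  proof -
    \<comment> \<open>The counit reads off the component at \<open>C\<close>, and is natural because
      \<open>dmap\<close> acts componentwise.\<close>
    define \<epsilon> where "\<epsilon> Y = (\<lambda>C\<in>I. \<lambda>S\<in>gsets G. \<lambda>x\<in>carrier (fob (sm (ep C :: ('a, 'u) val) (dsum (\<lambda>C. fst (Y C)))) S). dec x C)"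
      for Y :: "'a set set \<Rightarrow> ('a, ('a, 'u) val) mfun \<times> ('a, ('a, 'u) val) mtrafo"
    have \<epsilon>C: "\<epsilon> Y C = (\<lambda>S\<in>gsets G. \<lambda>x\<in>carrier (fob (sm (ep C :: ('a, 'u) val) (dsum (\<lambda>C. fst (Y C)))) S). dec x C)" if "C \<in> I" for Y C
      using that by (simp add: \<epsilon>_def)
    have sc: "\<epsilon> Y C \<in> Hom (sm (ep C) (dsum (\<lambda>C. fst (Y C)))) (fst (Y C))"
      "S \<in> gsets G \<Longrightarrow> bij_betw (\<epsilon> Y C S) (carrier (fob (sm (ep C) (dsum (\<lambda>C. fst (Y C)))) S)) (carrier (fob (fst (Y C)) S))"
      if "Y \<in> obj ?P" "C \<in> I" for Y C S
      unfolding \<epsilon>C[OF that(2)]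
      by (rule split_counit[of "\<lambda>C. fst (Y C)" C, OF MB(1)[OF that(1)] MB(2)[OF that(1)] that(2)], assumption+)+
    show ?thesis
    proof (rule naturally_isoI)
      fix X assume X: "X \<in> obj ?P"
      let ?D = "dsum (\<lambda>C. fst (X C))"
      note sX = sob[OF gob[OF X]]
      show "is_iso_arr ?P (fob (comp_func (splitting G r) gluing) X) (fob id_func X) (\<epsilon> X)"
        unfolding id_func_def comp_func_def func.simps
      proof (rule prod_iso)
        show "\<epsilon> X \<in> extensional I" by (simp add: \<epsilon>_def)
        fix C assume C: "C \<in> I"
        show "is_iso_arr (?B C) (fob (splitting G r) (fob gluing X) C) (X C) (\<epsilon> X C)"
          by (rule module_iso[OF gB[OF C] MB(3)[OF sX C] MB(3)[OF X C]]) (simp_all add: splitting_simps C gfst sc[OF X C])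
      qed
      fix Y f assume Y: "Y \<in> obj ?P" and f: "f \<in> arr ?P X Y"
      have f': "f C \<in> Hom (fst (X C)) (fst (Y C))" if "C \<in> I" for C using f arB[OF X Y] that by blast
      have d: "dmap (\<lambda>C. fst (X C)) f \<in> Hom ?D (dsum (\<lambda>C. fst (Y C)))"
        by (rule dmap_Hom[OF MB(1)[OF X] f'])
      have MD: "mack ?D" "mack (dsum (\<lambda>C. fst (Y C)))" using MA[OF gob[OF X]] MA[OF gob[OF Y]] by (simp_all add: gfst)
      have "hc (sm (ep C) ?D) (f C) (\<epsilon> X C) = hc (sm (ep C) ?D) (\<epsilon> Y C) (smap (ep C) ?D (dmap (\<lambda>C. fst (X C)) f))" if C: "C \<in> I" for C
        unfolding compose_def
      proof (intro restrict_ext)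
        fix S x assume S: "S \<in> gsets G" and x: "x \<in> carrier (fob (sm (ep C :: ('a, 'u) val) ?D) S)"
        have x': "x \<in> carrier (fob ?D S)" using x sm_mem[OF id[OF C] MD(1) S] by blast
        note sx = HomD(2)[OF smap_Hom[OF id[OF C] MD d] S x]
        have "smap (ep C) ?D (dmap (\<lambda>C. fst (X C)) f) S x = dmap (\<lambda>C. fst (X C)) f S x" using S x by (simp add: smap_def)
        then show "f C S (\<epsilon> X C S x) = \<epsilon> Y C S (smap (ep C) ?D (dmap (\<lambda>C. fst (X C)) f) S x)"
          using sx S x C dmap_dec[OF S x' C] by (simp add: \<epsilon>_def)
      qed
      then show "cmp ?P (fob (comp_func (splitting G r) gluing) X) (fob id_func X) (fob id_func Y) (fmor id_func X Y f) (\<epsilon> X) =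
        cmp ?P (fob (comp_func (splitting G r) gluing) X) (fob (comp_func (splitting G r) gluing) Y) (fob id_func Y) (\<epsilon> Y)
          (fmor (comp_func (splitting G r) gluing) X Y f)"
        unfolding id_func_def comp_func_def func.simps prod_cat_simps
        by (intro restrict_ext) (simp only: splitting_simps module_cat_simps gmor gfst Day_simps fst_conv)
    qed
  qed
  show ?thesis unfolding is_equivalence_def
    by (intro conjI exI[of _ gluing] F F' U E category_modules[OF gA] category_prod category_modules[OF gB])
qed

text \<open>The unit of the Burnside ring acts as the identity on every functor, so the isomorphism
  for general \<open>e\<close> specialises to modules over \<open>A\<close> on one side and all
  Mackey functors on the other.\<close>

lemma all_modules: "full_subcat (Mackey G r) (acts_as_id G r (one_A :: ('a, 'u) val)) = Mackey G r"
proof -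
  have "acts_as_id G r (one_A :: ('a, 'u) val) M" if "M \<in> obj (Mackey G r)" for M
    using that fixes_e_acts[of M "one_A :: ('a, 'u) val"] cact_one[of M] cycD(7)[OF gc[OF idem_monoid_burnside[where 'u = 'u]]]
    unfolding Mackey_obj_iff fixes_e_def by blast
  then show ?thesis unfolding full_subcat_def by (metis (mono_tags, lifting) Collect_cong Collect_mem_eq cat.surjective cat.update_convs(1))
qed

text \<open>As \<open>t\<close> commutes with \<open>e_C\<close>, which fixes \<open>m\<close>, the
  image is fixed by \<open>e_C\<close>; it is also fixed by \<open>e_D\<close>, and the two
  idempotents annihilate each other.\<close>

lemma orthogonal: fixes M N :: "('a, ('a, 'u) val) mfun"
  assumes CD: "C \<in> I" "D \<in> I" "C \<noteq> D" and M: "mack M" "acts_as_id G r (idem G r C) M" and N: "mack N" "acts_as_id G r (idem G r D) N"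
    and t: "t \<in> Hom M N" and S: "S \<in> gsets G" and m: "m \<in> carrier (fob M S)"
  shows "t S m = \<zero>\<^bsub>fob N S\<^esub>"
proof -
  have eb: "(ep C :: ('a, 'u) val) \<in> carrier (bob pt)" "(ep D :: ('a, 'u) val) \<in> carrier (bob pt)"
    using idem_char(1)[OF CD(1) refl] idem_char(1)[OF CD(2) refl] by blast+
  note tm = HomD(2)[OF t S m]
  have "t S m = cact N S (ep C :: ('a, 'u) val) (t S m)"
    using cact_Hom[OF M(1) t N(1) S eb(1) m] M(2) S m unfolding fixes_e_acts[OF M(1) eb(1)] fixes_e_def by metis
  also have "\<dots> = cact N S (ep C :: ('a, 'u) val) (cact N S (ep D :: ('a, 'u) val) (t S m))"
    using N(2) S tm unfolding fixes_e_acts[OF N(1) eb(2)] fixes_e_def by metis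
  also have "\<dots> = \<zero>\<^bsub>fob N S\<^esub>" by (rule cact_orth[OF N(1) S tm CD])
  finally show ?thesis .
qed

end

theorem theorem2:
  fixes G :: "('g, 'b) monoid_scheme" and r :: "('g set \<times> 'g set) set"
  assumes "group G" and "finite (carrier G)" and "transfer_system G r"
  shows
    "is_cat_iso (module_cat (Day G r :: ('g, 'u) mackey_moncat) (burnside_monoid G r))
       (Mackey G r) forget \<and>
     is_equivalence (module_cat (Day G r :: ('g, 'u) mackey_moncat) (burnside_monoid G r))
       (prod_cat (SubO_classes G r)
          (\<lambda>C. module_cat (Day G r) (summand_monoid G r (idem G r C))))
       (splitting G r) \<and>
     (\<forall>C\<in>SubO_classes G r.
        is_cat_iso (module_cat (Day G r :: ('g, 'u) mackey_moncat) (summand_monoid G r (idem G r C)))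
          (full_subcat (Mackey G r) (acts_as_id G r (idem G r C))) forget) \<and>
     (\<forall>C\<in>SubO_classes G r. \<forall>D\<in>SubO_classes G r. C \<noteq> D \<longrightarrow>
        (\<forall>M N t. M \<in> obj (Mackey G r :: ('g, 'u) mackey_cat) \<and> acts_as_id G r (idem G r C) M \<and>
           N \<in> obj (Mackey G r) \<and> acts_as_id G r (idem G r D) N \<and> t \<in> arr (Mackey G r) M N \<longrightarrow>
           (\<forall>S\<in>gsets G. \<forall>m\<in>carrier (fob M S). t S m = \<zero>\<^bsub>fob N S\<^esub>)))"
proof -
  interpret transfer_group G r using assms by (simp add: transfer_group_def transfer_group_axioms_def)
  show ?thesis
  proof (intro conjI ballI allI impI)
    show "is_cat_iso (module_cat (Day G r :: ('g, 'u) mackey_moncat) (burnside_monoid G r)) (Mackey G r) forget"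
      using modules_cat_iso[OF idem_monoid_burnside[where 'u = 'u]] unfolding all_modules .
    show "is_equivalence (module_cat (Day G r :: ('g, 'u) mackey_moncat) (burnside_monoid G r))
       (prod_cat (SubO_classes G r) (\<lambda>C. module_cat (Day G r) (summand_monoid G r (idem G r C)))) (splitting G r)"
      by (rule splitting_equivalence)
    show "is_cat_iso (module_cat (Day G r :: ('g, 'u) mackey_moncat) (summand_monoid G r (idem G r C)))
          (full_subcat (Mackey G r) (acts_as_id G r (idem G r C))) forget" if "C \<in> SubO_classes G r" for C
      by (rule modules_cat_iso[OF idem_monoid_summand[OF idem_char(3)[OF that refl]]])
  qed (auto simp: Mackey_obj_iff intro: orthogonal)
qed

end
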